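(* Suppose that the system $\dot x=f(x;\mu)$, $(x,\mu)\in\mathbb R^{2n}\times\mathbb R$, $n\ge2$, $f$ analytic, satisfies assumptions (R1)-(R7) of the context with $n_0=2$, and that $\bar a_2\ne0$ and $\bar b_2\neq0$, where $$\bar a_2=\int_{-\infty}^{\infty}\langle\psi_{n+2}(t),\mathrm D_\mu\mathrm D_xf(x^{\mathrm h}(t);0)\varphi_2(t)+\mathrm D_x^2f(x^{\mathrm h}(t);0)(\xi^\mu(t),\varphi_2(t))\rangle\,dt,$$ $$\bar b_2=\int_{-\infty}^{\infty}\Bigl\langle\psi_{n+2}(t),\tfrac16\mathrm D_x^3f(x^{\mathrm h}(t);0)(\varphi_2(t),\varphi_2(t),\varphi_2(t))+\mathrm D_x^2f(x^{\mathrm h}(t);0)(\xi^\alpha(t),\varphi_2(t))\Bigr\rangle\,dt .$$ Then there exist open intervals $I_1\ni0$ and $I_2\ni0$ and a differentiable function $\phi_2:I_2\to\mathbb R$ with $\phi_2(0)=0$, $\phi_2'(0)=0$, $\phi_2''(0)\neq0$ and $\phi_2(\alpha)=\phi_2(-\alpha)$ for $\alpha\in I_2$, such that a symmetric homoclinic orbit to the origin exists on $X^+$ for $\mu\in I_1$, and an $S$-conjugate pair of symmetric homoclinic orbits to the origin exists for $\mu=\phi_2(\alpha)$ ($\alpha\in I_2$, $\alpha\neq0$): a pitchfork bifurcation of homoclinic orbits occurs. Moreover, it is supercritical if $\bar a_2\bar b_2<0$ and subcritical if $\bar a_2\bar b_2>0$.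
   Context: Assumptions: (R1) The system is reversible: there is a linear involution $R$ with $f(Rx;\mu)+Rf(x;\mu)=0$ for all $(x,\mu)\in\mathbb R^{2n}\times\mathbb R$, and $\dim\mathrm{Fix}(R)=n$, where $\mathrm{Fix}(R)=\{x\in\mathbb R^{2n}\mid Rx=x\}$. (R2) $f(0;\mu)=0$ for all $\mu\in\mathbb R$. (R3) $\mathrm D_xf(0;0)$ has $2n$ eigenvalues $\pm\lambda_1,\dots,\pm\lambda_n$ with $0<\mathrm{Re}\,\lambda_1\le\dots\le\mathrm{Re}\,\lambda_n$. (R4) At $\mu=0$ the equilibrium $x=0$ has a symmetric homoclinic orbit $x^{\mathrm h}(t)$ with $x^{\mathrm h}(0)\in\mathrm{Fix}(R)$. (R5) (with $n_0=2$) The variational equation (VE) $\dot\xi=\mathrm D_xf(x^{\mathrm h}(t);0)\xi$ on $\mathbb R$ has exactly $2$ linearly independent bounded solutions, $\varphi_1(t)=\dot x^{\mathrm h}(t)$ and $\varphi_2(t)$, with $\varphi_2(0)\in\mathrm{Fix}(R)$. (R6) The system is $\mathbb Z_2$-equivariant: there is a $2n\times2n$ matrix $S$ with $S^2=\mathrm{id}$ and $Sf(x;\mu)=f(Sx;\mu)$. Then $\mathbb R^{2n}=X^+\oplus X^-$, where $Sx=x$ for $x\in X^+$ and $Sx=-x$ for $x\in X^-$. (R7) $X^-=(X^+)^\perp$, and for every $t\in\mathbb R$, $x^{\mathrm h}(t),\psi_{n+1}(t)\in X^+$ and $\varphi_2(t),\psi_{n+2}(t)\in X^-$. A solution $x(t)$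 (and its orbit) is symmetric if $x(t)=Rx(-t)$. If $\bar x(t)$ is a solution with $\bar x(t)\neq S\bar x(t)$, then the pair $\bar x(t)$, $S\bar x(t)$ is called $S$-conjugate. The bifurcating pair in the theorem is of the form $x=x^{\mathrm h}(t)+\alpha\varphi_2(t)+O(\sqrt{|\alpha|^4+|\mu|^2})$ with $x(0)\in\mathrm{Fix}(R)$, together with its $S$-image. The scalar product $\langle\cdot,\cdot\rangle$ on $\mathbb R^{2n}$ is chosen so that $\mathrm{Fix}(-R)=\mathrm{Fix}(R)^\perp$, where $\mathrm{Fix}(-R)=\{x\mid Rx=-x\}$. Solutions $\varphi_1,\dots,\varphi_{2n}$ of the VE are chosen linearly independent, with $\varphi_1,\varphi_2$ as in (R5) and: - for $j=3,\dots,n$: $|\varphi_j(t)|\to0$ as $t\to+\infty$ and $|\varphi_j(t)|\to\infty$ as $t\to-\infty$; - $|\varphi_{n+1}(t)|\to\infty$ as $t\to\pm\infty$ and $\varphi_{n+1}(0)\in\mathrm{Fix}(R)$; - $|\varphi_{n+2}(t)|\to\infty$ as $t\to\pm\infty$ and $\varphi_{n+2}(0)\in\mathrm{Fix}(-R)$; - $\varphi_{n+j}(t)=R\varphi_j(-t)$ for $j=3,\dots,n$. The functions $\psi_j(t)$, $j=1,\dots,2n$, are defined by $\langle\psi_j(t),\varphi_k(t)\rangle=\delta_{jk}$, $j,k=1,\dots,2n$. Let $0<\kappa<\frac14\mathrm{Re}\,\lambda_1$ and $$\hat{\mathcal Z}^0=\{z\in C^0(\mathbb R,\mathbb R^{2n})\mid\sup_{t\ge0}|z(t)|e^{\kappa|t|}<\infty,\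 z(t)=-Rz(-t)\},$$ $$\hat{\mathcal Z}^1=\{z\in C^1(\mathbb R,\mathbb R^{2n})\mid\sup_{t\ge0}|z(t)|e^{\kappa|t|}<\infty,\ \sup_{t\ge0}|\dot z(t)|e^{\kappa|t|}<\infty,\ z(t)=Rz(-t)\},$$ $$\hat{\mathcal Z}^1_0=\{z\in\hat{\mathcal Z}^1\mid\langle\psi_j(0),z(0)\rangle=0,\ j=1,2\}.$$ For $z\in\hat{\mathcal Z}^0$ put $\Pi z(t)=q(t)\left(\int_{-\infty}^\infty\langle\psi_{n+2}(\tau),z(\tau)\rangle\,d\tau\right)\varphi_{n+2}(t)$, where $q:\mathbb R\to\mathbb R$ is a fixed continuous function with $\sup_t|q(t)|e^{\kappa|t|}<\infty$, $q(t)=q(-t)$ and $\int_{-\infty}^\infty q(t)\,dt=1$. $\xi^\mu(t)$ and $\xi^\alpha(t)$ denote the unique solutions in $\hat{\mathcal Z}^1_0$ of, respectively, $$\dot\xi=\mathrm D_xf(x^{\mathrm h}(t);0)\xi+(\mathrm{id}-\Pi)\mathrm D_\mu f(x^{\mathrm h}(t);0),$$ $$\dot\xi=\mathrm D_xf(x^{\mathrm h}(t);0)\xi+\tfrac12(\mathrm{id}-\Pi)\mathrm D_x^2f(x^{\mathrm h}(t);0)(\varphi_2(t),\varphi_2(t)).$$ (In this situation $\Pi$ annihilates both inhomogeneous terms, since $\int\langle\psi_{n+2},\mathrm D_\mu f(x^{\mathrm h};0)\rangle dt=0$ and $\int\langle\psi_{n+2},\mathrm D_x^2f(x^{\mathrm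 h};0)(\varphi_2,\varphi_2)\rangle dt=0$.) The bifurcation is called supercritical (resp. subcritical) when the $S$-conjugate pairs on the curve $\mu=\phi_2(\alpha)$, $\alpha\neq0$ small, occur for $\mu>0$ (resp. $\mu<0$), i.e. when $\phi_2''(0)>0$ (resp. $\phi_2''(0)<0$). *)

theory Defs
  imports "HOL-Analysis.Analysis"
begin

text \<open>Real analyticity: near every point the function is the sum of an unconditionally convergent
  multi-variable power series. Multi-indices are functions on \<open>Basis\<close> (zero elsewhere).\<close>

definition real_analytic :: "('a::euclidean_space \<Rightarrow> 'b::euclidean_space) \<Rightarrow> bool" where
  "real_analytic f \<longleftrightarrow>
    (\<forall>p. \<exists>r>0. \<exists>c :: ('a \<Rightarrow> nat) \<Rightarrow> 'b. \<forall>x\<in>ball p r.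
       ((\<lambda>m. (\<Prod>b\<in>Basis. ((x - p) \<bullet> b) ^ m b) *\<^sub>R c m) has_sum f x)
         {m. \<forall>b. b \<notin> Basis \<longrightarrow> m b = 0})"

text \<open>Partial derivatives of a family of vector fields \<open>f x \<mu>\<close>. The higher \<open>x\<close>-derivatives are
  multilinear forms, given here by their values on vectors.\<close>

definition Dx :: "('a::euclidean_space \<Rightarrow> real \<Rightarrow> 'a) \<Rightarrow> 'a \<Rightarrow> real \<Rightarrow> 'a \<Rightarrow> 'a" where
  "Dx f x \<mu> u = frechet_derivative (\<lambda>y. f y \<mu>) (at x) u"

definition Dx2 :: "('a::euclidean_space \<Rightarrow> real \<Rightarrow> 'a) \<Rightarrow> 'a \<Rightarrow> real \<Rightarrow> 'a \<Rightarrow> 'a \<Rightarrow> 'a" where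
  "Dx2 f x \<mu> u v = frechet_derivative (\<lambda>y. Dx f y \<mu> u) (at x) v"

definition Dx3 :: "('a::euclidean_space \<Rightarrow> real \<Rightarrow> 'a) \<Rightarrow> 'a \<Rightarrow> real \<Rightarrow> 'a \<Rightarrow> 'a \<Rightarrow> 'a \<Rightarrow> 'a" where
  "Dx3 f x \<mu> u v w = frechet_derivative (\<lambda>y. Dx2 f y \<mu> u v) (at x) w"

definition Dmu :: "('a::euclidean_space \<Rightarrow> real \<Rightarrow> 'a) \<Rightarrow> 'a \<Rightarrow> real \<Rightarrow> 'a" where
  "Dmu f x \<mu> = vector_derivative (\<lambda>m. f x m) (at \<mu>)"

definition DmuDx :: "('a::euclidean_space \<Rightarrow> real \<Rightarrow> 'a) \<Rightarrow> 'a \<Rightarrow> real \<Rightarrow> 'a \<Rightarrow> 'a" where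
  "DmuDx f x \<mu> u = vector_derivative (\<lambda>m. Dx f x m u) (at \<mu>)"

definition scalar_product :: "('a::real_vector \<Rightarrow> 'a \<Rightarrow> real) \<Rightarrow> bool" where
  "scalar_product ip \<longleftrightarrow>
     bilinear ip \<and> (\<forall>x y. ip x y = ip y x) \<and> (\<forall>x. x \<noteq> 0 \<longrightarrow> ip x x > 0)"

definition orth_compl :: "('a \<Rightarrow> 'a \<Rightarrow> real) \<Rightarrow> 'a set \<Rightarrow> 'a set" where
  "orth_compl ip V = {x. \<forall>y\<in>V. ip x y = 0}"

definition Fix :: "('a \<Rightarrow> 'a) \<Rightarrow> 'a set" where
  "Fix R = {x. R x = x}"

definition Xplus :: "real ^ 'm ^ 'm \<Rightarrow> (real ^ 'm) set" where
  "Xplus S = {x. S *v x = x}"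

definition Xminus :: "real ^ 'm ^ 'm \<Rightarrow> (real ^ 'm) set" where
  "Xminus S = {x. S *v x = - x}"

definition homoclinic :: "('a::real_normed_vector \<Rightarrow> 'a) \<Rightarrow> (real \<Rightarrow> 'a) \<Rightarrow> bool" where
  "homoclinic g x \<longleftrightarrow>
     (\<forall>t. (x has_vector_derivative g (x t)) (at t)) \<and>
     (x \<longlongrightarrow> 0) at_top \<and> (x \<longlongrightarrow> 0) at_bot \<and> (\<exists>t. x t \<noteq> 0)"

definition symmetric :: "('a \<Rightarrow> 'a) \<Rightarrow> (real \<Rightarrow> 'a) \<Rightarrow> bool" where
  "symmetric R x \<longleftrightarrow> (\<forall>t. x t = R (x (- t)))"

definition conjugate_pair ::
  "(real ^ 'm) ^ 'm \<Rightarrow> (real \<Rightarrow> real ^ 'm) \<Rightarrow> (real \<Rightarrow> real ^ 'm) \<Rightarrow> bool" where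
  "conjugate_pair S x y \<longleftrightarrow> y = (\<lambda>t. S *v x t) \<and> x \<noteq> y"

definition solves_VE ::
  "('a::euclidean_space \<Rightarrow> real \<Rightarrow> 'a) \<Rightarrow> (real \<Rightarrow> 'a) \<Rightarrow> (real \<Rightarrow> 'a) \<Rightarrow> bool" where
  "solves_VE f xh \<xi> \<longleftrightarrow> (\<forall>t. (\<xi> has_vector_derivative Dx f (xh t) 0 (\<xi> t)) (at t))"

text \<open>Linear independence over the reals of functions of time (function spaces are not an instance
  of \<open>real_vector\<close>).\<close>

definition lin_indep_funs :: "nat set \<Rightarrow> (nat \<Rightarrow> real \<Rightarrow> 'a::real_vector) \<Rightarrow> bool" where
  "lin_indep_funs J \<phi> \<longleftrightarrow>
     (\<forall>c. (\<forall>t. (\<Sum>j\<in>J. c j *\<^sub>R \<phi> j t) = 0) \<longrightarrow> (\<forall>j\<in>J. c j = 0))"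

definition Z1 :: "('a::real_normed_vector \<Rightarrow> 'a) \<Rightarrow> real \<Rightarrow> (real \<Rightarrow> 'a) set" where
  "Z1 R \<kappa> = {z. z C1_differentiable_on UNIV \<and>
     bdd_above ((\<lambda>t. norm (z t) * exp (\<kappa> * \<bar>t\<bar>)) ` {0..}) \<and>
     bdd_above ((\<lambda>t. norm (vector_derivative z (at t)) * exp (\<kappa> * \<bar>t\<bar>)) ` {0..}) \<and>
     symmetric R z}"

definition Z10 ::
  "('a::real_normed_vector \<Rightarrow> 'a \<Rightarrow> real) \<Rightarrow> ('a \<Rightarrow> 'a) \<Rightarrow> real \<Rightarrow> (nat \<Rightarrow> real \<Rightarrow> 'a) \<Rightarrow>
     (real \<Rightarrow> 'a) set" where
  "Z10 ip R \<kappa> \<psi> = {z \<in> Z1 R \<kappa>. \<forall>j\<in>{1,2}. ip (\<psi> j 0) (z 0) = 0}"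

text \<open>The operator \<open>\<Pi>\<close>; its arguments \<open>w\<close> and \<open>v\<close> stand for
  \<open>\<psi>\<^sub>n\<^sub>+\<^sub>2\<close> and \<open>\<phi>\<^sub>n\<^sub>+\<^sub>2\<close>. It acts on continuous functions \<open>z\<close> with exponential decay and
  \<open>z(t) = - R z(-t)\<close>, for which the integral converges.\<close>

definition Pi_op ::
  "('a::real_normed_vector \<Rightarrow> 'a \<Rightarrow> real) \<Rightarrow> (real \<Rightarrow> real) \<Rightarrow> (real \<Rightarrow> 'a) \<Rightarrow> (real \<Rightarrow> 'a) \<Rightarrow>
     (real \<Rightarrow> 'a) \<Rightarrow> real \<Rightarrow> 'a" where
  "Pi_op ip q w v z t = (q t * (LBINT \<tau>. ip (w \<tau>) (z \<tau>))) *\<^sub>R v t"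

text \<open>\<open>\<xi>\<close> solves the variational equation with inhomogeneity \<open>(id - \<Pi>) g\<close>.\<close>

definition solves_inhom_VE ::
  "('a::euclidean_space \<Rightarrow> 'a \<Rightarrow> real) \<Rightarrow> (real \<Rightarrow> real) \<Rightarrow> (real \<Rightarrow> 'a) \<Rightarrow> (real \<Rightarrow> 'a) \<Rightarrow>
     ('a \<Rightarrow> real \<Rightarrow> 'a) \<Rightarrow> (real \<Rightarrow> 'a) \<Rightarrow> (real \<Rightarrow> 'a) \<Rightarrow> (real \<Rightarrow> 'a) \<Rightarrow> bool" where
  "solves_inhom_VE ip q w v f xh g \<xi> \<longleftrightarrow>
     (\<forall>t. (\<xi> has_vector_derivative
            Dx f (xh t) 0 (\<xi> t) + (g t - Pi_op ip q w v g t)) (at t))"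

definition a2bar ::
  "('a::euclidean_space \<Rightarrow> 'a \<Rightarrow> real) \<Rightarrow> ('a \<Rightarrow> real \<Rightarrow> 'a) \<Rightarrow> (real \<Rightarrow> 'a) \<Rightarrow>
     (real \<Rightarrow> 'a) \<Rightarrow> (real \<Rightarrow> 'a) \<Rightarrow> (real \<Rightarrow> 'a) \<Rightarrow> real" where
  "a2bar ip f xh w \<phi>2 \<xi>\<mu> =
     (LBINT t. ip (w t) (DmuDx f (xh t) 0 (\<phi>2 t) + Dx2 f (xh t) 0 (\<xi>\<mu> t) (\<phi>2 t)))"

definition b2bar ::
  "('a::euclidean_space \<Rightarrow> 'a \<Rightarrow> real) \<Rightarrow> ('a \<Rightarrow> real \<Rightarrow> 'a) \<Rightarrow> (real \<Rightarrow> 'a) \<Rightarrow>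
     (real \<Rightarrow> 'a) \<Rightarrow> (real \<Rightarrow> 'a) \<Rightarrow> (real \<Rightarrow> 'a) \<Rightarrow> real" where
  "b2bar ip f xh w \<phi>2 \<xi>\<alpha> =
     (LBINT t. ip (w t) ((1/6) *\<^sub>R Dx3 f (xh t) 0 (\<phi>2 t) (\<phi>2 t) (\<phi>2 t)
                         + Dx2 f (xh t) 0 (\<xi>\<alpha> t) (\<phi>2 t)))"

end

theory Submission
  imports Defs "HOL-Analysis.Analysis" "HOL-Computational_Algebra.Fundamental_Theorem_Algebra"
begin

text \<open>
  A symmetric orbit is determined by its half \<open>t \<ge> 0\<close> and the condition \<open>x(0) \<in> Fix R\<close>: for negative
  time it is \<open>R x(- t)\<close>. So everything is done on \<open>[0,\<infinity>)\<close>, and reversibility glues the two halves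
  (\<open>reflected_extension\<close>).

  An orbit \<open>x\<close> and its image \<open>S x\<close> are written as \<open>p + \<alpha> w\<close> and \<open>p - \<alpha> w\<close>. The mean and the difference
  quotient of \<open>f\<close> at these two points give a system for \<open>(p, w)\<close> with right-hand side
  \<open>(f(p + \<alpha> w) + f(p - \<alpha> w)) / 2\<close> and \<open>\<integral>\<^sub>0\<^sup>1 D\<^sub>x f(p + (2 s - 1) \<alpha> w) w ds\<close> (\<open>FF\<close>). It is smooth, even in \<open>\<alpha>\<close>, and
  at \<open>\<alpha> = \<mu> = 0\<close> it has the solution \<open>(x\<^sup>h, \<phi>\<^sub>2)\<close>, a homoclinic orbit in \<open>X\<^sup>+\<close> together with a solution of
  the variational equation in \<open>X\<^sup>-\<close>. Thus the pitchfork, a singular problem for \<open>x\<close>, is a regular one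
  for \<open>(p, w)\<close>: one solves for \<open>p = x\<^sup>h + y\<close>, \<open>w = \<phi>\<^sub>2 + v\<close> and \<open>\<mu>\<close> as functions of \<open>\<alpha>\<close>, where the part of
  \<open>w(0)\<close> along \<open>\<phi>\<^sub>2(0)\<close> is normalized. The solution is unique and the problem even, so \<open>\<mu> = \<Phi>(\<alpha>)\<close> is even.

  The linearization in \<open>(y, v, \<mu>)\<close> is triangular: \<open>y' = A y + \<mu> D\<^sub>\<mu>f + h\<^sub>1\<close> and
  \<open>v' = A v + B y + \<mu> \<eta> + h\<^sub>2\<close>, with \<open>A = D\<^sub>x f(x\<^sup>h)\<close>, \<open>B = D\<^sub>x\<^sup>2 f(x\<^sup>h)(\<cdot>, \<phi>\<^sub>2)\<close>, \<open>\<eta> = D\<^sub>\<mu> D\<^sub>x f(x\<^sup>h) \<phi>\<^sub>2\<close>. A bounded solution of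
  \<open>y' = A y + g\<close> that starts in \<open>Fix R\<close> exists if and only if \<open>\<psi>\<^sub>n\<^sub>+\<^sub>2\<close> annihilates \<open>g\<close>
  (\<open>Ksol_exists\<close>, \<open>solvability_integral\<close>, \<open>bdry_Fix\<close>). In the first equation this is automatic, since
  \<open>g\<close> lies in \<open>X\<^sup>+\<close>; in the second one it is an equation for \<open>\<mu>\<close> with coefficient \<open>- a\<^sub>2 / 2\<close>, half of the
  integral because the integrand is even. So \<open>a\<^sub>2 \<noteq> 0\<close> makes the linearization invertible, and a
  contraction gives the branch (\<open>even_parameter_branch\<close>). The second-order term in \<open>\<alpha>\<close> of \<open>FF\<close> is
  \<open>\<alpha>\<^sup>2 / 2\<close> times \<open>(D\<^sub>x\<^sup>2 f(\<phi>\<^sub>2, \<phi>\<^sub>2), D\<^sub>x\<^sup>3 f(\<phi>\<^sub>2, \<phi>\<^sub>2, \<phi>\<^sub>2) / 3)\<close>; the same solvability condition applied to it gives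
  \<open>\<Phi>''(0) = - 2 b\<^sub>2 / a\<^sub>2\<close> (\<open>half_line_branch\<close>). The orbits in \<open>X\<^sup>+\<close> come from a contraction for \<open>y\<close> alone
  (\<open>persistence\<close>).

  Bounded solutions on the half-line are controlled through the limit system: its eigenvalues
  split it into stable and unstable parts, whose estimates survive the decaying
  perturbation \<open>A(t) - L\<close> for large \<open>t\<close> (\<open>bounded_solution_estimate\<close>). The reversor exchanges the two
  parts, so the bounded solutions form a space of dimension at most \<open>n\<close> (\<open>bounded_solution_space_dim\<close>)
  and are the combinations of \<open>\<phi>\<^sub>1, \<dots>, \<phi>\<^sub>n\<close>.

  The involutions \<open>R\<close> and \<open>S\<close> may fail to commute. For this reason \<open>X\<^sup>+\<close> and \<open>X\<^sup>-\<close> are replaced by the common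
  eigenspaces \<open>V 1\<close> and \<open>V (-1)\<close> of \<open>S\<close> and \<open>R S R\<close>, which \<open>R\<close> preserves and which contain \<open>x\<^sup>h\<close> and \<open>\<phi>\<^sub>2\<close>.
\<close>


section \<open>Real analytic functions are smooth\<close>

definition multi_indices :: "('a::euclidean_space => nat) set" where
 "multi_indices = {m. ALL b. b \<notin> Basis --> m b = 0}"

definition monomial :: "('a::euclidean_space => nat) => 'a => real" where
 "monomial m y = (\<Prod>b\<in>Basis. (y \<bullet> b) ^ m b)"

definition total_degree :: "('a::euclidean_space => nat) => nat" where
 "total_degree m = (\<Sum>b\<in>Basis. m b)"

lemma countable_multi_indices: "countable (multi_indices :: ('a::euclidean_space => nat) set)"
proof -
 have "countable (PiE Basis (%_::'a. UNIV :: nat set))"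
  by (intro countable_PiE) auto
 moreover have "multi_indices \<subseteq> (%g b. if b \<in> Basis then g b else 0) `
   (PiE Basis (%_::'a. UNIV :: nat set))"
 proof
  fix m :: "'a => nat" assume m: "m \<in> multi_indices"
  have "m b = (if b \<in> Basis then (restrict m Basis) b else 0)" for b
  proof (cases "b \<in> Basis")
   case False
   with m have "m b = 0" unfolding multi_indices_def by blast
   with False show ?thesis by (simp only: if_False)
  qed (simp only: restrict_apply if_True)
  then have "m = (%b. if b \<in> Basis then (restrict m Basis) b else 0)" ..
  then show "m \<in> (%g b. if b \<in> Basis then g b else 0) ` (PiE Basis (%_::'a. UNIV :: nat set))"
   by (intro image_eqI[where x = "restrict m Basis"]) (simp_all only: restrict_PiE_iff UNIV_I ball_triv simp_thms)
 qed
 ultimately show ?thesis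
  by (meson countable_image countable_subset)
qed

lemma infinite_multi_indices: "infinite (multi_indices :: ('a::euclidean_space => nat) set)"
proof -
 obtain b0 :: 'a where b0: "b0 \<in> Basis" by (metis nonempty_Basis all_not_in_conv)
 have "inj (%k b. if b = b0 then (k::nat) else 0)"
  by (rule injI) (metis (mono_tags, lifting))
 moreover have "range (%k b. if b = b0 then (k::nat) else 0) \<subseteq> multi_indices"
  using b0 by (auto simp: multi_indices_def)
 ultimately show ?thesis
  using infinite_UNIV_nat range_inj_infinite infinite_super by blast
qed

lemma abs_monomial_le:
 assumes "!!b. b \<in> Basis ==> \<bar>y \<bullet> b\<bar> <= \<rho>"
 shows "\<bar>monomial m y\<bar> <= \<rho> ^ total_degree m"
proof -
 have "\<bar>monomial m y\<bar> = (\<Prod>b\<in>Basis. \<bar>y \<bullet> b\<bar> ^ m b)"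
  by (simp add: monomial_def abs_prod power_abs)
 also have "\<dots> <= (\<Prod>b\<in>Basis. \<rho> ^ m b)"
  by (intro prod_mono) (auto intro!: power_mono assms)
 also have "\<dots> = \<rho> ^ total_degree m"
  by (simp add: total_degree_def power_sum)
 finally show ?thesis .
qed

lemma monomial_has_derivative:
 "((%x. monomial m (x - p)) has_derivative
   (%h. \<Sum>b\<in>Basis. (h \<bullet> b) * (real (m b) * monomial (m(b := m b - 1)) (x - p)))) (at x within S)"
proof -
 have "((%x. \<Prod>b\<in>Basis. ((x - p) \<bullet> b) ^ m b) has_derivative
   (%h. \<Sum>b\<in>Basis. (real (m b) * (h \<bullet> b) * ((x - p) \<bullet> b) ^ (m b - 1)) *
    (\<Prod>b'\<in>Basis - {b}. ((x - p) \<bullet> b') ^ m b'))) (at x within S)"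
  by (rule has_derivative_prod) (auto intro!: derivative_eq_intros)
 moreover have "(h \<bullet> b) * (real (m b) * monomial (m(b := m b - 1)) (x - p)) =
  (real (m b) * (h \<bullet> b) * ((x - p) \<bullet> b) ^ (m b - 1)) *
    (\<Prod>b'\<in>Basis - {b}. ((x - p) \<bullet> b') ^ m b')" if "b \<in> Basis" for b h
 proof -
  have "monomial (m(b := m b - 1)) (x - p) =
   ((x - p) \<bullet> b) ^ (m b - 1) * (\<Prod>b'\<in>Basis - {b}. ((x - p) \<bullet> b') ^ m b')"
   unfolding monomial_def
   by (subst prod.remove[OF finite_Basis that]) (auto intro!: prod.cong)
  then show ?thesis by simp
 qed
 ultimately show ?thesis
  unfolding monomial_def[of m] by (elim has_derivative_eq_rhs) (intro ext sum.cong refl, metis)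
qed

text \<open>Reaching the corner \<open>p + \<rho>\<^sub>1 \<cdot> (1, \<dots>, 1)\<close> inside the ball of convergence gives geometric
 control of the coefficients.\<close>

lemma power_series_coefficients_summable:
 fixes c :: "('a::euclidean_space => nat) => 'b::euclidean_space"
 assumes r: "r > 0"
  and f: "!!x. x \<in> ball p r ==> ((%m. monomial m (x - p) *\<^sub>R c m) has_sum f x) multi_indices"
 obtains \<rho> where "\<rho> > 0" "\<rho> < r"
  "(%m. \<rho> ^ total_degree m * norm (c m)) summable_on multi_indices"
proof -
 define N where "N = norm (\<Sum>Basis :: 'a)"
 define \<rho> where "\<rho> = r / (2 * (N + 1))"
 have N: "N >= 0" by (simp add: N_def)
 have \<rho>: "\<rho> > 0" using r N by (simp add: \<rho>_def)
 have "\<rho> * N < r"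
 proof -
  have "\<rho> * N = r * (N / (2 * (N + 1)))" by (simp add: \<rho>_def)
  also have "\<dots> < r * 1"
   using N r by (intro mult_strict_left_mono) (auto simp: field_simps)
  finally show ?thesis by simp
 qed
 have "\<rho> < r"
 proof -
  have "r * 1 < r * (2 * (N + 1))" using N r by (intro mult_strict_left_mono) auto
  then show ?thesis using N by (simp add: \<rho>_def field_simps)
 qed
 define x0 where "x0 = p + \<rho> *\<^sub>R (\<Sum>Basis :: 'a)"
 have "x0 \<in> ball p r"
  using \<rho> \<open>\<rho> * N < r\<close> by (simp add: x0_def dist_norm N_def)
 have mono: "monomial m (x0 - p) = \<rho> ^ total_degree m" for m
 proof -
  have "monomial m (x0 - p) = (\<Prod>b\<in>Basis. \<rho> ^ m b)"
   unfolding monomial_def x0_def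
   by (intro prod.cong refl) (simp add: inner_sum_left_Basis)
  then show ?thesis by (simp add: total_degree_def power_sum)
 qed
 have hs: "((%m. \<rho> ^ total_degree m *\<^sub>R c m) has_sum f x0) multi_indices"
  using f[OF \<open>x0 \<in> ball p r\<close>] by (simp add: mono)
 have comp: "(%m. \<bar>\<rho> ^ total_degree m * (c m \<bullet> b)\<bar>) summable_on multi_indices" for b
 proof -
  have "(%m. (\<rho> ^ total_degree m *\<^sub>R c m) \<bullet> b) summable_on multi_indices"
   using summable_on_bounded_linear[OF bounded_linear_inner_left[of b], of "%m. \<rho> ^ total_degree m *\<^sub>R c m" multi_indices] hs
   by (auto simp: summable_on_def)
  then show ?thesis
   by (subst (asm) summable_on_iff_abs_summable_on_real) simp
 qed
 have "(%m. \<Sum>b\<in>I. \<bar>\<rho> ^ total_degree m * (c m \<bullet> b)\<bar>) summable_on multi_indices"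
  if "finite I" for I
  using that by induction (auto intro!: summable_on_add comp)
 from this[OF finite_Basis]
 have "(%m. \<rho> ^ total_degree m * norm (c m)) summable_on multi_indices"
 proof (rule summable_on_comparison_test)
  fix m :: "'a => nat"
  have "\<rho> ^ total_degree m * norm (c m) <= \<rho> ^ total_degree m * (\<Sum>b\<in>Basis. \<bar>c m \<bullet> b\<bar>)"
   using \<rho> by (intro mult_left_mono norm_le_l1) auto
  also have "\<dots> = (\<Sum>b\<in>Basis. \<bar>\<rho> ^ total_degree m * (c m \<bullet> b)\<bar>)"
   using \<rho> by (simp add: sum_distrib_left abs_mult)
  finally show "\<rho> ^ total_degree m * norm (c m) <= (\<Sum>b\<in>Basis. \<bar>\<rho> ^ total_degree m * (c m \<bullet> b)\<bar>)" .
 qed (use \<rho> in auto)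
 then show ?thesis using that \<rho> \<open>\<rho> < r\<close> by blast
qed

text \<open>Termwise differentiation: on a smaller ball the differentiated series is dominated by the
 geometric control of the coefficients, and its coefficients are again those of a power series.\<close>

lemma power_series_has_derivative:
 fixes c :: "('a::euclidean_space => nat) => 'b::euclidean_space"
 assumes r: "r > 0"
  and f: "!!x. x \<in> ball p r ==> ((%m. monomial m (x - p) *\<^sub>R c m) has_sum f x) multi_indices"
 shows "\<exists>\<rho>>0. EX D. \<forall>x\<in>ball p \<rho>.
  (f has_derivative (%h. \<Sum>b\<in>Basis. (h \<bullet> b) *\<^sub>R D b x)) (at x) &
  (\<forall>b\<in>Basis. ((%m. monomial m (x - p) *\<^sub>R (real (m b + 1) *\<^sub>R c (m(b := m b + 1)))) has_sum D b x)
    multi_indices)"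
proof -
 obtain \<rho>1 where \<rho>1: "\<rho>1 > 0" "\<rho>1 < r"
  and sm: "(%m. \<rho>1 ^ total_degree m * norm (c m)) summable_on multi_indices"
  using power_series_coefficients_summable[OF r f] by metis
 define \<rho> where "\<rho> = \<rho>1 / 2"
 have \<rho>: "\<rho> > 0" "\<rho> < r" using \<rho>1 by (auto simp: \<rho>_def)
 define tm where "tm b m x = (real (m b) * monomial (m(b := m b - 1)) (x - p)) *\<^sub>R c m" for b m and x :: 'a
 have tm_bound: "norm (tm b m x) <= (1 / \<rho>) * (\<rho>1 ^ total_degree m * norm (c m))"
  if b: "b \<in> Basis" and x: "x \<in> ball p \<rho>" for b m x
 proof (cases "m b = 0")
  case True
  then show ?thesis using \<rho> \<rho>1 by (simp add: tm_def)
 next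
  case False
  define d where "d = total_degree m"
  have d: "total_degree (m(b := m b - 1)) + 1 = d" "m b <= d"
  proof -
   have 1: "total_degree m = m b + (\<Sum>b'\<in>Basis - {b}. m b')"
    unfolding total_degree_def by (subst sum.remove[OF finite_Basis b]) auto
   have 2: "total_degree (m(b := m b - 1)) = (m b - 1) + (\<Sum>b'\<in>Basis - {b}. m b')"
    unfolding total_degree_def by (subst sum.remove[OF finite_Basis b]) (auto intro!: sum.cong)
   show "total_degree (m(b := m b - 1)) + 1 = d" "m b <= d"
    using 1 2 False by (auto simp: d_def)
  qed
  have "\<bar>(x - p) \<bullet> b'\<bar> <= \<rho>" if "b' \<in> Basis" for b'
  proof -
   have "\<bar>(x - p) \<bullet> b'\<bar> <= norm (x - p)" using that by (rule Basis_le_norm)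
   also have "\<dots> <= \<rho>" using x by (simp add: dist_norm norm_minus_commute)
   finally show ?thesis .
  qed
  then have "\<bar>monomial (m(b := m b - 1)) (x - p)\<bar> <= \<rho> ^ total_degree (m(b := m b - 1))"
   by (rule abs_monomial_le)
  also have "\<dots> = \<rho> ^ d / \<rho>" using d(1) \<rho> by (simp flip: d(1))
  finally have "real (m b) * \<bar>monomial (m(b := m b - 1)) (x - p)\<bar> <= real d * (\<rho> ^ d / \<rho>)"
   using d(2) by (intro mult_mono) auto
  also have "\<dots> <= 2 ^ d * (\<rho> ^ d / \<rho>)"
   using \<rho> by (intro mult_right_mono) (auto intro: less_imp_le of_nat_less_two_power)
  also have "\<dots> = (1 / \<rho>) * \<rho>1 ^ d"
   by (simp add: \<rho>_def power_divide)
  finally have "real (m b) * \<bar>monomial (m(b := m b - 1)) (x - p)\<bar> * norm (c m) <= (1 / \<rho>) * \<rho>1 ^ d * norm (c m)"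
   by (rule mult_right_mono) auto
  then show ?thesis by (simp add: tm_def abs_mult d_def)
 qed
 define e :: "nat => 'a => nat" where "e = from_nat_into multi_indices"
 have e: "bij_betw e UNIV multi_indices"
  unfolding e_def by (intro bij_betw_from_nat_into countable_multi_indices infinite_multi_indices)
 define B where "B i = (1 / \<rho>) * (\<rho>1 ^ total_degree (e i) * norm (c (e i)))" for i
 have Bnn: "B i >= 0" for i using \<rho> \<rho>1 by (simp add: B_def)
 have B: "summable B"
 proof -
  have "(%i. \<rho>1 ^ total_degree (e i) * norm (c (e i))) summable_on UNIV"
   using summable_on_reindex_bij_betw[OF e, of "%m. \<rho>1 ^ total_degree m * norm (c m)"] sm by simp
  then have "summable (%i. \<rho>1 ^ total_degree (e i) * norm (c (e i)))"
   by (rule summable_on_imp_summable)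
  then show ?thesis unfolding B_def by (rule summable_mult)
 qed
 define D where "D b x = (\<Sum>i. tm b (e i) x)" for b x
 have tm_hs: "((%i. tm b (e i) x) has_sum D b x) UNIV"
  if "b \<in> Basis" "x \<in> ball p \<rho>" for b x
 proof -
  have sn: "summable (%i. norm (tm b (e i) x))"
   by (rule summable_comparison_test'[OF B, of 0]) (use tm_bound[OF that] in \<open>auto simp: B_def\<close>)
  show ?thesis unfolding D_def
   by (rule norm_summable_imp_has_sum[OF sn]) (use summable_norm_cancel[OF sn] in \<open>simp add: summable_sums\<close>)
 qed
 have part: "((%m. monomial m (x - p) *\<^sub>R (real (m b + 1) *\<^sub>R c (m(b := m b + 1)))) has_sum D b x)
    multi_indices" if b: "b \<in> Basis" and x: "x \<in> ball p \<rho>" for b x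
 proof -
  have 1: "((%m. tm b m x) has_sum D b x) multi_indices"
   using tm_hs[OF that] has_sum_reindex_bij_betw[OF e, of "%m. tm b m x"] by simp
  define s where "s m = m(b := m b + 1)" for m :: "'a => nat"
  have inj: "inj_on s multi_indices"
  proof (rule inj_onI)
   fix m m' assume eq: "s m = s m'"
   show "m = m'"
   proof
    fix b' show "m b' = m' b'"
     using fun_cong[OF eq, of b'] by (cases "b' = b") (auto simp: s_def)
   qed
  qed
  have im: "s ` multi_indices = {m\<in>multi_indices. m b ~= 0}"
  proof
   show "s ` multi_indices \<subseteq> {m\<in>multi_indices. m b ~= 0}"
    using b by (auto simp: s_def multi_indices_def)
   show "{m\<in>multi_indices. m b ~= 0} \<subseteq> s ` multi_indices"
   proof
    fix m assume m: "m \<in> {m\<in>multi_indices. m b ~= 0}"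
    then have "m = s (m(b := m b - 1))" by (auto simp: s_def)
    moreover have "m(b := m b - 1) \<in> multi_indices" using m b by (auto simp: multi_indices_def)
    ultimately show "m \<in> s ` multi_indices" by blast
   qed
  qed
  have "((%m. tm b m x) has_sum D b x) (s ` multi_indices)"
   using 1 by (subst (asm) has_sum_cong_neutral[of _ _ _ "%m. tm b m x"]) (auto simp: im tm_def)
  then have "((%m. tm b m x) \<circ> s has_sum D b x) multi_indices"
   using has_sum_reindex[OF inj] by blast
  moreover have "((%m. tm b m x) \<circ> s) m = monomial m (x - p) *\<^sub>R (real (m b + 1) *\<^sub>R c (m(b := m b + 1)))" for m
   by (simp add: tm_def s_def mult.commute)
  ultimately show ?thesis by (simp add: o_def)
 qed
 define F' where "F' i x h = (\<Sum>b\<in>Basis. (h \<bullet> b) *\<^sub>R tm b (e i) x)" for i x and h :: 'a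
 define G where "G x h = (\<Sum>b\<in>Basis. (h \<bullet> b) *\<^sub>R D b x)" for x and h :: 'a
 define K where "K = real DIM('a)"
 have "EX g. \<forall>x\<in>ball p \<rho>. (%i. monomial (e i) (x - p) *\<^sub>R c (e i)) sums g x &
   (g has_derivative G x) (at x within ball p \<rho>)"
 proof (rule has_derivative_series[where f' = F' and x = p])
  show "((%x. monomial (e i) (x - p) *\<^sub>R c (e i)) has_derivative F' i x) (at x within ball p \<rho>)" for i x
  proof -
   have "((%x. monomial (e i) (x - p) *\<^sub>R c (e i)) has_derivative
    (%h. (\<Sum>b\<in>Basis. (h \<bullet> b) * (real (e i b) * monomial ((e i)(b := e i b - 1)) (x - p))) *\<^sub>R c (e i)))
    (at x within ball p \<rho>)"
    by (intro has_derivative_scaleR_left monomial_has_derivative)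
   then show ?thesis by (simp add: F'_def[abs_def] tm_def scaleR_sum_left)
  qed
  show "\<forall>\<^sub>F n in sequentially. \<forall>x\<in>ball p \<rho>. ALL h. norm ((\<Sum>i<n. F' i x h) - G x h) <= eps * norm h"
   if eps: "eps > 0" for eps
  proof -
   have "(%n. suminf B - sum B {..<n}) \<longlonglongrightarrow> suminf B - suminf B"
    by (intro tendsto_intros summable_LIMSEQ B)
   then have "\<forall>\<^sub>F n in sequentially. suminf B - sum B {..<n} < eps / (K + 1)"
    using eps by (intro order_tendstoD(2)[where y = 0]) (auto simp: K_def)
   then show ?thesis
   proof eventually_elim
    case (elim n)
    have *: "norm (D b x - (\<Sum>i<n. tm b (e i) x)) <= eps / (K + 1)"
     if b: "b \<in> Basis" and x: "x \<in> ball p \<rho>" for b x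
    proof -
     have su: "summable (%i. tm b (e i) x)"
      using has_sum_imp_sums[OF tm_hs[OF b x]] by (rule sums_summable)
     have nle: "norm (tm b (e i) x) <= B i" for i using tm_bound[OF b x] by (simp add: B_def)
     have "D b x - (\<Sum>i<n. tm b (e i) x) = (\<Sum>i. tm b (e (i + n)) x)"
      unfolding D_def using suminf_minus_initial_segment[OF su, of n] by simp
     also have "norm \<dots> <= (\<Sum>i. B (i + n))"
      using B nle by (intro norm_suminf_le) (auto simp: summable_iff_shift)
     also have "\<dots> = suminf B - sum B {..<n}"
      using suminf_minus_initial_segment[OF B, of n] by simp
     finally show ?thesis using elim by simp
    qed
    show ?case
    proof (intro ballI allI)
     fix x h assume x: "x \<in> ball p \<rho>"
     have "(\<Sum>i<n. F' i x h) - G x h = (\<Sum>b\<in>Basis. (h \<bullet> b) *\<^sub>R ((\<Sum>i<n. tm b (e i) x) - D b x))"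
      unfolding F'_def G_def
      by (subst sum.swap) (simp add: scaleR_diff_right sum_subtractf flip: scaleR_sum_right)
     also have "norm \<dots> <= (\<Sum>b\<in>(Basis::'a set). norm h * (eps / (K + 1)))"
     proof (rule order_trans[OF norm_sum], rule sum_mono)
      fix b :: 'a assume b: "b \<in> Basis"
      have "norm ((h \<bullet> b) *\<^sub>R ((\<Sum>i<n. tm b (e i) x) - D b x)) = \<bar>h \<bullet> b\<bar> * norm (D b x - (\<Sum>i<n. tm b (e i) x))"
       by (simp add: norm_minus_commute)
      also have "\<dots> <= norm h * (eps / (K + 1))"
       using *[OF b x] b by (intro mult_mono) (auto simp: Basis_le_norm)
      finally show "norm ((h \<bullet> b) *\<^sub>R ((\<Sum>i<n. tm b (e i) x) - D b x)) <= norm h * (eps / (K + 1))" .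
     qed
     also have "\<dots> = (K / (K + 1)) * (eps * norm h)" by (simp add: K_def)
     also have "\<dots> <= 1 * (eps * norm h)"
      using eps by (intro mult_right_mono) (auto simp: K_def)
     finally show "norm ((\<Sum>i<n. F' i x h) - G x h) <= eps * norm h" by simp
    qed
   qed
  qed
  show "(%i. monomial (e i) (p - p) *\<^sub>R c (e i)) sums f p"
   using has_sum_imp_sums[of "%i. monomial (e i) (p - p) *\<^sub>R c (e i)" "f p"]
    has_sum_reindex_bij_betw[OF e, of "%m. monomial m (p - p) *\<^sub>R c m" "f p"] f[of p] r by simp
 qed (use \<rho> in auto)
 then obtain g where g: "!!x. x \<in> ball p \<rho> ==> (%i. monomial (e i) (x - p) *\<^sub>R c (e i)) sums g x"
  "!!x. x \<in> ball p \<rho> ==> (g has_derivative G x) (at x within ball p \<rho>)" by blast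
 have gf: "g x = f x" if "x \<in> ball p \<rho>" for x
 proof -
  have "(%i. monomial (e i) (x - p) *\<^sub>R c (e i)) sums f x"
   using has_sum_imp_sums[of "%i. monomial (e i) (x - p) *\<^sub>R c (e i)" "f x"]
    has_sum_reindex_bij_betw[OF e, of "%m. monomial m (x - p) *\<^sub>R c m" "f x"] f[of x] that \<rho> by auto
  then show ?thesis using g(1)[OF that] sums_unique2 by blast
 qed
 have "(f has_derivative G x) (at x)" if x: "x \<in> ball p \<rho>" for x
 proof -
  have "(g has_derivative G x) (at x)" using g(2)[OF x] unfolding at_within_open[OF x open_ball] .
  then show ?thesis
   by (rule has_derivative_transform_within_open[OF _ open_ball x]) (use gf in auto)
 qed
 then show ?thesis using \<rho>(1) part unfolding G_def by blast
qed

lemma real_analytic_alt: "real_analytic f \<longleftrightarrow>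
  (ALL p. EX r>0. EX c. \<forall>x\<in>ball p r. ((%m. monomial m (x - p) *\<^sub>R c m) has_sum f x) multi_indices)"
 by (simp add: real_analytic_def monomial_def multi_indices_def)

lemma real_analytic_has_derivative:
 fixes f :: "'a::euclidean_space => 'b::euclidean_space"
 assumes "real_analytic f"
 shows "EX D. (ALL x. (f has_derivative (%h. \<Sum>b\<in>Basis. (h \<bullet> b) *\<^sub>R D b x)) (at x)) &
  (\<forall>b\<in>Basis. real_analytic (D b))"
proof -
 define D where "D b x = frechet_derivative f (at x) b" for b x
 have *: "\<exists>\<rho>>0. \<forall>x\<in>ball p \<rho>.
  (f has_derivative (%h. \<Sum>b\<in>Basis. (h \<bullet> b) *\<^sub>R D b x)) (at x) &
  (\<forall>b\<in>Basis. EX c. \<forall>x\<in>ball p \<rho>. ((%m. monomial m (x - p) *\<^sub>R c m) has_sum D b x) multi_indices)" for p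
 proof -
  obtain r c where "r > 0" "!!x. x\<in>ball p r ==> ((%m. monomial m (x - p) *\<^sub>R c m) has_sum f x) multi_indices"
   using assms unfolding real_analytic_alt by blast
  from power_series_has_derivative[OF this] obtain \<rho> E where \<rho>: "\<rho> > 0"
   and E: "!!x. x\<in>ball p \<rho> ==> (f has_derivative (%h. \<Sum>b\<in>Basis. (h \<bullet> b) *\<^sub>R E b x)) (at x)"
   and Es: "!!x b. x\<in>ball p \<rho> ==> b \<in> Basis ==>
    ((%m. monomial m (x - p) *\<^sub>R (real (m b + 1) *\<^sub>R c (m(b := m b + 1)))) has_sum E b x) multi_indices"
   by blast
  have DE: "D b x = E b x" if "x \<in> ball p \<rho>" "b \<in> Basis" for b x
  proof -
   have "D b x = (\<Sum>b'\<in>Basis. (b \<bullet> b') *\<^sub>R E b' x)"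
    unfolding D_def using frechet_derivative_at[OF E[OF that(1)]] by metis
   also have "\<dots> = (\<Sum>b'\<in>Basis. if b' = b then E b' x else 0)"
    using that by (intro sum.cong) (auto simp: inner_Basis)
   finally show ?thesis using that by simp
  qed
  have "(f has_derivative (%h. \<Sum>b\<in>Basis. (h \<bullet> b) *\<^sub>R D b x)) (at x)" if "x \<in> ball p \<rho>" for x
   using E[OF that] DE[OF that] by (simp cong: sum.cong)
  moreover have "EX c. \<forall>x\<in>ball p \<rho>. ((%m. monomial m (x - p) *\<^sub>R c m) has_sum D b x) multi_indices"
   if "b \<in> Basis" for b
   using Es[OF _ that] DE[OF _ that] by (intro exI[of _ "%m. real (m b + 1) *\<^sub>R c (m(b := m b + 1))"]) auto
  ultimately show ?thesis using \<rho> by blast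
 qed
 have "(f has_derivative (%h. \<Sum>b\<in>Basis. (h \<bullet> b) *\<^sub>R D b x)) (at x)" for x
  using *[of x] by (meson centre_in_ball)
 moreover have "real_analytic (D b)" if b: "b \<in> Basis" for b
  unfolding real_analytic_alt
 proof
  fix p
  obtain \<rho> where "\<rho> > 0" and \<rho>: "\<forall>x\<in>ball p \<rho>.
   (\<forall>b\<in>Basis. EX c. \<forall>x\<in>ball p \<rho>. ((%m. monomial m (x - p) *\<^sub>R c m) has_sum D b x) multi_indices)"
   using *[of p] by blast
  then have "p \<in> ball p \<rho>" by simp
  then show "EX r>0. EX c. \<forall>x\<in>ball p r. ((%m. monomial m (x - p) *\<^sub>R c m) has_sum D b x) multi_indices"
   using \<rho> b \<open>\<rho> > 0\<close> by blast
 qed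
 ultimately show ?thesis by blast
qed

lemma real_analytic_zero: "real_analytic (%x. 0)"
 unfolding real_analytic_alt by (intro allI exI[of _ 1] conjI exI[of _ "%_. 0"]) auto

lemma real_analytic_add_scaleR:
 assumes "real_analytic f" "real_analytic g"
 shows "real_analytic (%x. a *\<^sub>R f x + g x)"
 unfolding real_analytic_alt
proof
 fix p
 obtain r c where r: "r > 0" "!!x. x\<in>ball p r ==> ((%m. monomial m (x - p) *\<^sub>R c m) has_sum f x) multi_indices"
  using assms(1) unfolding real_analytic_alt by blast
 obtain r' c' where r': "r' > 0" "!!x. x\<in>ball p r' ==> ((%m. monomial m (x - p) *\<^sub>R c' m) has_sum g x) multi_indices"
  using assms(2) unfolding real_analytic_alt by blast
 have "((%m. monomial m (x - p) *\<^sub>R (a *\<^sub>R c m + c' m)) has_sum (a *\<^sub>R f x + g x)) multi_indices"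
  if "x \<in> ball p (min r r')" for x
 proof -
  have "((%m. a *\<^sub>R (monomial m (x - p) *\<^sub>R c m) + monomial m (x - p) *\<^sub>R c' m) has_sum
    (a *\<^sub>R f x + g x)) multi_indices"
   using that by (intro has_sum_add has_sum_scaleR r(2) r'(2)) auto
  then show ?thesis by (simp add: scaleR_add_right mult.commute)
 qed
 then show "EX r>0. EX c. \<forall>x\<in>ball p r. ((%m. monomial m (x - p) *\<^sub>R c m) has_sum (a *\<^sub>R f x + g x)) multi_indices"
  using r(1) r'(1) by (intro exI[of _ "min r r'"] conjI exI[of _ "%m. a *\<^sub>R c m + c' m"]) auto
qed

lemma real_analytic_linear_combination:
 assumes "finite I" "!!i. i \<in> I ==> real_analytic (g i)"
 shows "real_analytic (%x. \<Sum>i\<in>I. a i *\<^sub>R g i x)"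
 using assms
proof (induction I rule: finite_induct)
 case empty
 then show ?case by (simp add: real_analytic_zero)
next
 case (insert i I)
 then show ?case
  using real_analytic_add_scaleR[of "g i" "%x. \<Sum>i\<in>I. a i *\<^sub>R g i x" "a i"] by simp
qed

text \<open>Recursion on the order through directional derivatives keeps all maps within the same pair of spaces.\<close>

fun Ck :: "nat => ('a::euclidean_space => 'b::euclidean_space) => bool" where
 "Ck 0 f = continuous_on UNIV f"
| "Ck (Suc k) f = (EX f'. (ALL x. (f has_derivative f' x) (at x)) & (ALL h. Ck k (%x. f' x h)))"

text \<open>The partial derivatives of an analytic function are analytic, so the argument can be
 iterated.\<close>

lemma real_analytic_Ck: "real_analytic f ==> Ck k f"
proof (induction k arbitrary: f)
 case 0
 then show ?case
  using real_analytic_has_derivative[OF 0] has_derivative_continuous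
  by (fastforce simp: continuous_on_eq_continuous_at)
next
 case (Suc k)
 obtain D where D: "!!x. (f has_derivative (%h. \<Sum>b\<in>Basis. (h \<bullet> b) *\<^sub>R D b x)) (at x)"
  "!!b. b\<in>Basis ==> real_analytic (D b)"
  using real_analytic_has_derivative[OF Suc.prems] by blast
 have "Ck k (%x. \<Sum>b\<in>Basis. (h \<bullet> b) *\<^sub>R D b x)" for h
  by (intro Suc.IH real_analytic_linear_combination finite_Basis D(2))
 then show ?case using D(1) unfolding Ck.simps
  by (intro exI[of _ "%x h. \<Sum>b\<in>Basis. (h \<bullet> b) *\<^sub>R D b x"] conjI allI)
qed

section \<open>Calculus of smooth maps\<close>

lemma Ck_continuous: "Ck k f ==> continuous_on UNIV f"
 by (cases k) (auto simp: continuous_on_eq_continuous_at intro: has_derivative_continuous)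

lemma Ck_Suc_imp: "Ck (Suc k) f ==> Ck k f"
proof (induction k arbitrary: f)
 case 0
 then show ?case using Ck_continuous by (metis Ck.simps(1))
next
 case (Suc k)
 from Suc.prems obtain f' where "!!x. (f has_derivative f' x) (at x)" "!!h. Ck (Suc k) (%x. f' x h)"
  unfolding Ck.simps(2)[of "Suc k"] by blast
 then show ?case using Suc.IH unfolding Ck.simps(2)[of k] by blast
qed

lemma Ck_const: "Ck k (%x. c)"
proof (induction k arbitrary: c)
 case (Suc k)
 then show ?case unfolding Ck.simps by (intro exI[of _ "%_ _. 0"]) auto
qed simp

lemma Ck_bounded_linear: "bounded_linear f ==> Ck k f"
proof (cases k)
 case 0
 then show "bounded_linear f ==> Ck k f"
  by (simp add: linear_continuous_on)
next
 case (Suc j)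
 show ?thesis if "bounded_linear f"
  using that Ck_const bounded_linear_imp_has_derivative
  unfolding Suc Ck.simps by (intro exI[of _ "%_. f"]) auto
qed

lemma Ck_bounded_linear_compose: "bounded_linear L ==> Ck k g ==> Ck k (%x. L (g x))"
proof (induction k arbitrary: g)
 case 0
 then show ?case
  unfolding Ck.simps by (rule bounded_linear.continuous_on)
next
 case (Suc k)
 obtain g' where g': "!!x. (g has_derivative g' x) (at x)" "!!h. Ck k (%x. g' x h)"
  using Suc.prems unfolding Ck.simps by blast
 have "!!x. ((%x. L (g x)) has_derivative (%h. L (g' x h))) (at x)"
  by (rule bounded_linear.has_derivative[OF Suc.prems(1) g'(1)])
 then show ?case using Suc.IH[OF Suc.prems(1) g'(2)]
  unfolding Ck.simps by (intro exI[of _ "%x h. L (g' x h)"]) auto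
qed

lemma Ck_add: "Ck k f ==> Ck k g ==> Ck k (%x. f x + g x)"
proof (induction k arbitrary: f g)
 case 0
 then show ?case by (auto intro: continuous_intros)
next
 case (Suc k)
 obtain f' where f': "!!x. (f has_derivative f' x) (at x)" "!!h. Ck k (%x. f' x h)"
  using Suc.prems(1) unfolding Ck.simps by blast
 obtain g' where g': "!!x. (g has_derivative g' x) (at x)" "!!h. Ck k (%x. g' x h)"
  using Suc.prems(2) unfolding Ck.simps by blast
 show ?case using Suc.IH[OF f'(2) g'(2)] has_derivative_add[OF f'(1) g'(1)]
  unfolding Ck.simps by (intro exI[of _ "%x h. f' x h + g' x h"]) auto
qed

lemma Ck_sum: "finite I ==> (!!i. i \<in> I ==> Ck k (f i)) ==> Ck k (%x. \<Sum>i\<in>I. f i x)"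
 by (induction I rule: finite_induct) (auto intro: Ck_const Ck_add)

lemma Ck_scaleR: "Ck k a ==> Ck k f ==> Ck k (%x. a x *\<^sub>R f x)"
proof (induction k arbitrary: a f)
 case 0
 then show ?case by (auto intro: continuous_intros)
next
 case (Suc k)
 obtain f' where f': "!!x. (f has_derivative f' x) (at x)" "!!h. Ck k (%x. f' x h)"
  using Suc.prems(2) unfolding Ck.simps by blast
 obtain a' where a': "!!x. (a has_derivative a' x) (at x)" "!!h. Ck k (%x. a' x h)"
  using Suc.prems(1) unfolding Ck.simps by blast
 have "Ck k a" "Ck k f" using Suc.prems by (auto intro: Ck_Suc_imp simp del: Ck.simps)
 then have "Ck k (%x. a x *\<^sub>R f' x h + a' x h *\<^sub>R f x)" for h
  using a'(2) f'(2) by (intro Ck_add Suc.IH)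
 moreover have "((%x. a x *\<^sub>R f x) has_derivative (%h. a x *\<^sub>R f' x h + a' x h *\<^sub>R f x)) (at x)" for x
  by (rule has_derivative_scaleR[OF a'(1) f'(1)])
 ultimately show ?case
  unfolding Ck.simps by (intro exI[of _ "%x h. a x *\<^sub>R f' x h + a' x h *\<^sub>R f x"]) auto
qed

lemma Ck_Pair: "Ck k f ==> Ck k g ==> Ck k (%x. (f x, g x))"
proof (induction k arbitrary: f g)
 case 0
 then show ?case by (auto intro: continuous_intros)
next
 case (Suc k)
 obtain f' where f': "!!x. (f has_derivative f' x) (at x)" "!!h. Ck k (%x. f' x h)"
  using Suc.prems(1) unfolding Ck.simps by blast
 obtain g' where g': "!!x. (g has_derivative g' x) (at x)" "!!h. Ck k (%x. g' x h)"
  using Suc.prems(2) unfolding Ck.simps by blast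
 show ?case using Suc.IH[OF f'(2) g'(2)] has_derivative_Pair[OF f'(1) g'(1)]
  unfolding Ck.simps by (intro exI[of _ "%x h. (f' x h, g' x h)"]) auto
qed

lemma linear_sum_Basis:
 fixes v :: "'a::euclidean_space"
 assumes "linear L" shows "L v = (\<Sum>b\<in>Basis. (v \<bullet> b) *\<^sub>R L b)"
proof -
 have "L v = L (\<Sum>b\<in>Basis. (v \<bullet> b) *\<^sub>R b)" by (simp add: euclidean_representation)
 also have "\<dots> = (\<Sum>b\<in>Basis. (v \<bullet> b) *\<^sub>R L b)"
  using assms by (simp add: linear_sum linear_cmul)
 finally show ?thesis .
qed

lemma Ck_compose: "Ck k f ==> Ck k g ==> Ck k (%x. f (g x))"
proof (induction k arbitrary: f g)
 case 0
 then show ?case by (auto intro: continuous_on_compose2)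
next
 case (Suc k)
 obtain f' where f': "!!x. (f has_derivative f' x) (at x)" "!!h. Ck k (%x. f' x h)"
  using Suc.prems(1) unfolding Ck.simps by blast
 obtain g' where g': "!!x. (g has_derivative g' x) (at x)" "!!h. Ck k (%x. g' x h)"
  using Suc.prems(2) unfolding Ck.simps by blast
 have "Ck k g" using Suc.prems by (auto intro: Ck_Suc_imp simp del: Ck.simps)
 have "Ck k (%x. \<Sum>b\<in>Basis. (g' x h \<bullet> b) *\<^sub>R f' (g x) b)" for h
  by (intro Ck_sum finite_Basis Ck_scaleR Ck_bounded_linear_compose[OF bounded_linear_inner_left] g'(2)
    Suc.IH[OF f'(2)] \<open>Ck k g\<close>)
 moreover have "(\<Sum>b\<in>Basis. (g' x h \<bullet> b) *\<^sub>R f' (g x) b) = f' (g x) (g' x h)" for x h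
  using linear_sum_Basis[of "f' (g x)"] has_derivative_linear[OF f'(1)] by metis
 moreover have "((%x. f (g x)) has_derivative (%h. f' (g x) (g' x h))) (at x)" for x
  by (rule has_derivative_compose[OF g'(1) f'(1)])
 ultimately show ?case
  unfolding Ck.simps by (intro exI[of _ "%x h. f' (g x) (g' x h)"]) auto
qed

lemma has_derivative_integral_param:
 fixes g :: "real \<times> 'z::euclidean_space => 'b::euclidean_space"
 assumes g': "!!x. (g has_derivative g' x) (at x)" "!!h. continuous_on UNIV (%x. g' x h)"
 shows "((%z. integral {0..1} (%s. g (s, z))) has_derivative
   (%h. integral {0..1} (%s. g' (s, z) (0, h)))) (at z)"
proof -
 define G where "G z s = Blinfun (%h. g' (s, z) (0, h))" for z :: 'z and s :: real
 have lin: "bounded_linear (%h. g' (s, z) (0, h))" for s z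
  using bounded_linear_compose[OF has_derivative_bounded_linear[OF g'(1)], of "%h. (0, h)"]
  by (simp add: bounded_linear_Pair)
 have G: "blinfun_apply (G z s) = (%h. g' (s, z) (0, h))" for z s
  unfolding G_def by (rule bounded_linear_Blinfun_apply[OF lin])
 have cg: "continuous_on UNIV g"
  using g'(1) by (meson continuous_at_imp_continuous_on has_derivative_continuous)
 have cG: "continuous_on (UNIV \<times> cbox 0 1) (%(z, s). G z s)"
 proof (rule continuous_on_blinfun_componentwise)
  fix i :: 'z
  have "continuous_on (UNIV \<times> cbox 0 1) (%x. g' (snd x, fst x) (0, i))"
   by (rule continuous_on_compose2[OF g'(2)]) (auto intro!: continuous_intros)
  then show "continuous_on (UNIV \<times> cbox 0 1) (%x. blinfun_apply (case x of (z, s) => G z s) i)"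
   by (simp add: case_prod_unfold G)
 qed
 have "((%z. integral (cbox 0 1) (%s. g (s, z))) has_derivative
   blinfun_apply (integral (cbox 0 1) (G z))) (at z within UNIV)"
 proof (rule leibniz_rule[OF _ _ cG])
  show "((%z. g (s, z)) has_derivative blinfun_apply (G z s)) (at z within UNIV)" for z s
   unfolding G
   by (rule has_derivative_compose[of "%z. (s, z)" "%h. (0, h)" z UNIV g "g' (s, z)"])
    (auto intro!: has_derivative_Pair g'(1))
  show "(%s. g (s, z)) integrable_on cbox 0 1" for z
   by (intro integrable_continuous continuous_on_compose2[OF cg]) (auto intro!: continuous_intros)
 qed auto
 moreover have "blinfun_apply (integral (cbox 0 1) (G z)) = (%h. integral {0..1} (%s. g' (s, z) (0, h)))"
 proof
  fix h
  have "continuous_on (cbox 0 1) (%s. case (z, s) of (z, s) => G z s)"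
   by (rule continuous_on_compose2[OF cG, where f = "%s. (z, s)"]) (auto intro!: continuous_intros)
  then have "G z integrable_on cbox 0 1"
   by (intro integrable_continuous) simp
  then show "blinfun_apply (integral (cbox 0 1) (G z)) h = integral {0..1} (%s. g' (s, z) (0, h))"
   by (simp add: blinfun_apply_integral G)
 qed
 ultimately show ?thesis by simp
qed

lemma Ck_integral:
 fixes g :: "real \<times> 'z::euclidean_space => 'b::euclidean_space"
 shows "Ck k g ==> Ck k (%z. integral {0..1} (%s. g (s, z)))"
proof (induction k arbitrary: g)
 case 0
 have "continuous_on (UNIV \<times> cbox 0 1) (%(z, s). g (s, z))"
  unfolding case_prod_unfold
  by (rule continuous_on_compose2[of UNIV g]) (use 0 in \<open>auto intro!: continuous_intros\<close>)
 from integral_continuous_on_param[OF this] show ?case by simp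
next
 case (Suc k)
 obtain g' where g': "!!x. (g has_derivative g' x) (at x)" "!!h. Ck k (%x. g' x h)"
  using Suc.prems unfolding Ck.simps by blast
 show ?case
  unfolding Ck.simps
  using has_derivative_integral_param[OF g'(1) Ck_continuous[OF g'(2)]] Suc.IH[OF g'(2)]
  by (intro exI[of _ "%z h. integral {0..1} (%s. g' (s, z) (0, h))"]) auto
qed

lemma norm_linear_le_Basis:
 fixes L :: "'a::euclidean_space => 'b::real_normed_vector"
 assumes "linear L" "!!b. b \<in> Basis ==> norm (L b) <= B"
 shows "norm (L h) <= (real DIM('a) * B) * norm h"
proof -
 have "norm (L h) = norm (\<Sum>b\<in>Basis. (h \<bullet> b) *\<^sub>R L b)"
  using linear_sum_Basis[OF assms(1)] by metis
 also have "\<dots> <= (\<Sum>b\<in>(Basis::'a set). norm h * B)"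
 proof (rule order_trans[OF norm_sum], rule sum_mono)
  fix b :: 'a assume b: "b \<in> Basis"
  have "norm ((h \<bullet> b) *\<^sub>R L b) = \<bar>h \<bullet> b\<bar> * norm (L b)" by simp
  also have "\<dots> <= norm h * B"
   using assms(2)[OF b] b by (intro mult_mono) (auto simp: Basis_le_norm)
  finally show "norm ((h \<bullet> b) *\<^sub>R L b) <= norm h * B" .
 qed
 finally show ?thesis by (simp add: mult_ac)
qed

lemma C1_bound:
 fixes f :: "'a::euclidean_space => 'b::euclidean_space"
 assumes f': "!!x. (f has_derivative f' x) (at x)" "!!h. continuous_on UNIV (%x. f' x h)"
 shows "EX M>=0. \<forall>z\<in>cball 0 r. ALL h. norm (f' z h) <= M * norm h"
proof -
 have "continuous_on (cball 0 r) (%x. \<Sum>b\<in>Basis. norm (f' x b))"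
  by (intro continuous_intros continuous_on_subset[OF f'(2)]) auto
 then have "compact ((%x. \<Sum>b\<in>Basis. norm (f' x b)) ` cball 0 r)"
  by (rule compact_continuous_image) simp
 then have "bounded ((%x. \<Sum>b\<in>Basis. norm (f' x b)) ` cball 0 r)"
  by (rule compact_imp_bounded)
 then obtain B where "\<forall>y\<in>(%x. \<Sum>b\<in>Basis. norm (f' x b)) ` cball 0 r. norm y <= B"
  unfolding bounded_iff by blast
 then have B: "!!x. x \<in> cball 0 r ==> (\<Sum>b\<in>Basis. norm (f' x b)) <= B"
  by (force simp: abs_le_iff)
 define M where "M = real DIM('a) * max B 0"
 have "norm (f' z h) <= M * norm h" if z: "z \<in> cball 0 r" for z h
  unfolding M_def
 proof (rule norm_linear_le_Basis)
  show "linear (f' z)" using f'(1) has_derivative_linear by blast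
  fix b :: 'a assume "b \<in> Basis"
  then have "norm (f' z b) <= (\<Sum>b\<in>Basis. norm (f' z b))"
   by (intro member_le_sum) auto
  then show "norm (f' z b) <= max B 0" using B[OF z] by simp
 qed
 then show ?thesis unfolding M_def by (intro exI[of _ M]) (auto simp: M_def)
qed

lemma C2_bounds:
 fixes f :: "'a::euclidean_space => 'b::euclidean_space"
 assumes f': "!!x. (f has_derivative f' x) (at x)" "!!h. Ck 1 (%x. f' x h)"
 shows "EX M>=0. (\<forall>z\<in>cball 0 r. ALL h. norm (f' z h) <= M * norm h) &
  (\<forall>z\<in>cball 0 r. \<forall>z'\<in>cball 0 r. ALL h. norm (f' z' h - f' z h) <= M * norm (z' - z) * norm h) &
  (\<forall>z\<in>cball 0 r. \<forall>z'\<in>cball 0 r. norm (f z' - f z - f' z (z' - z)) <= M * norm (z' - z) ^ 2)"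
proof -
 obtain M1 where M1: "M1 >= 0" "!!z h. z \<in> cball 0 r ==> norm (f' z h) <= M1 * norm h"
  using C1_bound[OF f'(1) Ck_continuous[OF f'(2)], of r] by blast
 have "EX M>=0. \<forall>z\<in>cball 0 r. \<forall>z'\<in>cball 0 r. norm (f' z' b - f' z b) <= M * norm (z' - z)" for b
 proof -
  obtain g' where g': "!!x. ((%x. f' x b) has_derivative g' x) (at x)" "!!h. continuous_on UNIV (%x. g' x h)"
   using f'(2)[of b] by auto
  obtain M where M: "M >= 0" "!!z h. z \<in> cball 0 r ==> norm (g' z h) <= M * norm h"
   using C1_bound[OF g', of r] by blast
  have "norm (f' z' b - f' z b) <= M * norm (z' - z)" if "z \<in> cball 0 r" "z' \<in> cball 0 r" for z z'
   by (rule differentiable_bound[OF convex_cball has_derivative_at_withinI[OF g'(1)] _ that(2,1)])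
    (use M in \<open>auto intro!: onorm_le\<close>)
  then show ?thesis using M(1) by blast
 qed
 then obtain Mb where Mb: "!!b. Mb b >= 0"
  "!!b z z'. z \<in> cball 0 r ==> z' \<in> cball 0 r ==> norm (f' z' b - f' z b) <= Mb b * norm (z' - z)"
  by metis
 define M2 where "M2 = real DIM('a) * (\<Sum>b\<in>Basis. Mb b)"
 have M2: "M2 >= 0" unfolding M2_def by (intro mult_nonneg_nonneg sum_nonneg Mb) auto
 have lin: "linear (f' z)" for z using f'(1) has_derivative_linear by blast
 have *: "norm (f' z' h - f' z h) <= M2 * norm (z' - z) * norm h"
  if "z \<in> cball 0 r" "z' \<in> cball 0 r" for z z' h
 proof -
  have "norm ((%h. f' z' h - f' z h) h) <= (real DIM('a) * ((\<Sum>b\<in>Basis. Mb b) * norm (z' - z))) * norm h"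
  proof (rule norm_linear_le_Basis)
   show "linear (%h. f' z' h - f' z h)" by (intro linear_compose_sub lin)
   fix b :: 'a assume b: "b \<in> Basis"
   have "norm (f' z' b - f' z b) <= Mb b * norm (z' - z)" using Mb(2) that by blast
   also have "\<dots> <= (\<Sum>b\<in>Basis. Mb b) * norm (z' - z)"
    using b Mb(1) by (intro mult_right_mono member_le_sum) auto
   finally show "norm (f' z' b - f' z b) <= (\<Sum>b\<in>Basis. Mb b) * norm (z' - z)" .
  qed
  then show ?thesis by (simp add: M2_def mult_ac)
 qed
 have "norm (f z' - f z - f' z (z' - z)) <= M2 * norm (z' - z) ^ 2"
  if z: "z \<in> cball 0 r" and z': "z' \<in> cball 0 r" for z z'
 proof -
  have sub: "closed_segment z z' \<subseteq> cball 0 r"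
   using z z' by (simp add: closed_segment_subset)
  have "norm ((f z' - f' z z') - (f z - f' z z)) <= (M2 * norm (z' - z)) * norm (z' - z)"
  proof (rule differentiable_bound[where S = "closed_segment z z'" and f' = "%x h. f' x h - f' z h"])
   show "((%x. f x - f' z x) has_derivative (%h. f' x h - f' z h)) (at x within closed_segment z z')" for x
    by (intro has_derivative_diff has_derivative_at_withinI[OF f'(1)]
      bounded_linear_imp_has_derivative has_derivative_bounded_linear[OF f'(1)])
   show "onorm (%h. f' x h - f' z h) <= M2 * norm (z' - z)" if x: "x \<in> closed_segment z z'" for x
   proof (rule onorm_le)
    fix h
    have "norm (f' x h - f' z h) <= M2 * norm (x - z) * norm h"
     using * z x sub by blast
    also have "\<dots> <= M2 * norm (z' - z) * norm h"
     using segment_bound1[OF x] M2 by (intro mult_right_mono mult_left_mono) auto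
    finally show "norm (f' x h - f' z h) <= M2 * norm (z' - z) * norm h" .
   qed
  qed auto
  moreover have "f' z (z' - z) = f' z z' - f' z z" using lin linear_diff by blast
  moreover have "f z' - f z - (f' z z' - f' z z) = (f z' - f' z z') - (f z - f' z z)" by simp
  ultimately have "norm (f z' - f z - f' z (z' - z)) <= (M2 * norm (z' - z)) * norm (z' - z)"
   by (simp only:)
  then show ?thesis by (simp add: power2_eq_square mult.assoc)
 qed
 then have "norm (f z' - f z - f' z (z' - z)) <= max M1 M2 * norm (z' - z) ^ 2"
  if "z \<in> cball 0 r" "z' \<in> cball 0 r" for z z'
  using that by (meson order_trans max.cobounded2 mult_right_mono zero_le_power2)
 moreover have "norm (f' z' h - f' z h) <= max M1 M2 * norm (z' - z) * norm h"
  if "z \<in> cball 0 r" "z' \<in> cball 0 r" for z z' h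
  using *[OF that, of h] by (meson order_trans max.cobounded2 mult_right_mono norm_ge_zero)
 moreover have "norm (f' z h) <= max M1 M2 * norm h" if "z \<in> cball 0 r" for z h
  using M1(2)[OF that, of h] by (meson order_trans max.cobounded1 mult_right_mono norm_ge_zero)
 ultimately show ?thesis using M2 by (intro exI[of _ "max M1 M2"]) auto
qed

text \<open>Both orders of differentiation are limits of the same second difference \<open>f(x + s u + s v) -
 f(x + s v) - f(x + s u) + f(x)\<close> divided by \<open>s\<^sup>2\<close>.\<close>

lemma second_derivative_symmetric:
 fixes f :: "'a::euclidean_space => 'b::euclidean_space"
 assumes f': "!!x. (f has_derivative f' x) (at x)" "!!h. Ck 2 (%x. f' x h)"
  and u: "((%x. f' x u) has_derivative fu) (at x)"
  and v: "((%x. f' x v) has_derivative fv) (at x)"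
 shows "fu v = fv u"
proof -
 have key: "EX B>=0. ALL s. 0 < s --> s <= 1 -->
   norm ((f (x + s *\<^sub>R u + s *\<^sub>R v) - f (x + s *\<^sub>R v)) - (f (x + s *\<^sub>R u) - f x) - (s * s) *\<^sub>R fv u) <= B * s ^ 3"
  if v: "((%x. f' x v) has_derivative fv) (at x)" for u v fv
 proof -
  obtain g' where g': "!!x. ((%x. f' x v) has_derivative g' x) (at x)" "!!h. Ck 1 (%x. g' x h)"
   using f'(2)[of v] unfolding numeral_2_eq_2 One_nat_def Ck.simps(2)[of "Suc 0"] by blast
  have fv: "fv = g' x" using has_derivative_unique[OF v g'(1)] .
  have linfv: "linear fv" using has_derivative_linear[OF v] .
  define N where "N = norm u + norm v"
  obtain M where M: "M >= 0" and Mb: "!!z z'. z \<in> cball 0 (norm x + N) ==> z' \<in> cball 0 (norm x + N) ==>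
   norm (f' z' v - f' z v - g' z (z' - z)) <= M * norm (z' - z) ^ 2"
   using C2_bounds[OF g', of "norm x + N"] by blast
  have N: "N >= 0" by (simp add: N_def)
  have "norm ((f (x + s *\<^sub>R u + s *\<^sub>R v) - f (x + s *\<^sub>R v)) - (f (x + s *\<^sub>R u) - f x) - (s * s) *\<^sub>R fv u)
    <= (2 * M * N ^ 2) * s ^ 3" if s: "0 < s" "s <= 1" for s
  proof -
   define g where "g t = f (x + s *\<^sub>R u + t *\<^sub>R v) - f (x + t *\<^sub>R v) - (t * s) *\<^sub>R fv u" for t
   have der: "(g has_vector_derivative (f' (x + s *\<^sub>R u + t *\<^sub>R v) v - f' (x + t *\<^sub>R v) v - s *\<^sub>R fv u)) (at t)" for t
   proof -
    have 1: "((%t. f (y + t *\<^sub>R v)) has_vector_derivative f' (y + t *\<^sub>R v) v) (at t)" for y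
    proof -
     have "((%t. f (y + t *\<^sub>R v)) has_derivative (%k. f' (y + t *\<^sub>R v) (k *\<^sub>R v))) (at t)"
      by (rule has_derivative_compose[of "%t. y + t *\<^sub>R v" "%k. k *\<^sub>R v" t UNIV f "f' (y + t *\<^sub>R v)"])
       (auto intro!: derivative_eq_intros f'(1))
     then show ?thesis
      unfolding has_vector_derivative_def
      using linear_cmul[OF has_derivative_linear[OF f'(1)]] by simp
    qed
    have 2: "((%t. (t * s) *\<^sub>R fv u) has_vector_derivative s *\<^sub>R fv u) (at t)"
     by (auto intro!: derivative_eq_intros)
    show ?thesis unfolding g_def
     by (intro has_vector_derivative_diff 1 2)
   qed
   have "norm (g s - g 0) <= (2 * M * N ^ 2 * s ^ 2) * s - (2 * M * N ^ 2 * s ^ 2) * 0"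
   proof (rule differentiable_bound_general[OF s(1) _ _ der, where \<phi>' = "%_. 2 * M * N ^ 2 * s ^ 2"])
    show "continuous_on {0..s} g"
     using der by (meson continuous_at_imp_continuous_on has_vector_derivative_continuous)
    show "((*) (2 * M * N\<^sup>2 * s\<^sup>2) has_vector_derivative 2 * M * N\<^sup>2 * s\<^sup>2) (at t)" for t
     by (auto intro!: derivative_eq_intros simp: has_real_derivative_iff_has_vector_derivative[symmetric])
    fix t assume t: "0 < t" "t < s"
    have n1: "norm (s *\<^sub>R u + t *\<^sub>R v) <= s * N"
    proof -
     have "norm (s *\<^sub>R u + t *\<^sub>R v) <= s * norm u + t * norm v"
      using norm_triangle_ineq[of "s *\<^sub>R u" "t *\<^sub>R v"] s t by simp
     also have "\<dots> <= s * norm u + s * norm v" using t by (simp add: mult_right_mono)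
     finally show ?thesis by (simp add: N_def algebra_simps)
    qed
    have n2: "norm (t *\<^sub>R v) <= s * N"
    proof -
     have "norm (t *\<^sub>R v) <= s * norm v" using s t by (simp add: mult_right_mono)
     also have "\<dots> <= s * N" using s by (simp add: N_def)
     finally show ?thesis .
    qed
    have sN: "s * N <= N" using s N by (simp add: mult_left_le_one_le)
    have E: "norm (f' (x + w) v - f' x v - fv w) <= M * N ^ 2 * s ^ 2" if "norm w <= s * N" for w
    proof -
     have "norm (x + w) <= norm x + N"
      using norm_triangle_ineq[of x w] that sN by linarith
     then have "norm (f' (x + w) v - f' x v - fv w) <= M * norm w ^ 2"
      using Mb[of x "x + w"] N by (simp add: fv)
     also have "\<dots> <= M * (s * N) ^ 2"
      using that M by (intro mult_left_mono power_mono) auto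
     finally show ?thesis by (simp add: power_mult_distrib mult_ac)
    qed
    have "f' (x + s *\<^sub>R u + t *\<^sub>R v) v - f' (x + t *\<^sub>R v) v - s *\<^sub>R fv u =
      (f' (x + (s *\<^sub>R u + t *\<^sub>R v)) v - f' x v - fv (s *\<^sub>R u + t *\<^sub>R v)) - (f' (x + t *\<^sub>R v) v - f' x v - fv (t *\<^sub>R v))"
     by (simp add: linear_add[OF linfv] linear_cmul[OF linfv] add.assoc)
    also have "norm \<dots> <= M * N ^ 2 * s ^ 2 + M * N ^ 2 * s ^ 2"
     by (rule order_trans[OF norm_triangle_ineq4 add_mono[OF E[OF n1] E[OF n2]]])
    finally show "norm (f' (x + s *\<^sub>R u + t *\<^sub>R v) v - f' (x + t *\<^sub>R v) v - s *\<^sub>R fv u) <= 2 * M * N ^ 2 * s ^ 2"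
     by simp
   qed (auto intro!: continuous_intros)
   moreover have "g s - g 0 = (f (x + s *\<^sub>R u + s *\<^sub>R v) - f (x + s *\<^sub>R v)) - (f (x + s *\<^sub>R u) - f x) - (s * s) *\<^sub>R fv u"
    by (simp add: g_def)
   ultimately show ?thesis by (simp add: power2_eq_square power3_eq_cube mult_ac)
  qed
  then show ?thesis using M by (intro exI[of _ "2 * M * N ^ 2"]) auto
 qed
 obtain B1 where B1: "B1 >= 0" "!!s. 0 < s ==> s <= 1 ==>
   norm ((f (x + s *\<^sub>R u + s *\<^sub>R v) - f (x + s *\<^sub>R v)) - (f (x + s *\<^sub>R u) - f x) - (s * s) *\<^sub>R fv u) <= B1 * s ^ 3"
  using key[OF v, of u] by blast
 obtain B2 where B2: "B2 >= 0" "!!s. 0 < s ==> s <= 1 ==>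
   norm ((f (x + s *\<^sub>R v + s *\<^sub>R u) - f (x + s *\<^sub>R u)) - (f (x + s *\<^sub>R v) - f x) - (s * s) *\<^sub>R fu v) <= B2 * s ^ 3"
  using key[OF u, of v] by blast
 have le: "norm (fu v - fv u) <= (B1 + B2) * s" if s: "0 < s" "s <= 1" for s
 proof -
  have "(s * s) *\<^sub>R (fu v - fv u) =
    ((f (x + s *\<^sub>R u + s *\<^sub>R v) - f (x + s *\<^sub>R v)) - (f (x + s *\<^sub>R u) - f x) - (s * s) *\<^sub>R fv u)
    - ((f (x + s *\<^sub>R v + s *\<^sub>R u) - f (x + s *\<^sub>R u)) - (f (x + s *\<^sub>R v) - f x) - (s * s) *\<^sub>R fu v)"
   by (simp add: scaleR_diff_right algebra_simps)
  also have "norm \<dots> <= B1 * s ^ 3 + B2 * s ^ 3"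
   by (rule order_trans[OF norm_triangle_ineq4 add_mono[OF B1(2)[OF s] B2(2)[OF s]]])
  finally have n: "norm ((s * s) *\<^sub>R (fu v - fv u)) <= B1 * s ^ 3 + B2 * s ^ 3" .
  have "(s * s) * norm (fu v - fv u) <= (s * s) * ((B1 + B2) * s)"
   using n s unfolding norm_scaleR by (simp add: power3_eq_cube distrib_left distrib_right mult_ac)
  then show ?thesis using s by simp
 qed
 have "norm (fu v - fv u) <= e" if "e > 0" for e
 proof -
  define s where "s = min 1 (e / (B1 + B2 + 1))"
  have "0 < s" "s <= 1" using that B1(1) B2(1) by (auto simp: s_def)
  then have "norm (fu v - fv u) <= (B1 + B2) * s" by (rule le)
  also have "\<dots> <= (B1 + B2 + 1) * (e / (B1 + B2 + 1))"
   using B1(1) B2(1) \<open>0 < s\<close> by (intro mult_mono) (auto simp: s_def)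
  also have "\<dots> = e" using B1(1) B2(1) by simp
  finally show ?thesis .
 qed
 then have "norm (fu v - fv u) <= 0" by (rule field_le_epsilon) simp
 then show ?thesis by simp
qed

section \<open>Fixed points depending on an even parameter\<close>

lemma contraction_on_subspace_ball:
 fixes G :: "'x::banach => 'x"
 assumes Z: "closed Z" "0 \<in> Z" and r: "r > 0"
  and maps: "!!u. u \<in> Z ==> norm u <= r ==> G u \<in> Z"
  and contr: "!!u v. u \<in> Z ==> norm u <= r ==> v \<in> Z ==> norm v <= r ==>
   norm (G u - G v) <= norm (u - v) / 2"
  and small: "norm (G 0) <= r / 2"
 shows "\<exists>!u. u \<in> Z \<inter> cball 0 r & G u = u"
proof -
 have "\<exists>!u\<in>Z \<inter> cball 0 r. G u = u"
 proof (rule Banach_fix[where c = "1/2"])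
  show "complete (Z \<inter> cball 0 r)"
   by (simp add: complete_eq_closed closed_Int Z)
  show "Z \<inter> cball 0 r ~= {}" using Z r by force
  show "G ` (Z \<inter> cball 0 r) \<subseteq> Z \<inter> cball 0 r"
  proof (rule image_subsetI)
   fix u assume "u \<in> Z \<inter> cball 0 r"
   then have u: "u \<in> Z" "norm u <= r" by auto
   have "norm (G u) <= norm (G u - G 0) + norm (G 0)"
    by (metis diff_add_cancel norm_triangle_ineq)
   also have "\<dots> <= norm (u - 0) / 2 + r / 2"
    using u Z r by (intro add_mono contr small) auto
   finally show "G u \<in> Z \<inter> cball 0 r" using u maps[OF u] by simp
  qed
 qed (use contr in \<open>auto simp: dist_norm\<close>)
 then show ?thesis by simp
qed

text \<open>The smallness of \<open>G 0 q\<close> needed by the contraction principle comes from \<open>G 0 0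
 = 0\<close> and the Lipschitz bound in the parameter.\<close>

lemma parametric_fixed_point:
 fixes G :: "'x::banach => real => 'x"
 assumes Z: "closed Z" "0 \<in> Z" and r: "r > 0" "a > 0"
  and maps: "!!u q. u \<in> Z ==> norm u <= r ==> \<bar>q\<bar> <= a ==> G u q \<in> Z"
  and contr: "!!u v q. u \<in> Z ==> norm u <= r ==> v \<in> Z ==> norm v <= r ==> \<bar>q\<bar> <= a ==>
   norm (G u q - G v q) <= norm (u - v) / 2"
  and lip: "!!u q \<beta>. u \<in> Z ==> norm u <= r ==> \<bar>q\<bar> <= a ==> \<bar>\<beta>\<bar> <= a ==>
   norm (G u q - G u \<beta>) <= C * \<bar>q - \<beta>\<bar>"
  and G0: "G 0 0 = 0" and C: "C >= 0"
 shows "EX a' U. 0 < a' & a' <= a & U 0 = 0 & (ALL q. \<bar>q\<bar> <= a' --> U q \<in> Z & norm (U q) <= r & G (U q) q = U q) &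
  (ALL q u. \<bar>q\<bar> <= a' --> u \<in> Z --> norm u <= r --> G u q = u --> u = U q) &
  (ALL q \<beta>. \<bar>q\<bar> <= a' --> \<bar>\<beta>\<bar> <= a' --> norm (U q - U \<beta>) <= 2 * C * \<bar>q - \<beta>\<bar>)"
proof -
 define a' where "a' = min a (r / (2 * (C + 1)))"
 have a': "a' > 0" "a' <= a" using r C by (auto simp: a'_def)
 define U where "U q = (THE u. u \<in> Z \<inter> cball 0 r & G u q = u)" for q
 have ex: "\<exists>!u. u \<in> Z \<inter> cball 0 r & G u q = u" if q: "\<bar>q\<bar> <= a'" for q
 proof (rule contraction_on_subspace_ball[OF Z r(1)])
  have "norm (G 0 q) <= C * \<bar>q\<bar>"
   using lip[of 0 q 0] G0 Z r q a' by simp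
  also have "\<dots> <= (C + 1) * (r / (2 * (C + 1)))"
   using q C by (intro mult_mono) (auto simp: a'_def)
  also have "\<dots> = r / 2" using C by (simp add: field_simps)
  finally show "norm (G 0 q) <= r / 2" .
 qed (use q a' maps contr in auto)
 have U: "U q \<in> Z \<inter> cball 0 r & G (U q) q = U q" if "\<bar>q\<bar> <= a'" for q
  unfolding U_def by (rule theI'[OF ex[OF that]])
 have un: "u = U q" if "\<bar>q\<bar> <= a'" "u \<in> Z" "norm u <= r" "G u q = u" for q u
  using ex[OF that(1)] U[OF that(1)] that by auto
 have "norm (U q - U \<beta>) <= 2 * C * \<bar>q - \<beta>\<bar>" if ab: "\<bar>q\<bar> <= a'" "\<bar>\<beta>\<bar> <= a'" for q \<beta>
 proof -
  have "U q - U \<beta> = (G (U q) q - G (U \<beta>) q) + (G (U \<beta>) q - G (U \<beta>) \<beta>)"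
   using U[OF ab(1)] U[OF ab(2)] by simp
  also have "norm \<dots> <= norm (U q - U \<beta>) / 2 + C * \<bar>q - \<beta>\<bar>"
   using U[OF ab(1)] U[OF ab(2)] ab a'
   by (intro order_trans[OF norm_triangle_ineq] add_mono contr lip) auto
  finally show ?thesis by simp
 qed
 moreover have "U 0 = 0" using un[of 0 0] G0 Z r a' by simp
 moreover have "ALL q. \<bar>q\<bar> <= a' --> U q \<in> Z & norm (U q) <= r & G (U q) q = U q"
  using U by simp
 ultimately show ?thesis
  using un a' by (intro exI[of _ a'] exI[of _ U]) blast
qed

text \<open>Differentiability of the fixed point in the parameter, from a first-order expansion of \<open>G\<close> with linear part \<open>L\<close> in \<open>u\<close> and \<open>b\<close> in the parameter: \<open>U'\<close> solves \<open>U' = L U' + b\<close>. Since \<open>b\<close> is \<open>q c\<close> to leading order, \<open>c\<close> is the second derivative of the branch at \<open>0\<close>.\<close>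

lemma even_parameter_branch:
 fixes G :: "'x::banach => real => 'x"
 assumes Z: "closed Z" "subspace Z" and r: "r > 0" "a > 0"
  and maps: "!!u q. u \<in> Z ==> norm u <= r ==> \<bar>q\<bar> <= a ==> G u q \<in> Z"
  and G0: "G 0 0 = 0" and M: "M >= 0"
  and L: "!!u q h. u \<in> Z ==> norm u <= r ==> \<bar>q\<bar> <= a ==> h \<in> Z ==> L u q h \<in> Z"
  and Ldiff: "!!u q h k. u \<in> Z ==> norm u <= r ==> \<bar>q\<bar> <= a ==> h \<in> Z ==> k \<in> Z ==>
   L u q (h - k) = L u q h - L u q k"
  and Lscale: "!!u q h c. u \<in> Z ==> norm u <= r ==> \<bar>q\<bar> <= a ==> h \<in> Z ==>
   L u q (c *\<^sub>R h) = c *\<^sub>R L u q h"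
  and Lhalf: "!!u q h. u \<in> Z ==> norm u <= r ==> \<bar>q\<bar> <= a ==> h \<in> Z ==> norm (L u q h) <= norm h / 2"
  and Lsmall: "!!u q h. u \<in> Z ==> norm u <= r ==> \<bar>q\<bar> <= a ==> h \<in> Z ==>
   norm (L u q h) <= M * (norm u + \<bar>q\<bar>) * norm h"
  and contr: "!!u v q. u \<in> Z ==> norm u <= r ==> v \<in> Z ==> norm v <= r ==> \<bar>q\<bar> <= a ==>
   norm (G u q - G v q) <= norm (u - v) / 2"
  and lip: "!!u q \<beta>. u \<in> Z ==> norm u <= r ==> \<bar>q\<bar> <= a ==> \<bar>\<beta>\<bar> <= a ==>
   norm (G u q - G u \<beta>) <= C * \<bar>q - \<beta>\<bar>"
  and C: "C >= 0"
  and b: "!!u q. u \<in> Z ==> norm u <= r ==> \<bar>q\<bar> <= a ==> b u q \<in> Z"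
  and taylor: "!!u q v \<beta>. u \<in> Z ==> norm u <= r ==> v \<in> Z ==> norm v <= r ==> \<bar>q\<bar> <= a ==> \<bar>\<beta>\<bar> <= a ==>
   norm (G v \<beta> - G u q - L u q (v - u) - (\<beta> - q) *\<^sub>R b u q) <= M * (norm (v - u) + \<bar>\<beta> - q\<bar>) ^ 2"
  and b_even: "!!u q. u \<in> Z ==> norm u <= r ==> \<bar>q\<bar> <= a ==>
   norm (b u q - q *\<^sub>R c) <= M * (norm u + \<bar>q\<bar>) * \<bar>q\<bar>"
 shows "EX a' U U' K. 0 < a' & a' <= a & U 0 = 0 & K >= 0 &
  (ALL q. \<bar>q\<bar> <= a' --> U q \<in> Z & norm (U q) <= r & G (U q) q = U q) &
  (ALL q u. \<bar>q\<bar> <= a' --> u \<in> Z --> norm u <= r --> G u q = u --> u = U q) &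
  (ALL q. \<bar>q\<bar> < a' --> (U has_vector_derivative U' q) (at q) &
    norm (U' q - q *\<^sub>R c) <= K * q ^ 2 &
    norm (U q - (q ^ 2 / 2) *\<^sub>R c) <= K * \<bar>q\<bar> ^ 3)"
proof -
 have Z0: "0 \<in> Z" using Z(2) by (rule subspace_0)
 have "EX a' U. 0 < a' & a' <= a & U 0 = 0 & (ALL q. \<bar>q\<bar> <= a' --> U q \<in> Z & norm (U q) <= r & G (U q) q = U q) &
  (ALL q u. \<bar>q\<bar> <= a' --> u \<in> Z --> norm u <= r --> G u q = u --> u = U q) &
  (ALL q \<beta>. \<bar>q\<bar> <= a' --> \<bar>\<beta>\<bar> <= a' --> norm (U q - U \<beta>) <= 2 * C * \<bar>q - \<beta>\<bar>)"
  by (rule parametric_fixed_point[OF Z(1) Z0 r]) (fact maps contr lip G0 C)+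
 then obtain a' U where UU: "0 < a' & a' <= a & U 0 = 0 & (ALL q. \<bar>q\<bar> <= a' --> U q \<in> Z & norm (U q) <= r & G (U q) q = U q) &
  (ALL q u. \<bar>q\<bar> <= a' --> u \<in> Z --> norm u <= r --> G u q = u --> u = U q) &
  (ALL q \<beta>. \<bar>q\<bar> <= a' --> \<bar>\<beta>\<bar> <= a' --> norm (U q - U \<beta>) <= 2 * C * \<bar>q - \<beta>\<bar>)"
  by (elim exE) (rule that)
 have U: "a' > 0" "a' <= a" "U 0 = 0"
  "!!q. \<bar>q\<bar> <= a' ==> U q \<in> Z" "!!q. \<bar>q\<bar> <= a' ==> norm (U q) <= r"
  "!!q. \<bar>q\<bar> <= a' ==> G (U q) q = U q"
  "!!q u. \<bar>q\<bar> <= a' ==> u \<in> Z ==> norm u <= r ==> G u q = u ==> u = U q"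
  "!!q \<beta>. \<bar>q\<bar> <= a' ==> \<bar>\<beta>\<bar> <= a' ==> norm (U q - U \<beta>) <= 2 * C * \<bar>q - \<beta>\<bar>"
  using UU by blast+
 have "EX w. w \<in> Z & L (U q) q w + b (U q) q = w" if q: "\<bar>q\<bar> <= a'" for q
 proof -
  have u: "U q \<in> Z" "norm (U q) <= r" "\<bar>q\<bar> <= a" using U q by auto
  define R where "R = 2 * norm (b (U q) q) + 1"
  have "\<exists>!w. w \<in> Z \<inter> cball 0 R & L (U q) q w + b (U q) q = w"
  proof (rule contraction_on_subspace_ball[OF Z(1) Z0])
   show "R > 0" by (simp add: R_def add_nonneg_pos)
   show "L (U q) q w + b (U q) q \<in> Z" if "w \<in> Z" for w
    using that u by (intro subspace_add[OF Z(2)] L b)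
   show "norm (L (U q) q w + b (U q) q - (L (U q) q v + b (U q) q)) <= norm (w - v) / 2"
    if "w \<in> Z" "v \<in> Z" for w v
    using Lhalf[OF u subspace_diff[OF Z(2) that]] Ldiff[OF u that] by simp
   have "L (U q) q 0 = 0" using Ldiff[OF u Z0 Z0] by simp
   then show "norm (L (U q) q 0 + b (U q) q) <= R / 2" by (simp add: R_def)
  qed
  then show ?thesis by blast
 qed
 then obtain U' where U': "!!q. \<bar>q\<bar> <= a' ==> U' q \<in> Z"
  "!!q. \<bar>q\<bar> <= a' ==> L (U q) q (U' q) + b (U q) q = U' q" by metis
 define M2 where "M2 = 2 * M * (2 * C + 1) ^ 2"
 have quad: "norm (U \<beta> - U q - (\<beta> - q) *\<^sub>R U' q) <= M2 * (\<beta> - q) ^ 2"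
  if ab: "\<bar>q\<bar> <= a'" "\<bar>\<beta>\<bar> <= a'" for q \<beta>
 proof -
  have u: "U q \<in> Z" "norm (U q) <= r" "\<bar>q\<bar> <= a" and v: "U \<beta> \<in> Z" "norm (U \<beta>) <= r" "\<bar>\<beta>\<bar> <= a"
   using U ab by auto
  define D where "D = U \<beta> - U q - (\<beta> - q) *\<^sub>R U' q"
  have DZ: "D \<in> Z" unfolding D_def
   by (intro subspace_diff[OF Z(2)] subspace_scale[OF Z(2)] u v U' ab)
  have LD: "L (U q) q D = L (U q) q (U \<beta> - U q) - (\<beta> - q) *\<^sub>R L (U q) q (U' q)"
   unfolding D_def
   using Ldiff[OF u subspace_diff[OF Z(2) v(1) u(1)] subspace_scale[OF Z(2) U'(1)[OF ab(1)]]]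
    Lscale[OF u U'(1)[OF ab(1)]] by simp
  have "D = (G (U \<beta>) \<beta> - G (U q) q - L (U q) q (U \<beta> - U q) - (\<beta> - q) *\<^sub>R b (U q) q) + L (U q) q D"
  proof -
   have "(\<beta> - q) *\<^sub>R U' q = (\<beta> - q) *\<^sub>R L (U q) q (U' q) + (\<beta> - q) *\<^sub>R b (U q) q"
    unfolding scaleR_add_right[symmetric] U'(2)[OF ab(1)] ..
   then show ?thesis unfolding LD using U(6)[OF ab(1)] U(6)[OF ab(2)] by (simp add: D_def)
  qed
  then have "norm D <= norm (G (U \<beta>) \<beta> - G (U q) q - L (U q) q (U \<beta> - U q) - (\<beta> - q) *\<^sub>R b (U q) q)
    + norm (L (U q) q D)"
   by (metis norm_triangle_ineq)
  also have "\<dots> <= M * (norm (U \<beta> - U q) + \<bar>\<beta> - q\<bar>) ^ 2 + norm D / 2"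
   by (intro add_mono taylor Lhalf u v DZ)
  finally have "norm D <= 2 * M * (norm (U \<beta> - U q) + \<bar>\<beta> - q\<bar>) ^ 2" by simp
  also have "\<dots> <= 2 * M * (2 * C * \<bar>\<beta> - q\<bar> + \<bar>\<beta> - q\<bar>) ^ 2"
   using U(8)[OF ab(2,1)] M by (intro mult_left_mono power_mono add_mono) auto
  also have "\<dots> = M2 * (\<beta> - q) ^ 2"
  proof -
   have "2 * C * \<bar>\<beta> - q\<bar> + \<bar>\<beta> - q\<bar> = (2 * C + 1) * \<bar>\<beta> - q\<bar>" by (simp add: algebra_simps)
   then show ?thesis by (simp add: M2_def power_mult_distrib)
  qed
  finally show ?thesis by (simp add: D_def)
 qed
 have M2: "M2 >= 0" using M by (simp add: M2_def)
 have der: "(U has_vector_derivative U' q) (at q)" if q: "\<bar>q\<bar> < a'" for q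
  unfolding has_vector_derivative_def has_derivative_at_alt
 proof (intro conjI allI impI)
  show "bounded_linear (%x. x *\<^sub>R U' q)" by (rule bounded_linear_scaleR_left)
  fix e :: real assume e: "e > 0"
  define d where "d = min (a' - \<bar>q\<bar>) (e / (M2 + 1))"
  have "d > 0" using q e M2 by (auto simp: d_def)
  moreover have "norm (U y - U q - (y - q) *\<^sub>R U' q) <= e * norm (y - q)"
   if y: "norm (y - q) < d" for y
  proof -
   have "\<bar>y\<bar> <= a'" using y by (auto simp: d_def)
   then have "norm (U y - U q - (y - q) *\<^sub>R U' q) <= M2 * (y - q) ^ 2"
    using quad q by simp
   also have "\<dots> = (M2 * \<bar>y - q\<bar>) * \<bar>y - q\<bar>" by (simp add: power2_eq_square)
   also have "\<dots> <= e * \<bar>y - q\<bar>"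
   proof (rule mult_right_mono)
    have "M2 * \<bar>y - q\<bar> <= (M2 + 1) * (e / (M2 + 1))"
     using y M2 by (intro mult_mono) (auto simp: d_def)
    then show "M2 * \<bar>y - q\<bar> <= e" using M2 by simp
   qed simp
   finally show ?thesis by simp
  qed
  ultimately show "EX d>0. ALL y. norm (y - q) < d -->
    norm (U y - U q - (y - q) *\<^sub>R U' q) <= e * norm (y - q)" by blast
 qed
 define B where "B = norm c + M * (r + a)"
 define K where "K = M * (2 * C + 1) * (2 * B) + M * (2 * C + 1)"
 have B: "B >= 0" using M r by (simp add: B_def)
 have K: "K >= 0" using M C B by (simp add: K_def)
 have U'_bound: "norm (U' q - q *\<^sub>R c) <= K * q ^ 2" if q: "\<bar>q\<bar> < a'" for q
 proof -
  have u: "U q \<in> Z" "norm (U q) <= r" "\<bar>q\<bar> <= a" and q': "\<bar>q\<bar> <= a'" using U q by auto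
  have nU: "norm (U q) + \<bar>q\<bar> <= (2 * C + 1) * \<bar>q\<bar>"
   using U(8)[OF q', of 0] U(1,3) by (simp add: algebra_simps)
  have be: "norm (b (U q) q - q *\<^sub>R c) <= M * (norm (U q) + \<bar>q\<bar>) * \<bar>q\<bar>"
   by (rule b_even[OF u])
  have "norm (b (U q) q) <= norm (b (U q) q - q *\<^sub>R c) + norm (q *\<^sub>R c)"
   by (metis diff_add_cancel norm_triangle_ineq)
  also have "\<dots> <= M * (r + a) * \<bar>q\<bar> + \<bar>q\<bar> * norm c"
   using u M by (intro add_mono order_trans[OF be] mult_right_mono mult_left_mono) auto
  finally have bb: "norm (b (U q) q) <= B * \<bar>q\<bar>" by (simp add: B_def algebra_simps)
  have "norm (U' q) <= norm (L (U q) q (U' q)) + norm (b (U q) q)"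
   by (metis U'(2)[OF q'] norm_triangle_ineq)
  also have "\<dots> <= norm (U' q) / 2 + B * \<bar>q\<bar>"
   by (intro add_mono Lhalf u U' q' bb)
  finally have nU': "norm (U' q) <= 2 * B * \<bar>q\<bar>" by simp
  have "U' q - q *\<^sub>R c = L (U q) q (U' q) + (b (U q) q - q *\<^sub>R c)"
   using U'(2)[OF q'] by simp
  also have "norm \<dots> <= M * (norm (U q) + \<bar>q\<bar>) * norm (U' q) + M * (norm (U q) + \<bar>q\<bar>) * \<bar>q\<bar>"
   by (intro order_trans[OF norm_triangle_ineq] add_mono Lsmall u U' q' be)
  also have "\<dots> <= M * ((2 * C + 1) * \<bar>q\<bar>) * (2 * B * \<bar>q\<bar>) + M * ((2 * C + 1) * \<bar>q\<bar>) * \<bar>q\<bar>"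
   using nU nU' M C by (intro add_mono mult_mono mult_left_mono mult_nonneg_nonneg) auto
  also have "\<dots> = K * (\<bar>q\<bar> * \<bar>q\<bar>)" by (simp add: K_def algebra_simps)
  finally show ?thesis by (simp add: power2_eq_square)
 qed
 have U_bound: "norm (U q - (q ^ 2 / 2) *\<^sub>R c) <= K * \<bar>q\<bar> ^ 3" if q: "\<bar>q\<bar> < a'" for q
 proof -
  have "norm ((U q - (q ^ 2 / 2) *\<^sub>R c) - (U 0 - (0 ^ 2 / 2) *\<^sub>R c)) <= (K * q ^ 2) * norm (q - 0)"
  proof (rule differentiable_bound[where S = "{- \<bar>q\<bar>..\<bar>q\<bar>}" and f' = "%t h. h *\<^sub>R (U' t - t *\<^sub>R c)"])
   fix t assume t: "t \<in> {- \<bar>q\<bar>..\<bar>q\<bar>}"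
   then have ta: "\<bar>t\<bar> < a'" "\<bar>t\<bar> <= \<bar>q\<bar>" using q by auto
   have "((%t. U t - (t ^ 2 / 2) *\<^sub>R c) has_vector_derivative (U' t - t *\<^sub>R c)) (at t within {- \<bar>q\<bar>..\<bar>q\<bar>})"
    by (intro has_vector_derivative_diff has_vector_derivative_at_within[OF der[OF ta(1)]])
     (auto intro!: derivative_eq_intros)
   then show "((%t. U t - (t ^ 2 / 2) *\<^sub>R c) has_derivative (%h. h *\<^sub>R (U' t - t *\<^sub>R c))) (at t within {- \<bar>q\<bar>..\<bar>q\<bar>})"
    by (simp add: has_vector_derivative_def)
   have "norm (U' t - t *\<^sub>R c) <= K * t ^ 2" by (rule U'_bound[OF ta(1)])
   also have "\<dots> <= K * q ^ 2"
    using K ta(2) by (intro mult_left_mono) (auto simp: abs_le_square_iff)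
   finally show "onorm (%h. h *\<^sub>R (U' t - t *\<^sub>R c)) <= K * q ^ 2"
    by (intro onorm_le) (simp add: mult.commute mult_left_mono)
  qed auto
  then show ?thesis using U(3) by (simp add: power3_eq_cube power2_eq_square)
 qed
 show ?thesis
  using UU der K U'_bound U_bound
  by (intro exI[of _ a'] exI[of _ U] exI[of _ U'] exI[of _ K]) blast
qed

section \<open>Complex linear systems and annihilating products\<close>

lemma norm_smult_complex: "norm (c *s x) = cmod c * norm x" for x :: "complex ^ 'm"
 by (simp add: norm_vec_def norm_mult L2_set_right_distrib)

lemma bounded_bilinear_smult: "bounded_bilinear ((*s) :: complex => complex ^ 'm => complex ^ 'm)"
proof
 show "EX K. ALL a b. norm (a *s b :: complex ^ 'm) <= norm a * norm b * K"
  by (intro exI[of _ 1]) (simp add: norm_smult_complex)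
qed (simp_all add: vec_eq_iff algebra_simps)

lemma has_vector_derivative_exp_smult:
 fixes z :: "real => complex ^ 'm"
 assumes "(z has_vector_derivative \<rho> *s z t + h) (at t within S)"
 shows "((%t. exp (- \<rho> * of_real t) *s z t) has_vector_derivative exp (- \<rho> * of_real t) *s h) (at t within S)"
proof -
 have "((%t. exp (- \<rho> * of_real t)) has_vector_derivative - \<rho> * exp (- \<rho> * of_real t)) (at t within S)"
 proof -
  have "((%w. exp (- \<rho> * w)) has_field_derivative (- \<rho> * exp (- \<rho> * of_real t))) (at (of_real t))"
   by (auto intro!: derivative_eq_intros)
  then show ?thesis
   using has_vector_derivative_real_field has_vector_derivative_at_within by blast
 qed
 from bounded_bilinear.has_vector_derivative[OF bounded_bilinear_smult this assms]
 show ?thesis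
  by (rule has_vector_derivative_eq_rhs) (simp add: vec_eq_iff algebra_simps)
qed

lemma scalar_stable_bound:
 fixes z :: "real => complex ^ 'm"
 assumes z: "!!t. t >= T ==> (z has_vector_derivative \<rho> *s z t + h t) (at t within {T..})"
  and \<rho>: "Re \<rho> < 0" and h: "!!t. t >= T ==> norm (h t) <= H" and t: "t >= T"
 shows "norm (z t) <= exp (Re \<rho> * (t - T)) * norm (z T) + H / (- Re \<rho>)"
proof -
 define a where "a = - Re \<rho>"
 have a: "a > 0" using \<rho> by (simp add: a_def)
 have H: "H >= 0" using h[of T] norm_ge_zero order_trans by blast
 define \<zeta> where "\<zeta> t = exp (- \<rho> * of_real t) *s z t" for t
 have n\<zeta>: "norm (\<zeta> t) = exp (a * t) * norm (z t)" for t
  by (simp add: \<zeta>_def norm_smult_complex a_def)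
 have d\<zeta>: "(\<zeta> has_vector_derivative exp (- \<rho> * of_real s) *s h s) (at s within {T..})" if "s >= T" for s
  unfolding \<zeta>_def by (rule has_vector_derivative_exp_smult[OF z[OF that]])
 have "norm (\<zeta> t - \<zeta> T) <= (H / a) * exp (a * t) - (H / a) * exp (a * T)"
 proof (cases "t = T")
  case False
  then have tT: "T < t" using t by simp
  show ?thesis
  proof (rule differentiable_bound_general[OF tT, where \<phi>' = "%s. H * exp (a * s)"])
   show "continuous_on {T..t} \<zeta>"
   proof (rule continuous_on_subset[where s = "{T..}"])
    show "continuous_on {T..} \<zeta>"
     using d\<zeta> has_vector_derivative_continuous by (fastforce simp: continuous_on_eq_continuous_within)
   qed auto
   show "(\<zeta> has_vector_derivative exp (- \<rho> * of_real s) *s h s) (at s)" if "T < s" "s < t" for s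
   proof -
    have eq: "at s within {T..} = at s"
     by (rule at_within_interior) (use that in \<open>simp add: interior_real_atLeast\<close>)
    have "T <= s" using that by simp
    from d\<zeta>[OF this] show ?thesis unfolding eq .
   qed
   show "((%s. H / a * exp (a * s)) has_vector_derivative H * exp (a * s)) (at s)" for s
    unfolding has_real_derivative_iff_has_vector_derivative[symmetric]
    using a by (auto intro!: derivative_eq_intros)
   show "norm (exp (- \<rho> * complex_of_real s) *s h s) <= H * exp (a * s)" if "T < s" "s < t" for s
    using h[of s] that by (simp add: norm_smult_complex a_def mult.commute mult_right_mono)
  qed (use a in \<open>auto intro!: continuous_intros\<close>)
 qed auto
 then have "norm (\<zeta> t) <= norm (\<zeta> T) + (H / a) * exp (a * t)"
  using norm_triangle_sub[of "\<zeta> t" "\<zeta> T"] a H by (smt (verit) divide_nonneg_pos exp_ge_zero mult_nonneg_nonneg)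
 then have "exp (a * t) * norm (z t) <= exp (a * t) * (exp (- a * (t - T)) * norm (z T) + H / a)"
  by (simp add: n\<zeta> distrib_left mult.assoc[symmetric] exp_add[symmetric] algebra_simps)
 then show ?thesis by (simp add: a_def)
qed

text \<open>In an unstable direction the initial value cannot be prescribed: integrating backwards from
 infinity, a bounded solution is governed by the inhomogeneity alone.\<close>

lemma scalar_unstable_bound:
 fixes z :: "real => complex ^ 'm"
 assumes z: "!!t. t >= T ==> (z has_vector_derivative \<rho> *s z t + h t) (at t within {T..})"
  and \<rho>: "Re \<rho> > 0" and h: "!!t. t >= T ==> norm (h t) <= H"
  and Z: "!!t. t >= T ==> norm (z t) <= Z" and t: "t >= T"
 shows "norm (z t) <= H / Re \<rho>"
proof -
 define a where "a = Re \<rho>"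
 have a: "a > 0" using \<rho> by (simp add: a_def)
 have H: "H >= 0" using h[of T] norm_ge_zero order_trans by blast
 define \<zeta> where "\<zeta> t = exp (- \<rho> * of_real t) *s z t" for t
 have n\<zeta>: "norm (\<zeta> t) = exp (- a * t) * norm (z t)" for t
  by (simp add: \<zeta>_def norm_smult_complex a_def)
 have d\<zeta>: "(\<zeta> has_vector_derivative exp (- \<rho> * of_real s) *s h s) (at s within {T..})" if "s >= T" for s
  unfolding \<zeta>_def by (rule has_vector_derivative_exp_smult[OF z[OF that]])
 have le: "exp (- a * t) * norm (z t) <= (H / a) * exp (- a * t) + Z * exp (- a * u)" if u: "u > t" for u
 proof -
  have "norm (\<zeta> u - \<zeta> t) <= - (H / a) * exp (- a * u) - - (H / a) * exp (- a * t)"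
  proof (rule differentiable_bound_general[OF u, where \<phi>' = "%s. H * exp (- a * s)"])
   show "continuous_on {t..u} \<zeta>"
   proof (rule continuous_on_subset[where s = "{T..}"])
    show "continuous_on {T..} \<zeta>"
     using d\<zeta> has_vector_derivative_continuous by (fastforce simp: continuous_on_eq_continuous_within)
   qed (use t in auto)
   show "(\<zeta> has_vector_derivative exp (- \<rho> * of_real s) *s h s) (at s)" if "t < s" "s < u" for s
   proof -
    have eq: "at s within {T..} = at s"
     by (rule at_within_interior) (use that t in \<open>simp add: interior_real_atLeast\<close>)
    have "T <= s" using that t by simp
    from d\<zeta>[OF this] show ?thesis unfolding eq .
   qed
   show "((%s. - (H / a) * exp (- a * s)) has_vector_derivative H * exp (- a * s)) (at s)" for s
    unfolding has_real_derivative_iff_has_vector_derivative[symmetric]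
    using a by (auto intro!: derivative_eq_intros)
   show "norm (exp (- \<rho> * complex_of_real s) *s h s) <= H * exp (- a * s)" if "t < s" "s < u" for s
    using h[of s] that t by (simp add: norm_smult_complex a_def mult.commute mult_right_mono)
  qed (use a in \<open>auto intro!: continuous_intros\<close>)
  moreover have "norm (\<zeta> t) <= norm (\<zeta> u) + norm (\<zeta> u - \<zeta> t)"
   by (metis norm_minus_commute norm_triangle_sub)
  moreover have "norm (\<zeta> u) <= Z * exp (- a * u)"
   using Z[of u] u t by (simp add: n\<zeta> mult.commute mult_right_mono)
  moreover have "(H / a) * exp (- a * u) >= 0" using H a by simp
  ultimately show ?thesis unfolding n\<zeta> by linarith
 qed
 have "((%u. (H / a) * exp (- a * t) + Z * exp (- a * u)) \<longlongrightarrow> (H / a) * exp (- a * t) + Z * 0) at_top"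
 proof (intro tendsto_intros)
  have "filterlim (%u. - a * u) at_bot at_top"
   by (rule filterlim_tendsto_neg_mult_at_bot[OF tendsto_const _ filterlim_ident]) (use a in simp)
  then show "((%u. exp (- a * u)) \<longlongrightarrow> 0) at_top"
   by (rule filterlim_compose[OF exp_at_bot])
 qed
 then have "exp (- a * t) * norm (z t) <= (H / a) * exp (- a * t) + Z * 0"
  by (rule tendsto_lowerbound) (use le in \<open>auto intro: eventually_mono[OF eventually_gt_at_top[of t]]\<close>)
 then have "exp (- a * t) * norm (z t) <= exp (- a * t) * (H / a)" by (simp add: mult.commute)
 then have "norm (z t) <= H / a" by (subst (asm) mult_le_cancel_left_pos) auto
 then show ?thesis by (simp add: a_def)
qed

lemma scalar_decay:
 fixes z :: "real => complex ^ 'm"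
 assumes z: "!!t. t >= T ==> (z has_vector_derivative \<rho> *s z t + h t) (at t within {T..})"
  and \<rho>: "Re \<rho> ~= 0" and h: "(h \<longlongrightarrow> 0) at_top"
  and Z: "!!t. t >= T ==> norm (z t) <= Z"
 shows "(z \<longlongrightarrow> 0) at_top"
proof (rule tendstoI)
 fix e :: real assume e: "e > 0"
 define H where "H = \<bar>Re \<rho>\<bar> * (e / 3)"
 have "H > 0" using \<rho> e by (simp add: H_def)
 then have "\<forall>\<^sub>F t in at_top. norm (h t) < H" using tendstoD[OF h, of H] by simp
 then obtain T1 where T1: "!!t. t >= T1 ==> norm (h t) < H"
  unfolding eventually_at_top_linorder by blast
 define T2 where "T2 = max T T1"
 have z2: "(z has_vector_derivative \<rho> *s z t + h t) (at t within {T2..})" if "t >= T2" for t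
  by (rule has_vector_derivative_within_subset[OF z]) (use that in \<open>auto simp: T2_def\<close>)
 have h2: "norm (h t) <= H" if "t >= T2" for t using T1[of t] that by (auto simp: T2_def)
 show "\<forall>\<^sub>F t in at_top. dist (z t) 0 < e"
 proof (cases "Re \<rho> > 0")
  case True
  have "norm (z t) <= H / Re \<rho>" if "t >= T2" for t
   by (rule scalar_unstable_bound[of T2 z \<rho> h H Z t]) (use z2 True h2 Z that in \<open>auto simp: T2_def\<close>)
  then have "norm (z t) < e" if "t >= T2" for t using that True e by (fastforce simp: H_def)
  then show ?thesis unfolding eventually_at_top_linorder by auto
 next
  case False
  then have neg: "Re \<rho> < 0" using \<rho> by simp
  have b: "norm (z t) <= exp (Re \<rho> * (t - T2)) * norm (z T2) + e / 3" if "t >= T2" for t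
   using scalar_stable_bound[of T2 z \<rho> h H t] z2 neg h2 that by (auto simp: H_def)
  have "filterlim (%t. - T2 + t) at_top at_top"
   by (rule filterlim_tendsto_add_at_top[OF tendsto_const filterlim_ident])
  then have "filterlim (%t. t - T2) at_top at_top" by simp
  then have "filterlim (%t. Re \<rho> * (t - T2)) at_bot at_top"
   by (rule filterlim_tendsto_neg_mult_at_bot[OF tendsto_const neg])
  then have "((%t. exp (Re \<rho> * (t - T2)) * norm (z T2)) \<longlongrightarrow> 0 * norm (z T2)) at_top"
   by (intro tendsto_mult_right filterlim_compose[OF exp_at_bot])
  then have "\<forall>\<^sub>F t in at_top. exp (Re \<rho> * (t - T2)) * norm (z T2) < e / 3"
   using order_tendstoD(2)[of _ "0 * norm (z T2)" at_top "e / 3"] e by simp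
  then show ?thesis
   using eventually_ge_at_top[of T2]
  proof eventually_elim
   case (elim t)
   then show ?case using b[of t] e by simp
  qed
 qed
qed

fun rprod :: "complex ^ 'm ^ 'm => complex list => complex ^ 'm => complex ^ 'm" where
 "rprod A [] x = x"
| "rprod A (\<rho> # \<rho>s) x = A *v rprod A \<rho>s x - \<rho> *s rprod A \<rho>s x"

lemma matrix_mult_smult: "A *v (c *s x) = c *s (A *v x)" for A :: "complex ^ 'm ^ 'm"
 by (simp add: vec_eq_iff matrix_vector_mult_def sum_distrib_left mult_ac)

lemma rprod_diff: "rprod A \<rho>s (x - y) = rprod A \<rho>s x - rprod A \<rho>s y"
proof (induction \<rho>s)
 case (Cons a \<rho>s)
 show ?case
  unfolding rprod.simps Cons.IH matrix_vector_mult_diff_distrib vector_ssub_ldistrib by simp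
qed simp

lemma rprod_add: "rprod A \<rho>s (x + y) = rprod A \<rho>s x + rprod A \<rho>s y"
proof (induction \<rho>s)
 case (Cons a \<rho>s)
 show ?case
  unfolding rprod.simps Cons.IH matrix_vector_right_distrib vector_add_ldistrib by simp
qed simp

lemma rprod_smult: "rprod A \<rho>s (c *s x) = c *s rprod A \<rho>s x"
 by (induction \<rho>s) (simp_all add: matrix_mult_smult vector_ssub_ldistrib vector_smult_assoc mult.commute)

lemma rprod_zero[simp]: "rprod A \<rho>s 0 = 0"
 using rprod_diff[of A \<rho>s 0 0] by simp

lemma rprod_append: "rprod A (\<rho>s @ \<sigma>s) x = rprod A \<rho>s (rprod A \<sigma>s x)"
 by (induction \<rho>s) simp_all

lemma rprod_matrix_commute: "A *v rprod A \<rho>s x = rprod A \<rho>s (A *v x)"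
 by (induction \<rho>s) (simp_all add: matrix_vector_mult_diff_distrib matrix_mult_smult)

lemma rprod_Cons': "rprod A (\<rho> # \<rho>s) x = rprod A \<rho>s (A *v x - \<rho> *s x)"
 by (simp add: rprod_matrix_commute rprod_diff rprod_smult)

lemma rprod_commute: "rprod A \<rho>s (rprod A \<sigma>s x) = rprod A \<sigma>s (rprod A \<rho>s x)"
 by (induction \<rho>s arbitrary: x) (simp_all add: rprod_matrix_commute rprod_diff rprod_smult)

lemma scaleR_smult_complex: "r *\<^sub>R x = of_real r *s x" for x :: "complex ^ 'm"
 by (simp add: vec_eq_iff) (simp add: scaleR_conv_of_real)

lemma bounded_linear_rprod: "bounded_linear (rprod A \<rho>s)"
proof -
 have "linear (rprod A \<rho>s)"
  by (intro linearI) (simp_all add: rprod_add scaleR_smult_complex rprod_smult)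
 then show ?thesis by (simp add: linear_conv_bounded_linear)
qed

lemma bounded_linear_matrix_complex: "bounded_linear ((*v) A)" for A :: "complex ^ 'm ^ 'm"
proof -
 have "(*v) A = rprod A [0]" by (auto simp: fun_eq_iff)
 then show ?thesis using bounded_linear_rprod by metis
qed

definition pos_part :: "complex => complex" where "pos_part \<rho> = (if Re \<rho> > 0 then \<rho> else - \<rho>)"

lemma rprod_pos_neg:
 "rprod A (map pos_part \<rho>s) (rprod A (map uminus (map pos_part \<rho>s)) x) = rprod A \<rho>s (rprod A (map uminus \<rho>s) x)"
proof (induction \<rho>s arbitrary: x)
 case (Cons \<rho> \<rho>s)
 have sq: "A *v (A *v y - (- pos_part \<rho>) *s y) - pos_part \<rho> *s (A *v y - (- pos_part \<rho>) *s y) =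
   A *v (A *v y - (- \<rho>) *s y) - \<rho> *s (A *v y - (- \<rho>) *s y)" for y
  by (simp add: pos_part_def matrix_vector_mult_diff_distrib matrix_vector_right_distrib matrix_mult_smult vector_add_ldistrib
    vector_ssub_ldistrib vector_smult_assoc algebra_simps)
 define P where "P = map pos_part \<rho>s"
 define N where "N = map uminus P"
 have swap: "rprod A [\<sigma>] (rprod A Q (rprod A [- \<sigma>] y)) = rprod A [\<sigma>] (rprod A [- \<sigma>] (rprod A Q y))" for \<sigma> Q y
  by (simp only: rprod_commute[of A Q "[- \<sigma>]"])
 have "rprod A (map pos_part (\<rho> # \<rho>s)) (rprod A (map uminus (map pos_part (\<rho> # \<rho>s))) x) =
   rprod A [pos_part \<rho>] (rprod A P (rprod A [- pos_part \<rho>] (rprod A N x)))"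
  by (simp add: P_def N_def)
 also have "\<dots> = rprod A [pos_part \<rho>] (rprod A [- pos_part \<rho>] (rprod A P (rprod A N x)))"
  by (rule swap)
 also have "\<dots> = rprod A [\<rho>] (rprod A [- \<rho>] (rprod A P (rprod A N x)))"
  using sq by simp
 also have "\<dots> = rprod A [\<rho>] (rprod A [- \<rho>] (rprod A \<rho>s (rprod A (map uminus \<rho>s) x)))"
  unfolding P_def N_def Cons.IH ..
 also have "\<dots> = rprod A [\<rho>] (rprod A \<rho>s (rprod A [- \<rho>] (rprod A (map uminus \<rho>s) x)))"
  by (rule swap[symmetric])
 also have "\<dots> = rprod A (\<rho> # \<rho>s) (rprod A (map uminus (\<rho> # \<rho>s)) x)"
  by simp
 finally show ?case .
qed simp

text \<open>Annihilating products: every vector is annihilated by a product of factors \<open>A - \<rho>\<close> over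
 eigenvalues \<open>\<rho>\<close>.\<close>

definition polyop :: "complex poly => complex ^ 'm ^ 'm => complex ^ 'm => complex ^ 'm" where
 "polyop p A x = fold_coeffs (%a y. a *s x + A *v y) p 0"

lemma polyop_0[simp]: "polyop 0 A x = 0" by (simp add: polyop_def)

lemma polyop_pCons: "polyop (pCons a p) A x = a *s x + A *v polyop p A x"
 by (cases "a = 0 & p = 0") (auto simp: polyop_def)

lemma polyop_add: "polyop (p + q) A x = polyop p A x + polyop q A x"
proof (induction p arbitrary: q)
 case (pCons a p)
 show ?case
  by (cases q) (simp add: polyop_pCons pCons.IH vector_sadd_rdistrib matrix_vector_right_distrib)
qed simp

lemma polyop_smult: "polyop (smult c p) A x = c *s polyop p A x"
 by (induction p) (simp_all add: polyop_pCons vector_add_ldistrib vector_smult_assoc matrix_mult_smult)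

lemma polyop_linear_factor: "polyop ([:- z, 1:] * q) A x = A *v polyop q A x - z *s polyop q A x"
proof -
 have "[:- z, 1:] * q = smult (- z) q + pCons 0 q" by simp
 then show ?thesis by (simp only: polyop_add polyop_smult polyop_pCons) (simp add: vec_eq_iff)
qed

lemma polyop_factorize:
 assumes "p ~= 0"
 shows "\<exists>\<rho>s c. c ~= 0 & (ALL x. polyop p A x = c *s rprod A \<rho>s x)"
 using assms
proof (induction "degree p" arbitrary: p rule: less_induct)
 case less
 show ?case
 proof (cases "degree p = 0")
  case True
  then obtain c where c: "p = [:c:]" using degree_eq_zeroE by blast
  with less.prems show ?thesis
   by (intro exI[of _ "[]"] exI[of _ c]) (simp add: polyop_pCons)
 next
  case False
  then have "\<not> constant (poly p)" by (simp add: constant_degree)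
  then obtain z where "poly p z = 0" using fundamental_theorem_of_algebra by blast
  then obtain q where q: "p = [:- z, 1:] * q" using poly_eq_0_iff_dvd by blast
  then have q0: "q ~= 0" using less.prems by auto
  then have "degree p = Suc (degree q)" unfolding q by (subst degree_mult_eq) auto
  then obtain \<rho>s c where "c ~= 0" "!!x. polyop q A x = c *s rprod A \<rho>s x"
   using less.hyps[of q] q0 by auto
  then show ?thesis unfolding q polyop_linear_factor
   by (intro exI[of _ "z # \<rho>s"] exI[of _ c])
    (simp add: matrix_mult_smult vector_ssub_ldistrib vector_smult_assoc mult.commute)
 qed
qed

lemma polyop_monom: "polyop (monom c k) A x = c *s ((((*v) A) ^^ k) x)"
 by (induction k) (simp_all add: monom_0 monom_Suc polyop_pCons matrix_mult_smult)

lemma polyop_sum: "finite I ==> polyop (\<Sum>i\<in>I. p i) A x = (\<Sum>i\<in>I. polyop (p i) A x)"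
 by (induction I rule: finite_induct) (simp_all add: polyop_add)

lemma exists_annihilating_poly:
 fixes A :: "complex ^ 'm ^ 'm"
 shows "EX p. p ~= 0 & polyop p A x = 0"
proof -
 obtain e :: "'m => nat" where e: "bij_betw e UNIV {0..<CARD('m)}"
  using ex_bij_betw_finite_nat[of "UNIV :: 'm set"] by auto
 define N where "N = CARD('m)"
 define K :: "complex ^ 'm ^ 'm" where "K = (\<chi> i j. ((((*v) A) ^^ e j) x) $ i)"
 have K: "K *v c = polyop (\<Sum>j\<in>UNIV. monom (c $ j) (e j)) A x" for c
  by (simp add: polyop_sum polyop_monom) (simp add: vec_eq_iff K_def matrix_vector_mult_def mult.commute)
 have coeff: "coeff (\<Sum>j\<in>UNIV. monom (c $ j) (e j)) (e j0) = c $ j0" for c :: "complex ^ 'm" and j0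
 proof -
  have inj: "e j = e j0 \<longleftrightarrow> j = j0" for j using e by (auto simp: bij_betw_def inj_on_def)
  show ?thesis by (simp add: coeff_sum inj sum.delta)
 qed
 have coeffN: "coeff (\<Sum>j\<in>UNIV. monom (c $ j) (e j)) N = 0" for c :: "complex ^ 'm"
 proof -
  have "e j ~= N" for j using e by (force simp: bij_betw_def N_def)
  then show ?thesis by (simp add: coeff_sum)
 qed
 show ?thesis
 proof (cases "EX c. c ~= 0 & K *v c = 0")
  case True
  then obtain c where c: "c ~= 0" "K *v c = 0" by blast
  then obtain j0 where "c $ j0 ~= 0" by (metis vec_eq_iff zero_index)
  then have "(\<Sum>j\<in>UNIV. monom (c $ j) (e j)) ~= 0" using coeff[of c j0] by auto
  then show ?thesis using c K by metis
 next
  case False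
  then have "EX B. B ** K = mat 1" by (auto simp: matrix_left_invertible_ker)
  then have "EX B. K ** B = mat 1" using matrix_left_right_inverse by metis
  then have "surj ((*v) K)" using matrix_right_invertible_surjective by blast
  then obtain c where c: "K *v c = (((*v) A) ^^ N) x" by (metis surjD)
  define p where "p = monom 1 N + smult (- 1) (\<Sum>j\<in>UNIV. monom (c $ j) (e j))"
  have "coeff p N = 1" by (simp add: p_def coeffN)
  then have "p ~= 0" by auto
  moreover have "polyop p A x = 0"
   unfolding p_def polyop_add polyop_smult polyop_monom K[symmetric] c by (simp add: vec_eq_iff)
  ultimately show ?thesis by blast
 qed
qed

definition eigenvalues :: "complex ^ 'm ^ 'm => complex set" where
 "eigenvalues A = {\<rho>. EX v. v ~= 0 & A *v v = \<rho> *s v}"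

lemma rprod_restrict_eigenvalues:
 assumes "rprod A \<rho>s x = 0"
 shows "\<exists>\<sigma>s. set \<sigma>s \<subseteq> eigenvalues A & rprod A \<sigma>s x = 0"
 using assms
proof (induction \<rho>s arbitrary: x)
 case Nil
 then show ?case by (intro exI[of _ "[]"]) auto
next
 case (Cons \<rho> \<rho>s)
 then have "rprod A \<rho>s (A *v x - \<rho> *s x) = 0" by (simp add: rprod_Cons'[symmetric])
 then obtain \<sigma>s where \<sigma>s: "set \<sigma>s \<subseteq> eigenvalues A" "rprod A \<sigma>s (A *v x - \<rho> *s x) = 0"
  using Cons.IH by blast
 show ?case
 proof (cases "\<rho> \<in> eigenvalues A")
  case True
  then show ?thesis using \<sigma>s by (intro exI[of _ "\<rho> # \<sigma>s"]) (auto simp: rprod_Cons' simp del: rprod.simps)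
 next
  case False
  have "A *v rprod A \<sigma>s x = \<rho> *s rprod A \<sigma>s x"
   using \<sigma>s(2) by (simp add: rprod_matrix_commute rprod_diff rprod_smult)
  then have "rprod A \<sigma>s x = 0" using False by (auto simp: eigenvalues_def)
  then show ?thesis using \<sigma>s by blast
 qed
qed

text \<open>A vector and its iterates are linearly dependent, which gives an annihilating polynomial; factors
 whose root is not an eigenvalue are injective and can be dropped.\<close>

lemma exists_annihilating_eigenvalues:
 fixes A :: "complex ^ 'm ^ 'm"
 shows "\<exists>\<sigma>s. set \<sigma>s \<subseteq> eigenvalues A & (ALL x. rprod A \<sigma>s x = 0)"
proof -
 have one: "\<exists>\<sigma>s. set \<sigma>s \<subseteq> eigenvalues A & rprod A \<sigma>s x = 0" for x
 proof -
  obtain p where p: "p ~= 0" "polyop p A x = 0" using exists_annihilating_poly by blast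
  obtain \<rho>s c where "c ~= 0" "ALL x. polyop p A x = c *s rprod A \<rho>s x"
   using polyop_factorize[OF p(1)] by blast
  then have "rprod A \<rho>s x = 0" using p(2) by auto
  then show ?thesis by (rule rprod_restrict_eigenvalues)
 qed
 have "\<exists>\<sigma>s. set \<sigma>s \<subseteq> eigenvalues A & (\<forall>x\<in>F. rprod A \<sigma>s x = 0)" if "finite F" for F
  using that
 proof (induction F rule: finite_induct)
  case empty
  then show ?case by (intro exI[of _ "[]"]) auto
 next
  case (insert x F)
  then obtain \<sigma>s where \<sigma>s: "set \<sigma>s \<subseteq> eigenvalues A" "\<forall>x\<in>F. rprod A \<sigma>s x = 0" by blast
  obtain \<tau>s where \<tau>s: "set \<tau>s \<subseteq> eigenvalues A" "rprod A \<tau>s x = 0" using one by blast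
  have "rprod A (\<sigma>s @ \<tau>s) y = 0" if "y \<in> insert x F" for y
   using that \<sigma>s \<tau>s rprod_commute[of A \<sigma>s \<tau>s y] by (auto simp: rprod_append)
  then show ?case using \<sigma>s \<tau>s by (intro exI[of _ "\<sigma>s @ \<tau>s"]) auto
 qed
 from this[of "range (%i. axis i 1)"] obtain \<sigma>s where
  \<sigma>s: "set \<sigma>s \<subseteq> eigenvalues A" "!!i. rprod A \<sigma>s (axis i 1) = 0" by auto
 have "rprod A \<sigma>s x = 0" for x
 proof -
  have sum: "rprod A \<sigma>s (\<Sum>i\<in>I. g i) = (\<Sum>i\<in>I. rprod A \<sigma>s (g i))" for I and g :: "'m => complex ^ 'm"
   using linear_sum[of "rprod A \<sigma>s" g I] bounded_linear_rprod bounded_linear.linear by blast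
  have "rprod A \<sigma>s x = rprod A \<sigma>s (\<Sum>i\<in>UNIV. (x $ i) *s axis i 1)" by (simp only: basis_expansion)
  also have "\<dots> = 0" unfolding sum by (simp add: rprod_smult \<sigma>s)
  finally show ?thesis .
 qed
 then show ?thesis using \<sigma>s by blast
qed

section \<open>Half-line estimates for asymptotically hyperbolic reversible systems\<close>

definition csol :: "complex ^ 'm ^ 'm => real => (real => complex ^ 'm) => (real => complex ^ 'm) => bool" where
 "csol A T y g \<longleftrightarrow> (ALL t>=T. (y has_vector_derivative A *v y t + g t) (at t within {T..}))"

lemma csol_rprod:
 assumes "csol A T y g"
 shows "csol A T (%t. rprod A \<rho>s (y t)) (%t. rprod A \<rho>s (g t))"
 unfolding csol_def
proof (intro allI impI)
 fix t assume "t >= T"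
 then have "(y has_vector_derivative A *v y t + g t) (at t within {T..})"
  using assms by (simp add: csol_def)
 from bounded_linear.has_vector_derivative[OF bounded_linear_rprod this]
 show "((%t. rprod A \<rho>s (y t)) has_vector_derivative A *v rprod A \<rho>s (y t) + rprod A \<rho>s (g t))
   (at t within {T..})"
  by (simp add: rprod_add rprod_matrix_commute)
qed

lemma csol_scalar:
 assumes "csol A T y g" "t >= T"
 shows "(y has_vector_derivative \<rho> *s y t + (rprod A [\<rho>] (y t) + g t)) (at t within {T..})"
 using assms by (auto simp: csol_def algebra_simps)

lemma rprod_inner: "rprod A \<rho>s (rprod A [\<rho>] x) = rprod A (\<rho> # \<rho>s) x"
 by (subst rprod_Cons') simp

text \<open>Applying the factors one at a time turns the system into a chain of scalar equations, each driven
 by the next; the scalar bounds add up along the chain.\<close>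

lemma chain_up:
 fixes A :: "complex ^ 'm ^ 'm"
 assumes "\<forall>\<rho>\<in>set \<rho>s. Re \<rho> > 0"
 shows "EX C>=0. ALL T y g H V Y. csol A T y g --> (ALL t>=T. norm (g t) <= H) --> (ALL t>=T. norm (y t) <= Y) -->
   (ALL t>=T. norm (rprod A \<rho>s (y t)) <= V) --> (ALL t>=T. norm (y t) <= C * (V + H))"
 using assms
proof (induction \<rho>s)
 case Nil
 have "norm (y t) <= 1 * (V + H)" if "ALL t>=T. norm (g t) <= H" "ALL t>=T. norm (y t) <= V" "t >= T"
  for y g :: "real => complex ^ 'm" and H V T t
  using that norm_ge_zero[of "g t"] by (smt (verit))
 then show ?case by (intro exI[of _ 1]) auto
next
 case (Cons \<rho> \<rho>s)
 have "\<forall>\<rho>\<in>set \<rho>s. Re \<rho> > 0" using Cons.prems by simp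
 from Cons.IH[OF this] obtain C0 where C0: "C0 >= 0" and IH: "!!T y g H V Y. csol A T y g ==> ALL t>=T. norm (g t) <= H ==>
  ALL t>=T. norm (y t) <= Y ==> ALL t>=T. norm (rprod A \<rho>s (y t)) <= V ==> ALL t>=T. norm (y t) <= C0 * (V + H)"
  by (elim exE conjE) (rule that, assumption, blast)
 have \<rho>: "Re \<rho> > 0" using Cons.prems by simp
 obtain K where K: "K >= 0" "!!x. norm (rprod A [\<rho>] x) <= norm x * K"
  using bounded_linear.nonneg_bounded[OF bounded_linear_rprod[of A "[\<rho>]"]] by blast
 define C where "C = (C0 * (1 + K) + 1) / Re \<rho>"
 have C: "C >= 0" using C0 K \<rho> by (simp add: C_def)
 have "norm (y t) <= C * (V + H)"
  if y: "csol A T y g" and g: "ALL t>=T. norm (g t) <= H" and Y: "ALL t>=T. norm (y t) <= Y"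
   and V: "ALL t>=T. norm (rprod A (\<rho> # \<rho>s) (y t)) <= V" and t: "t >= T" for T y g H V Y t
 proof -
  have H: "H >= 0" using g norm_ge_zero order_trans by blast
  have V0: "V >= 0" using V norm_ge_zero order_trans by blast
  have v: "norm (rprod A [\<rho>] (y s)) <= C0 * (V + H * K)" if "s >= T" for s
  proof -
   have "ALL t>=T. norm (rprod A [\<rho>] (y t)) <= C0 * (V + H * K)"
   proof (rule IH[OF csol_rprod[OF y]])
    show "ALL t>=T. norm (rprod A [\<rho>] (g t)) <= H * K"
     using g K by (meson mult_right_mono order_trans)
    show "ALL t>=T. norm (rprod A [\<rho>] (y t)) <= Y * K"
     using Y K by (meson mult_right_mono order_trans)
    show "ALL t>=T. norm (rprod A \<rho>s (rprod A [\<rho>] (y t))) <= V"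
     using V unfolding rprod_inner .
   qed
   then show ?thesis using that by blast
  qed
  have "norm (y t) <= (C0 * (V + H * K) + H) / Re \<rho>"
  proof (rule scalar_unstable_bound[OF csol_scalar[OF y] \<rho> _ _ t])
   show "norm (rprod A [\<rho>] (y s) + g s) <= C0 * (V + H * K) + H" if "s >= T" for s
    using v[OF that] g that by (intro order_trans[OF norm_triangle_ineq] add_mono) auto
   show "norm (y s) <= Y" if "s >= T" for s using Y that by blast
  qed
  also have "\<dots> <= ((C0 * (1 + K) + 1) * (V + H)) / Re \<rho>"
  proof (rule divide_right_mono)
   have "0 <= C0 * K * V" "0 <= C0 * H" using C0 K V0 H by auto
   then show "C0 * (V + H * K) + H <= (C0 * (1 + K) + 1) * (V + H)"
    using V0 by (simp add: algebra_simps)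
  qed (use \<rho> in simp)
  also have "\<dots> = C * (V + H)" by (simp add: C_def)
  finally show ?thesis .
 qed
 then show ?case using C by (intro exI[of _ C]) blast
qed

lemma chain_down:
 fixes A :: "complex ^ 'm ^ 'm"
 assumes "\<forall>\<rho>\<in>set \<rho>s. Re \<rho> < 0"
 shows "EX C>=0. ALL T y g H. csol A T y g --> (ALL t>=T. norm (g t) <= H) -->
   (ALL t>=T. rprod A \<rho>s (y t) = 0) --> (ALL t>=T. norm (y t) <= C * (norm (y T) + H))"
 using assms
proof (induction \<rho>s)
 case Nil
 then show ?case by (intro exI[of _ 0]) auto
next
 case (Cons \<rho> \<rho>s)
 have "\<forall>\<rho>\<in>set \<rho>s. Re \<rho> < 0" using Cons.prems by simp
 from Cons.IH[OF this] obtain C0 where C0: "C0 >= 0" and IH: "!!T y g H. csol A T y g ==> ALL t>=T. norm (g t) <= H ==>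
  ALL t>=T. rprod A \<rho>s (y t) = 0 ==> ALL t>=T. norm (y t) <= C0 * (norm (y T) + H)"
  by (elim exE conjE) (rule that, assumption, blast)
 have \<rho>: "Re \<rho> < 0" using Cons.prems by simp
 obtain K where K: "K >= 0" "!!x. norm (rprod A [\<rho>] x) <= norm x * K"
  using bounded_linear.nonneg_bounded[OF bounded_linear_rprod[of A "[\<rho>]"]] by blast
 define a where "a = - Re \<rho>"
 have a: "a > 0" using \<rho> by (simp add: a_def)
 define C where "C = 1 + (C0 * K + 1) / a"
 have C: "C >= 0" using C0 K a by (simp add: C_def)
 have "norm (y t) <= C * (norm (y T) + H)"
  if y: "csol A T y g" and g: "ALL t>=T. norm (g t) <= H"
   and V: "ALL t>=T. rprod A (\<rho> # \<rho>s) (y t) = 0" and t: "t >= T" for T y g H t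
 proof -
  have H: "H >= 0" using g norm_ge_zero order_trans by blast
  have v: "norm (rprod A [\<rho>] (y s)) <= C0 * K * (norm (y T) + H)" if "s >= T" for s
  proof -
   have "ALL t>=T. norm (rprod A [\<rho>] (y t)) <= C0 * (norm (rprod A [\<rho>] (y T)) + H * K)"
   proof (rule IH[OF csol_rprod[OF y]])
    show "ALL t>=T. norm (rprod A [\<rho>] (g t)) <= H * K"
     using g K by (meson mult_right_mono order_trans)
    show "ALL t>=T. rprod A \<rho>s (rprod A [\<rho>] (y t)) = 0"
     using V unfolding rprod_inner .
   qed
   then have "norm (rprod A [\<rho>] (y s)) <= C0 * (norm (rprod A [\<rho>] (y T)) + H * K)" using that by blast
   also have "\<dots> <= C0 * (norm (y T) * K + H * K)"
    using K C0 by (intro mult_left_mono add_right_mono) auto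
   finally show ?thesis by (simp add: algebra_simps)
  qed
  have "norm (y t) <= exp (Re \<rho> * (t - T)) * norm (y T) + (C0 * K * (norm (y T) + H) + H) / (- Re \<rho>)"
  proof (rule scalar_stable_bound[OF csol_scalar[OF y] \<rho> _ t])
   show "norm (rprod A [\<rho>] (y s) + g s) <= C0 * K * (norm (y T) + H) + H" if "s >= T" for s
    using v[OF that] g that by (intro order_trans[OF norm_triangle_ineq] add_mono) auto
  qed
  also have "\<dots> <= 1 * (norm (y T) + H) + ((C0 * K + 1) * (norm (y T) + H)) / a"
  proof (rule add_mono)
   have "exp (Re \<rho> * (t - T)) * norm (y T) <= 1 * norm (y T)"
    using \<rho> t by (intro mult_right_mono) (auto simp: mult_nonpos_nonneg)
   then show "exp (Re \<rho> * (t - T)) * norm (y T) <= 1 * (norm (y T) + H)" using H by simp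
   show "(C0 * K * (norm (y T) + H) + H) / (- Re \<rho>) <= ((C0 * K + 1) * (norm (y T) + H)) / a"
    unfolding a_def[symmetric] using a by (intro divide_right_mono) (auto simp: algebra_simps)
  qed
  also have "\<dots> = C * (norm (y T) + H)" by (simp add: C_def algebra_simps)
  finally show ?thesis .
 qed
 then show ?case using C by (intro exI[of _ C]) blast
qed

lemma chain_decay:
 fixes A :: "complex ^ 'm ^ 'm"
 assumes "\<forall>\<rho>\<in>set \<rho>s. Re \<rho> ~= 0" "csol A T y g" "(g \<longlongrightarrow> 0) at_top" "ALL t>=T. norm (y t) <= Y"
  "ALL t>=T. rprod A \<rho>s (y t) = 0"
 shows "(y \<longlongrightarrow> 0) at_top"
 using assms
proof (induction \<rho>s arbitrary: y g Y)
 case Nil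
 then have "\<forall>\<^sub>F t in at_top. y t = 0" by (auto simp: eventually_at_top_linorder)
 then show ?case by (rule tendsto_eventually)
next
 case (Cons \<rho> \<rho>s)
 obtain K where K: "K >= 0" "!!x. norm (rprod A [\<rho>] x) <= norm x * K"
  using bounded_linear.nonneg_bounded[OF bounded_linear_rprod[of A "[\<rho>]"]] by blast
 have g0: "((%t. rprod A [\<rho>] (g t)) \<longlongrightarrow> 0) at_top"
  using bounded_linear.tendsto[OF bounded_linear_rprod[of A "[\<rho>]"] Cons.prems(3)] by (simp only: rprod_zero)
 have "((%t. rprod A [\<rho>] (y t)) \<longlongrightarrow> 0) at_top"
 proof (rule Cons.IH[OF _ csol_rprod[OF Cons.prems(2)] g0])
  show "\<forall>\<rho>\<in>set \<rho>s. Re \<rho> ~= 0" using Cons.prems(1) by simp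
  show "ALL t>=T. norm (rprod A [\<rho>] (y t)) <= Y * K"
   using Cons.prems(4) K by (meson mult_right_mono order_trans)
  show "ALL t>=T. rprod A \<rho>s (rprod A [\<rho>] (y t)) = 0"
   using Cons.prems(5) unfolding rprod_inner .
 qed
 then have "((%t. rprod A [\<rho>] (y t) + g t) \<longlongrightarrow> 0 + 0) at_top"
  by (intro tendsto_add Cons.prems(3))
 then show ?case
  using Cons.prems(1,4)
  by (intro scalar_decay[OF csol_scalar[OF Cons.prems(2)]]) auto
qed

text \<open>A perturbation that is half as large as the solution can be absorbed into the left-hand side,
 because the supremum is known to be finite.\<close>

lemma sup_bootstrap:
 fixes y :: "real => 'a::real_normed_vector"
 assumes Y: "!!t. t >= T ==> norm (y t) <= Y"
  and step: "!!Y t. (!!t. t >= T ==> norm (y t) <= Y) ==> t >= T ==> norm (y t) <= a + Y / 2"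
  and t: "t >= T"
 shows "norm (y t) <= 2 * a"
proof -
 define S where "S = (SUP t\<in>{T..}. norm (y t))"
 have bdd: "bdd_above ((%t. norm (y t)) ` {T..})" by (rule bdd_aboveI2[where M = Y]) (use Y in auto)
 have up: "norm (y t) <= S" if "t >= T" for t
  unfolding S_def using that by (intro cSUP_upper bdd) auto
 have "S <= a + S / 2" unfolding S_def
  by (rule cSUP_least) (use step[OF up] in \<open>auto simp: S_def\<close>)
 then show ?thesis using up[OF t] by simp
qed

text \<open>Complexification; \<open>cpair a b\<close> is \<open>a + i b\<close>, with estimates in both directions so that real solutions inherit the complex bounds.\<close>

definition cpair :: "real ^ 'm => real ^ 'm => complex ^ 'm" where
 "cpair a b = (\<chi> i. Complex (a $ i) (b $ i))"

definition cmat :: "(real ^ 'm => real ^ 'm) => complex ^ 'm ^ 'm" where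
 "cmat M = (\<chi> i j. complex_of_real (matrix M $ i $ j))"

lemma cmat_cpair: "linear M ==> cmat M *v cpair a b = cpair (M a) (M b)"
proof -
 assume "linear M"
 then have M: "M x = matrix M *v x" for x by (simp add: matrix_vector_mul(2)[symmetric])
 have "cmat M *v cpair a b = cpair (matrix M *v a) (matrix M *v b)"
  by (simp add: vec_eq_iff cmat_def cpair_def matrix_vector_mult_def complex_eq_iff)
 then show ?thesis using M by simp
qed

lemma cpair_surj: "EX a b. x = cpair a b"
 by (rule exI[of _ "\<chi> i. Re (x $ i)"], rule exI[of _ "\<chi> i. Im (x $ i)"]) (simp add: cpair_def vec_eq_iff)

lemma linear_cpair: "linear (%(a, b). cpair a b)"
 by (intro linearI) (auto simp: cpair_def vec_eq_iff complex_eq_iff)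

lemma cpair_add: "cpair a b + cpair c d = cpair (a + c) (b + d)"
 and cpair_diff: "cpair a b - cpair c d = cpair (a - c) (b - d)"
 and cpair_zero: "cpair 0 0 = 0"
 and cpair_scaleR: "r *\<^sub>R cpair a b = cpair (r *\<^sub>R a) (r *\<^sub>R b)"
 by (auto simp: cpair_def vec_eq_iff complex_eq_iff)

lemma norm_cpair_ge1: "norm a <= norm (cpair a b)"
 unfolding norm_vec_def by (rule L2_set_mono) (auto simp: cpair_def cmod_def real_le_rsqrt)

lemma norm_cpair_ge2: "norm b <= norm (cpair a b)"
 unfolding norm_vec_def by (rule L2_set_mono) (auto simp: cpair_def cmod_def real_le_rsqrt)

lemma norm_cpair_0: "norm (cpair a 0) = norm a"
 unfolding norm_vec_def by (rule L2_set_cong) (auto simp: cpair_def cmod_def)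

lemma norm_cpair_le: "norm (cpair a b) <= norm a + norm b"
proof -
 have "cpair a b = cpair a 0 + cpair 0 b" by (simp add: cpair_add)
 also have "norm \<dots> <= norm (cpair a 0) + norm (cpair 0 b)" by (rule norm_triangle_ineq)
 also have "norm (cpair 0 b) = norm b"
  unfolding norm_vec_def by (rule L2_set_cong) (auto simp: cpair_def cmod_def)
 finally show ?thesis by (simp add: norm_cpair_0)
qed

lemma bounded_linear_cpair: "bounded_linear (%x. cpair (fst x) (snd x))"
 using linear_cpair by (simp add: linear_conv_bounded_linear case_prod_unfold)

lemma has_vector_derivative_cpair:
 assumes "(y has_vector_derivative y') (at t within S)" "(z has_vector_derivative z') (at t within S)"
 shows "((%t. cpair (y t) (z t)) has_vector_derivative cpair y' z') (at t within S)"
 using bounded_linear.has_vector_derivative[OF bounded_linear_cpair has_vector_derivative_Pair[OF assms]]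
 by simp

locale hyperbolic_reversible =
 fixes L R :: "real ^ 'm => real ^ 'm" and n :: nat and \<Lambda> :: "nat => complex"
 assumes linL: "linear L" and linR: "linear R" and RR: "!!x. R (R x) = x"
  and anti: "!!x. L (R x) = - R (L x)"
  and char_poly: "!!z. det (mat z - (\<chi> i j. complex_of_real (matrix L $ i $ j)))
        = (\<Prod>j = 1..n. (z - \<Lambda> j) * (z + \<Lambda> j))"
  and Re_pos: "!!j. j \<in> {1..n} ==> Re (\<Lambda> j) > 0"
begin

lemma eigenvalue_Re: "\<rho> \<in> eigenvalues (cmat L) ==> Re \<rho> ~= 0"
proof -
 assume "\<rho> \<in> eigenvalues (cmat L)"
 then obtain v where v: "v ~= 0" "cmat L *v v = \<rho> *s v" by (auto simp: eigenvalues_def)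
 have "(mat \<rho> - cmat L) *v v = 0"
 proof -
  have "mat \<rho> *v v = \<rho> *s v"
   by (simp add: vec_eq_iff matrix_vector_mult_def mat_def if_distrib[of "%x. x * _"] sum.delta cong: if_cong)
  then show ?thesis by (simp add: matrix_vector_mult_diff_rdistrib v)
 qed
 then have "\<not> (EX B. B ** (mat \<rho> - cmat L) = mat 1)"
  using v(1) by (auto simp: matrix_left_invertible_ker)
 then have "\<not> invertible (mat \<rho> - cmat L)" by (auto simp: invertible_def)
 then have "det (mat \<rho> - cmat L) = 0" using invertible_det_nz by blast
 then have "(\<Prod>j = 1..n. (\<rho> - \<Lambda> j) * (\<rho> + \<Lambda> j)) = 0" using char_poly unfolding cmat_def by simp
 then obtain j where j: "j \<in> {1..n}" "(\<rho> - \<Lambda> j) * (\<rho> + \<Lambda> j) = 0" by (auto simp: prod_zero_iff)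
 then have "\<rho> = \<Lambda> j \<or> \<rho> = - \<Lambda> j" by (auto simp: eq_neg_iff_add_eq_0)
 then show "Re \<rho> ~= 0" using Re_pos[OF j(1)] by auto
qed

definition unstable_roots :: "complex list" where
 "unstable_roots = map pos_part (SOME \<sigma>s. set \<sigma>s \<subseteq> eigenvalues (cmat L) & (ALL x. rprod (cmat L) \<sigma>s x = 0))"

abbreviation "P_unst \<equiv> rprod (cmat L) unstable_roots"
abbreviation "P_stab \<equiv> rprod (cmat L) (map uminus unstable_roots)"

lemma unstable_roots: "\<forall>\<rho>\<in>set unstable_roots. Re \<rho> > 0" and P_unst_stab: "P_unst (P_stab x) = 0"
proof -
 define \<sigma>s where "\<sigma>s = (SOME \<sigma>s. set \<sigma>s \<subseteq> eigenvalues (cmat L) & (ALL x. rprod (cmat L) \<sigma>s x = 0))"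
 have \<sigma>s: "set \<sigma>s \<subseteq> eigenvalues (cmat L) & (ALL x. rprod (cmat L) \<sigma>s x = 0)"
  unfolding \<sigma>s_def by (rule someI_ex[OF exists_annihilating_eigenvalues])
 show "\<forall>\<rho>\<in>set unstable_roots. Re \<rho> > 0"
  using \<sigma>s eigenvalue_Re by (auto simp: unstable_roots_def \<sigma>s_def[symmetric] pos_part_def) (metis linorder_neqE_linordered_idom subsetD)
 show "P_unst (P_stab x) = 0"
  unfolding unstable_roots_def \<sigma>s_def[symmetric] rprod_pos_neg using \<sigma>s by simp
qed

lemma P_stab_unst: "P_stab (P_unst x) = 0"
 using P_unst_stab rprod_commute by metis

lemma cmat_R: "cmat R *v (cmat R *v x) = x" "cmat L *v (cmat R *v x) = - (cmat R *v (cmat L *v x))"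
proof -
 obtain a b where x: "x = cpair a b" using cpair_surj by blast
 show "cmat R *v (cmat R *v x) = x" by (simp add: x cmat_cpair linR RR)
 have "cpair (- u) (- v) = - cpair u v" for u v :: "real ^ 'm"
  by (simp add: cpair_def vec_eq_iff complex_eq_iff)
 then show "cmat L *v (cmat R *v x) = - (cmat R *v (cmat L *v x))"
  by (simp add: x cmat_cpair linR linL anti)
qed

lemma rprod_reverse:
 "rprod (cmat L) \<rho>s (cmat R *v x) = (- 1) ^ length \<rho>s *s (cmat R *v rprod (cmat L) (map uminus \<rho>s) x)"
proof (induction \<rho>s)
 case (Cons \<rho> \<rho>s)
 define y where "y = rprod (cmat L) (map uminus \<rho>s) x"
 have "rprod (cmat L) (\<rho> # \<rho>s) (cmat R *v x) =
  (- 1) ^ length \<rho>s *s (cmat L *v (cmat R *v y) - \<rho> *s (cmat R *v y))"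
  by (simp add: Cons.IH y_def matrix_mult_smult vector_ssub_ldistrib vector_smult_assoc mult.commute)
 also have "\<dots> = (- 1) ^ length \<rho>s *s (- (cmat R *v (cmat L *v y - (- \<rho>) *s y)))"
  by (simp add: cmat_R matrix_vector_mult_diff_distrib matrix_vector_right_distrib matrix_mult_smult)
 also have "\<dots> = (- 1) ^ length (\<rho> # \<rho>s) *s (cmat R *v rprod (cmat L) (map uminus (\<rho> # \<rho>s)) x)"
  by (simp add: y_def)
 finally show ?case .
qed simp

text \<open>The reversor exchanges the two spectral halves, so each has at most half of the dimension.\<close>

lemma dim_range_P_unst: "dim (range P_unst) <= CARD('m)"
proof -
 define K where "K = {x. P_unst x = 0}"
 have linP: "linear P_unst" "linear P_stab" using bounded_linear_rprod bounded_linear.linear by blast+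
 have subK: "subspace K" unfolding K_def using linear_subspace_kernel[OF linP(1)] by simp
 define K' where "K' = {y \<in> UNIV. \<forall>x \<in> K. orthogonal x y}"
 have dK: "dim K' + dim K = DIM(complex ^ 'm)"
  unfolding K'_def using dim_subspace_orthogonal_to_vectors[OF subK subspace_UNIV] by simp
 have "range P_unst \<subseteq> P_unst ` K'"
 proof clarify
  fix x
  obtain y z where yz: "y \<in> span K" "!!w. w \<in> span K ==> orthogonal z w" "x = y + z"
   using orthogonal_subspace_decomp_exists by metis
  have "y \<in> K" using yz(1) subK span_eq_iff by blast
  have "z \<in> K'" unfolding K'_def using yz(2) span_base orthogonal_commute by blast
  moreover have "P_unst x = P_unst z"
   using \<open>y \<in> K\<close> by (simp add: yz(3) rprod_add K_def)
  ultimately show "P_unst x \<in> P_unst ` K'" by blast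
 qed
 then have "dim (range P_unst) <= dim (P_unst ` K')" by (rule dim_subset)
 also have "\<dots> <= dim K'" by (rule dim_image_le[OF linP(1)])
 finally have 1: "dim (range P_unst) <= dim K'" .
 have "range P_unst \<subseteq> ((*v) (cmat R)) ` range P_stab"
 proof clarify
  fix x
  have "P_unst x = P_unst (cmat R *v (cmat R *v x))" by (simp add: cmat_R)
  also have "\<dots> = cmat R *v P_stab ((- 1) ^ length unstable_roots *s (cmat R *v x))"
   by (simp add: rprod_reverse rprod_smult matrix_mult_smult)
  finally show "P_unst x \<in> ((*v) (cmat R)) ` range P_stab" by blast
 qed
 then have "dim (range P_unst) <= dim (((*v) (cmat R)) ` range P_stab)" by (rule dim_subset)
 also have "\<dots> <= dim (range P_stab)"
  by (rule dim_image_le[OF bounded_linear.linear[OF bounded_linear_matrix_complex]])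
 also have "\<dots> <= dim K" by (rule dim_subset) (auto simp: K_def P_unst_stab)
 finally have 2: "dim (range P_unst) <= dim K" .
 have "DIM(complex ^ 'm) = 2 * CARD('m)" by simp
 then show ?thesis using 1 2 dK by linarith
qed

lemma constant_coefficient_estimate:
 "EX C>=0. ALL T y g H Y. csol (cmat L) T y g --> (ALL t>=T. norm (g t) <= H) --> (ALL t>=T. norm (y t) <= Y) -->
   (ALL t>=T. norm (y t) <= C * (norm (P_unst (y T)) + H))"
proof -
 obtain C1 where C1: "C1 >= 0" and up: "!!T y g H V Y. csol (cmat L) T y g ==> ALL t>=T. norm (g t) <= H ==>
  ALL t>=T. norm (y t) <= Y ==> ALL t>=T. norm (P_unst (y t)) <= V ==> ALL t>=T. norm (y t) <= C1 * (V + H)"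
  using chain_up[OF unstable_roots, where A = "cmat L"] by (elim exE conjE) (rule that, assumption, blast)
 have neg: "\<forall>\<rho>\<in>set (map uminus unstable_roots). Re \<rho> < 0" using unstable_roots by simp
 obtain C2 where C2: "C2 >= 0" and down: "!!T y g H. csol (cmat L) T y g ==> ALL t>=T. norm (g t) <= H ==>
  ALL t>=T. P_stab (y t) = 0 ==> ALL t>=T. norm (y t) <= C2 * (norm (y T) + H)"
  using chain_down[OF neg, where A = "cmat L"] by (elim exE conjE) (rule that, assumption, blast)
 obtain K where K: "K >= 0" "!!x. norm (P_unst x) <= norm x * K"
  using bounded_linear.nonneg_bounded[OF bounded_linear_rprod] by blast
 define C where "C = C1 * (C2 * (1 + K) + 1)"
 have C: "C >= 0" using C1 C2 K by (simp add: C_def)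
 have "norm (y t) <= C * (norm (P_unst (y T)) + H)"
  if y: "csol (cmat L) T y g" and g: "ALL t>=T. norm (g t) <= H" and Y: "ALL t>=T. norm (y t) <= Y" and t: "t >= T"
  for T y g H Y t
 proof -
  have H: "H >= 0" using g norm_ge_zero order_trans by blast
  have gK: "ALL t>=T. norm (P_unst (g t)) <= H * K"
   using g K by (meson mult_right_mono order_trans)
  have "ALL t>=T. norm (P_unst (y t)) <= C2 * (norm (P_unst (y T)) + H * K)"
   by (rule down[OF csol_rprod[OF y] gK]) (simp add: P_stab_unst)
  from up[OF y g Y this] t
  have "norm (y t) <= C1 * (C2 * (norm (P_unst (y T)) + H * K) + H)" by blast
  also have "\<dots> <= C1 * ((C2 * (1 + K) + 1) * (norm (P_unst (y T)) + H))"
  proof (rule mult_left_mono[OF _ C1])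
   have "0 <= C2 * K * norm (P_unst (y T))" "0 <= C2 * H" "0 <= norm (P_unst (y T))" using C2 K H by auto
   then show "C2 * (norm (P_unst (y T)) + H * K) + H <= (C2 * (1 + K) + 1) * (norm (P_unst (y T)) + H)"
    by (simp add: algebra_simps)
  qed
  finally show ?thesis by (simp add: C_def mult_ac)
 qed
 then show ?thesis using C by blast
qed

end

text \<open>Systems \<open>y' = A(t) y + g\<close> on \<open>[0,\<infinity>)\<close> whose coefficient tends to a hyperbolic reversible matrix.\<close>

definition hsol :: "(real => 'a::real_normed_vector => 'a) => (real => 'a) => (real => 'a) => bool" where
 "hsol A y g \<longleftrightarrow> (ALL t>=0. (y has_vector_derivative A t (y t) + g t) (at t within {0..}))"

locale asymptotically_hyperbolic = hyperbolic_reversible L R n \<Lambda>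
 for L R :: "real ^ 'm => real ^ 'm" and n \<Lambda> +
 fixes A :: "real => real ^ 'm => real ^ 'm"
 assumes linA: "!!t. linear (A t)"
  and A_limit: "!!e. e > 0 ==> EX T>=0. ALL t>=T. ALL x. norm (A t x - L x) <= e * norm x"
begin

lemma csol_of_hsol:
 assumes "hsol A y g" "hsol A z h" "T >= 0"
 shows "csol (cmat L) T (%t. cpair (y t) (z t))
  (%t. cpair (A t (y t) - L (y t) + g t) (A t (z t) - L (z t) + h t))"
 unfolding csol_def
proof (intro allI impI)
 fix t assume t: "t >= T"
 have "(y has_vector_derivative A t (y t) + g t) (at t within {T..})"
  by (rule has_vector_derivative_within_subset[of _ _ _ "{0..}"]) (use assms t in \<open>auto simp: hsol_def\<close>)
 moreover have "(z has_vector_derivative A t (z t) + h t) (at t within {T..})"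
  by (rule has_vector_derivative_within_subset[of _ _ _ "{0..}"]) (use assms t in \<open>auto simp: hsol_def\<close>)
 ultimately show "((%t. cpair (y t) (z t)) has_vector_derivative cmat L *v cpair (y t) (z t) +
   cpair (A t (y t) - L (y t) + g t) (A t (z t) - L (z t) + h t)) (at t within {T..})"
  using has_vector_derivative_cpair by (fastforce simp: cmat_cpair linL cpair_add)
qed

lemma halfline_estimate:
 "EX C>=0. EX T>=0. ALL y z g H Y. hsol A y g --> hsol A z (%_. 0) --> (ALL t>=0. norm (g t) <= H) -->
   (ALL t>=0. norm (cpair (y t) (z t)) <= Y) -->
   (ALL t>=T. norm (cpair (y t) (z t)) <= C * (norm (P_unst (cpair (y T) (z T))) + H))"
proof -
 obtain C where C: "C >= 0" and est: "!!T y g H Y. csol (cmat L) T y g ==> ALL t>=T. norm (g t) <= H ==>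
  ALL t>=T. norm (y t) <= Y ==> ALL t>=T. norm (y t) <= C * (norm (P_unst (y T)) + H)"
  using constant_coefficient_estimate by (elim exE conjE) (rule that, assumption, blast)
 define e where "e = 1 / (4 * (C + 1))"
 have e: "e > 0" using C by (simp add: e_def)
 obtain T where T: "T >= 0" "!!t x. t >= T ==> norm (A t x - L x) <= e * norm x"
  using A_limit[OF e] by blast
 have "norm (cpair (y t) (z t)) <= 2 * C * (norm (P_unst (cpair (y T) (z T))) + H)"
  if y: "hsol A y g" and z: "hsol A z (%_. 0)" and g: "ALL t>=0. norm (g t) <= H"
   and Y: "ALL t>=0. norm (cpair (y t) (z t)) <= Y" and t: "t >= T" for y z g H Y t
 proof -
  have "norm (cpair (y t) (z t)) <= 2 * (C * (norm (P_unst (cpair (y T) (z T))) + H))"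
  proof (rule sup_bootstrap[where y = "%t. cpair (y t) (z t)" and Y = Y and T = T])
   show "norm (cpair (y t) (z t)) <= Y" if "t >= T" for t using Y that T by auto
   fix Y' t assume Y': "!!t. T <= t ==> norm (cpair (y t) (z t)) <= Y'" and t: "T <= t"
   have "norm (cpair (A t (y t) - L (y t) + g t) (A t (z t) - L (z t) + 0)) <= H + 2 * e * Y'" if t: "t >= T" for t
   proof -
    have "norm (cpair (A t (y t) - L (y t) + g t) (A t (z t) - L (z t) + 0)) <=
     norm (A t (y t) - L (y t) + g t) + norm (A t (z t) - L (z t) + 0)" by (rule norm_cpair_le)
    also have "\<dots> <= (e * norm (y t) + H) + e * norm (z t)"
    proof (rule add_mono)
     show "norm (A t (y t) - L (y t) + g t) <= e * norm (y t) + H"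
      using T t g by (intro order_trans[OF norm_triangle_ineq] add_mono) auto
    qed (use T t in auto)
    also have "\<dots> <= (e * Y' + H) + e * Y'"
     using Y'[OF t] norm_cpair_ge1[of "y t" "z t"] norm_cpair_ge2[of "z t" "y t"] e
     by (intro add_mono mult_left_mono) auto
    finally show ?thesis by (simp add: algebra_simps)
   qed
   then have "norm (cpair (y t) (z t)) <= C * (norm (P_unst (cpair (y T) (z T))) + (H + 2 * e * Y'))"
    using est[OF csol_of_hsol[OF y z T(1)], of "H + 2 * e * Y'" Y'] Y' t by blast
   also have "\<dots> = C * (norm (P_unst (cpair (y T) (z T))) + H) + (2 * C * e) * Y'"
    by (simp add: algebra_simps)
   also have "\<dots> <= C * (norm (P_unst (cpair (y T) (z T))) + H) + (1 / 2) * Y'"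
   proof -
    have "Y' >= 0" using Y'[of T] norm_ge_zero order_trans by blast
    moreover have "2 * C * e <= 1 / 2" using C by (simp add: e_def field_simps)
    ultimately show ?thesis by (intro add_left_mono mult_right_mono)
   qed
   finally show "norm (cpair (y t) (z t)) <= C * (norm (P_unst (cpair (y T) (z T))) + H) + Y' / 2" by simp
  qed (rule t)
  then show ?thesis by simp
 qed
 then show ?thesis using C T(1) by (intro exI[of _ "2 * C"] conjI exI[of _ T]) auto
qed

lemma hsol_zero: "hsol A (%_. 0) (%_. 0)"
 using linear_0[OF linA] by (simp add: hsol_def)

lemma hsol_lincomb:
 assumes "hsol A y g" "hsol A z h"
 shows "hsol A (%t. a *\<^sub>R y t + b *\<^sub>R z t) (%t. a *\<^sub>R g t + b *\<^sub>R h t)"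
 unfolding hsol_def
proof (intro allI impI)
 fix t :: real assume "t >= 0"
 then have "((%t. a *\<^sub>R y t + b *\<^sub>R z t) has_vector_derivative
   a *\<^sub>R (A t (y t) + g t) + b *\<^sub>R (A t (z t) + h t)) (at t within {0..})"
  using assms unfolding hsol_def
  by (intro has_vector_derivative_add bounded_linear.has_vector_derivative[OF bounded_linear_scaleR_right]) auto
 then show "((%t. a *\<^sub>R y t + b *\<^sub>R z t) has_vector_derivative
   A t (a *\<^sub>R y t + b *\<^sub>R z t) + (a *\<^sub>R g t + b *\<^sub>R h t)) (at t within {0..})"
  by (rule has_vector_derivative_eq_rhs)
   (simp add: linear_add[OF linA] linear_cmul[OF linA] scaleR_add_right)
qed

lemma bounded_solution_estimate:
 "EX C>=0. EX T>=0. ALL y g H. hsol A y g --> (ALL t>=0. norm (g t) <= H) --> bounded (y ` {0..}) -->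
   (ALL t>=T. norm (y t) <= C * (norm (y T) + H))"
proof -
 obtain C T where C: "C >= 0" "T >= 0" and est0: "ALL y z g H Y. hsol A y g --> hsol A z (%_. 0) --> (ALL t>=0. norm (g t) <= H) -->
   (ALL t>=0. norm (cpair (y t) (z t)) <= Y) -->
   (ALL t>=T. norm (cpair (y t) (z t)) <= C * (norm (P_unst (cpair (y T) (z T))) + H))"
  using halfline_estimate by (elim exE conjE) (rule that, assumption, assumption, assumption)
 note est = est0[THEN spec, THEN spec, THEN spec, THEN spec, THEN spec, THEN mp, THEN mp, THEN mp, THEN mp]
 obtain K where K: "K >= 0" "!!x. norm (P_unst x) <= norm x * K"
  using bounded_linear.nonneg_bounded[OF bounded_linear_rprod] by blast
 have "norm (y t) <= C * (K + 1) * (norm (y T) + H)"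
  if y: "hsol A y g" and g: "ALL t>=0. norm (g t) <= H" and Y: "bounded (y ` {0..})" and t: "t >= T" for y g H t
 proof -
  have H: "H >= 0" using g norm_ge_zero order_trans by blast
  obtain Y where "ALL t>=0. norm (y t) <= Y" using Y unfolding bounded_iff by auto
  then have "norm (y t) <= C * (norm (P_unst (cpair (y T) 0)) + H)"
   using est[OF y hsol_zero g, of Y] t by (simp add: norm_cpair_0)
  also have "\<dots> <= C * (norm (y T) * K + H)"
   using K(2)[of "cpair (y T) 0"] C by (intro mult_left_mono add_right_mono) (auto simp: norm_cpair_0)
  also have "\<dots> <= C * ((K + 1) * (norm (y T) + H))"
   using C K H by (intro mult_left_mono) (auto simp: algebra_simps)
  finally show ?thesis by (simp add: mult_ac)
 qed
 then show ?thesis using C K by (intro exI[of _ "C * (K + 1)"] conjI exI[of _ T]) auto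
qed

text \<open>A bounded homogeneous solution is determined by the stable part of its value at \<open>T\<close>,
 and the stable part has at most half of the dimension by the reversor.\<close>

lemma bounded_solution_space_dim:
 "EX T>=0. subspace {y T |y. hsol A y (%_. 0) & bounded (y ` {0..})} &
   2 * dim {y T |y. hsol A y (%_. 0) & bounded (y ` {0..})} <= CARD('m)"
proof -
 obtain C T where C: "C >= 0" "T >= 0" and est0: "ALL y z g H Y. hsol A y g --> hsol A z (%_. 0) --> (ALL t>=0. norm (g t) <= H) -->
   (ALL t>=0. norm (cpair (y t) (z t)) <= Y) -->
   (ALL t>=T. norm (cpair (y t) (z t)) <= C * (norm (P_unst (cpair (y T) (z T))) + H))"
  using halfline_estimate by (elim exE conjE) (rule that, assumption, assumption, assumption)
 note est = est0[THEN spec, THEN spec, THEN spec, THEN spec, THEN spec, THEN mp, THEN mp, THEN mp, THEN mp]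
 define W where "W = {y T |y. hsol A y (%_. 0) & bounded (y ` {0..})}"
 have bl: "EX y. a *\<^sub>R y1 T + b *\<^sub>R y2 T = y T & hsol A y (%_. 0) & bounded (y ` {0..})"
  if "hsol A y1 (%_. 0)" "bounded (y1 ` {0..})" "hsol A y2 (%_. 0)" "bounded (y2 ` {0..})" for a b y1 y2
 proof -
  have "bounded ((%t. a *\<^sub>R y1 t + b *\<^sub>R y2 t) ` {0..})"
   using that by (intro bounded_plus_comp bounded_scaleR_comp)
  then show ?thesis
   using hsol_lincomb[OF that(1,3), of a b]
   by (intro exI[of _ "%t. a *\<^sub>R y1 t + b *\<^sub>R y2 t"]) simp
 qed
 have sub: "subspace W"
  unfolding subspace_def
 proof (intro conjI ballI allI)
  show "0 \<in> W" unfolding W_def using hsol_zero by (auto intro!: exI[of _ "%_. 0"] simp: image_constant_conv)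
  show "x + y \<in> W" if "x \<in> W" "y \<in> W" for x y
   using that bl[of _ _ 1 1] unfolding W_def by fastforce
  show "c *\<^sub>R x \<in> W" if "x \<in> W" for c x
   using that bl[of _ _ c 0] unfolding W_def by fastforce
 qed
 have "2 * dim W <= CARD('m)"
 proof (rule ccontr)
  assume *: "\<not> 2 * dim W <= CARD('m)"
  define \<Theta> where "\<Theta> = (%x. P_unst (cpair (fst x) (snd x)))"
  have lin\<Theta>: "linear \<Theta>" unfolding \<Theta>_def
   using bounded_linear_compose[OF bounded_linear_rprod bounded_linear_cpair] bounded_linear.linear by blast
  have "dim (W \<times> W) = 2 * dim W" using dim_Times[OF sub sub] by simp
  moreover have "dim (\<Theta> ` (W \<times> W)) <= CARD('m)"
   using dim_range_P_unst by (rule order_trans[OF dim_subset, rotated]) (auto simp: \<Theta>_def)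
  ultimately have "dim (\<Theta> ` (W \<times> W)) ~= dim (W \<times> W)" using * by linarith
  then have "\<not> inj_on \<Theta> (span (W \<times> W))" using dim_image_eq[OF lin\<Theta>] by blast
  moreover have "span (W \<times> W) = W \<times> W" using subspace_Times[OF sub sub] by (simp add: span_eq_iff)
  ultimately obtain x where x: "x \<in> W \<times> W" "x ~= 0" "\<Theta> x = 0"
   using linear_injective_on_subspace_0[OF lin\<Theta> subspace_Times[OF sub sub]] by auto
  then obtain y z where y: "hsol A y (%_. 0)" "bounded (y ` {0..})" and z: "hsol A z (%_. 0)" "bounded (z ` {0..})"
   and xyz: "x = (y T, z T)" unfolding W_def by auto
  obtain Y where Y: "ALL t>=0. norm (y t) <= Y" using y(2) unfolding bounded_iff by auto
  obtain Y2 where Y2: "ALL t>=0. norm (z t) <= Y2" using z(2) unfolding bounded_iff by auto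
  have "ALL t>=0. norm (cpair (y t) (z t)) <= Y + Y2"
   using Y Y2 norm_cpair_le order_trans by (meson add_mono)
  from est[OF y(1) z(1) _ this, of 0] have "norm (cpair (y T) (z T)) <= C * (norm (P_unst (cpair (y T) (z T))) + 0)"
   by simp
  then have "norm (cpair (y T) (z T)) <= 0" using x(3) by (simp add: \<Theta>_def xyz)
  then have "norm (y T) <= 0" "norm (z T) <= 0"
   using norm_cpair_ge1[of "y T" "z T"] norm_cpair_ge2[of "z T" "y T"] by linarith+
  then show False using x(2) xyz by (simp add: zero_prod_def)
 qed
 then show ?thesis using sub C(2) unfolding W_def by blast
qed

text \<open>Once the inhomogeneity is small, the estimate on \<open>[T, \<infinity>)\<close> bounds the upper
 limit of \<open>|y|\<close> by an arbitrarily small multiple of the size of \<open>y\<close>.\<close>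

lemma bounded_solution_decay:
 assumes y: "hsol A y g" and g: "(g \<longlongrightarrow> 0) at_top" and b: "bounded (y ` {0..})"
 shows "(y \<longlongrightarrow> 0) at_top"
proof -
 obtain Y where Y: "!!t. t >= 0 ==> norm (y t) <= Y" using b unfolding bounded_iff by auto
 have Y0: "Y >= 0" using Y[of 0] norm_ge_zero order_trans by blast
 define h where "h t = cpair (A t (y t) - L (y t) + g t) (A t 0 - L 0 + 0)" for t
 have h: "(h \<longlongrightarrow> 0) at_top"
 proof (rule tendstoI)
  fix e :: real assume e: "e > 0"
  define d where "d = e / (2 * (Y + 1))"
  have d: "d > 0" using e Y0 by (simp add: d_def)
  obtain T where T: "T >= 0" "!!t x. t >= T ==> norm (A t x - L x) <= d * norm x" using A_limit[OF d] by blast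
  have "\<forall>\<^sub>F t in at_top. norm (g t) < e / 2" using tendstoD[OF g, of "e / 2"] e by simp
  then show "\<forall>\<^sub>F t in at_top. dist (h t) 0 < e"
   using eventually_ge_at_top[of T]
  proof eventually_elim
   case (elim t)
   have "norm (h t) = norm (A t (y t) - L (y t) + g t)"
    by (simp add: h_def linear_0[OF linA] linear_0[OF linL] norm_cpair_0)
   also have "\<dots> <= d * norm (y t) + norm (g t)"
    using T elim by (intro order_trans[OF norm_triangle_ineq] add_right_mono) auto
   also have "\<dots> <= d * (Y + 1) + norm (g t)"
    using Y[of t] elim T d by (intro add_right_mono mult_left_mono) auto
   also have "d * (Y + 1) = e / 2" using Y0 by (simp add: d_def field_simps)
   also have "e / 2 + norm (g t) < e" using elim by simp
   finally show ?case by simp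
  qed
 qed
 have "((%t. cpair (y t) 0) \<longlongrightarrow> 0) at_top"
 proof (rule chain_decay[where A = "cmat L" and T = 0 and \<rho>s = "unstable_roots @ map uminus unstable_roots" and Y = Y])
  show "csol (cmat L) 0 (%t. cpair (y t) 0) h"
   using csol_of_hsol[OF y hsol_zero, of 0] by (simp add: h_def[abs_def])
  show "\<forall>\<rho>\<in>set (unstable_roots @ map uminus unstable_roots). Re \<rho> ~= 0"
   using unstable_roots by auto
 qed (use h Y in \<open>auto simp: norm_cpair_0 rprod_append P_unst_stab\<close>)
 then have "((%t. norm (cpair (y t) 0)) \<longlongrightarrow> 0) at_top" by (rule tendsto_norm_zero)
 then show ?thesis by (simp add: norm_cpair_0 tendsto_norm_zero_iff)
qed

end

section \<open>The variational equation on the half-line\<close>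

lemma has_vector_derivative_at_halfline:
 assumes "(y has_vector_derivative y') (at t within {0..})" "t > 0"
 shows "(y has_vector_derivative y') (at (t::real))"
proof -
 have eq: "at t within {0..} = at t"
  by (rule at_within_interior) (use assms(2) in \<open>simp add: interior_real_atLeast\<close>)
 show ?thesis using assms(1) unfolding eq .
qed

lemma hsol_continuous: "hsol A y g ==> continuous_on {0..} y"
 unfolding hsol_def continuous_on_eq_continuous_within
 using has_vector_derivative_continuous by fastforce

text \<open>The weighted energy \<open>exp (- (2 M + 1) s) (|y|\<^sup>2 + H\<^sup>2)\<close> decreases along solutions, because
 \<open>2 |y| H <= |y|\<^sup>2 + H\<^sup>2\<close>.\<close>

lemma hsol_growth:
 fixes A :: "real => 'a::euclidean_space => 'a"
 assumes y: "hsol A y g" and t: "t >= 0" and M: "M >= 0" "!!s x. s \<in> {0..t} ==> norm (A s x) <= M * norm x"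
  and g: "!!s. s \<in> {0..t} ==> norm (g s) <= H"
 shows "norm (y t) <= exp ((2 * M + 1) * t) * (norm (y 0) + H)"
proof -
 define c where "c = 2 * M + 1"
 define E where "E s = exp (- c * s) * (y s \<bullet> y s + H\<^sup>2)" for s
 have H: "H >= 0" by (rule order_trans[OF norm_ge_zero g[of 0]]) (use t in simp)
 have "E t <= E 0"
 proof (rule DERIV_nonpos_imp_decreasing_open[OF t])
  fix s assume s: "0 < s" "s < t"
  let ?d = "A s (y s) + g s"
  have "(y has_vector_derivative ?d) (at s)"
   using y s by (intro has_vector_derivative_at_halfline) (auto simp: hsol_def)
  then have "((%s. y s \<bullet> y s) has_vector_derivative y s \<bullet> ?d + ?d \<bullet> y s) (at s)"
   by (intro bounded_bilinear.has_vector_derivative[OF bounded_bilinear_inner])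
  then have "((%s. y s \<bullet> y s) has_real_derivative 2 * (y s \<bullet> ?d)) (at s)"
   by (simp add: has_real_derivative_iff_has_vector_derivative inner_commute)
  then have "(E has_real_derivative (exp (- c * s) * (2 * (y s \<bullet> ?d)) +
    exp (- c * s) * (- c) * (y s \<bullet> y s + H\<^sup>2))) (at s)"
   unfolding E_def by (auto intro!: derivative_eq_intros)
  moreover have "exp (- c * s) * (2 * (y s \<bullet> ?d)) + exp (- c * s) * (- c) * (y s \<bullet> y s + H\<^sup>2) <= 0"
  proof -
   have "norm ?d <= M * norm (y s) + H"
    using norm_triangle_ineq[of "A s (y s)" "g s"] M(2)[of s "y s"] g[of s] s by simp
   then have "y s \<bullet> ?d <= norm (y s) * (M * norm (y s) + H)"
    by (intro order_trans[OF norm_cauchy_schwarz] mult_left_mono) auto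
   moreover have "0 <= (norm (y s) - H)\<^sup>2 + 2 * M * H\<^sup>2" using M(1) by simp
   ultimately have "2 * (y s \<bullet> ?d) - c * ((norm (y s))\<^sup>2 + H\<^sup>2) <= 0"
    by (simp add: c_def power2_eq_square algebra_simps)
   then have "exp (- c * s) * (2 * (y s \<bullet> ?d) - c * ((norm (y s))\<^sup>2 + H\<^sup>2)) <= 0"
    by (intro mult_nonneg_nonpos) auto
   then show ?thesis by (simp add: power2_norm_eq_inner algebra_simps)
  qed
  ultimately show "EX e. (E has_real_derivative e) (at s) & e <= 0" by blast
 next
  have "continuous_on {0..t} y" using hsol_continuous[OF y] continuous_on_subset by fastforce
  then show "continuous_on {0..t} E" unfolding E_def by (intro continuous_intros)
 qed
 then have "exp (c * t) * (exp (- c * t) * ((norm (y t))\<^sup>2 + H\<^sup>2)) <= exp (c * t) * ((norm (y 0))\<^sup>2 + H\<^sup>2)"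
  by (intro mult_left_mono) (simp_all add: E_def power2_norm_eq_inner)
 then have "(norm (y t))\<^sup>2 + H\<^sup>2 <= exp (c * t) * ((norm (y 0))\<^sup>2 + H\<^sup>2)"
  by (simp add: mult.assoc[symmetric] mult_exp_exp)
 also have "\<dots> <= exp (c * t) * (norm (y 0) + H)\<^sup>2"
  using H by (intro mult_left_mono) (auto simp: power2_sum)
 also have "\<dots> <= (exp (c * t))\<^sup>2 * (norm (y 0) + H)\<^sup>2"
 proof (rule mult_right_mono)
  have "1 <= exp (c * t)" using M(1) t by (simp add: c_def)
  then show "exp (c * t) <= (exp (c * t))\<^sup>2" using mult_left_mono[of 1 "exp (c * t)" "exp (c * t)"] by (simp add: power2_eq_square)
 qed simp
 finally have "(norm (y t))\<^sup>2 <= (exp (c * t) * (norm (y 0) + H))\<^sup>2"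
  using zero_le_power2[of H] unfolding power_mult_distrib by linarith
 then show ?thesis unfolding c_def by (rule power2_le_imp_le) (use H in auto)
qed

lemma hsol_unique_zero:
 fixes A :: "real => 'a::euclidean_space => 'a"
 assumes y: "hsol A y (%_. 0)" and y0: "y 0 = 0"
  and bnd: "!!\<tau>. EX M. \<forall>t\<in>{0..\<tau>}. ALL x. norm (A t x) <= M * norm x"
  and t: "t >= 0"
 shows "y t = 0"
proof -
 obtain M where M: "!!s x. s \<in> {0..t} ==> norm (A s x) <= M * norm x" using bnd[of t] by blast
 have "norm (A s x) <= max M 0 * norm x" if "s \<in> {0..t}" for s x
  using M[OF that, of x] mult_right_mono[of M "max M 0" "norm x"] by simp
 then show ?thesis using hsol_growth[OF y t, of "max M 0" 0] y0 by simp
qed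

locale homoclinic_VE = asymptotically_hyperbolic L R n \<Lambda> A
 for L R :: "real ^ 'm => real ^ 'm" and n \<Lambda> A +
 fixes ip :: "real ^ 'm => real ^ 'm => real" and \<phi> \<psi> :: "nat => real => real ^ 'm"
 assumes n2: "n >= 2" and card_m: "CARD('m) = 2 * n"
  and A_bound: "!!\<tau>. EX M. \<forall>t\<in>{0..\<tau>}. ALL x. norm (A t x) <= M * norm x"
  and ip: "Defs.scalar_product ip"
  and phi_sol: "!!j. j \<in> {1..2 * n} ==> hsol A (\<phi> j) (%_. 0)"
  and dual: "!!j k t. j \<in> {1..2 * n} ==> k \<in> {1..2 * n} ==> ip (\<psi> j t) (\<phi> k t) = (if j = k then 1 else 0)"
  and phi_stable: "!!j. j \<in> {1..n} ==> bounded (\<phi> j ` {0..})"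
  and phi2_R: "R (\<phi> 2 0) = \<phi> 2 0"
begin

lemma bl_ip: "bilinear ip" and ip_sym: "ip x y = ip y x" and ip_pos: "x ~= 0 ==> ip x x > 0"
 using ip by (auto simp: scalar_product_def)

lemma ip_add: "ip x (y + z) = ip x y + ip x z" and ip_add_left: "ip (y + z) x = ip y x + ip z x"
 and ip_scale: "ip x (c *\<^sub>R y) = c * ip x y" and ip_scale_left: "ip (c *\<^sub>R y) x = c * ip y x"
 and ip_diff: "ip x (y - z) = ip x y - ip x z" and ip_diff_left: "ip (y - z) x = ip y x - ip z x"
 and ip_0: "ip x 0 = 0" and ip_0_left: "ip 0 x = 0"
 and ip_minus: "ip x (- y) = - ip x y" and ip_minus_left: "ip (- y) x = - ip y x"
 using bilinear_radd[OF bl_ip] bilinear_ladd[OF bl_ip] bilinear_rmul[OF bl_ip] bilinear_lmul[OF bl_ip]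
  bilinear_rsub[OF bl_ip] bilinear_lsub[OF bl_ip] bilinear_rzero[OF bl_ip] bilinear_lzero[OF bl_ip]
  bilinear_rneg[OF bl_ip] bilinear_lneg[OF bl_ip] by auto

lemma ip_sum: "ip x (\<Sum>i\<in>I. f i) = (\<Sum>i\<in>I. ip x (f i))"
 by (induction I rule: infinite_finite_induct) (simp_all add: ip_add ip_0)

lemma ip_linear: "linear (ip x)"
 by (intro linearI) (simp_all add: ip_add ip_scale)

lemma ip_bounded_linear: "bounded_linear (ip x)"
 using ip_linear by (simp add: linear_conv_bounded_linear)

lemma phi_continuous: "j \<in> {1..2 * n} ==> continuous_on {0..} (\<phi> j)"
 using phi_sol hsol_continuous by blast

text \<open>The matrix with columns \<open>\<phi>\<^sub>1(t), \<dots>, \<phi>\<^sub>2\<^sub>n(t)\<close>; its inverse gives the coordinates \<open>\<langle>\<psi>\<^sub>j(t), \<cdot>\<rangle>\<close>.\<close>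

definition idx :: "'m => nat" where "idx = (SOME h. bij_betw h UNIV {1..2 * n})"

lemma idx: "bij_betw idx UNIV {1..2 * n}"
proof -
 have "card (UNIV :: 'm set) = card {1..2 * n}" using card_m by simp
 then have "EX h. bij_betw h (UNIV :: 'm set) {1..2 * n}"
  by (intro finite_same_card_bij) auto
 then show ?thesis unfolding idx_def by (rule someI_ex)
qed

lemma idx_mem: "idx k \<in> {1..2 * n}" using idx by (auto simp: bij_betw_def)

lemma idx_eq: "idx k = idx l \<longleftrightarrow> k = l" using idx by (auto simp: bij_betw_def inj_on_def)

lemma sum_idx: "(\<Sum>k\<in>UNIV. f (idx k)) = (\<Sum>j\<in>{1..2 * n}. f j)"
 using idx by (rule sum.reindex_bij_betw)

definition fundmat :: "real => real ^ 'm ^ 'm" where "fundmat t = (\<chi> i k. \<phi> (idx k) t $ i)"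

lemma fundmat_mult: "fundmat t *v c = (\<Sum>k\<in>UNIV. c $ k *\<^sub>R \<phi> (idx k) t)"
 by (simp add: vec_eq_iff fundmat_def matrix_vector_mult_def mult.commute)

lemma coord_fundmat: "ip (\<psi> (idx l) t) (fundmat t *v c) = c $ l"
proof -
 have "ip (\<psi> (idx l) t) (fundmat t *v c) = (\<Sum>k\<in>UNIV. c $ k * (if l = k then 1 else 0))"
  unfolding fundmat_mult ip_sum ip_scale by (intro sum.cong refl) (simp add: dual[OF idx_mem idx_mem] idx_eq)
 then show ?thesis by (simp add: if_distrib cong: if_cong)
qed

lemma fundmat_invertible: "invertible (fundmat t)"
proof -
 have "c = 0" if "fundmat t *v c = 0" for c
  using coord_fundmat[of _ t c] that by (simp add: ip_0 vec_eq_iff)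
 then have "EX B. B ** fundmat t = mat 1" by (auto simp: matrix_left_invertible_ker)
 then show ?thesis using matrix_left_right_inverse by (auto simp: invertible_def)
qed

lemma surj_fundmat: "surj ((*v) (fundmat t))"
proof -
 obtain B where "fundmat t ** B = mat 1" using fundmat_invertible unfolding invertible_def by blast
 then show ?thesis unfolding matrix_right_invertible_surjective[symmetric] by blast
qed

lemma representation: "x = (\<Sum>j\<in>{1..2 * n}. ip (\<psi> j t) x *\<^sub>R \<phi> j t)"
proof -
 obtain c where c: "x = fundmat t *v c" using surj_fundmat by (metis surjD)
 have "x = (\<Sum>k\<in>UNIV. ip (\<psi> (idx k) t) x *\<^sub>R \<phi> (idx k) t)"
  unfolding c coord_fundmat by (rule fundmat_mult)
 then show ?thesis using sum_idx[of "%j. ip (\<psi> j t) x *\<^sub>R \<phi> j t"] by simp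
qed

text \<open>The curves \<open>\<psi>\<^sub>j\<close> are only given by duality; Cramer's rule expresses their
 pairing with \<open>g\<close> through the continuous curves \<open>\<phi>\<^sub>k\<close>.\<close>

lemma coordinate_continuous:
 assumes j: "j \<in> {1..2 * n}" and g: "continuous_on {0..} g"
 shows "continuous_on {0..} (%t. ip (\<psi> j t) (g t))"
proof -
 obtain l where l: "j = idx l" using idx j unfolding bij_betw_def by (metis imageE)
 define D where "D t = (\<chi> i k. if k = l then g t $ i else fundmat t $ i $ k)" for t
 have det0: "det (fundmat t) ~= 0" for t using fundmat_invertible invertible_det_nz by blast
 have eq: "ip (\<psi> j t) (g t) = det (D t) / det (fundmat t)" for t
 proof -
  obtain c where c: "fundmat t *v c = g t" using surj_fundmat by (metis surjD)
  then have "c = (\<chi> k. det (\<chi> i j. if j = k then g t $ i else fundmat t $ i $ j) / det (fundmat t))"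
   using cramer[OF det0] by blast
  then have "c $ l = det (D t) / det (fundmat t)" by (simp add: D_def)
  then show ?thesis using coord_fundmat[of l t c] by (simp add: c l)
 qed
 have cf: "continuous_on {0..} (%t. fundmat t $ i $ k)" for i k
  unfolding fundmat_def using phi_continuous[OF idx_mem] by (simp add: continuous_on_component)
 have cD: "continuous_on {0..} (%t. D t $ i $ k)" for i k
  using cf g by (cases "k = l") (simp_all add: D_def continuous_on_component)
 show ?thesis
  unfolding eq det_def using det0[unfolded det_def]
  by (intro continuous_on_divide continuous_on_sum continuous_on_mult continuous_on_const continuous_on_prod cf cD) auto
qed

lemma integral_has_derivative_halfline:
 fixes h :: "real => real"
 assumes h: "continuous_on {0..} h" and t: "t >= 0"
 shows "((%t. integral {0..t} h) has_vector_derivative h t) (at t within {0..})"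
proof -
 have "continuous_on {0..t + 1} h" using h continuous_on_subset by fastforce
 then have "((%t. integral {0..t} h) has_vector_derivative h t) (at t within {0..t + 1})"
  by (rule integral_has_vector_derivative) (use t in auto)
 moreover have "at t within {0..t + 1} = at t within {0..}"
  by (rule at_within_nhd[where S = "{..<t + 1}"]) (use t in auto)
 ultimately show ?thesis by (simp only:)
qed

definition voc :: "(nat => real) => (real => real ^ 'm) => real => real ^ 'm" where
 "voc c g t = (\<Sum>j\<in>{1..2 * n}. (c j + integral {0..t} (%s. ip (\<psi> j s) (g s))) *\<^sub>R \<phi> j t)"

lemma hsol_voc:
 assumes g: "continuous_on {0..} g"
 shows "hsol A (voc c g) g"
 unfolding hsol_def
proof (intro allI impI)
 fix t :: real assume t: "t >= 0"
 have "((%t. (c j + integral {0..t} (%s. ip (\<psi> j s) (g s))) *\<^sub>R \<phi> j t) has_vector_derivative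
   (c j + integral {0..t} (%s. ip (\<psi> j s) (g s))) *\<^sub>R A t (\<phi> j t) + (0 + ip (\<psi> j t) (g t)) *\<^sub>R \<phi> j t) (at t within {0..})"
  if j: "j \<in> {1..2 * n}" for j
 proof (rule bounded_bilinear.has_vector_derivative[OF bounded_bilinear_scaleR])
  show "((%t. c j + integral {0..t} (%s. ip (\<psi> j s) (g s))) has_vector_derivative 0 + ip (\<psi> j t) (g t)) (at t within {0..})"
   by (intro has_vector_derivative_add has_vector_derivative_const
     integral_has_derivative_halfline coordinate_continuous j g t)
  show "(\<phi> j has_vector_derivative A t (\<phi> j t)) (at t within {0..})"
   using phi_sol[OF j] t by (simp add: hsol_def)
 qed
 then have "(voc c g has_vector_derivative (\<Sum>j\<in>{1..2 * n}.
   (c j + integral {0..t} (%s. ip (\<psi> j s) (g s))) *\<^sub>R A t (\<phi> j t) + (0 + ip (\<psi> j t) (g t)) *\<^sub>R \<phi> j t)) (at t within {0..})"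
  unfolding voc_def[abs_def] by (rule has_vector_derivative_sum)
 moreover have "(\<Sum>j\<in>{1..2 * n}.
   (c j + integral {0..t} (%s. ip (\<psi> j s) (g s))) *\<^sub>R A t (\<phi> j t) + (0 + ip (\<psi> j t) (g t)) *\<^sub>R \<phi> j t) = A t (voc c g t) + g t"
  unfolding voc_def sum.distrib using representation[of "g t" t, symmetric]
  by (simp add: linear_sum[OF linA] linear_cmul[OF linA])
 ultimately show "(voc c g has_vector_derivative A t (voc c g t) + g t) (at t within {0..})" by simp
qed

lemma voc_0: "voc c g 0 = (\<Sum>j\<in>{1..2 * n}. c j *\<^sub>R \<phi> j 0)"
 by (simp add: voc_def)

lemma coord_sum:
 assumes "j \<in> {1..2 * n}"
 shows "ip (\<psi> j t) (\<Sum>k\<in>{1..2 * n}. c k *\<^sub>R \<phi> k t) = c j"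
proof -
 have "ip (\<psi> j t) (\<Sum>k\<in>{1..2 * n}. c k *\<^sub>R \<phi> k t) = (\<Sum>k\<in>{1..2 * n}. if k = j then c k else 0)"
  unfolding ip_sum ip_scale using assms by (intro sum.cong refl) (simp add: dual)
 then show ?thesis using assms by simp
qed

lemma hsol_diff:
 assumes "hsol A y g" "hsol A z h" shows "hsol A (%t. y t - z t) (%t. g t - h t)"
 using hsol_lincomb[OF assms, of 1 "-1"] by simp

lemma hsol_eq_voc:
 assumes y: "hsol A y g" and g: "continuous_on {0..} g" and t: "t >= 0"
 shows "y t = voc (%j. ip (\<psi> j 0) (y 0)) g t"
proof -
 have "hsol A (%t. y t - voc (%j. ip (\<psi> j 0) (y 0)) g t) (%t. 0)"
  using hsol_diff[OF y hsol_voc[OF g]] by simp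
 moreover have "y 0 - voc (%j. ip (\<psi> j 0) (y 0)) g 0 = 0"
  unfolding voc_0 using representation[of "y 0" 0] by simp
 ultimately have "y t - voc (%j. ip (\<psi> j 0) (y 0)) g t = 0"
  by (rule hsol_unique_zero[OF _ _ A_bound t])
 then show ?thesis by simp
qed

lemma hsol_hom_eq:
 assumes y: "hsol A y (%_. 0)" and t: "t >= 0"
 shows "y t = (\<Sum>j\<in>{1..2 * n}. ip (\<psi> j 0) (y 0) *\<^sub>R \<phi> j t)"
 using hsol_eq_voc[OF y _ t] by (simp add: voc_def ip_0)

text \<open>The bounded solutions on \<open>[0,\<infinity>)\<close> are exactly the combinations of \<open>\<phi>\<^sub>1, \<dots>, \<phi>\<^sub>n\<close>.\<close>

lemma bounded_hom_coord:
 assumes y: "hsol A y (%_. 0)" and b: "bounded (y ` {0..})" and j: "j \<in> {n + 1..2 * n}"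
 shows "ip (\<psi> j 0) (y 0) = 0"
proof -
 obtain T where T: "T >= 0" and sub: "subspace {y T |y. hsol A y (%_. 0) & bounded (y ` {0..})}"
  and dim: "2 * dim {y T |y. hsol A y (%_. 0) & bounded (y ` {0..})} <= CARD('m)"
  using bounded_solution_space_dim by blast
 define W where "W = {y T |y. hsol A y (%_. 0) & bounded (y ` {0..})}"
 define B where "B = (%i. \<phi> i T) ` {1..n}"
 have BW: "B \<subseteq> W"
  unfolding B_def W_def using phi_sol phi_stable by fastforce
 have inj: "inj_on (%i. \<phi> i T) {1..n}"
 proof (rule inj_onI)
  fix i k assume ik: "i \<in> {1..n}" "k \<in> {1..n}" "\<phi> i T = \<phi> k T"
  then have "ip (\<psi> i T) (\<phi> k T) = 1" using dual[of i i T] by auto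
  then show "i = k" using dual[of i k T] ik by (auto split: if_splits)
 qed
 have ortho: "ip (\<psi> k T) x = 0" if "x \<in> span B'" "\<forall>b\<in>B'. ip (\<psi> k T) b = 0" for B' x k
  using that(1)
 proof (induction rule: span_induct_alt)
  case base
  then show ?case by (simp add: ip_0)
 next
  case (step c x y)
  then show ?case using that(2) by (simp add: ip_add ip_scale)
 qed
 have indep: "independent B"
  unfolding dependent_def
 proof clarsimp
  fix b assume "b \<in> B" and bs: "b \<in> span (B - {b})"
  then obtain i where i: "i \<in> {1..n}" "b = \<phi> i T" by (auto simp: B_def)
  have "\<forall>b'\<in>B - {b}. ip (\<psi> i T) b' = 0"
   using i by (auto simp: B_def dual split: if_splits)
  then have "ip (\<psi> i T) b = 0" using ortho bs by blast
  then show False using dual[of i i T] i by simp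
 qed
 have "card B = n" using card_image[OF inj] by (simp add: B_def)
 then have "W \<subseteq> span B"
  using dim card_m by (intro card_ge_dim_independent[OF BW indep]) (simp add: W_def)
 moreover have "y T \<in> W" unfolding W_def using y b by blast
 ultimately have "y T \<in> span B" by blast
 then have "ip (\<psi> j T) (y T) = 0"
  by (rule ortho) (use j in \<open>auto simp: B_def dual\<close>)
 moreover have "ip (\<psi> j T) (y T) = ip (\<psi> j 0) (y 0)"
  unfolding hsol_hom_eq[OF y T] using j by (intro coord_sum) auto
 ultimately show ?thesis by simp
qed

text \<open>Boundary data at \<open>t = 0\<close>: \<open>\<gamma>\<^sub>j\<close> are coordinates in the basis \<open>\<phi>\<^sub>j(0)\<close>. Elements of \<open>bdry\<close> lie in
 \<open>Fix R + span \<phi>\<^sub>n\<^sub>+\<^sub>2(0)\<close> and are normalized against \<open>\<phi>\<^sub>2(0)\<close>.\<close>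

definition \<gamma> :: "nat => real ^ 'm => real" where "\<gamma> j x = ip (\<psi> j 0) x"

definition bdry :: "(real ^ 'm) set" where
 "bdry = {x. \<gamma> 1 x = 0 & (\<forall>j\<in>{3..n}. \<gamma> (n + j) x = \<gamma> j x) & ip (\<phi> 2 0) x = 0}"

lemma bdry_diff: "x \<in> bdry ==> y \<in> bdry ==> x - y \<in> bdry"
 and bdry_scale: "x \<in> bdry ==> c *\<^sub>R x \<in> bdry" and bdry_add: "x \<in> bdry ==> y \<in> bdry ==> x + y \<in> bdry"
 by (auto simp: bdry_def \<gamma>_def ip_diff ip_scale ip_add)

lemma closed_bdry: "closed bdry"
proof -
 have c: "continuous_on UNIV (ip x)" for x using ip_bounded_linear linear_continuous_on by blast
 have "bdry = {x. ip (\<psi> 1 0) x = 0} \<inter> (\<Inter>j\<in>{3..n}. {x. ip (\<psi> (n + j) 0) x = ip (\<psi> j 0) x}) \<inter> {x. ip (\<phi> 2 0) x = 0}"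
  by (auto simp: bdry_def \<gamma>_def)
 then show ?thesis using c by (auto intro!: closed_Int closed_INT closed_Collect_eq continuous_intros)
qed

lemma phi2_nonzero: "ip (\<phi> 2 0) (\<phi> 2 0) > 0"
proof (rule ip_pos)
 show "\<phi> 2 0 ~= 0" using dual[of 2 2 0] n2 by (auto simp: ip_0)
qed

lemma bounded_bdry_zero:
 assumes y: "hsol A y (%_. 0)" and b: "bounded (y ` {0..})" and y0: "y 0 \<in> bdry"
 shows "y 0 = 0"
proof -
 have z: "\<gamma> j (y 0) = 0" if "j \<in> {1..2 * n}" "j ~= 2" for j
 proof (cases "j >= n + 1")
  case True
  then show ?thesis using bounded_hom_coord[OF y b, of j] that by (simp add: \<gamma>_def)
 next
  case False
  show ?thesis
  proof (cases "j = 1")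
   case True
   then show ?thesis using y0 by (simp add: bdry_def)
  next
   case j1: False
   then have "\<gamma> (n + j) (y 0) = \<gamma> j (y 0)" using y0 that False by (auto simp: bdry_def)
   moreover have "\<gamma> (n + j) (y 0) = 0"
    using bounded_hom_coord[OF y b, of "n + j"] that False by (simp add: \<gamma>_def)
   ultimately show ?thesis by simp
  qed
 qed
 have "y 0 = (\<Sum>j\<in>{1..2 * n}. \<gamma> j (y 0) *\<^sub>R \<phi> j 0)"
  using representation[of "y 0" 0] by (simp add: \<gamma>_def)
 also have "\<dots> = \<gamma> 2 (y 0) *\<^sub>R \<phi> 2 0 + (\<Sum>j\<in>{1..2 * n} - {2}. \<gamma> j (y 0) *\<^sub>R \<phi> j 0)"
  using n2 by (intro sum.remove) auto
 also have "(\<Sum>j\<in>{1..2 * n} - {2}. \<gamma> j (y 0) *\<^sub>R \<phi> j 0) = 0"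
  using z by (intro sum.neutral) auto
 finally have eq: "y 0 = \<gamma> 2 (y 0) *\<^sub>R \<phi> 2 0" by simp
 have "ip (\<phi> 2 0) (y 0) = 0" using y0 by (simp add: bdry_def)
 then have "\<gamma> 2 (y 0) * ip (\<phi> 2 0) (\<phi> 2 0) = 0" by (subst (asm) eq) (simp add: ip_scale)
 then show ?thesis using phi2_nonzero eq by simp
qed

lemma bounded_continuous_image:
 "continuous_on {0..} y ==> (!!t. t >= T ==> norm (y t) <= K) ==> bounded (y ` {0..})"
 for y :: "real => 'b::real_normed_vector"
proof -
 assume c: "continuous_on {0..} y" and K: "!!t. t >= T ==> norm (y t) <= K"
 have "bounded (y ` {0..T})"
  by (intro compact_imp_bounded compact_continuous_image continuous_on_subset[OF c]) auto
 moreover have "bounded (y ` {T..})" using K by (auto simp: bounded_iff)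
 ultimately have "bounded (y ` {0..T} \<union> y ` {T..})" by (simp add: bounded_Un)
 moreover have "y ` {0..} \<subseteq> y ` {0..T} \<union> y ` {T..}"
 proof (rule image_subsetI)
  show "y t \<in> y ` {0..T} \<union> y ` {T..}" if "t \<in> {0..}" for t using that by (cases "t <= T") auto
 qed
 ultimately show ?thesis by (rule bounded_subset)
qed

lemma short_time_estimate:
 "EX Q>=0. ALL y g H. hsol A y g --> (ALL t>=0. norm (g t) <= H) --> (\<forall>t\<in>{0..T}. norm (y t) <= Q * (norm (y 0) + H))"
proof -
 obtain M where M: "!!s x. s \<in> {0..T} ==> norm (A s x) <= M * norm x" using A_bound[of T] by blast
 have M': "norm (A s x) <= max M 0 * norm x" if "s \<in> {0..T}" for s x
  using M[OF that, of x] mult_right_mono[of M "max M 0" "norm x"] by simp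
 have "norm (y t) <= exp ((2 * max M 0 + 1) * T) * (norm (y 0) + H)"
  if y: "hsol A y g" and H: "ALL t>=0. norm (g t) <= H" and t: "t \<in> {0..T}" for y g H t
 proof -
  have "norm (y t) <= exp ((2 * max M 0 + 1) * t) * (norm (y 0) + H)"
   by (rule hsol_growth[OF y]) (use H t M' in auto)
  also have "\<dots> <= exp ((2 * max M 0 + 1) * T) * (norm (y 0) + H)"
  proof (rule mult_right_mono)
   show "exp ((2 * max M 0 + 1) * t) <= exp ((2 * max M 0 + 1) * T)" using t by (simp add: mult_left_mono)
   have "norm (g 0) <= H" using H by simp
   then show "0 <= norm (y 0) + H" using norm_ge_zero[of "y 0"] norm_ge_zero[of "g 0"] by linarith
  qed
  finally show ?thesis .
 qed
 then show ?thesis by (intro exI[of _ "exp ((2 * max M 0 + 1) * T)"]) auto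
qed

lemma initial_value_estimate:
 "EX C>=0. ALL y g H. hsol A y g --> continuous_on {0..} g --> (ALL t>=0. norm (g t) <= H) --> bounded (y ` {0..}) -->
   (ALL t>=0. norm (y t) <= C * (norm (y 0) + H))"
proof -
 obtain C T where C: "C >= 0" "T >= 0" and est0: "ALL y g H. hsol A y g --> (ALL t>=0. norm (g t) <= H) --> bounded (y ` {0..}) -->
   (ALL t>=T. norm (y t) <= C * (norm (y T) + H))"
  using bounded_solution_estimate by (elim exE conjE) (rule that, assumption, assumption, assumption)
 obtain Q where Q: "Q >= 0" and short0: "ALL y g H. hsol A y g --> (ALL t>=0. norm (g t) <= H) -->
   (\<forall>t\<in>{0..T}. norm (y t) <= Q * (norm (y 0) + H))"
  using short_time_estimate[of T] by (elim exE conjE) (rule that, assumption, assumption)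
 note short = short0[THEN spec, THEN spec, THEN spec, THEN mp, THEN mp, THEN bspec]
 define C' where "C' = Q + C * (Q + 1)"
 have C': "C' >= 0" using Q C by (simp add: C'_def)
 have "norm (y t) <= C' * (norm (y 0) + H)"
  if y: "hsol A y g" and g: "continuous_on {0..} g" and H: "ALL t>=0. norm (g t) <= H" and b: "bounded (y ` {0..})" and t: "t >= 0"
  for y g H t
 proof -
  have H0: "H >= 0" using H norm_ge_zero order_trans by blast
  have pos: "0 <= norm (y 0) + H" using H0 by simp
  show ?thesis
  proof (cases "t <= T")
   case True
   then have "norm (y t) <= Q * (norm (y 0) + H)" using short[OF y H] t by simp
   also have "\<dots> <= C' * (norm (y 0) + H)" using C Q pos by (intro mult_right_mono) (auto simp: C'_def)
   finally show ?thesis .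
  next
   case False
   then have "norm (y t) <= C * (norm (y T) + H)" using est0 y H b by auto
   also have "\<dots> <= C * (Q * (norm (y 0) + H) + (norm (y 0) + H))"
    using short[OF y H, of T] C by (intro mult_left_mono add_mono) auto
   also have "\<dots> <= C' * (norm (y 0) + H)"
   proof -
    have "0 <= Q * (norm (y 0) + H)" using Q pos by simp
    then show ?thesis by (simp add: C'_def algebra_simps)
   qed
   finally show ?thesis .
  qed
 qed
 then show ?thesis using C' by blast
qed

text \<open>By compactness: a sequence violating the estimate, normalized at \<open>t = 0\<close>, converges
 to a bounded homogeneous solution with nonzero value in \<open>bdry\<close>, which does not exist.\<close>

lemma boundary_estimate:
 "EX C>=0. ALL y g H. hsol A y g --> continuous_on {0..} g --> (ALL t>=0. norm (g t) <= H) --> bounded (y ` {0..}) -->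
   y 0 \<in> bdry --> (ALL t>=0. norm (y t) <= C * H)"
proof -
 obtain C where C: "C >= 0" and est0: "ALL y g H. hsol A y g --> continuous_on {0..} g --> (ALL t>=0. norm (g t) <= H) --> bounded (y ` {0..}) -->
   (ALL t>=0. norm (y t) <= C * (norm (y 0) + H))"
  using initial_value_estimate by (elim exE conjE) (rule that, assumption, assumption)
 define BP where "BP y g H \<longleftrightarrow> hsol A y g & continuous_on {0..} g & (ALL t>=0. norm (g t) <= H) & bounded (y ` {0..}) &
   y 0 \<in> bdry" for y g and H :: real
 have "EX K. ALL y g H. BP y g H --> norm (y 0) <= K * H"
 proof (rule ccontr)
  assume contra: "\<not> ?thesis"
  have "EX y g H. BP y g H & norm (y 0) > real (Suc k) * H" for k :: nat
   using contra by (meson not_le)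
  then obtain y g H where BP: "!!k. BP (y k) (g k) (H k)" and big: "!!k::nat. norm (y k 0) > real (Suc k) * H k"
   by metis
  have y: "!!k. hsol A (y k) (g k)" and gc: "!!k. continuous_on {0..} (g k)"
   and gH: "!!k. ALL t>=0. norm (g k t) <= H k" and yb: "!!k. bounded (y k ` {0..})"
   and y0: "!!k. y k 0 \<in> bdry"
   using BP unfolding BP_def by blast+
  have H0: "H k >= 0" for k using gH[of k] norm_ge_zero order_trans by blast
  define N where "N k = norm (y k 0)" for k
  have N: "N k > 0" for k
   using big[of k] H0[of k] by (smt (verit) N_def mult_nonneg_nonneg of_nat_0_le_iff)
  define z where "z k t = (1 / N k) *\<^sub>R y k t" for k t
  define h where "h k t = (1 / N k) *\<^sub>R g k t" for k t
  have z: "hsol A (z k) (h k)" for k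
   using hsol_lincomb[OF y[of k] y[of k], of "1 / N k" 0] by (simp add: z_def[abs_def] h_def[abs_def])
  have hc: "continuous_on {0..} (h k)" for k unfolding h_def using gc by (intro continuous_intros)
  have hH: "norm (h k t) <= 1 / real (Suc k)" if "t >= 0" for k t
  proof -
   have "norm (h k t) <= H k / N k" using gH[of k] that N[of k] by (simp add: h_def divide_right_mono)
   also have "\<dots> <= 1 / real (Suc k)"
    using big[of k] N[of k] by (simp add: N_def field_simps)
   finally show ?thesis .
  qed
  have zb: "bounded (z k ` {0..})" for k unfolding z_def using yb by (intro bounded_scaleR_comp)
  have z1: "norm (z k 0) = 1" for k using N[of k] by (simp add: z_def N_def)
  have zbd: "z k 0 \<in> bdry" for k unfolding z_def by (intro bdry_scale y0)
  have "\<exists>l\<in>sphere 0 1. EX r. strict_mono r & ((%k. z k 0) \<circ> r) \<longlonglongrightarrow> l"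
  proof -
   have "compact (sphere (0::real ^ 'm) 1)" by simp
   then show ?thesis unfolding compact_def using z1 by auto
  qed
  then obtain l r where l: "norm l = 1" and r: "strict_mono r" and conv: "(%k. z (r k) 0) \<longlonglongrightarrow> l"
   by (auto simp: o_def)
  have lb: "l \<in> bdry"
   using closed_sequentially[OF closed_bdry, of "%k. z (r k) 0" l] zbd conv by auto
  define w where "w t = voc (%j. ip (\<psi> j 0) l) (%_. 0) t" for t
  have w: "hsol A w (%_. 0)" unfolding w_def[abs_def] by (rule hsol_voc) auto
  have w0: "w 0 = l" unfolding w_def voc_0 using representation[of l 0] by simp
  have wb: "norm (w t) <= 2 * C" if t: "t >= 0" for t
  proof (rule tendsto_upperbound)
   obtain Q where Q: "Q >= 0" and short0: "ALL y g H. hsol A y g --> (ALL t>=0. norm (g t) <= H) -->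
     (\<forall>s\<in>{0..t}. norm (y s) <= Q * (norm (y 0) + H))"
    using short_time_estimate[of t] by (elim exE conjE) (rule that, assumption, assumption)
   have bound: "norm (z (r k) t - w t) <= Q * (norm (z (r k) 0 - l) + 1 / real (Suc k))" for k
   proof -
    have "hsol A (%t. z (r k) t - w t) (h (r k))" using hsol_diff[OF z w] by simp
    note hs = this
    have hb: "ALL t>=0. norm (h (r k) t) <= 1 / real (Suc k)"
    proof (intro allI impI)
     fix t :: real assume "t >= 0"
     then have "norm (h (r k) t) <= 1 / real (Suc (r k))" by (rule hH)
     also have "\<dots> <= 1 / real (Suc k)" using seq_suble[OF r, of k] by (intro divide_left_mono) auto
     finally show "norm (h (r k) t) <= 1 / real (Suc k)" .
    qed
    show ?thesis
     using short0[THEN spec, THEN spec, THEN spec, THEN mp, THEN mp, OF hs hb] t w0 by auto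
   qed
   have "(%k. Q * (norm (z (r k) 0 - l) + 1 / real (Suc k))) \<longlonglongrightarrow> Q * (norm (l - l) + 0)"
    by (intro tendsto_intros conv LIMSEQ_Suc[OF lim_1_over_n])
   then have lim0: "(%k. Q * (norm (z (r k) 0 - l) + 1 / real (Suc k))) \<longlonglongrightarrow> 0" by simp
   have "\<forall>\<^sub>F k in sequentially. norm (z (r k) t - w t) <= Q * (norm (z (r k) 0 - l) + 1 / real (Suc k))"
    by (rule always_eventually) (rule allI, rule bound)
   from Lim_null_comparison[OF this lim0]
   have "(%k. z (r k) t) \<longlonglongrightarrow> w t" by (rule LIM_zero_cancel)
   then show "((%k. norm (z (r k) t)) \<longlongrightarrow> norm (w t)) sequentially" by (rule tendsto_norm)
   have "norm (z (r k) t) <= 2 * C" for k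
   proof -
    have hb: "ALL t>=0. norm (h (r k) t) <= 1"
    proof (intro allI impI)
     fix t :: real assume "t >= 0"
     then have "norm (h (r k) t) <= 1 / real (Suc (r k))" by (rule hH)
     also have "\<dots> <= 1" by simp
     finally show "norm (h (r k) t) <= 1" .
    qed
    have "norm (z (r k) t) <= C * (norm (z (r k) 0) + 1)"
     using est0[THEN spec, THEN spec, THEN spec, THEN mp, THEN mp, THEN mp, THEN mp, OF z hc hb zb] t by blast
    then show ?thesis by (simp add: z1)
   qed
   then show "\<forall>\<^sub>F k in sequentially. norm (z (r k) t) <= 2 * C" by simp
  qed simp
  then have "bounded (w ` {0..})" by (auto simp: bounded_iff)
  then have "l = 0" using bounded_bdry_zero[OF w] lb w0 by simp
  then show False using l by simp
 qed
 then obtain K where K: "ALL y g H. BP y g H --> norm (y 0) <= K * H" by blast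
 have "norm (y t) <= C * (max K 0 + 1) * H"
  if y: "hsol A y g" "continuous_on {0..} g" "ALL t>=0. norm (g t) <= H" "bounded (y ` {0..})" "y 0 \<in> bdry" and t: "t >= 0" for y g H t
 proof -
  have H0: "H >= 0" using y(3) norm_ge_zero order_trans by blast
  have "norm (y 0) <= K * H" using K y by (simp add: BP_def)
  also have "\<dots> <= max K 0 * H" using H0 by (intro mult_right_mono) auto
  finally have "norm (y 0) <= max K 0 * H" .
  moreover have "norm (y t) <= C * (norm (y 0) + H)" using est0 y t by blast
  ultimately have "norm (y t) <= C * (max K 0 * H + H)"
   using C by (meson add_right_mono mult_left_mono order_trans)
  then show ?thesis by (simp add: algebra_simps)
 qed
 then show ?thesis using C by (intro exI[of _ "C * (max K 0 + 1)"]) auto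
qed

end

section \<open>The boundary value problem and its solvability condition\<close>

context homoclinic_VE
begin

definition Ksol :: "(real => real ^ 'm) => (real => real ^ 'm) => bool" where
 "Ksol g y \<longleftrightarrow> hsol A y g & bounded (y ` {0..}) & y 0 \<in> bdry"

definition K_const :: real where
 "K_const = (SOME C. C >= 0 & (ALL y g H. hsol A y g --> continuous_on {0..} g --> (ALL t>=0. norm (g t) <= H) --> bounded (y ` {0..}) -->
   y 0 \<in> bdry --> (ALL t>=0. norm (y t) <= C * H)))"

lemma K_const: "K_const >= 0 & (ALL y g H. hsol A y g --> continuous_on {0..} g --> (ALL t>=0. norm (g t) <= H) --> bounded (y ` {0..}) -->
   y 0 \<in> bdry --> (ALL t>=0. norm (y t) <= K_const * H))"
 unfolding K_const_def by (rule someI_ex) (rule boundary_estimate)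

lemma Ksol_bound:
 assumes "Ksol g y" "continuous_on {0..} g" "!!t. t >= 0 ==> norm (g t) <= H" "t >= 0"
 shows "norm (y t) <= K_const * H"
proof -
 have y: "hsol A y g" "bounded (y ` {0..})" "y 0 \<in> bdry" using assms(1) by (simp_all add: Ksol_def)
 have H: "ALL t>=0. norm (g t) <= H" using assms(3) by blast
 show ?thesis
  using K_const[THEN conjunct2, THEN spec, THEN spec, THEN spec, THEN mp, THEN mp, THEN mp, THEN mp, THEN mp,
    OF y(1) assms(2) H y(2,3)] assms(4) by blast
qed

lemma Ksol_lincomb:
 assumes "Ksol g y" "Ksol h z"
 shows "Ksol (%t. a *\<^sub>R g t + b *\<^sub>R h t) (%t. a *\<^sub>R y t + b *\<^sub>R z t)"
 using assms unfolding Ksol_def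
 by (auto intro!: hsol_lincomb bounded_plus_comp bounded_scaleR_comp bdry_add bdry_scale)

lemma Ksol_diff: "Ksol g y ==> Ksol h z ==> Ksol (%t. g t - h t) (%t. y t - z t)"
 using Ksol_lincomb[of g y h z 1 "-1"] by simp

lemma Ksol_unique:
 assumes "Ksol g y" "Ksol g z" "t >= 0" shows "y t = z t"
 using Ksol_bound[OF Ksol_diff[OF assms(1,2)], of 0 t] assms(3) by simp

text \<open>For an inhomogeneity that vanishes after \<open>\<tau>\<close> the unstable coordinates have to
 vanish at \<open>\<tau>\<close>; this fixes the coordinates above \<open>n\<close>, and the condition
 \<open>bdry\<close> fixes the others.\<close>

lemma Ksol_compact_support:
 assumes g: "continuous_on {0..} g" and \<tau>: "\<tau> >= 0" and supp: "!!t. t >= \<tau> ==> g t = 0"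
 shows "EX y. Ksol g y & \<gamma> (n + 2) (y 0) = - integral {0..\<tau>} (%s. ip (\<psi> (n + 2) s) (g s))"
proof -
 define d where "d j = integral {0..\<tau>} (%s. ip (\<psi> j s) (g s))" for j
 define c0 where "c0 j = (if j > n then - d j else if j >= 3 then - d (n + j) else 0)" for j
 define s where "s = (\<Sum>j\<in>{1..2 * n}. c0 j *\<^sub>R \<phi> j 0)"
 define c where "c = c0(2 := - ip (\<phi> 2 0) s / ip (\<phi> 2 0) (\<phi> 2 0))"
 define y where "y = voc c g"
 have mem2: "2 \<in> {1..2 * n}" using n2 by auto
 have y0: "y 0 = (\<Sum>j\<in>{1..2 * n}. c j *\<^sub>R \<phi> j 0)" by (simp add: y_def voc_0)
 have y0s: "y 0 = s + c 2 *\<^sub>R \<phi> 2 0"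
 proof -
  have "y 0 = c 2 *\<^sub>R \<phi> 2 0 + (\<Sum>j\<in>{1..2 * n} - {2}. c j *\<^sub>R \<phi> j 0)"
   unfolding y0 using mem2 by (intro sum.remove) auto
  moreover have "s = c0 2 *\<^sub>R \<phi> 2 0 + (\<Sum>j\<in>{1..2 * n} - {2}. c0 j *\<^sub>R \<phi> j 0)"
   unfolding s_def using mem2 by (intro sum.remove) auto
  moreover have "c0 2 = 0" using n2 by (simp add: c0_def)
  moreover have "(\<Sum>j\<in>{1..2 * n} - {2}. c j *\<^sub>R \<phi> j 0) = (\<Sum>j\<in>{1..2 * n} - {2}. c0 j *\<^sub>R \<phi> j 0)"
   by (intro sum.cong) (auto simp: c_def)
  ultimately show ?thesis by simp
 qed
 have \<gamma>: "\<gamma> j (y 0) = c j" if "j \<in> {1..2 * n}" for j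
  unfolding y0 \<gamma>_def by (rule coord_sum[OF that])
 have bd: "y 0 \<in> bdry"
  unfolding bdry_def
 proof (intro CollectI conjI ballI)
  show "\<gamma> 1 (y 0) = 0" using \<gamma>[of 1] n2 by (simp add: c_def c0_def)
  show "\<gamma> (n + j) (y 0) = \<gamma> j (y 0)" if "j \<in> {3..n}" for j
   using \<gamma>[of "n + j"] \<gamma>[of j] that n2 by (simp add: c_def c0_def)
  show "ip (\<phi> 2 0) (y 0) = 0"
   unfolding y0s using phi2_nonzero by (simp add: ip_add ip_diff ip_minus ip_scale c_def)
 qed
 have sol: "hsol A y g" unfolding y_def by (rule hsol_voc[OF g])
 have "EX B. ALL t>=0. norm (\<phi> j t) <= B" if "j \<in> {1..n}" for j
  using phi_stable[OF that] unfolding bounded_iff by auto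
 then obtain B where B: "!!j t. j \<in> {1..n} ==> t >= 0 ==> norm (\<phi> j t) <= B j" by metis
 have late: "y t = (\<Sum>j\<in>{1..n}. (c j + d j) *\<^sub>R \<phi> j t)" if t: "t >= \<tau>" for t
 proof -
  have int: "integral {0..t} (%s. ip (\<psi> j s) (g s)) = d j" if j: "j \<in> {1..2 * n}" for j
  proof -
   have "continuous_on {0..t} (%s. ip (\<psi> j s) (g s))"
    using coordinate_continuous[OF j g] by (rule continuous_on_subset) auto
   then have "(%s. ip (\<psi> j s) (g s)) integrable_on {0..t}" by (rule integrable_continuous_real)
   then have "integral {0..\<tau>} (%s. ip (\<psi> j s) (g s)) + integral {\<tau>..t} (%s. ip (\<psi> j s) (g s)) =
     integral {0..t} (%s. ip (\<psi> j s) (g s))"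
    using Henstock_Kurzweil_Integration.integral_combine \<tau> t by blast
   moreover have "integral {\<tau>..t} (%s. ip (\<psi> j s) (g s)) = integral {\<tau>..t} (%s. 0)"
    by (rule integral_cong) (simp add: supp ip_0)
   ultimately show ?thesis by (simp add: d_def)
  qed
  have "y t = (\<Sum>j\<in>{1..2 * n}. (c j + d j) *\<^sub>R \<phi> j t)"
   unfolding y_def voc_def by (intro sum.cong refl) (simp only: int)
  also have "\<dots> = (\<Sum>j\<in>{1..n}. (c j + d j) *\<^sub>R \<phi> j t)"
  proof (rule sum.mono_neutral_right)
   show "\<forall>j\<in>{1..2 * n} - {1..n}. (c j + d j) *\<^sub>R \<phi> j t = 0"
    using n2 by (auto simp: c_def c0_def)
  qed auto
  finally show ?thesis .
 qed
 have bdd: "bounded (y ` {0..})"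
 proof (rule bounded_continuous_image[OF hsol_continuous[OF sol], of \<tau>])
  fix t assume t: "t >= \<tau>"
  show "norm (y t) <= (\<Sum>j\<in>{1..n}. \<bar>c j + d j\<bar> * B j)"
   unfolding late[OF t]
  proof (rule order_trans[OF norm_sum], rule sum_mono)
   fix j assume "j \<in> {1..n}"
   then show "norm ((c j + d j) *\<^sub>R \<phi> j t) <= \<bar>c j + d j\<bar> * B j"
    using B[of j t] t \<tau> by (simp add: mult_left_mono)
  qed
 qed
 have "\<gamma> (n + 2) (y 0) = - d (n + 2)"
  using \<gamma>[of "n + 2"] n2 by (simp add: c_def c0_def)
 then show ?thesis using sol bdd bd unfolding Ksol_def d_def by blast
qed

definition cutoff :: "nat => real => real" where "cutoff k t = max 0 (min 1 (real k + 1 - t))"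

lemma cutoff: "0 <= cutoff k t" "cutoff k t <= 1" "t <= real k ==> cutoff k t = 1" "t >= real k + 1 ==> cutoff k t = 0"
 by (auto simp: cutoff_def)

lemma cutoff_continuous: "continuous_on S (cutoff k)"
 unfolding cutoff_def[abs_def] by (intro continuous_intros)

text \<open>Existence by cutting off \<open>g\<close>: by the boundary estimate the solutions form a Cauchy
 sequence, uniformly in time, since \<open>g\<close> decays.\<close>

lemma Ksol_exists_approx:
 assumes g: "continuous_on {0..} g" and g0: "(g \<longlongrightarrow> 0) at_top"
 shows "EX y. Ksol g y &
  (%k. - integral {0..real k + 1} (%s. cutoff k s * ip (\<psi> (n + 2) s) (g s))) \<longlonglongrightarrow> \<gamma> (n + 2) (y 0)"
proof -
 define gk where "gk k t = cutoff k t *\<^sub>R g t" for k t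
 have gkc: "continuous_on {0..} (gk k)" for k
  unfolding gk_def by (intro continuous_intros cutoff_continuous g)
 have "EX y. Ksol (gk k) y & \<gamma> (n + 2) (y 0) = - integral {0..real k + 1} (%s. ip (\<psi> (n + 2) s) (gk k s))" for k
  by (rule Ksol_compact_support[OF gkc]) (auto simp: gk_def cutoff)
 then obtain y where y: "!!k. Ksol (gk k) (y k)"
  and \<gamma>y: "!!k. \<gamma> (n + 2) (y k 0) = - integral {0..real k + 1} (%s. ip (\<psi> (n + 2) s) (gk k s))" by metis
 have K0: "K_const >= 0" using K_const by blast
 have cau: "Cauchy (%k. y k t)" if t: "t >= 0" for t
  unfolding Cauchy_def
 proof (intro allI impI)
  fix e :: real assume e: "e > 0"
  define e' where "e' = (e / 2) / (K_const + 1)"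
  have e': "e' > 0" using e K0 by (simp add: e'_def)
  have "\<forall>\<^sub>F t in at_top. norm (g t) < e'" using tendstoD[OF g0 e'] by simp
  then obtain N0 where N0: "!!t. t >= N0 ==> norm (g t) < e'" unfolding eventually_at_top_linorder by blast
  define N where "N = nat \<lceil>max N0 0\<rceil>"
  have N: "real N >= N0" by (simp add: N_def) linarith
  have "dist (y k t) (y l t) < e" if "k >= N" "l >= N" for k l
  proof -
   have "norm (y k t - y l t) <= K_const * e'"
   proof (rule Ksol_bound[OF Ksol_diff[OF y y] _ _ t])
    show "continuous_on {0..} (%t. gk k t - gk l t)" by (intro continuous_intros gkc)
    fix s :: real assume "s >= 0"
    have eq: "gk k s - gk l s = (cutoff k s - cutoff l s) *\<^sub>R g s" by (simp add: gk_def scaleR_diff_left)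
    show "norm (gk k s - gk l s) <= e'"
    proof (cases "s <= real N")
     case True
     then have "cutoff k s = 1" "cutoff l s = 1" using that by (auto intro!: cutoff(3))
     then show ?thesis using e' by (simp add: eq)
    next
     case False
     then have "norm (g s) <= e'" using N0[of s] N by simp
     moreover have "\<bar>cutoff k s - cutoff l s\<bar> <= 1" using cutoff(1,2)[of k s] cutoff(1,2)[of l s] by linarith
     ultimately have "\<bar>cutoff k s - cutoff l s\<bar> * norm (g s) <= 1 * e'" by (intro mult_mono) auto
     then show ?thesis by (simp add: eq)
    qed
   qed
   also have "\<dots> < e"
   proof -
    have "K_const * e' <= (K_const + 1) * e'" using e' by (intro mult_right_mono) auto
    also have "\<dots> = e / 2"
    proof -
     have "K_const + 1 ~= 0" using K0 by linarith
     then show ?thesis unfolding e'_def by (metis nonzero_mult_div_cancel_left times_divide_eq_right)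
    qed
    also have "\<dots> < e" using e by simp
    finally show ?thesis .
   qed
   finally show ?thesis by (simp add: dist_norm)
  qed
  then show "EX M. ALL m>=M. ALL n>=M. dist (y m t) (y n t) < e" by blast
 qed
 define Y where "Y t = lim (%k. y k t)" for t
 have lim: "(%k. y k t) \<longlonglongrightarrow> Y t" if "t >= 0" for t
  unfolding Y_def using cau[OF that] Cauchy_convergent convergent_LIMSEQ_iff by blast
 have ipc: "(%k. ip (\<psi> j 0) (y k 0)) \<longlonglongrightarrow> ip (\<psi> j 0) (Y 0)" for j
  by (rule bounded_linear.tendsto[OF ip_bounded_linear lim]) simp
 define z where "z = voc (%j. ip (\<psi> j 0) (Y 0)) g"
 have zY: "z t = Y t" if t: "t >= 0" for t
 proof (rule LIMSEQ_unique[OF _ lim[OF t]])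
  have "(%k. voc (%j. ip (\<psi> j 0) (y k 0)) g t) \<longlonglongrightarrow> z t"
   unfolding z_def voc_def by (intro tendsto_intros ipc)
  moreover have "\<forall>\<^sub>F k in sequentially. voc (%j. ip (\<psi> j 0) (y k 0)) g t = y k t"
  proof -
   obtain N where N: "real N >= t" using real_arch_simple by blast
   have "voc (%j. ip (\<psi> j 0) (y k 0)) g t = y k t" if "k >= N" for k
   proof -
    have "hsol A (y k) (gk k)" using y by (simp add: Ksol_def)
    then have "y k t = voc (%j. ip (\<psi> j 0) (y k 0)) (gk k) t" by (rule hsol_eq_voc[OF _ gkc t])
    also have "\<dots> = voc (%j. ip (\<psi> j 0) (y k 0)) g t"
    proof -
     have "integral {0..t} (%s. ip (\<psi> j s) (gk k s)) = integral {0..t} (%s. ip (\<psi> j s) (g s))" for j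
      by (rule integral_cong) (use N that in \<open>auto simp: gk_def cutoff(3)\<close>)
     then show ?thesis unfolding voc_def by (simp only:)
    qed
    finally show ?thesis by simp
   qed
   then show ?thesis unfolding eventually_sequentially by blast
  qed
  ultimately show "(%k. y k t) \<longlonglongrightarrow> z t" by (rule Lim_transform_eventually)
 qed
 have gb: "bounded (g ` {0..})"
 proof -
  have "\<forall>\<^sub>F t in at_top. norm (g t) < 1" using tendstoD[OF g0, of 1] by simp
  then obtain N0 where N0: "!!t. t >= N0 ==> norm (g t) <= 1" unfolding eventually_at_top_linorder by (meson less_imp_le)
  show ?thesis by (rule bounded_continuous_image[OF g N0])
 qed
 then obtain G where G: "!!t. t >= 0 ==> norm (g t) <= G" unfolding bounded_iff by auto
 have "Ksol g z"
  unfolding Ksol_def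
 proof (intro conjI)
  show "hsol A z g" unfolding z_def by (rule hsol_voc[OF g])
  have "norm (Y t) <= K_const * G" if t: "t >= 0" for t
  proof (rule tendsto_upperbound[OF tendsto_norm[OF lim[OF t]]])
   have "norm (y k t) <= K_const * G" for k
   proof (rule Ksol_bound[OF y gkc _ t])
    fix s :: real assume "s >= 0"
    then have "\<bar>cutoff k s\<bar> * norm (g s) <= 1 * G"
     using cutoff(1,2)[of k s] G by (intro mult_mono) auto
    then show "norm (gk k s) <= G" by (simp add: gk_def)
   qed
   then show "\<forall>\<^sub>F k in sequentially. norm (y k t) <= K_const * G" by simp
  qed simp
  then show "bounded (z ` {0..})" using zY by (auto simp: bounded_iff)
  show "z 0 \<in> bdry"
   using closed_sequentially[OF closed_bdry, of "%k. y k 0" "Y 0"] y lim[of 0] zY[of 0] by (simp add: Ksol_def)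
 qed
 moreover have "(%k. - integral {0..real k + 1} (%s. cutoff k s * ip (\<psi> (n + 2) s) (g s))) \<longlonglongrightarrow> \<gamma> (n + 2) (z 0)"
  using ipc[of "n + 2"] \<gamma>y zY[of 0] by (simp add: \<gamma>_def gk_def ip_scale)
 ultimately show ?thesis by blast
qed

lemma Ksol_exists: "continuous_on {0..} g ==> (g \<longlongrightarrow> 0) at_top ==> EX y. Ksol g y"
 using Ksol_exists_approx by blast

lemma Ksol_tendsto: "Ksol g y ==> (g \<longlongrightarrow> 0) at_top ==> (y \<longlongrightarrow> 0) at_top"
 unfolding Ksol_def using bounded_solution_decay by blast

lemma solvability_approx:
 assumes "continuous_on {0..} g" "(g \<longlongrightarrow> 0) at_top" "Ksol g y"
 shows "(%k. - integral {0..real k + 1} (%s. cutoff k s * ip (\<psi> (n + 2) s) (g s))) \<longlonglongrightarrow> \<gamma> (n + 2) (y 0)"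
 using Ksol_exists_approx[OF assms(1,2)] Ksol_unique[OF assms(3), of _ 0] by auto

lemma solvability_zero:
 assumes "continuous_on {0..} g" "(g \<longlongrightarrow> 0) at_top" "Ksol g y"
  and z: "!!s. s >= 0 ==> ip (\<psi> (n + 2) s) (g s) = 0"
 shows "\<gamma> (n + 2) (y 0) = 0"
proof -
 have "integral {0..real k + 1} (%s. cutoff k s * ip (\<psi> (n + 2) s) (g s)) = integral {0..real k + 1} (%s. 0)" for k
  by (rule integral_cong) (subst z, auto)
 then show ?thesis using solvability_approx[OF assms(1-3)] LIMSEQ_unique[OF _ tendsto_const] by fastforce
qed

text \<open>The coordinate of \<open>y 0\<close> along \<open>\<phi>\<^sub>n\<^sub>+\<^sub>2(0)\<close> is
 what separates \<open>bdry\<close> from \<open>Fix R\<close>. Dominated convergence removes the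
 cutoff.\<close>

lemma solvability_integral:
 assumes g: "continuous_on {0..} g" "(g \<longlongrightarrow> 0) at_top" "Ksol g y"
  and F: "(%s. ip (\<psi> (n + 2) s) (g s)) absolutely_integrable_on {0..}"
 shows "\<gamma> (n + 2) (y 0) = - integral {0..} (%s. ip (\<psi> (n + 2) s) (g s))"
proof -
 define F where "F s = ip (\<psi> (n + 2) s) (g s)" for s
 have Fa: "F absolutely_integrable_on {0..}" using F by (simp add: F_def[abs_def])
 have Fc: "continuous_on {0..} F" unfolding F_def[abs_def] using n2 by (intro coordinate_continuous g) auto
 define Fk where "Fk k s = (if s < 0 then 0 else cutoff k s * F s)" for k s
 have hi: "(Fk k has_integral integral {0..real k + 1} (Fk k)) {0..}" for k
 proof -
  have "continuous_on {0..real k + 1} (Fk k)"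
  proof (rule continuous_on_eq)
   show "continuous_on {0..real k + 1} (%s. cutoff k s * F s)"
    by (intro continuous_intros cutoff_continuous continuous_on_subset[OF Fc]) auto
  qed (auto simp: Fk_def)
  then have "(Fk k has_integral integral {0..real k + 1} (Fk k)) {0..real k + 1}"
   using integrable_continuous_real by blast
  then show ?thesis
   by (rule has_integral_on_superset) (auto simp: Fk_def cutoff)
 qed
 have "(%k. integral {0..} (Fk k)) \<longlonglongrightarrow> integral {0..} F"
 proof (rule dominated_convergence(2))
  show "Fk k integrable_on {0..}" for k using hi by blast
  show "(%s. norm (F s)) integrable_on {0..}" using Fa by (simp add: absolutely_integrable_on_def)
  show "norm (Fk k s) <= norm (F s)" if "s \<in> {0..}" for k s
   using cutoff(1,2)[of k s] by (simp add: Fk_def abs_mult mult_left_le_one_le)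
  show "(%k. Fk k s) \<longlonglongrightarrow> F s" if s: "s \<in> {0..}" for s
  proof (rule tendsto_eventually)
   obtain N where N: "real N >= s" using real_arch_simple by blast
   then have "Fk k s = F s" if "k >= N" for k using that s by (simp add: Fk_def cutoff(3))
   then show "\<forall>\<^sub>F k in sequentially. Fk k s = F s" unfolding eventually_sequentially by blast
  qed
 qed
 moreover have "integral {0..} (Fk k) = integral {0..real k + 1} (Fk k)" for k
  using hi by (rule integral_unique)
 ultimately have "(%k. - integral {0..real k + 1} (Fk k)) \<longlonglongrightarrow> - integral {0..} F"
  by (intro tendsto_minus) simp
 moreover have "integral {0..real k + 1} (Fk k) = integral {0..real k + 1} (%s. cutoff k s * ip (\<psi> (n + 2) s) (g s))" for k
  by (rule integral_cong) (simp add: Fk_def F_def)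
 then have "(%k. - integral {0..real k + 1} (Fk k)) \<longlonglongrightarrow> \<gamma> (n + 2) (y 0)"
  using solvability_approx[OF g] by (simp only:)
 ultimately have "\<gamma> (n + 2) (y 0) = - integral {0..} F" by (rule LIMSEQ_unique[rotated])
 then show ?thesis by (simp add: F_def[abs_def])
qed

end

section \<open>Symmetries and the linearized bifurcation problem\<close>

text \<open>The two eigenspaces of the involution are orthogonal complements of each other.\<close>

lemma involution_self_adjoint:
 assumes ip: "Defs.scalar_product ip" and J: "linear J" "!!x. J (J x) = x"
  and orth: "{x. J x = - x} = orth_compl ip {x. J x = x}"
 shows "ip (J x) y = ip x (J y)"
proof -
 have bl: "bilinear ip" and sym: "!!x y. ip x y = ip y x" using ip by (auto simp: scalar_product_def)
 note bil = bilinear_radd[OF bl] bilinear_ladd[OF bl] bilinear_rsub[OF bl] bilinear_lsub[OF bl]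
 have 0: "ip m p = 0" if "J m = - m" "J p = p" for m p
  using that orth unfolding orth_compl_def by blast
 have p: "J (u + J u) = u + J u" for u by (simp add: linear_add[OF J(1)] J(2) add.commute)
 have m: "J (u - J u) = - (u - J u)" for u by (simp add: linear_diff[OF J(1)] J(2))
 have "ip (y - J y) (x + J x) = 0" "ip (x - J x) (y + J y) = 0" using 0[OF m p] by auto
 then show ?thesis by (simp add: bil sym)
qed

locale symmetric_homoclinic_VE = homoclinic_VE L R n \<Lambda> A ip \<phi> \<psi>
 for L R :: "real ^ 'm => real ^ 'm" and n \<Lambda> A ip \<phi> \<psi> +
 fixes S :: "real ^ 'm => real ^ 'm"
 assumes phi_R1: "R (\<phi> 1 0) = - \<phi> 1 0"
  and phi_Rn1: "R (\<phi> (n + 1) 0) = \<phi> (n + 1) 0"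
  and phi_Rn2: "R (\<phi> (n + 2) 0) = - \<phi> (n + 2) 0"
  and phi_Rj: "!!j. j \<in> {3..n} ==> R (\<phi> j 0) = \<phi> (n + j) 0"
  and R_orth: "{x. R x = - x} = orth_compl ip {x. R x = x}"
  and linS: "linear S" and SS: "!!x. S (S x) = x"
  and S_orth: "{x. S x = - x} = orth_compl ip {x. S x = x}"
  and S_A: "!!t x. t >= 0 ==> A t (S x) = S (A t x)"
  and T_A: "!!t x. t >= 0 ==> A t (R (S (R x))) = R (S (R (A t x)))"
  and S_phi1: "S (\<phi> 1 0) = \<phi> 1 0" and S_phi2: "S (\<phi> 2 0) = - \<phi> 2 0"
  and S_psi: "!!t. t >= 0 ==> S (\<psi> (n + 2) t) = - \<psi> (n + 2) t"
begin

abbreviation "TT x \<equiv> R (S (R x))"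

lemma R_adj: "ip (R x) y = ip x (R y)"
 by (rule involution_self_adjoint[OF ip linR RR R_orth])

lemma S_adj: "ip (S x) y = ip x (S y)"
 by (rule involution_self_adjoint[OF ip linS SS S_orth])

lemma linTT: "linear (%x. TT x)"
 using linear_compose[OF linear_compose[OF linR linS] linR] by (simp add: o_def)

text \<open>The two isotypic subspaces of both involutions \<open>S\<close> and \<open>R S R\<close>; these are invariant under \<open>R\<close>
 although \<open>R\<close> and \<open>S\<close> need not commute.\<close>

definition V :: "real => (real ^ 'm) set" where
 "V \<sigma> = {x. S x = \<sigma> *\<^sub>R x & TT x = \<sigma> *\<^sub>R x}"

lemma V_lincomb: "x \<in> V \<sigma> ==> y \<in> V \<sigma> ==> a *\<^sub>R x + b *\<^sub>R y \<in> V \<sigma>"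
 unfolding V_def
 by (simp add: linear_add[OF linS] linear_cmul[OF linS] linear_add[OF linR] linear_cmul[OF linR] scaleR_add_right)
  (simp add: mult.commute)

lemma subspace_V: "subspace (V \<sigma>)"
 unfolding subspace_def
 using V_lincomb[of _ \<sigma> _ 1 1] V_lincomb[of _ \<sigma> _ _ 0]
 by (auto simp: V_def linear_0[OF linS] linear_0[OF linR])

lemma V_plus_orth: "x \<in> V 1 ==> t >= 0 ==> ip (\<psi> (n + 2) t) x = 0"
proof -
 assume x: "x \<in> V 1" and t: "t >= 0"
 have "ip (\<psi> (n + 2) t) x = ip (\<psi> (n + 2) t) (S x)" using x by (simp add: V_def)
 also have "\<dots> = ip (S (\<psi> (n + 2) t)) x" by (simp add: S_adj)
 also have "\<dots> = - ip (\<psi> (n + 2) t) x" by (simp only: S_psi[OF t] ip_minus_left)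
 finally show ?thesis by simp
qed

lemma sum_split:
 fixes F :: "nat => 'b::comm_monoid_add"
 shows "(\<Sum>j\<in>{1..2 * n}. F j) = F 1 + F 2 + F (n + 1) + F (n + 2) + (\<Sum>j\<in>{3..n}. F j + F (n + j))"
proof -
 have 1: "{1..2 * n} = {1..n} \<union> {n + 1..2 * n}" using n2 by auto
 have 2: "(\<Sum>j\<in>{1..n}. F j) = F 1 + (F 2 + (\<Sum>j\<in>{3..n}. F j))"
 proof -
  have "{1..n} = insert 1 (insert 2 {3..n})" using n2 by auto
  then show ?thesis by simp
 qed
 have 3: "(\<Sum>j\<in>{n + 1..2 * n}. F j) = (\<Sum>j\<in>{1..n}. F (n + j))"
  using sum.shift_bounds_cl_nat_ivl[of F 1 n n] by (simp add: add.commute mult_2)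
 have 4: "(\<Sum>j\<in>{1..n}. F (n + j)) = F (n + 1) + (F (n + 2) + (\<Sum>j\<in>{3..n}. F (n + j)))"
 proof -
  have "{1..n} = insert 1 (insert 2 {3..n})" using n2 by auto
  then show ?thesis by simp
 qed
 have "(\<Sum>j\<in>{1..2 * n}. F j) = (\<Sum>j\<in>{1..n}. F j) + (\<Sum>j\<in>{n + 1..2 * n}. F j)"
  unfolding 1 by (rule sum.union_disjoint) auto
 then show ?thesis unfolding 2 3 4 sum.distrib by (simp only: ac_simps)
qed

text \<open>The reversor permutes the basis \<open>\<phi>\<^sub>j(0)\<close> up to sign; this is its action on
 coordinates.\<close>

lemma coord_R:
 "\<gamma> 1 (R x) = - \<gamma> 1 x" "\<gamma> 2 (R x) = \<gamma> 2 x" "\<gamma> (n + 1) (R x) = \<gamma> (n + 1) x" "\<gamma> (n + 2) (R x) = - \<gamma> (n + 2) x"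
 "j \<in> {3..n} ==> \<gamma> (n + j) (R x) = \<gamma> j x" "j \<in> {3..n} ==> \<gamma> j (R x) = \<gamma> (n + j) x"
proof -
 define c where "c j = (if j = 1 then - \<gamma> 1 x else if j = 2 then \<gamma> 2 x else if j = n + 1 then \<gamma> (n + 1) x
  else if j = n + 2 then - \<gamma> (n + 2) x else if j <= n then \<gamma> (n + j) x else \<gamma> (j - n) x)" for j
 have "R x = R (\<Sum>j\<in>{1..2 * n}. \<gamma> j x *\<^sub>R \<phi> j 0)"
  using representation[of x 0] by (simp add: \<gamma>_def)
 also have "\<dots> = (\<Sum>j\<in>{1..2 * n}. \<gamma> j x *\<^sub>R R (\<phi> j 0))"
  by (simp add: linear_sum[OF linR] linear_cmul[OF linR])
 also have "\<dots> = (\<Sum>j\<in>{1..2 * n}. c j *\<^sub>R \<phi> j 0)"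
 proof -
  have "R (\<phi> (n + j) 0) = \<phi> j 0" if "j \<in> {3..n}" for j
   using phi_Rj[OF that] RR by metis
  then have "(\<Sum>j\<in>{3..n}. \<gamma> j x *\<^sub>R R (\<phi> j 0) + \<gamma> (n + j) x *\<^sub>R R (\<phi> (n + j) 0)) =
   (\<Sum>j\<in>{3..n}. c j *\<^sub>R \<phi> j 0 + c (n + j) *\<^sub>R \<phi> (n + j) 0)"
   using n2 by (intro sum.cong refl) (auto simp: phi_Rj c_def add.commute)
  then show ?thesis
   unfolding sum_split phi_R1 phi_Rn1 phi_Rn2 phi2_R using n2 by (simp add: c_def)
 qed
 finally have c: "\<gamma> j (R x) = c j" if "j \<in> {1..2 * n}" for j
  unfolding \<gamma>_def using coord_sum[OF that] by simp
 show "\<gamma> 1 (R x) = - \<gamma> 1 x" "\<gamma> 2 (R x) = \<gamma> 2 x" "\<gamma> (n + 1) (R x) = \<gamma> (n + 1) x" "\<gamma> (n + 2) (R x) = - \<gamma> (n + 2) x"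
  using c[of 1] c[of 2] c[of "n + 1"] c[of "n + 2"] n2 by (auto simp: c_def)
 show "\<gamma> (n + j) (R x) = \<gamma> j x" "\<gamma> j (R x) = \<gamma> (n + j) x" if "j \<in> {3..n}"
  using c[of "n + j"] c[of j] that n2 by (auto simp: c_def)
qed

lemma eqI_coord: "(!!j. j \<in> {1..2 * n} ==> \<gamma> j x = \<gamma> j y) ==> x = y"
 using representation[of x 0] representation[of y 0] unfolding \<gamma>_def by (metis (no_types, lifting) sum.cong)

lemma index_cases:
 assumes "j \<in> {1..2 * n}"
 obtains "j = 1" | "j = 2" | "j = n + 1" | "j = n + 2" | "j \<in> {3..n}" | k where "j = n + k" "k \<in> {3..n}"
proof -
 consider "j = 1" | "j = 2" | "j \<in> {3..n}" | "j = n + 1" | "j = n + 2" | "j >= n + 3" using assms n2 by fastforce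
 then show ?thesis
 proof cases
  case 6
  then have "j = n + (j - n)" "j - n \<in> {3..n}" using assms by auto
  then show ?thesis using that(6) by blast
 qed (use that in blast)+
qed

lemma bdry_Fix:
 assumes "x \<in> bdry" "\<gamma> (n + 2) x = 0" shows "R x = x"
proof (rule eqI_coord)
 fix j assume "j \<in> {1..2 * n}"
 then show "\<gamma> j (R x) = \<gamma> j x"
 proof (cases j rule: index_cases)
  case (6 k)
  then show ?thesis using assms coord_R(5)[of k x] by (auto simp: bdry_def)
 qed (use assms coord_R in \<open>auto simp: bdry_def\<close>)
qed

lemma Fix_bdry:
 assumes "R x = x" "ip (\<phi> 2 0) x = 0" shows "x \<in> bdry" "\<gamma> (n + 2) x = 0"
proof -
 show "\<gamma> (n + 2) x = 0" using coord_R(4)[of x] assms by simp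
 have "\<gamma> 1 x = 0" using coord_R(1)[of x] assms by simp
 moreover have "\<gamma> (n + j) x = \<gamma> j x" if "j \<in> {3..n}" for j
  using coord_R(5)[OF that, of x] assms by simp
 ultimately show "x \<in> bdry" using assms by (simp add: bdry_def)
qed

lemma R_Fix_orth: "R x = x ==> R y = - y ==> ip y x = 0"
 using R_orth unfolding orth_compl_def by blast

lemma hsol_map:
 assumes y: "hsol A y g" and J: "linear J" and comm: "!!t x. t >= 0 ==> A t (J x) = J (A t x)"
 shows "hsol A (%t. J (y t)) (%t. J (g t))"
 unfolding hsol_def
proof (intro allI impI)
 fix t :: real assume t: "t >= 0"
 have J': "bounded_linear J" using J by (simp add: linear_conv_bounded_linear)
 have "(y has_vector_derivative A t (y t) + g t) (at t within {0..})" using y t by (simp add: hsol_def)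
 from bounded_linear.has_vector_derivative[OF J' this]
 show "((%t. J (y t)) has_vector_derivative A t (J (y t)) + J (g t)) (at t within {0..})"
  by (simp add: linear_add[OF J] comm[OF t])
qed

lemma bounded_linear_image_halfline:
 fixes J :: "real ^ 'm => real ^ 'm" and y :: "real => real ^ 'm"
 assumes "linear J" "bounded (y ` {0..})" shows "bounded ((%t. J (y t)) ` {0..})"
 using bounded_linear_image[OF assms(2)] assms(1) by (simp add: linear_conv_bounded_linear image_image)

text \<open>Applying \<open>S\<close> or \<open>R S R\<close> and changing sign gives a bounded solution of the same equation; the difference is a bounded homogeneous solution, which is excluded by its value at \<open>0\<close>.\<close>

lemma Ksol_V:
 assumes y: "Ksol g y" and gV: "!!t. t >= 0 ==> g t \<in> V \<sigma>" and l0: "\<gamma> (n + 2) (y 0) = 0"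
  and \<sigma>: "\<sigma> = 1 \<or> \<sigma> = - 1" and t: "t >= 0"
 shows "y t \<in> V \<sigma>"
proof -
 have ys: "hsol A y g" "bounded (y ` {0..})" "y 0 \<in> bdry" using y by (auto simp: Ksol_def)
 have Ry: "R (y 0) = y 0" by (rule bdry_Fix[OF ys(3) l0])
 define z1 where "z1 t = \<sigma> *\<^sub>R S (y t) - y t" for t
 define z2 where "z2 t = \<sigma> *\<^sub>R TT (y t) - y t" for t
 have ss: "\<sigma> *\<^sub>R \<sigma> *\<^sub>R x = x" for x :: "real ^ 'm" using \<sigma> by auto
 have ss1: "\<sigma> * \<sigma> = 1" using \<sigma> by auto
 have z1: "hsol A z1 (%_. 0)"
 proof -
  have "hsol A (%t. \<sigma> *\<^sub>R S (y t) + (- 1) *\<^sub>R y t) (%t. \<sigma> *\<^sub>R S (g t) + (- 1) *\<^sub>R g t)"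
   by (rule hsol_lincomb[OF hsol_map[OF ys(1) linS S_A] ys(1)])
  then show ?thesis using gV by (simp add: hsol_def z1_def[abs_def] V_def ss1)
 qed
 have z2: "hsol A z2 (%_. 0)"
 proof -
  have "hsol A (%t. \<sigma> *\<^sub>R TT (y t) + (- 1) *\<^sub>R y t) (%t. \<sigma> *\<^sub>R TT (g t) + (- 1) *\<^sub>R g t)"
   by (rule hsol_lincomb[OF hsol_map[OF ys(1) linTT T_A] ys(1)])
  then show ?thesis using gV by (simp add: hsol_def z2_def[abs_def] V_def ss1)
 qed
 have b1: "bounded (z1 ` {0..})" unfolding z1_def
  by (rule bounded_minus_comp[OF bounded_scaleR_comp[OF bounded_linear_image_halfline[OF linS ys(2)]] ys(2)])
 have b2: "bounded (z2 ` {0..})" unfolding z2_def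
  by (rule bounded_minus_comp[OF bounded_scaleR_comp[OF bounded_linear_image_halfline[OF linTT ys(2)]] ys(2)])
 define \<eta> where "\<eta> = z1 0"
 have R\<eta>: "R \<eta> = z2 0"
  by (simp add: \<eta>_def z1_def z2_def linear_diff[OF linR] linear_cmul[OF linR] Ry)
 have c1: "\<gamma> j \<eta> = 0" if "j \<in> {n + 1..2 * n}" for j
  using bounded_hom_coord[OF z1 b1 that] by (simp add: \<eta>_def \<gamma>_def)
 have c2: "\<gamma> j (R \<eta>) = 0" if "j \<in> {n + 1..2 * n}" for j
  using bounded_hom_coord[OF z2 b2 that] by (simp add: R\<eta> \<gamma>_def)
 have \<eta>: "\<eta> = \<gamma> 1 \<eta> *\<^sub>R \<phi> 1 0 + \<gamma> 2 \<eta> *\<^sub>R \<phi> 2 0"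
 proof -
  have z: "\<gamma> j \<eta> = 0" if "j \<in> {3..n}" for j
   using coord_R(5)[OF that, of \<eta>] c2[of "n + j"] that by simp
  have "\<eta> = (\<Sum>j\<in>{1..2 * n}. \<gamma> j \<eta> *\<^sub>R \<phi> j 0)" using representation[of \<eta> 0] by (simp add: \<gamma>_def)
  also have "\<dots> = \<gamma> 1 \<eta> *\<^sub>R \<phi> 1 0 + \<gamma> 2 \<eta> *\<^sub>R \<phi> 2 0"
  proof -
   have "(\<Sum>j\<in>{3..n}. \<gamma> j \<eta> *\<^sub>R \<phi> j 0 + \<gamma> (n + j) \<eta> *\<^sub>R \<phi> (n + j) 0) = 0"
    using z c1 by (intro sum.neutral) auto
   moreover have "\<gamma> (n + 1) \<eta> = 0" "\<gamma> (n + 2) \<eta> = 0" using c1[of "n + 1"] c1[of "n + 2"] n2 by auto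
   ultimately show ?thesis unfolding sum_split by simp
  qed
  finally show ?thesis .
 qed
 have p12: "ip (\<phi> 1 0) (\<phi> 2 0) = 0" by (rule R_Fix_orth[OF phi2_R phi_R1])
 have "ip (\<phi> 1 0) \<eta> = \<sigma> * ip (S (\<phi> 1 0)) (y 0) - ip (\<phi> 1 0) (y 0)"
  by (simp add: \<eta>_def z1_def ip_diff ip_scale S_adj)
 also have "\<dots> = 0" using R_Fix_orth[OF Ry phi_R1] unfolding S_phi1 by simp
 finally have e1: "ip (\<phi> 1 0) \<eta> = 0" .
 have "ip (\<phi> 2 0) \<eta> = \<sigma> * ip (S (\<phi> 2 0)) (y 0) - ip (\<phi> 2 0) (y 0)"
  by (simp add: \<eta>_def z1_def ip_diff ip_scale S_adj)
 also have "\<dots> = 0" using ys(3) by (simp add: S_phi2 ip_minus_left bdry_def)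
 finally have e2: "ip (\<phi> 2 0) \<eta> = 0" .
 have "\<phi> 1 0 ~= 0" using dual[of 1 1 0] n2 by (auto simp: ip_0)
 then have pos1: "ip (\<phi> 1 0) (\<phi> 1 0) > 0" by (rule ip_pos)
 have e1': "ip (\<phi> 1 0) (\<gamma> 1 \<eta> *\<^sub>R \<phi> 1 0 + \<gamma> 2 \<eta> *\<^sub>R \<phi> 2 0) = 0"
  using e1 unfolding \<eta>[symmetric] .
 have e2': "ip (\<phi> 2 0) (\<gamma> 1 \<eta> *\<^sub>R \<phi> 1 0 + \<gamma> 2 \<eta> *\<^sub>R \<phi> 2 0) = 0"
  using e2 unfolding \<eta>[symmetric] .
 have "\<gamma> 1 \<eta> * ip (\<phi> 1 0) (\<phi> 1 0) = 0"
  using e1' by (simp only: ip_add ip_scale p12 mult_zero_right add_0_right)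
 moreover have "\<gamma> 2 \<eta> * ip (\<phi> 2 0) (\<phi> 2 0) = 0"
  using e2' by (simp only: ip_add ip_scale p12 ip_sym[of "\<phi> 2 0" "\<phi> 1 0"] mult_zero_right add_0_left)
 ultimately have \<eta>0: "\<eta> = 0" using \<eta> pos1 phi2_nonzero by simp
 have "z1 t = 0" by (rule hsol_unique_zero[OF z1 _ A_bound t]) (use \<eta>0 in \<open>simp add: \<eta>_def\<close>)
 moreover have "z2 t = 0"
  by (rule hsol_unique_zero[OF z2 _ A_bound t]) (use \<eta>0 R\<eta> linear_0[OF linR] in simp)
 ultimately have "\<sigma> *\<^sub>R S (y t) = y t" "\<sigma> *\<^sub>R TT (y t) = y t" by (simp_all add: z1_def z2_def)
 then show ?thesis using ss unfolding V_def by (metis (mono_tags, lifting) mem_Collect_eq)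
qed

end

text \<open>The triangular linear problem for the unknowns \<open>(y, v, \<mu>)\<close>. The solution \<open>\<xi>\<close> is the response of \<open>y\<close> to \<open>\<mu> = 1\<close> and \<open>va\<close> the induced response of \<open>v\<close>, which must violate the boundary condition.\<close>

locale linearized_bifurcation = symmetric_homoclinic_VE L R n \<Lambda> A ip \<phi> \<psi> S
 for L R :: "real ^ 'm => real ^ 'm" and n \<Lambda> A ip \<phi> \<psi> S +
 fixes fm \<eta> :: "real => real ^ 'm" and B :: "real => real ^ 'm => real ^ 'm"
  and \<xi> va :: "real => real ^ 'm" and MB :: real
 assumes fm: "continuous_on {0..} fm" "(fm \<longlongrightarrow> 0) at_top" "!!t. t >= 0 ==> fm t \<in> V 1"
  and eta: "continuous_on {0..} \<eta>" "(\<eta> \<longlongrightarrow> 0) at_top" "!!t. t >= 0 ==> \<eta> t \<in> V (- 1)"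
  and linB: "!!t. linear (B t)" and B_bound: "!!t x. t >= 0 ==> norm (B t x) <= MB * norm x"
  and B_cont: "!!y. continuous_on {0..} y ==> continuous_on {0..} (%t. B t (y t))"
  and B_V: "!!t x. t >= 0 ==> x \<in> V 1 ==> B t x \<in> V (- 1)"
  and xi: "Ksol fm \<xi>" and va: "Ksol (%t. B t (\<xi> t) + \<eta> t) va" and nondeg: "\<gamma> (n + 2) (va 0) ~= 0"
begin

lemma MB: "MB >= 0"
proof -
 obtain b :: "real ^ 'm" where b: "b \<in> Basis" using nonempty_Basis by blast
 have "0 <= norm (B 0 b)" by simp
 also have "\<dots> <= MB * norm b" by (rule B_bound) simp
 finally show ?thesis using b by simp
qed

lemma B_tendsto: "(y \<longlongrightarrow> 0) at_top ==> ((%t. B t (y t)) \<longlongrightarrow> 0) at_top"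
proof -
 assume y: "(y \<longlongrightarrow> 0) at_top"
 have "((%t. MB * norm (y t)) \<longlongrightarrow> MB * norm (0 :: real ^ 'm)) at_top" by (intro tendsto_intros y)
 then have "((%t. MB * norm (y t)) \<longlongrightarrow> 0) at_top" by simp
 moreover have "\<forall>\<^sub>F t in at_top. norm (B t (y t)) <= MB * norm (y t)"
  using eventually_ge_at_top[of 0] by eventually_elim (rule B_bound)
 ultimately show ?thesis by (rule Lim_null_comparison[rotated])
qed

definition Qsol :: "(real => real ^ 'm) => (real => real ^ 'm) => (real => real ^ 'm) => (real => real ^ 'm) => real => bool" where
 "Qsol h1 h2 y v \<mu> \<longleftrightarrow> Ksol (%t. \<mu> *\<^sub>R fm t + h1 t) y & Ksol (%t. B t (y t) + \<mu> *\<^sub>R \<eta> t + h2 t) v &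
   \<gamma> (n + 2) (v 0) = 0"

definition admissible :: "(real => real ^ 'm) => (real => real ^ 'm) => bool" where
 "admissible h1 h2 \<longleftrightarrow> continuous_on {0..} h1 & continuous_on {0..} h2 & (h1 \<longlongrightarrow> 0) at_top & (h2 \<longlongrightarrow> 0) at_top &
   (ALL t>=0. h1 t \<in> V 1) & (ALL t>=0. h2 t \<in> V (- 1))"

lemma Ksol_continuous: "Ksol g y ==> continuous_on {0..} y"
 by (auto simp: Ksol_def intro: hsol_continuous)

lemma \<gamma>_lincomb: "\<gamma> j (a *\<^sub>R x + b *\<^sub>R y) = a * \<gamma> j x + b * \<gamma> j y"
 by (simp add: \<gamma>_def ip_add ip_scale)

lemma Qsol_unique_zero:
 assumes "Qsol (%_. 0) (%_. 0) y v \<mu>"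
 shows "\<mu> = 0" "!!t. t >= 0 ==> y t = 0" "!!t. t >= 0 ==> v t = 0"
proof -
 have y: "Ksol (%t. \<mu> *\<^sub>R fm t) y" and v: "Ksol (%t. B t (y t) + \<mu> *\<^sub>R \<eta> t) v" and v0: "\<gamma> (n + 2) (v 0) = 0"
  using assms by (auto simp: Qsol_def)
 have "Ksol (%t. \<mu> *\<^sub>R fm t) (%t. \<mu> *\<^sub>R \<xi> t)" using Ksol_lincomb[OF xi xi, of \<mu> 0] by simp
 then have y\<xi>: "y t = \<mu> *\<^sub>R \<xi> t" if "t >= 0" for t using Ksol_unique[OF y _ that] by blast
 have "Ksol (%t. \<mu> *\<^sub>R (B t (\<xi> t) + \<eta> t)) (%t. \<mu> *\<^sub>R va t)" using Ksol_lincomb[OF va va, of \<mu> 0] by simp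
 then have "Ksol (%t. B t (y t) + \<mu> *\<^sub>R \<eta> t) (%t. \<mu> *\<^sub>R va t)"
  by (simp add: Ksol_def hsol_def y\<xi> linear_cmul[OF linB] scaleR_add_right)
 then have vv: "v t = \<mu> *\<^sub>R va t" if "t >= 0" for t using Ksol_unique[OF v _ that] by blast
 have "\<mu> * \<gamma> (n + 2) (va 0) = 0" using v0 vv[of 0] by (simp add: \<gamma>_def ip_scale)
 then show "\<mu> = 0" using nondeg by simp
 then show "!!t. t >= 0 ==> y t = 0" "!!t. t >= 0 ==> v t = 0" using y\<xi> vv by auto
qed

lemma Qsol_lincomb:
 assumes "Qsol h1 h2 y v \<mu>" "Qsol k1 k2 z w \<nu>"
 shows "Qsol (%t. a *\<^sub>R h1 t + b *\<^sub>R k1 t) (%t. a *\<^sub>R h2 t + b *\<^sub>R k2 t) (%t. a *\<^sub>R y t + b *\<^sub>R z t)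
  (%t. a *\<^sub>R v t + b *\<^sub>R w t) (a * \<mu> + b * \<nu>)"
proof -
 have e1: "(a * \<mu> + b * \<nu>) *\<^sub>R fm t + (a *\<^sub>R h1 t + b *\<^sub>R k1 t) =
  a *\<^sub>R (\<mu> *\<^sub>R fm t + h1 t) + b *\<^sub>R (\<nu> *\<^sub>R fm t + k1 t)" for t
  by (simp add: algebra_simps)
 have e2: "B t (a *\<^sub>R y t + b *\<^sub>R z t) + (a * \<mu> + b * \<nu>) *\<^sub>R \<eta> t + (a *\<^sub>R h2 t + b *\<^sub>R k2 t) =
  a *\<^sub>R (B t (y t) + \<mu> *\<^sub>R \<eta> t + h2 t) + b *\<^sub>R (B t (z t) + \<nu> *\<^sub>R \<eta> t + k2 t)" for t
  by (simp add: linear_add[OF linB] linear_cmul[OF linB] algebra_simps)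
 show ?thesis
  unfolding Qsol_def e1 e2 \<gamma>_lincomb
  using assms by (auto simp: Qsol_def intro!: Ksol_lincomb)
qed

lemma Qsol_unique:
 assumes "Qsol h1 h2 y v \<mu>" "Qsol h1 h2 z w \<nu>"
 shows "\<mu> = \<nu>" "!!t. t >= 0 ==> y t = z t" "!!t. t >= 0 ==> v t = w t"
proof -
 have "Qsol (%_. 0) (%_. 0) (%t. y t - z t) (%t. v t - w t) (\<mu> - \<nu>)"
  using Qsol_lincomb[OF assms, of 1 "-1"] by simp
 note z = Qsol_unique_zero[OF this]
 show "\<mu> = \<nu>" using z(1) by simp
 show "y t = z t" if "t >= 0" for t using z(2)[OF that] by simp
 show "v t = w t" if "t >= 0" for t using z(3)[OF that] by simp
qed

text \<open>First the triangular system is solved with \<open>\<mu> = 0\<close>; then a multiple of the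
 solution for \<open>\<mu> = 1\<close> is added to remove the obstruction. Here \<open>nondeg\<close>
 enters.\<close>

lemma Qsol_exists:
 assumes "admissible h1 h2"
 shows "EX y v \<mu>. Qsol h1 h2 y v \<mu>"
proof -
 have h: "continuous_on {0..} h1" "continuous_on {0..} h2" "(h1 \<longlongrightarrow> 0) at_top" "(h2 \<longlongrightarrow> 0) at_top"
  using assms by (auto simp: admissible_def)
 obtain y1 where y1: "Ksol h1 y1" using Ksol_exists[OF h(1,3)] by blast
 have "continuous_on {0..} (%t. B t (y1 t) + h2 t)"
  by (intro continuous_on_add B_cont Ksol_continuous[OF y1] h)
 moreover have "((%t. B t (y1 t) + h2 t) \<longlongrightarrow> 0 + 0) at_top"
  by (intro tendsto_add B_tendsto Ksol_tendsto[OF y1] h)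
 ultimately obtain v1 where v1: "Ksol (%t. B t (y1 t) + h2 t) v1" using Ksol_exists by fastforce
 define \<mu> where "\<mu> = - \<gamma> (n + 2) (v1 0) / \<gamma> (n + 2) (va 0)"
 have "Ksol (%t. \<mu> *\<^sub>R fm t + h1 t) (%t. \<mu> *\<^sub>R \<xi> t + y1 t)"
  using Ksol_lincomb[OF xi y1, of \<mu> 1] by simp
 moreover have "Ksol (%t. B t (\<mu> *\<^sub>R \<xi> t + y1 t) + \<mu> *\<^sub>R \<eta> t + h2 t) (%t. \<mu> *\<^sub>R va t + v1 t)"
  using Ksol_lincomb[OF va v1, of \<mu> 1]
  by (simp add: linear_add[OF linB] linear_cmul[OF linB] scaleR_add_right add_ac)
 moreover have "\<gamma> (n + 2) (\<mu> *\<^sub>R va 0 + v1 0) = 0"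
  using \<gamma>_lincomb[of "n + 2" \<mu> "va 0" 1 "v1 0"] nondeg by (simp add: \<mu>_def)
 ultimately show ?thesis unfolding Qsol_def by blast
qed

lemma \<gamma>_bounded: "EX C>=0. ALL x. \<bar>\<gamma> j x\<bar> <= C * norm x"
 using bounded_linear.nonneg_bounded[OF ip_bounded_linear[of "\<psi> j 0"]] by (auto simp: \<gamma>_def mult.commute)

lemma Qsol_bound:
 "EX C>=0. ALL h1 h2 y v \<mu> H. admissible h1 h2 --> Qsol h1 h2 y v \<mu> -->
   (ALL t>=0. norm (h1 t) <= H) --> (ALL t>=0. norm (h2 t) <= H) -->
   \<bar>\<mu>\<bar> <= C * H & (ALL t>=0. norm (y t) <= C * H) & (ALL t>=0. norm (v t) <= C * H)"
proof -
 obtain G where G: "G >= 0" "!!x. \<bar>\<gamma> (n + 2) x\<bar> <= G * norm x" using \<gamma>_bounded by blast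
 obtain X where X: "!!t. t >= 0 ==> norm (\<xi> t) <= X" using xi unfolding Ksol_def bounded_iff by auto
 obtain W where W: "!!t. t >= 0 ==> norm (va t) <= W" using va unfolding Ksol_def bounded_iff by auto
 have X0: "X >= 0" and W0: "W >= 0" using X[of 0] W[of 0] norm_ge_zero order_trans by blast+
 define a where "a = \<bar>\<gamma> (n + 2) (va 0)\<bar>"
 have a: "a > 0" using nondeg by (simp add: a_def)
 have K0: "K_const >= 0" using K_const by blast
 define C1 where "C1 = K_const"
 define C2 where "C2 = K_const * (MB * C1 + 1)"
 define C3 where "C3 = G * C2 / a"
 define C where "C = C3 + (C3 * X + C1) + (C3 * W + C2)"
 have C123: "C1 >= 0" "C2 >= 0" "C3 >= 0" using K0 MB G a by (auto simp: C1_def C2_def C3_def)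
 have C: "C >= 0" "C3 <= C" "C3 * X + C1 <= C" "C3 * W + C2 <= C" using C123 X0 W0 by (auto simp: C_def)
 have "\<bar>\<mu>\<bar> <= C * H & (ALL t>=0. norm (y t) <= C * H) & (ALL t>=0. norm (v t) <= C * H)"
  if adm: "admissible h1 h2" and Q: "Qsol h1 h2 y v \<mu>" and h1H: "ALL t>=0. norm (h1 t) <= H" and h2H: "ALL t>=0. norm (h2 t) <= H"
  for h1 h2 y v \<mu> H
 proof -
  have H: "H >= 0" using h1H norm_ge_zero order_trans by blast
  have h: "continuous_on {0..} h1" "continuous_on {0..} h2" "(h1 \<longlongrightarrow> 0) at_top" "(h2 \<longlongrightarrow> 0) at_top"
   using adm by (auto simp: admissible_def)
  obtain y1 where y1: "Ksol h1 y1" using Ksol_exists[OF h(1,3)] by blast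
  have c: "continuous_on {0..} (%t. B t (y1 t) + h2 t)"
   by (intro continuous_on_add B_cont Ksol_continuous[OF y1] h)
  moreover have "((%t. B t (y1 t) + h2 t) \<longlongrightarrow> 0 + 0) at_top"
   by (intro tendsto_add B_tendsto Ksol_tendsto[OF y1] h)
  ultimately obtain v1 where v1: "Ksol (%t. B t (y1 t) + h2 t) v1" using Ksol_exists by fastforce
  define \<mu>' where "\<mu>' = - \<gamma> (n + 2) (v1 0) / \<gamma> (n + 2) (va 0)"
  have Q': "Qsol h1 h2 (%t. \<mu>' *\<^sub>R \<xi> t + y1 t) (%t. \<mu>' *\<^sub>R va t + v1 t) \<mu>'"
  proof -
   have "Ksol (%t. \<mu>' *\<^sub>R fm t + h1 t) (%t. \<mu>' *\<^sub>R \<xi> t + y1 t)"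
    using Ksol_lincomb[OF xi y1, of \<mu>' 1] by simp
   moreover have "Ksol (%t. B t (\<mu>' *\<^sub>R \<xi> t + y1 t) + \<mu>' *\<^sub>R \<eta> t + h2 t) (%t. \<mu>' *\<^sub>R va t + v1 t)"
    using Ksol_lincomb[OF va v1, of \<mu>' 1]
    by (simp add: linear_add[OF linB] linear_cmul[OF linB] scaleR_add_right add_ac)
   moreover have "\<gamma> (n + 2) (\<mu>' *\<^sub>R va 0 + v1 0) = 0"
    using \<gamma>_lincomb[of "n + 2" \<mu>' "va 0" 1 "v1 0"] nondeg by (simp add: \<mu>'_def)
   ultimately show ?thesis unfolding Qsol_def by blast
  qed
  have eq: "\<mu> = \<mu>'" "!!t. t >= 0 ==> y t = \<mu>' *\<^sub>R \<xi> t + y1 t" "!!t. t >= 0 ==> v t = \<mu>' *\<^sub>R va t + v1 t"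
   using Qsol_unique[OF Q Q'] by auto
  have by1: "norm (y1 t) <= C1 * H" if "t >= 0" for t
   unfolding C1_def by (rule Ksol_bound[OF y1 h(1) _ that]) (use h1H in blast)
  have bv1: "norm (v1 t) <= C2 * H" if "t >= 0" for t
  proof -
   have "norm (v1 t) <= K_const * (MB * (C1 * H) + H)"
   proof (rule Ksol_bound[OF v1 c _ that])
    fix s :: real assume s: "s >= 0"
    have "norm (B s (y1 s)) <= MB * (C1 * H)"
     using B_bound[OF s, of "y1 s"] by1[OF s] MB by (meson mult_left_mono order_trans)
    then show "norm (B s (y1 s) + h2 s) <= MB * (C1 * H) + H"
     using h2H s by (intro order_trans[OF norm_triangle_ineq] add_mono) auto
   qed
   then show ?thesis by (simp add: C2_def algebra_simps)
  qed
  have b\<mu>: "\<bar>\<mu>'\<bar> <= C3 * H"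
  proof -
   have "\<bar>\<gamma> (n + 2) (v1 0)\<bar> <= G * (C2 * H)"
    using G(2)[of "v1 0"] bv1[of 0] G(1) by (meson mult_left_mono order_refl order_trans)
   then have "\<bar>\<mu>'\<bar> <= G * (C2 * H) / a" using a by (simp add: \<mu>'_def a_def divide_right_mono)
   then show ?thesis by (simp add: C3_def)
  qed
  have "norm (y t) <= C * H" if t: "t >= 0" for t
  proof -
   have "norm (y t) <= \<bar>\<mu>'\<bar> * norm (\<xi> t) + norm (y1 t)"
    unfolding eq(2)[OF t] by (rule order_trans[OF norm_triangle_ineq]) simp
   also have "\<dots> <= (C3 * H) * X + C1 * H"
    using b\<mu> X[OF t] by1[OF t] C123 H by (intro add_mono mult_mono) auto
   also have "\<dots> = (C3 * X + C1) * H" by (simp add: algebra_simps)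
   also have "\<dots> <= C * H" using C H by (intro mult_right_mono) auto
   finally show ?thesis .
  qed
  moreover have "norm (v t) <= C * H" if t: "t >= 0" for t
  proof -
   have "norm (v t) <= \<bar>\<mu>'\<bar> * norm (va t) + norm (v1 t)"
    unfolding eq(3)[OF t] by (rule order_trans[OF norm_triangle_ineq]) simp
   also have "\<dots> <= (C3 * H) * W + C2 * H"
    using b\<mu> W[OF t] bv1[OF t] C123 H by (intro add_mono mult_mono) auto
   also have "\<dots> = (C3 * W + C2) * H" by (simp add: algebra_simps)
   also have "\<dots> <= C * H" using C H by (intro mult_right_mono) auto
   finally show ?thesis .
  qed
  moreover have "\<bar>\<mu>\<bar> <= C * H"
   unfolding eq(1) using b\<mu> C H by (meson mult_right_mono order_trans)
  ultimately show ?thesis by blast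
 qed
 then show ?thesis using C(1) by blast
qed

lemma Qsol_V:
 assumes adm: "admissible h1 h2" and Q: "Qsol h1 h2 y v \<mu>"
 shows "!!t. t >= 0 ==> y t \<in> V 1" "!!t. t >= 0 ==> v t \<in> V (- 1)" "R (y 0) = y 0" "R (v 0) = v 0"
  "(y \<longlongrightarrow> 0) at_top" "(v \<longlongrightarrow> 0) at_top"
proof -
 have y: "Ksol (%t. \<mu> *\<^sub>R fm t + h1 t) y" and v: "Ksol (%t. B t (y t) + \<mu> *\<^sub>R \<eta> t + h2 t) v"
  and v0: "\<gamma> (n + 2) (v 0) = 0" using Q by (auto simp: Qsol_def)
 have h: "continuous_on {0..} h1" "continuous_on {0..} h2" "(h1 \<longlongrightarrow> 0) at_top" "(h2 \<longlongrightarrow> 0) at_top"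
  "!!t. t >= 0 ==> h1 t \<in> V 1" "!!t. t >= 0 ==> h2 t \<in> V (- 1)"
  using adm by (auto simp: admissible_def)
 have g1: "\<mu> *\<^sub>R fm t + h1 t \<in> V 1" if "t >= 0" for t
  using V_lincomb[OF fm(3)[OF that] h(5)[OF that], of \<mu> 1] by simp
 have "((%t. \<mu> *\<^sub>R fm t + h1 t) \<longlongrightarrow> \<mu> *\<^sub>R 0 + 0) at_top" by (intro tendsto_intros fm h)
 then have t1: "((%t. \<mu> *\<^sub>R fm t + h1 t) \<longlongrightarrow> 0) at_top" by simp
 have c1: "continuous_on {0..} (%t. \<mu> *\<^sub>R fm t + h1 t)" by (intro continuous_intros fm h)
 have y0: "\<gamma> (n + 2) (y 0) = 0"
  by (rule solvability_zero[OF c1 t1 y]) (use g1 V_plus_orth in blast)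
 show yV: "!!t. t >= 0 ==> y t \<in> V 1" by (rule Ksol_V[OF y g1 y0]) auto
 have g2: "B t (y t) + \<mu> *\<^sub>R \<eta> t + h2 t \<in> V (- 1)" if t: "t >= 0" for t
  using subspace_add[OF subspace_V subspace_add[OF subspace_V B_V[OF t yV[OF t]] subspace_scale[OF subspace_V eta(3)[OF t]]] h(6)[OF t]] .
 show "!!t. t >= 0 ==> v t \<in> V (- 1)" by (rule Ksol_V[OF v g2 v0]) auto
 show "R (y 0) = y 0" by (rule bdry_Fix[OF _ y0]) (use y in \<open>simp add: Ksol_def\<close>)
 show "R (v 0) = v 0" by (rule bdry_Fix[OF _ v0]) (use v in \<open>simp add: Ksol_def\<close>)
 show yt: "(y \<longlongrightarrow> 0) at_top" by (rule Ksol_tendsto[OF y t1])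
 have "((%t. B t (y t) + \<mu> *\<^sub>R \<eta> t + h2 t) \<longlongrightarrow> 0 + \<mu> *\<^sub>R 0 + 0) at_top"
  by (intro tendsto_add tendsto_scaleR tendsto_const B_tendsto yt eta h)
 then show "(v \<longlongrightarrow> 0) at_top" by (intro Ksol_tendsto[OF v]) simp
qed

end

section \<open>The nonlinear problem in a space of bounded functions\<close>

lemma hsol_cong:
 assumes "hsol A y g" "!!t. t >= 0 ==> y' t = y t" "!!t. t >= 0 ==> g' t = g t"
 shows "hsol A y' g'"
 unfolding hsol_def
proof (intro allI impI)
 fix t :: real assume t: "t >= 0"
 have "(y has_vector_derivative A t (y t) + g t) (at t within {0..})" using assms(1) t by (simp add: hsol_def)
 then have "(y' has_vector_derivative A t (y t) + g t) (at t within {0..})"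
  by (rule has_vector_derivative_transform[rotated 2]) (use t assms(2) in auto)
 then show "(y' has_vector_derivative A t (y' t) + g' t) (at t within {0..})"
  using assms(2,3) t by simp
qed

text \<open>Functions on \<open>[0,\<infinity>)\<close> as bounded continuous functions on the line, constant for negative time.\<close>

definition halfline_bcontfun :: "(real => 'a::real_normed_vector) => real \<Rightarrow>\<^sub>C 'a" where
 "halfline_bcontfun y = Bcontfun (%t. y (max 0 t))"

lemma halfline_bcontfun:
 assumes "continuous_on {0..} y" "bounded (y ` {0..})"
 shows "apply_bcontfun (halfline_bcontfun y) t = y (max 0 t)"
proof -
 have "continuous_on UNIV (%t. y (max 0 t))"
  by (rule continuous_on_compose2[OF assms(1)]) (auto intro!: continuous_intros)
 moreover have "bounded (range (%t. y (max 0 t)))"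
  by (rule bounded_subset[OF assms(2)]) auto
 ultimately have "(%t. y (max 0 t)) \<in> bcontfun" by (simp add: bcontfun_def)
 then show ?thesis by (simp add: halfline_bcontfun_def Bcontfun_inverse)
qed

text \<open>Decay at infinity and values in a closed set survive uniform limits.\<close>

lemma closed_decaying:
 fixes X :: "'a::real_normed_vector set"
 assumes X: "closed X"
 shows "closed {u :: real \<Rightarrow>\<^sub>C 'a. (apply_bcontfun u \<longlongrightarrow> 0) at_top & (ALL t>=0. apply_bcontfun u t \<in> X)}" (is "closed ?Z")
 unfolding closed_sequential_limits
proof (intro allI impI, elim conjE)
 fix u l assume u: "ALL k. u k \<in> ?Z" and lim: "u \<longlonglongrightarrow> l"
 have pt: "(%k. apply_bcontfun (u k) t) \<longlonglongrightarrow> apply_bcontfun l t" for t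
 proof (rule metric_tendsto_imp_tendsto[OF lim])
  show "\<forall>\<^sub>F k in sequentially. dist (apply_bcontfun (u k) t) (apply_bcontfun l t) <= dist (u k) l"
   by (simp add: dist_bounded)
 qed
 have "apply_bcontfun l t \<in> X" if "t >= 0" for t
  using closed_sequentially[OF X _ pt[of t]] u that by auto
 moreover have "(apply_bcontfun l \<longlongrightarrow> 0) at_top"
 proof (rule tendstoI)
  fix e :: real assume e: "e > 0"
  have "\<forall>\<^sub>F k in sequentially. dist (u k) l < e / 2" using tendstoD[OF lim, of "e / 2"] e by simp
  then obtain k where k: "dist (u k) l < e / 2" by (meson eventually_sequentially order_refl)
  have "(apply_bcontfun (u k) \<longlongrightarrow> 0) at_top" using u by simp
  then have "\<forall>\<^sub>F t in at_top. dist (apply_bcontfun (u k) t) 0 < e / 2" using tendstoD e by (metis half_gt_zero)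
  then show "\<forall>\<^sub>F t in at_top. dist (apply_bcontfun l t) 0 < e"
  proof eventually_elim
   case (elim t)
   have "dist (apply_bcontfun l t) 0 <=
     dist (apply_bcontfun (u k) t) (apply_bcontfun l t) + dist (apply_bcontfun (u k) t) 0"
    by (metis dist_commute dist_triangle)
   also have "\<dots> < e" using dist_bounded[of "u k" t l] k elim by linarith
   finally show ?case .
  qed
 qed
 ultimately show "l \<in> ?Z" by simp
qed

lemma derivative_in_subspace:
 fixes F :: "'a::euclidean_space => 'b::euclidean_space"
 assumes F: "(F has_derivative F') (at x)" and X: "subspace X" "x \<in> X" "h \<in> X"
  and Y: "subspace Y" and map: "!!x. x \<in> X ==> F x \<in> Y"
 shows "F' h \<in> Y"
proof -
 obtain y z where yz: "y \<in> span Y" "!!w. w \<in> span Y ==> orthogonal z w" "F' h = y + z"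
  using orthogonal_subspace_decomp_exists by metis
 have sY: "span Y = Y" using Y by (simp add: span_eq_iff)
 have "((%s. F (x + s *\<^sub>R h)) has_derivative (%s. F' (s *\<^sub>R h))) (at 0)"
  by (rule has_derivative_compose[of "%s. x + s *\<^sub>R h" "%s. s *\<^sub>R h" 0 UNIV F F'])
   (auto intro!: derivative_eq_intros F)
 then have "((%s. z \<bullet> F (x + s *\<^sub>R h)) has_derivative (%s. z \<bullet> F' (s *\<^sub>R h))) (at 0)"
  by (intro has_derivative_inner_right)
 moreover have "z \<bullet> F (x + s *\<^sub>R h) = 0" for s
 proof -
  have "F (x + s *\<^sub>R h) \<in> span Y"
   unfolding sY using X by (intro map subspace_add[OF X(1)] subspace_scale[OF X(1)])
  then show ?thesis using yz(2) by (simp add: orthogonal_def)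
 qed
 ultimately have "((%s. 0) has_derivative (%s. z \<bullet> F' (s *\<^sub>R h))) (at 0)" by simp
 from has_derivative_unique[OF this has_derivative_const]
 have "z \<bullet> F' (1 *\<^sub>R h) = 0" by meson
 then have "z \<bullet> (y + z) = 0" by (simp add: yz(3))
 moreover have "z \<bullet> y = 0" using yz(1,2) by (simp add: orthogonal_def)
 ultimately have "z = 0" by (simp add: inner_add_right)
 then show ?thesis using yz sY by simp
qed

lemma derivative_of_even:
 fixes F :: "'a::euclidean_space => 'b::euclidean_space"
 assumes F: "(F has_derivative F') (at x)" and even: "!!s. F (x + (- s) *\<^sub>R h) = F (x + s *\<^sub>R h)"
 shows "F' h = 0"
proof -
 have D: "((%s. F (x + s *\<^sub>R k)) has_derivative (%s. F' (s *\<^sub>R k))) (at 0)" for k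
  by (rule has_derivative_compose[of "%s. x + s *\<^sub>R k" "%s. s *\<^sub>R k" 0 UNIV F F'])
   (auto intro!: derivative_eq_intros F)
 have "(%s. F (x + s *\<^sub>R h)) = (%s. F (x + s *\<^sub>R (- h)))" using even by simp
 then have "(%s. F' (s *\<^sub>R h)) = (%s. F' (s *\<^sub>R (- h)))"
  using has_derivative_unique[OF D[of h]] D[of "- h"] by metis
 then have "F' (1 *\<^sub>R h) = F' (1 *\<^sub>R (- h))" by meson
 then have eq: "F' h = - F' h" using linear_neg[OF has_derivative_linear[OF F]] by simp
 have "2 *\<^sub>R F' h = F' h + F' h" by (simp add: scaleR_2)
 also have "\<dots> = F' h + - F' h" by (simp only: eq[symmetric])
 finally show ?thesis by simp
qed

locale nonlinear_problem = linearized_bifurcation L R n \<Lambda> A ip \<phi> \<psi> S fm \<eta> B \<xi> va MB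
 for L R :: "real ^ 'm => real ^ 'm" and n \<Lambda> A ip \<phi> \<psi> S fm \<eta> B \<xi> va MB +
 fixes F :: "((real ^ 'm) \<times> (real ^ 'm)) \<times> (real \<times> real) => (real ^ 'm) \<times> (real ^ 'm)"
  and F' :: "((real ^ 'm) \<times> (real ^ 'm)) \<times> (real \<times> real) => ((real ^ 'm) \<times> (real ^ 'm)) \<times> (real \<times> real) => (real ^ 'm) \<times> (real ^ 'm)"
  and F2 :: "((real ^ 'm) \<times> (real ^ 'm)) \<times> (real \<times> real) => ((real ^ 'm) \<times> (real ^ 'm)) \<times> (real \<times> real) => (real ^ 'm) \<times> (real ^ 'm)"
  and base :: "real => (real ^ 'm) \<times> (real ^ 'm)"
 assumes F': "!!z. (F has_derivative F' z) (at z)" "!!h. Ck 1 (%z. F' z h)"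
  and F2: "!!z. ((%z. F' z (0, (0, 1))) has_derivative F2 z) (at z)" "!!h. Ck 1 (%z. F2 z h)"
  and F_V: "!!x m. x \<in> V 1 \<times> V (- 1) ==> F (x, m) \<in> V 1 \<times> V (- 1)"
  and F_0: "!!m. F (0, m) = 0"
  and F_even: "!!x \<mu> q. F (x, (\<mu>, - q)) = F (x, (\<mu>, q))"
  and base: "continuous_on {0..} base" "(base \<longlongrightarrow> 0) at_top" "!!t. t >= 0 ==> base t \<in> V 1 \<times> V (- 1)"
  and base_sol: "!!t. t >= 0 ==> (base has_vector_derivative F (base t, (0, 0))) (at t within {0..})"
  and F'_base: "!!t y v \<mu>. t >= 0 ==> F' (base t, (0, 0)) ((y, v), (\<mu>, 0)) =
   (A t y + \<mu> *\<^sub>R fm t, B t y + A t v + \<mu> *\<^sub>R \<eta> t)"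
begin

abbreviation "VV \<equiv> V 1 \<times> V (- 1)"

lemma subspace_VV: "subspace VV" by (intro subspace_Times subspace_V)

abbreviation dq :: "((real ^ 'm) \<times> (real ^ 'm)) \<times> (real \<times> real)" where "dq \<equiv> (0, (0, 1))"

lemma linF': "linear (F' z)" and linF2: "linear (F2 z)"
 using F'(1) F2(1) has_derivative_linear by blast+

lemma F'_even: "F' (x, (\<mu>, 0)) dq = 0"
 by (rule derivative_of_even[OF F'(1)]) (use F_even[of x \<mu>] in simp)

lemma F'_VV: "x \<in> VV ==> h \<in> VV ==> F' (x, m) (h, k) \<in> VV"
 by (rule derivative_in_subspace[OF F'(1), where X = "VV \<times> UNIV"])
  (auto intro!: subspace_Times subspace_V F_V[unfolded mem_Times_iff, simplified] F_V)

lemma F2_VV: "x \<in> VV ==> F2 (x, m) dq \<in> VV"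
proof (rule derivative_in_subspace[OF F2(1), where X = "VV \<times> UNIV"])
 show "F' z (0, 0, 1) \<in> VV" if "z \<in> VV \<times> UNIV" for z
  using that F'_VV[of "fst z" 0 "snd z"] subspace_0[OF subspace_VV] by auto
qed (auto intro!: subspace_Times subspace_V subspace_0[OF subspace_V] simp: zero_prod_def)

lemma F'_0: "F' (0, m) (0, k) = 0"
proof -
 have "F' (0, m) (0, k) \<in> {0}"
  by (rule derivative_in_subspace[OF F'(1), where X = "{0} \<times> UNIV"])
   (auto intro!: subspace_Times simp: F_0)
 then show ?thesis by simp
qed

lemma F2_0: "F2 (0, m) dq = 0"
proof -
 have "F2 (0, m) dq \<in> {0}"
  by (rule derivative_in_subspace[OF F2(1), where X = "{0} \<times> UNIV"])
   (auto intro!: subspace_Times simp: F'_0)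
 then show ?thesis by simp
qed

text \<open>The solution operator of the linearized problem on admissible right-hand sides.\<close>

definition adm :: "(real => (real ^ 'm) \<times> (real ^ 'm)) => bool" where
 "adm h \<longleftrightarrow> continuous_on {0..} h & (h \<longlongrightarrow> 0) at_top & (ALL t>=0. h t \<in> VV)"

lemma adm_admissible: "adm h ==> admissible (%t. fst (h t)) (%t. snd (h t))"
 unfolding adm_def admissible_def
 using tendsto_fst[of h 0 at_top] tendsto_snd[of h 0 at_top]
 by (auto intro: continuous_on_fst continuous_on_snd simp: mem_Times_iff)

lemma adm_lincomb: "adm h ==> adm k ==> adm (%t. a *\<^sub>R h t + b *\<^sub>R k t)"
proof -
 assume h: "adm h" and k: "adm k"
 have "((%t. a *\<^sub>R h t + b *\<^sub>R k t) \<longlongrightarrow> a *\<^sub>R 0 + b *\<^sub>R 0) at_top"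
  using h k by (intro tendsto_intros) (auto simp: adm_def)
 moreover have "continuous_on {0..} (%t. a *\<^sub>R h t + b *\<^sub>R k t)"
  using h k by (intro continuous_intros) (auto simp: adm_def)
 moreover have "a *\<^sub>R h t + b *\<^sub>R k t \<in> VV" if "t >= 0" for t
  using h k that by (intro subspace_add[OF subspace_VV] subspace_scale[OF subspace_VV]) (auto simp: adm_def)
 ultimately show ?thesis by (simp add: adm_def)
qed

definition QQ :: "(real => (real ^ 'm) \<times> (real ^ 'm)) => (real => (real ^ 'm) \<times> (real ^ 'm)) => real => bool" where
 "QQ h z \<mu> \<longleftrightarrow> Qsol (%t. fst (h t)) (%t. snd (h t)) (%t. fst (z t)) (%t. snd (z t)) \<mu>"

definition Qop :: "(real => (real ^ 'm) \<times> (real ^ 'm)) => (real \<Rightarrow>\<^sub>C ((real ^ 'm) \<times> (real ^ 'm))) \<times> real" where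
 "Qop h = (let (z, \<mu>) = (SOME p. QQ h (fst p) (snd p)) in (halfline_bcontfun z, \<mu>))"

lemma Ksol_cong:
 assumes "Ksol g y" "!!t. t >= 0 ==> y' t = y t" "!!t. t >= 0 ==> g' t = g t"
 shows "Ksol g' y'"
proof -
 have "y' ` {0..} = y ` {0..}" using assms(2) by (intro image_cong) auto
 then show ?thesis
  using assms(1) hsol_cong[OF _ assms(2,3), of A] assms(2)[of 0] unfolding Ksol_def by auto
qed

lemma QQ_cong:
 assumes "QQ h z \<mu>" "!!t. t >= 0 ==> h' t = h t" "!!t. t >= 0 ==> z' t = z t"
 shows "QQ h' z' \<mu>"
 using assms unfolding QQ_def Qsol_def
 by (auto intro: Ksol_cong)

lemma QQ_regular:
 assumes "QQ h z \<mu>" shows "continuous_on {0..} z" "bounded (z ` {0..})"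
proof -
 have k: "continuous_on {0..} (%t. fst (z t))" "continuous_on {0..} (%t. snd (z t))"
  "bounded ((%t. fst (z t)) ` {0..})" "bounded ((%t. snd (z t)) ` {0..})"
  using assms Ksol_continuous by (auto simp: QQ_def Qsol_def Ksol_def intro: hsol_continuous)
 show "continuous_on {0..} z" using continuous_on_Pair[OF k(1,2)] by simp
 have "z ` {0..} \<subseteq> (%t. fst (z t)) ` {0..} \<times> (%t. snd (z t)) ` {0..}"
 proof (rule image_subsetI)
  fix t :: real assume t: "t \<in> {0..}"
  have "fst (z t) \<in> (%t. fst (z t)) ` {0..}" "snd (z t) \<in> (%t. snd (z t)) ` {0..}"
   by (rule imageI[OF t])+
  then show "z t \<in> (%t. fst (z t)) ` {0..} \<times> (%t. snd (z t)) ` {0..}"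
   by (simp add: mem_Times_iff)
 qed
 then show "bounded (z ` {0..})" using bounded_Times[OF k(3,4)] bounded_subset by blast
qed

lemma Qop_representative:
 assumes "adm h"
 obtains z \<mu> where "QQ h z \<mu>" "Qop h = (halfline_bcontfun z, \<mu>)"
proof -
 obtain y v \<mu> where "Qsol (%t. fst (h t)) (%t. snd (h t)) y v \<mu>"
  using Qsol_exists[OF adm_admissible[OF assms]] by blast
 then have "EX p. QQ h (fst p) (snd p)" by (intro exI[of _ "(%t. (y t, v t), \<mu>)"]) (simp add: QQ_def)
 from someI_ex[OF this] have "QQ h (fst (SOME p. QQ h (fst p) (snd p))) (snd (SOME p. QQ h (fst p) (snd p)))" .
 then show ?thesis by (rule that) (simp add: Qop_def case_prod_unfold Let_def)
qed

lemma Qop_QQ: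
 assumes "adm h" shows "QQ h (apply_bcontfun (fst (Qop h))) (snd (Qop h))"
proof -
 obtain z \<mu> where p: "QQ h z \<mu>" "Qop h = (halfline_bcontfun z, \<mu>)" using Qop_representative[OF assms] .
 show ?thesis
  using QQ_cong[OF p(1), of h "apply_bcontfun (halfline_bcontfun z)"] halfline_bcontfun[OF QQ_regular[OF p(1)]]
  by (simp add: p(2))
qed

lemma Qop_clamped:
 assumes "t <= 0" "adm h" shows "apply_bcontfun (fst (Qop h)) t = apply_bcontfun (fst (Qop h)) 0"
proof -
 obtain z \<mu> where p: "QQ h z \<mu>" "Qop h = (halfline_bcontfun z, \<mu>)" using Qop_representative[OF assms(2)] .
 then show ?thesis using halfline_bcontfun[OF QQ_regular[OF p(1)]] assms(1) by simp
qed

lemma QQ_unique: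
 assumes "QQ h z \<mu>" "QQ h w \<nu>" shows "\<mu> = \<nu>" "!!t. t >= 0 ==> z t = w t"
 using Qsol_unique[OF assms[unfolded QQ_def]] by (auto simp: prod_eq_iff)

lemma QQ_lincomb:
 assumes "QQ h z \<mu>" "QQ k w \<nu>"
 shows "QQ (%t. a *\<^sub>R h t + b *\<^sub>R k t) (%t. a *\<^sub>R z t + b *\<^sub>R w t) (a * \<mu> + b * \<nu>)"
 using Qsol_lincomb[OF assms[unfolded QQ_def], of a b] by (simp add: QQ_def)

lemma Qop_lincomb:
 assumes h: "adm h" and k: "adm k"
 shows "Qop (%t. a *\<^sub>R h t + b *\<^sub>R k t) = a *\<^sub>R Qop h + b *\<^sub>R Qop k"
proof -
 note hk = adm_lincomb[OF h k, of a b]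
 note u = QQ_unique[OF Qop_QQ[OF hk] QQ_lincomb[OF Qop_QQ[OF h] Qop_QQ[OF k], of a b]]
 have "apply_bcontfun (fst (Qop (%t. a *\<^sub>R h t + b *\<^sub>R k t))) t =
   apply_bcontfun (a *\<^sub>R fst (Qop h) + b *\<^sub>R fst (Qop k)) t" for t
 proof (cases "t >= 0")
  case True
  then show ?thesis using u(2) by simp
 next
  case False
  then have t0: "t <= 0" by simp
  have "apply_bcontfun (a *\<^sub>R fst (Qop h) + b *\<^sub>R fst (Qop k)) t =
    a *\<^sub>R apply_bcontfun (fst (Qop h)) t + b *\<^sub>R apply_bcontfun (fst (Qop k)) t" by simp
  then show ?thesis
   unfolding Qop_clamped[OF t0 h] Qop_clamped[OF t0 k] Qop_clamped[OF t0 hk]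
   using u(2)[of 0] by (simp only: order_refl)
 qed
 then have "fst (Qop (%t. a *\<^sub>R h t + b *\<^sub>R k t)) = a *\<^sub>R fst (Qop h) + b *\<^sub>R fst (Qop k)"
  by (rule bcontfun_eqI)
 then show ?thesis using u(1) by (simp add: prod_eq_iff)
qed

lemma Qop_diff: "adm h ==> adm k ==> Qop (%t. h t - k t) = Qop h - Qop k"
 using Qop_lincomb[of h k 1 "-1"] by simp

lemma Qop_scale: "adm h ==> Qop (%t. a *\<^sub>R h t) = a *\<^sub>R Qop h"
 using Qop_lincomb[of h h a 0] by simp

lemma Qop_bound: "EX C>=0. ALL h H. adm h --> (ALL t>=0. norm (h t) <= H) --> norm (Qop h) <= C * H"
proof -
 obtain C where C: "C >= 0" and est: "ALL h1 h2 y v \<mu> H. admissible h1 h2 --> Qsol h1 h2 y v \<mu> -->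
   (ALL t>=0. norm (h1 t) <= H) --> (ALL t>=0. norm (h2 t) <= H) -->
   \<bar>\<mu>\<bar> <= C * H & (ALL t>=0. norm (y t) <= C * H) & (ALL t>=0. norm (v t) <= C * H)"
  using Qsol_bound by (elim exE conjE) (rule that, assumption, assumption)
 have "norm (Qop h) <= (3 * C) * H" if h: "adm h" and H: "ALL t>=0. norm (h t) <= H" for h H
 proof -
  have H1: "ALL t>=0. norm (fst (h t)) <= H" and H2: "ALL t>=0. norm (snd (h t)) <= H"
   using H norm_fst_le[of "fst (h t)" "snd (h t)" for t] norm_snd_le[of "snd (h t)" "fst (h t)" for t]
   by (auto intro: order_trans)
  define z where "z = apply_bcontfun (fst (Qop h))"
  have e: "\<bar>snd (Qop h)\<bar> <= C * H & (ALL t>=0. norm (fst (z t)) <= C * H) & (ALL t>=0. norm (snd (z t)) <= C * H)"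
   using est[THEN spec, THEN spec, THEN spec, THEN spec, THEN spec, THEN spec, THEN mp, THEN mp, THEN mp, THEN mp,
     OF adm_admissible[OF h] Qop_QQ[OF h, unfolded QQ_def] H1 H2]
   by (simp add: z_def)
  have z: "norm (z t) <= 2 * C * H" if "t >= 0" for t
  proof -
   have "norm (z t) <= norm (fst (z t)) + norm (snd (z t))" using norm_Pair_le[of "fst (z t)" "snd (z t)"] by simp
   then show ?thesis using e that by fastforce
  qed
  have "norm (fst (Qop h)) <= 2 * C * H"
  proof (rule norm_bound)
   fix t show "norm (apply_bcontfun (fst (Qop h)) t) <= 2 * C * H"
   proof (cases "t >= 0")
    case True
    then show ?thesis using z[of t] by (simp add: z_def)
   next
    case False
    then have "apply_bcontfun (fst (Qop h)) t = z 0" using Qop_clamped[of t h] h by (simp add: z_def)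
    then show ?thesis using z[of 0] by simp
   qed
  qed
  then show ?thesis using norm_Pair_le[of "fst (Qop h)" "snd (Qop h)"] e by simp
 qed
 then show ?thesis using C by (intro exI[of _ "3 * C"]) auto
qed

definition ZZ :: "((real \<Rightarrow>\<^sub>C ((real ^ 'm) \<times> (real ^ 'm))) \<times> real) set" where
 "ZZ = {u. (apply_bcontfun (fst u) \<longlongrightarrow> 0) at_top & (ALL t>=0. apply_bcontfun (fst u) t \<in> VV)}"

lemma subspace_ZZ: "subspace ZZ"
 unfolding subspace_def
proof (intro conjI ballI allI)
 show "0 \<in> ZZ" unfolding ZZ_def using subspace_0[OF subspace_VV] by simp
 show "u + v \<in> ZZ" if "u \<in> ZZ" "v \<in> ZZ" for u v
  using that tendsto_add[of "apply_bcontfun (fst u)" 0 at_top "apply_bcontfun (fst v)" 0]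
   subspace_add[OF subspace_VV] unfolding ZZ_def by auto
 show "c *\<^sub>R u \<in> ZZ" if "u \<in> ZZ" for c u
  using that tendsto_scaleR[OF tendsto_const, of "apply_bcontfun (fst u)" 0 at_top c]
   subspace_scale[OF subspace_VV] unfolding ZZ_def by auto
qed

lemma closed_ZZ: "closed ZZ"
proof -
 have "ZZ = fst -` {u. (apply_bcontfun u \<longlongrightarrow> 0) at_top & (ALL t>=0. apply_bcontfun u t \<in> VV)}"
  by (auto simp: ZZ_def)
 then show ?thesis using closed_vimage_fst[OF closed_decaying[OF closed_subspace[OF subspace_VV]]] by simp
qed

lemma Qop_ZZ: "adm h ==> Qop h \<in> ZZ"
proof -
 assume h: "adm h"
 note V = Qsol_V[OF adm_admissible[OF h] Qop_QQ[OF h, unfolded QQ_def]]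
 show ?thesis
  unfolding ZZ_def using V(1,2) tendsto_Pair[OF V(5,6)] by (auto simp: mem_Times_iff zero_prod_def)
qed

text \<open>Evaluation of an unknown \<open>u = (z, \<mu>)\<close> and a parameter \<open>q\<close> at time \<open>t\<close>.\<close>

definition ev :: "(real \<Rightarrow>\<^sub>C ((real ^ 'm) \<times> (real ^ 'm))) \<times> real => real => real => ((real ^ 'm) \<times> (real ^ 'm)) \<times> (real \<times> real)" where
 "ev u q t = (apply_bcontfun (fst u) t, (snd u, q))"

definition bb :: "real => ((real ^ 'm) \<times> (real ^ 'm)) \<times> (real \<times> real)" where "bb t = (base t, (0, 0))"

lemma ev_diff: "ev v \<beta> t - ev u q t = ev (v - u) (\<beta> - q) t"
 by (simp add: ev_def)

lemma ev_split: "ev u q t = ev u 0 t + q *\<^sub>R dq"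
 by (simp add: ev_def)

lemma norm_ev: "norm (ev u q t) <= 2 * norm u + \<bar>q\<bar>"
proof -
 have "norm (ev u q t) <= norm (apply_bcontfun (fst u) t) + norm (snd u, q)"
  unfolding ev_def by (rule norm_Pair_le)
 also have "\<dots> <= norm (fst u) + (norm (snd u) + norm q)"
  by (intro add_mono norm_bounded norm_Pair_le)
 also have "\<dots> <= norm u + (norm u + norm q)"
  using norm_fst_le[of "fst u" "snd u"] norm_snd_le[of "snd u" "fst u"] by simp
 finally show ?thesis by simp
qed

lemma ev_continuous: "continuous_on {0..} (ev u q)"
 unfolding ev_def[abs_def] by (intro continuous_intros continuous_on_apply_bcontfun)

lemma bb_continuous: "continuous_on {0..} bb"
 unfolding bb_def[abs_def] by (intro continuous_intros base)

lemma bb_limit: "(bb \<longlongrightarrow> 0) at_top"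
 using tendsto_Pair[OF base(2) tendsto_const[of "(0, 0)"]] by (simp add: bb_def[abs_def] zero_prod_def)

lemma bb_ev_limit: "u \<in> ZZ ==> ((%t. bb t + ev u q t) \<longlongrightarrow> (0, (snd u, q))) at_top"
proof -
 assume u: "u \<in> ZZ"
 have "((%t. bb t + ev u q t) \<longlongrightarrow> 0 + (0, (snd u, q))) at_top"
  unfolding ev_def using u by (intro tendsto_add bb_limit tendsto_Pair tendsto_const) (auto simp: ZZ_def)
 then show ?thesis by simp
qed

lemma bb_ev_VV: "u \<in> ZZ ==> t >= 0 ==> \<exists>x\<in>VV. bb t + ev u q t = (x, (snd u, q))"
 using subspace_add[OF subspace_VV base(3)] by (fastforce simp: ZZ_def bb_def ev_def)

lemma continuous_F: "continuous_on UNIV F"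
 by (meson F'(1) continuous_at_imp_continuous_on has_derivative_continuous)

lemma continuous_F': "continuous_on UNIV (%z. F' z h)" by (rule Ck_continuous[OF F'(2)])

lemma continuous_F2: "continuous_on UNIV (%z. F2 z h)" by (rule Ck_continuous[OF F2(2)])

lemma continuous_F'_joint: "continuous_on I a ==> continuous_on I b ==> continuous_on I (%t. F' (a t) (b t))"
proof -
 assume a: "continuous_on I a" and b: "continuous_on I b"
 have eq: "F' (a t) (b t) = (\<Sum>i\<in>Basis. (b t \<bullet> i) *\<^sub>R F' (a t) i)" for t
  using linear_sum_Basis[OF linF'] .
 show ?thesis unfolding eq
  by (intro continuous_intros continuous_on_compose2[OF continuous_F' a] b) auto
qed

lemma tendsto_F'_joint: "(a \<longlongrightarrow> x) G ==> (b \<longlongrightarrow> h) G ==> ((%t. F' (a t) (b t)) \<longlongrightarrow> F' x h) G"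
proof -
 assume a: "(a \<longlongrightarrow> x) G" and b: "(b \<longlongrightarrow> h) G"
 have eq: "F' y k = (\<Sum>i\<in>Basis. (k \<bullet> i) *\<^sub>R F' y i)" for y k
  using linear_sum_Basis[OF linF'] .
 have "((%t. F' (a t) i) \<longlongrightarrow> F' x i) G" for i
  by (rule continuous_on_tendsto_compose[OF continuous_F' a]) auto
 then have "((%t. \<Sum>i\<in>Basis. (b t \<bullet> i) *\<^sub>R F' (a t) i) \<longlongrightarrow> (\<Sum>i\<in>Basis. (h \<bullet> i) *\<^sub>R F' x i)) G"
  by (intro tendsto_intros b)
 then show ?thesis by (simp only: eq[symmetric])
qed

lemma adm_F: "u \<in> ZZ ==> adm (%t. F (bb t + ev u q t))"
proof -
 assume u: "u \<in> ZZ"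
 have "continuous_on {0..} (%t. F (bb t + ev u q t))"
  by (intro continuous_on_compose2[OF continuous_F] continuous_intros bb_continuous ev_continuous) auto
 moreover have "((%t. F (bb t + ev u q t)) \<longlongrightarrow> F (0, (snd u, q))) at_top"
  by (rule continuous_on_tendsto_compose[OF continuous_F bb_ev_limit[OF u]]) auto
 moreover have "F (bb t + ev u q t) \<in> VV" if "t >= 0" for t
  using bb_ev_VV[OF u that, of q] F_V by auto
 ultimately show ?thesis by (simp add: adm_def F_0)
qed

lemma adm_F':
 assumes u: "u \<in> ZZ" and h: "h \<in> ZZ"
 shows "adm (%t. F' (bb t + ev u q t) (ev h \<beta> t))"
proof -
 have "continuous_on {0..} (%t. F' (bb t + ev u q t) (ev h \<beta> t))"
  by (intro continuous_F'_joint continuous_intros bb_continuous ev_continuous)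
 moreover have "((%t. F' (bb t + ev u q t) (ev h \<beta> t)) \<longlongrightarrow> F' (0, (snd u, q)) (0, (snd h, \<beta>))) at_top"
 proof (rule tendsto_F'_joint[OF bb_ev_limit[OF u]])
  show "(ev h \<beta> \<longlongrightarrow> (0, (snd h, \<beta>))) at_top"
   unfolding ev_def[abs_def] using h by (intro tendsto_intros) (auto simp: ZZ_def)
 qed
 moreover have "F' (bb t + ev u q t) (ev h \<beta> t) \<in> VV" if t: "t >= 0" for t
 proof -
  obtain x where "x \<in> VV" "bb t + ev u q t = (x, (snd u, q))" using bb_ev_VV[OF u t] by blast
  moreover have "apply_bcontfun (fst h) t \<in> VV" using h t by (simp add: ZZ_def)
  ultimately show ?thesis using F'_VV by (simp add: ev_def)
 qed
 ultimately show ?thesis by (simp add: adm_def F'_0)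
qed

lemma zero_ZZ: "0 \<in> ZZ" by (rule subspace_0[OF subspace_ZZ])

lemma ev_0: "ev 0 0 t = 0" "ev 0 1 t = dq" by (simp_all add: ev_def zero_prod_def)

definition cc :: "real => (real ^ 'm) \<times> (real ^ 'm)" where "cc t = F2 (bb t) dq"

lemma adm_cc: "adm cc"
proof -
 have "continuous_on {0..} cc" unfolding cc_def[abs_def]
  by (intro continuous_on_compose2[OF continuous_F2] bb_continuous) auto
 moreover have "(cc \<longlongrightarrow> F2 0 dq) at_top" unfolding cc_def[abs_def]
  by (rule continuous_on_tendsto_compose[OF continuous_F2 bb_limit]) auto
 moreover have "cc t \<in> VV" if "t >= 0" for t unfolding cc_def bb_def by (rule F2_VV[OF base(3)[OF that]])
 ultimately show ?thesis using F2_0[of 0] by (simp add: adm_def zero_prod_def)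
qed

definition NN :: "(real \<Rightarrow>\<^sub>C ((real ^ 'm) \<times> (real ^ 'm))) \<times> real => real => real => (real ^ 'm) \<times> (real ^ 'm)" where
 "NN u q t = F (bb t + ev u q t) - F (bb t) - F' (bb t) (ev u q t)"

definition NL :: "(real \<Rightarrow>\<^sub>C ((real ^ 'm) \<times> (real ^ 'm))) \<times> real => real => (real \<Rightarrow>\<^sub>C ((real ^ 'm) \<times> (real ^ 'm))) \<times> real => real => real => (real ^ 'm) \<times> (real ^ 'm)" where
 "NL u q h \<beta> t = F' (bb t + ev u q t) (ev h \<beta> t) - F' (bb t) (ev h \<beta> t)"

lemma adm_diff: "adm h ==> adm k ==> adm (%t. h t - k t)"
 using adm_lincomb[of h k 1 "-1"] by simp

lemma adm_NN: "u \<in> ZZ ==> adm (NN u q)"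
 using adm_diff[OF adm_diff[OF adm_F[of u q] adm_F[OF zero_ZZ, of 0]] adm_F'[OF zero_ZZ, of u 0 q]]
 by (simp add: NN_def[abs_def] ev_0)

lemma adm_NL: "u \<in> ZZ ==> h \<in> ZZ ==> adm (NL u q h \<beta>)"
 using adm_diff[OF adm_F'[of u h q \<beta>] adm_F'[OF zero_ZZ, of h 0 \<beta>]]
 by (simp add: NL_def[abs_def] ev_0)

end

instance bcontfun :: (metric_space, banach) banach ..

context nonlinear_problem
begin

lemma F'_bb_dq: "F' (bb t) dq = 0"
 unfolding bb_def by (rule F'_even)

lemma F'_ev_split: "F' z (ev h \<beta> t) = F' z (ev h 0 t) + \<beta> *\<^sub>R F' z dq"
 unfolding ev_split[of h \<beta>] by (simp only: linear_add[OF linF'] linear_cmul[OF linF'])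

lemma F'_ev_diff: "F' z (ev (h - k) (\<beta> - \<delta>) t) = F' z (ev h \<beta> t) - F' z (ev k \<delta> t)"
 unfolding ev_diff[symmetric] by (simp add: linear_diff[OF linF'])

lemma F'_ev_scale: "F' z (ev (c *\<^sub>R h) 0 t) = c *\<^sub>R F' z (ev h 0 t)"
proof -
 have "ev (c *\<^sub>R h) 0 t = c *\<^sub>R ev h 0 t" by (simp add: ev_def)
 then show ?thesis by (simp add: linear_cmul[OF linF'])
qed

lemma NL_diff: "NL u q (h - k) 0 t = NL u q h 0 t - NL u q k 0 t"
 using F'_ev_diff[of _ h k 0 0 t] by (simp add: NL_def)

lemma NL_scale: "NL u q (c *\<^sub>R h) 0 t = c *\<^sub>R NL u q h 0 t"
 by (simp add: NL_def F'_ev_scale scaleR_diff_right)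

lemma NL_split: "NL u q h \<beta> t = NL u q h 0 t + \<beta> *\<^sub>R NL u q 0 1 t"
 unfolding NL_def F'_ev_split[of _ h \<beta>] ev_0 by (simp add: scaleR_diff_right)

lemma NN_even: "NN u (- q) t = NN u q t"
proof -
 have "F (bb t + ev u (- q) t) = F (bb t + ev u q t)"
  by (simp add: bb_def ev_def F_even)
 moreover have "F' (bb t) (ev u (- q) t) = F' (bb t) (ev u q t)"
  unfolding F'_ev_split[of _ u "- q"] F'_ev_split[of _ u q] F'_bb_dq by simp
 ultimately show ?thesis by (simp add: NN_def)
qed

lemma NN_0: "NN 0 0 t = 0"
 by (simp add: NN_def ev_0 linear_0[OF linF'])

lemma bb_bounded: "EX R0. ALL t>=0. norm (bb t) <= R0"
proof -
 have "\<forall>\<^sub>F t in at_top. norm (bb t) < 1" using tendstoD[OF bb_limit, of 1] by simp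
 then obtain N where N: "!!t. t >= N ==> norm (bb t) <= 1"
  unfolding eventually_at_top_linorder by (meson less_imp_le)
 have "bounded (bb ` {0..})" by (rule bounded_continuous_image[OF bb_continuous N])
 then show ?thesis unfolding bounded_iff by auto
qed

text \<open>Taylor estimates of \<open>F\<close> on a bounded neighbourhood of the base solution, which is a
 bounded curve.\<close>

lemma pointwise_estimates:
 "EX M>=0. ALL u v q \<beta> t h \<delta>. norm u <= 1 --> norm v <= 1 --> \<bar>q\<bar> <= 1 --> \<bar>\<beta>\<bar> <= 1 --> t >= 0 -->
   norm (NN v \<beta> t - NN u q t - NL u q (v - u) (\<beta> - q) t) <= M * (2 * norm (v - u) + \<bar>\<beta> - q\<bar>) ^ 2 &
   norm (NL u q h \<delta> t) <= M * (2 * norm u + \<bar>q\<bar>) * (2 * norm h + \<bar>\<delta>\<bar>) &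
   norm (NL u q 0 1 t - q *\<^sub>R cc t) <= M * (2 * norm u + \<bar>q\<bar>) * \<bar>q\<bar>"
proof -
 obtain R0 where R0: "!!t. t >= 0 ==> norm (bb t) <= R0" using bb_bounded by blast
 define r where "r = R0 + 3"
 obtain M1 where M1: "M1 >= 0"
  "\<forall>z\<in>cball 0 r. \<forall>z'\<in>cball 0 r. ALL h. norm (F' z' h - F' z h) <= M1 * norm (z' - z) * norm h"
  "\<forall>z\<in>cball 0 r. \<forall>z'\<in>cball 0 r. norm (F z' - F z - F' z (z' - z)) <= M1 * norm (z' - z) ^ 2"
  using C2_bounds[OF F', of r] by blast
 obtain M2 where M2: "M2 >= 0"
  "\<forall>z\<in>cball 0 r. \<forall>z'\<in>cball 0 r. ALL h. norm (F2 z' h - F2 z h) <= M2 * norm (z' - z) * norm h"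
  "\<forall>z\<in>cball 0 r. \<forall>z'\<in>cball 0 r. norm (F' z' dq - F' z dq - F2 z (z' - z)) <= M2 * norm (z' - z) ^ 2"
  using C2_bounds[OF F2, of r] by blast
 define M where "M = max M1 M2"
 have M: "M >= 0" "M1 <= M" "M2 <= M" using M1(1) by (auto simp: M_def)
 have ball: "bb t + ev u q t \<in> cball 0 r" if "norm u <= 1" "\<bar>q\<bar> <= 1" "t >= 0" for u q t
  using norm_triangle_ineq[of "bb t" "ev u q t"] R0[OF that(3)] norm_ev[of u q t] that by (simp add: r_def)
 have ball0: "bb t \<in> cball 0 r" if "t >= 0" for t using R0[OF that] by (simp add: r_def)
 have "norm (NN v \<beta> t - NN u q t - NL u q (v - u) (\<beta> - q) t) <= M * (2 * norm (v - u) + \<bar>\<beta> - q\<bar>) ^ 2"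
  if uv: "norm u <= 1" "norm v <= 1" "\<bar>q\<bar> <= 1" "\<bar>\<beta>\<bar> <= 1" "t >= 0" for u v q \<beta> t
 proof -
  define z where "z = bb t + ev u q t"
  define z' where "z' = bb t + ev v \<beta> t"
  have d: "z' - z = ev (v - u) (\<beta> - q) t" by (simp add: z_def z'_def ev_diff)
  have bz: "z \<in> cball 0 r" "z' \<in> cball 0 r"
   unfolding z_def z'_def by (rule ball[OF uv(1,3,5)], rule ball[OF uv(2,4,5)])
  have eq: "NN v \<beta> t - NN u q t - NL u q (v - u) (\<beta> - q) t = F z' - F z - F' z (z' - z)"
   unfolding d NN_def NL_def z_def[symmetric] z'_def[symmetric] F'_ev_diff[of "bb t"] by simp
  have "norm (NN v \<beta> t - NN u q t - NL u q (v - u) (\<beta> - q) t) <= M1 * norm (z' - z) ^ 2"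
   unfolding eq using M1(3) bz by blast
  also have "\<dots> <= M * (2 * norm (v - u) + \<bar>\<beta> - q\<bar>) ^ 2"
   unfolding d using M norm_ev by (intro mult_mono power_mono) auto
  finally show ?thesis .
 qed
 moreover have "norm (NL u q h \<delta> t) <= M * (2 * norm u + \<bar>q\<bar>) * (2 * norm h + \<bar>\<delta>\<bar>)"
  if uv: "norm u <= 1" "\<bar>q\<bar> <= 1" "t >= 0" for u q t h \<delta>
 proof -
  have "norm (NL u q h \<delta> t) <= M1 * norm (bb t + ev u q t - bb t) * norm (ev h \<delta> t)"
   unfolding NL_def using M1(2) ball[OF uv] ball0[OF uv(3)] by blast
  also have "\<dots> <= M * (2 * norm u + \<bar>q\<bar>) * (2 * norm h + \<bar>\<delta>\<bar>)"
   using M norm_ev[of u q t] norm_ev[of h \<delta> t] M1(1) by (intro mult_mono) auto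
  finally show ?thesis .
 qed
 moreover have "norm (NL u q 0 1 t - q *\<^sub>R cc t) <= M * (2 * norm u + \<bar>q\<bar>) * \<bar>q\<bar>"
  if uv: "norm u <= 1" "\<bar>q\<bar> <= 1" "t >= 0" for u q t
 proof -
  define z where "z = bb t + ev u 0 t"
  define z' where "z' = bb t + ev u q t"
  have zz: "z' - z = q *\<^sub>R dq" unfolding z_def z'_def ev_split[of u q] by simp
  have F'z: "F' z dq = 0"
  proof -
   have "z = (base t + apply_bcontfun (fst u) t, (snd u, 0))" by (simp add: z_def bb_def ev_def)
   then show ?thesis using F'_even by (simp only:)
  qed
  have bz: "z \<in> cball 0 r" "z' \<in> cball 0 r" unfolding z_def z'_def using ball[OF uv(1) _ uv(3), of 0] ball[OF uv] by auto
  have "NL u q 0 1 t - q *\<^sub>R cc t = (F' z' dq - F' z dq - F2 z (z' - z)) + q *\<^sub>R (F2 z dq - F2 (bb t) dq)"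
   unfolding zz linear_cmul[OF linF2] NL_def ev_0 z'_def[symmetric] F'_bb_dq F'z cc_def
   by (simp add: scaleR_diff_right)
  also have "norm \<dots> <= M2 * norm (z' - z) ^ 2 + \<bar>q\<bar> * (M2 * norm (z - bb t) * norm dq)"
   unfolding norm_scaleR[symmetric]
  proof (rule order_trans[OF norm_triangle_ineq add_mono])
   show "norm (F' z' dq - F' z dq - F2 z (z' - z)) <= M2 * norm (z' - z) ^ 2" using M2(3) bz by blast
   have "norm (F2 z dq - F2 (bb t) dq) <= M2 * norm (z - bb t) * norm dq" using M2(2) bz(1) ball0[OF uv(3)] by blast
   then show "norm (q *\<^sub>R (F2 z dq - F2 (bb t) dq)) <= \<bar>q\<bar> * (M2 * norm (z - bb t) * norm dq)"
    unfolding norm_scaleR by (rule mult_left_mono) simp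
  qed
  also have "\<dots> = M2 * \<bar>q\<bar> ^ 2 + \<bar>q\<bar> * (M2 * norm (ev u 0 t))"
   unfolding zz by (simp add: norm_Pair z_def)
  also have "\<dots> <= M2 * \<bar>q\<bar> ^ 2 + \<bar>q\<bar> * (M2 * (2 * norm u))"
   using norm_ev[of u 0 t] M2(1) by (intro add_left_mono mult_left_mono) auto
  also have "\<dots> = M2 * ((2 * norm u + \<bar>q\<bar>) * \<bar>q\<bar>)" by (simp add: power2_eq_square algebra_simps)
  also have "\<dots> <= M * ((2 * norm u + \<bar>q\<bar>) * \<bar>q\<bar>)" using M by (intro mult_right_mono) auto
  finally show ?thesis by (simp add: mult.assoc)
 qed
 ultimately show ?thesis using M(1) by (intro exI[of _ M]) blast
qed

text \<open>The map \<open>u \<mapsto> Qop (NN u q)\<close> has small derivative near the base solution, so it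
 is a contraction; evenness of \<open>F\<close> in the parameter makes its parameter derivative of first
 order.\<close>

lemma abstract_branch:
 "EX a U U' K. 0 < a & a <= 1 & U 0 = 0 & K >= 0 &
  (ALL q. \<bar>q\<bar> <= a --> U q \<in> ZZ & Qop (NN (U q) q) = U q & U (- q) = U q) &
  (ALL q. \<bar>q\<bar> < a --> (U has_vector_derivative U' q) (at q) &
    norm (U' q - q *\<^sub>R Qop cc) <= K * q ^ 2 &
    norm (U q - (q ^ 2 / 2) *\<^sub>R Qop cc) <= K * \<bar>q\<bar> ^ 3)"
proof -
 obtain M where M: "M >= 0" and est: "ALL u v q \<beta> t h \<delta>. norm u <= 1 --> norm v <= 1 --> \<bar>q\<bar> <= 1 --> \<bar>\<beta>\<bar> <= 1 --> t >= 0 -->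
   norm (NN v \<beta> t - NN u q t - NL u q (v - u) (\<beta> - q) t) <= M * (2 * norm (v - u) + \<bar>\<beta> - q\<bar>) ^ 2 &
   norm (NL u q h \<delta> t) <= M * (2 * norm u + \<bar>q\<bar>) * (2 * norm h + \<bar>\<delta>\<bar>) &
   norm (NL u q 0 1 t - q *\<^sub>R cc t) <= M * (2 * norm u + \<bar>q\<bar>) * \<bar>q\<bar>"
  using pointwise_estimates by (elim exE conjE) (rule that, assumption, assumption)
 have est1: "norm (NN v \<beta> t - NN u q t - NL u q (v - u) (\<beta> - q) t) <= M * (2 * norm (v - u) + \<bar>\<beta> - q\<bar>) ^ 2"
  if "norm u <= 1" "norm v <= 1" "\<bar>q\<bar> <= 1" "\<bar>\<beta>\<bar> <= 1" "t >= 0" for u v q \<beta> t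
  using est that by blast
 have est2: "norm (NL u q h \<delta> t) <= M * (2 * norm u + \<bar>q\<bar>) * (2 * norm h + \<bar>\<delta>\<bar>)"
  if "norm u <= 1" "\<bar>q\<bar> <= 1" "t >= 0" for u q h \<delta> t
  using est that by blast
 have est3: "norm (NL u q 0 1 t - q *\<^sub>R cc t) <= M * (2 * norm u + \<bar>q\<bar>) * \<bar>q\<bar>"
  if "norm u <= 1" "\<bar>q\<bar> <= 1" "t >= 0" for u q t
  using est that by blast
 obtain C where C: "C >= 0" and Qb0: "ALL h H. adm h --> (ALL t>=0. norm (h t) <= H) --> norm (Qop h) <= C * H"
  using Qop_bound by (elim exE conjE) (rule that, assumption, assumption)
 have Qb: "norm (Qop h) <= C * H" if "adm h" "!!t. t >= 0 ==> norm (h t) <= H" for h H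
  using Qb0 that by blast
 define r where "r = min 1 (1 / (28 * (C * M) + 1))"
 have CM: "C * M >= 0" using C M by simp
 have r: "0 < r" "r <= 1" using CM by (auto simp: r_def)
 have rs: "28 * (C * M) * r <= 1"
 proof -
  have "28 * (C * M) * r <= (28 * (C * M) + 1) * (1 / (28 * (C * M) + 1))"
   using CM r by (intro mult_mono) (auto simp: r_def)
  also have "\<dots> = 1"
  proof -
   have "28 * (C * M) + 1 ~= 0" using CM by linarith
   then show ?thesis unfolding times_divide_eq_right mult_1_right by (rule divide_self)
  qed
  finally show ?thesis .
 qed
 define G where "G u q = Qop (NN u q)" for u q
 define Lo where "Lo u q h = Qop (NL u q h 0)" for u q h
 define b where "b u q = Qop (NL u q 0 1)" for u q
 have sub: "subspace ZZ" by (rule subspace_ZZ)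
 have combine: "G v \<beta> - G u q - Lo u q (v - u) - (\<beta> - q) *\<^sub>R b u q =
   Qop (%t. NN v \<beta> t - NN u q t - NL u q (v - u) (\<beta> - q) t)" if uv: "u \<in> ZZ" "v \<in> ZZ" for u v q \<beta>
 proof -
  have vu: "v - u \<in> ZZ" using uv subspace_diff[OF sub] by blast
  have 1: "Qop (NL u q (v - u) (\<beta> - q)) = Lo u q (v - u) + (\<beta> - q) *\<^sub>R b u q"
   using Qop_lincomb[OF adm_NL[OF uv(1) vu, of q 0] adm_NL[OF uv(1) zero_ZZ, of q 1], of 1 "\<beta> - q"]
   unfolding Lo_def b_def NL_split[of u q "v - u" "\<beta> - q", symmetric, abs_def] scaleR_one .
  show ?thesis
   using Qop_diff[OF adm_diff[OF adm_NN[OF uv(2)] adm_NN[OF uv(1)]] adm_NL[OF uv(1) vu], of \<beta> q q "\<beta> - q"]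
    Qop_diff[OF adm_NN[OF uv(2)] adm_NN[OF uv(1)], of \<beta> q]
   by (simp add: 1 G_def)
 qed
 have taylor: "norm (G v \<beta> - G u q - Lo u q (v - u) - (\<beta> - q) *\<^sub>R b u q) <= C * (M * (2 * norm (v - u) + \<bar>\<beta> - q\<bar>) ^ 2)"
  if "u \<in> ZZ" "norm u <= r" "v \<in> ZZ" "norm v <= r" "\<bar>q\<bar> <= r" "\<bar>\<beta>\<bar> <= r" for u v q \<beta>
  unfolding combine[OF that(1,3)]
 proof (rule Qb)
  show "adm (%t. NN v \<beta> t - NN u q t - NL u q (v - u) (\<beta> - q) t)"
   using that by (intro adm_diff adm_NN adm_NL subspace_diff[OF sub])
  show "norm (NN v \<beta> t - NN u q t - NL u q (v - u) (\<beta> - q) t) <= M * (2 * norm (v - u) + \<bar>\<beta> - q\<bar>) ^ 2" if "t >= 0" for t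
   using r that \<open>norm u <= r\<close> \<open>norm v <= r\<close> \<open>\<bar>q\<bar> <= r\<close> \<open>\<bar>\<beta>\<bar> <= r\<close> by (intro est1) auto
 qed
 have Lb: "norm (Lo u q h) <= C * (M * (2 * norm u + \<bar>q\<bar>) * (2 * norm h))"
  if "u \<in> ZZ" "norm u <= r" "\<bar>q\<bar> <= r" "h \<in> ZZ" for u q h
  unfolding Lo_def
 proof (rule Qb)
  show "adm (NL u q h 0)" using that by (intro adm_NL)
  show "norm (NL u q h 0 t) <= M * (2 * norm u + \<bar>q\<bar>) * (2 * norm h)" if "t >= 0" for t
   using est2[of u q t h 0] r that \<open>norm u <= r\<close> \<open>\<bar>q\<bar> <= r\<close> by simp
 qed
 have bb: "norm (b u q) <= C * (M * (2 * norm u + \<bar>q\<bar>))"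
  if "u \<in> ZZ" "norm u <= r" "\<bar>q\<bar> <= r" for u q
  unfolding b_def
 proof (rule Qb)
  show "adm (NL u q 0 1)" using that by (intro adm_NL zero_ZZ)
  show "norm (NL u q 0 1 t) <= M * (2 * norm u + \<bar>q\<bar>)" if "t >= 0" for t
   using est2[of u q t 0 1] r that \<open>norm u <= r\<close> \<open>\<bar>q\<bar> <= r\<close> by simp
 qed
 have G_even: "G u (- q) = G u q" for u q unfolding G_def using NN_even[of u q] by presburger
 have "EX a' U U' K. 0 < a' & a' <= r & U 0 = 0 & K >= 0 &
  (ALL q. \<bar>q\<bar> <= a' --> U q \<in> ZZ & norm (U q) <= r & G (U q) q = U q) &
  (ALL q u. \<bar>q\<bar> <= a' --> u \<in> ZZ --> norm u <= r --> G u q = u --> u = U q) &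
  (ALL q. \<bar>q\<bar> < a' --> (U has_vector_derivative U' q) (at q) &
    norm (U' q - q *\<^sub>R Qop cc) <= K * q ^ 2 &
    norm (U q - (q ^ 2 / 2) *\<^sub>R Qop cc) <= K * \<bar>q\<bar> ^ 3)"
 proof (rule even_parameter_branch[where L = Lo and b = b and M = "4 * (C * M)" and C = "5 * (C * M)"])
  show "closed ZZ" "subspace ZZ" by (rule closed_ZZ subspace_ZZ)+
  show "G u q \<in> ZZ" if "u \<in> ZZ" for u q unfolding G_def by (intro Qop_ZZ adm_NN that)
  show "G 0 0 = 0"
   using Qb[OF adm_NN[OF zero_ZZ], of 0 0] NN_0 by (simp add: G_def)
  show "Lo u q h \<in> ZZ" if "u \<in> ZZ" "h \<in> ZZ" for u q h unfolding Lo_def by (intro Qop_ZZ adm_NL that)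
  show "b u q \<in> ZZ" if "u \<in> ZZ" for u q unfolding b_def by (intro Qop_ZZ adm_NL that zero_ZZ)
  show "Lo u q (h - k) = Lo u q h - Lo u q k" if "u \<in> ZZ" "h \<in> ZZ" "k \<in> ZZ" for u q h k
   using Qop_diff[OF adm_NL[OF that(1,2), of q 0] adm_NL[OF that(1,3), of q 0]]
   unfolding Lo_def NL_diff[of u q h k, symmetric, abs_def] .
  show "Lo u q (s *\<^sub>R h) = s *\<^sub>R Lo u q h" if "u \<in> ZZ" "h \<in> ZZ" for u q h s
   using Qop_scale[OF adm_NL[OF that(1,2), of q 0], of s]
   unfolding Lo_def NL_scale[of u q s h, symmetric, abs_def] .
  show "norm (Lo u q h) <= 4 * (C * M) * (norm u + \<bar>q\<bar>) * norm h"
   if "u \<in> ZZ" "norm u <= r" "\<bar>q\<bar> <= r" "h \<in> ZZ" for u q h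
  proof -
   have "norm (Lo u q h) <= (C * M) * (2 * norm u + \<bar>q\<bar>) * (2 * norm h)"
    using Lb[OF that] by (simp only: mult.assoc)
   also have "\<dots> <= (C * M) * (2 * (norm u + \<bar>q\<bar>)) * (2 * norm h)"
    using CM by (intro mult_right_mono mult_left_mono) auto
   finally show ?thesis by (simp add: mult_ac)
  qed
  show "norm (Lo u q h) <= norm h / 2"
   if "u \<in> ZZ" "norm u <= r" "\<bar>q\<bar> <= r" "h \<in> ZZ" for u q h
  proof -
   have "norm (Lo u q h) <= (C * M) * (2 * norm u + \<bar>q\<bar>) * (2 * norm h)"
    using Lb[OF that] by (simp only: mult.assoc)
   also have "\<dots> <= (C * M) * (3 * r) * (2 * norm h)"
    using CM that by (intro mult_right_mono mult_left_mono) auto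
   also have "\<dots> = (28 * (C * M) * r) * ((6 / 28) * norm h)" by simp
   also have "\<dots> <= 1 * ((6 / 28) * norm h)" using rs by (intro mult_right_mono) auto
   also have "\<dots> <= norm h / 2" by simp
   finally show ?thesis .
  qed
  show "norm (G u q - G v q) <= norm (u - v) / 2"
   if "u \<in> ZZ" "norm u <= r" "v \<in> ZZ" "norm v <= r" "\<bar>q\<bar> <= r" for u v q
  proof -
   have uv: "u - v \<in> ZZ" using that subspace_diff[OF sub] by blast
   have "norm (G u q - G v q - Lo v q (u - v)) <= C * (M * (2 * norm (u - v)) ^ 2)"
    using taylor[of v u q q] that by simp
   moreover have "norm (Lo v q (u - v)) <= C * (M * (2 * norm v + \<bar>q\<bar>) * (2 * norm (u - v)))"
    by (rule Lb[OF that(3,4,5) uv])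
   moreover have "norm (G u q - G v q) <= norm (G u q - G v q - Lo v q (u - v)) + norm (Lo v q (u - v))"
    by (metis diff_add_cancel norm_triangle_ineq)
   ultimately have "norm (G u q - G v q) <= (C * M) * (4 * norm (u - v) + 2 * (2 * norm v + \<bar>q\<bar>)) * norm (u - v)"
    by (simp add: power2_eq_square algebra_simps)
   also have "\<dots> <= (C * M) * (14 * r) * norm (u - v)"
    using norm_triangle_ineq4[of u v] that CM by (intro mult_right_mono mult_left_mono) auto
   also have "\<dots> = (28 * (C * M) * r) * (norm (u - v) / 2)" by simp
   also have "\<dots> <= 1 * (norm (u - v) / 2)" using rs by (intro mult_right_mono) auto
   finally show ?thesis by simp
  qed
  show "norm (G u q - G u \<beta>) <= 5 * (C * M) * \<bar>q - \<beta>\<bar>"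
   if "u \<in> ZZ" "norm u <= r" "\<bar>q\<bar> <= r" "\<bar>\<beta>\<bar> <= r" for u q \<beta>
  proof -
   have Lo0: "Lo u \<beta> 0 = 0" using Lb[OF that(1,2,4) zero_ZZ] by simp
   have "norm (G u q - G u \<beta> - (q - \<beta>) *\<^sub>R b u \<beta>) <= C * (M * \<bar>q - \<beta>\<bar> ^ 2)"
    using taylor[of u u \<beta> q] that Lo0 by simp
   moreover have "norm ((q - \<beta>) *\<^sub>R b u \<beta>) <= \<bar>q - \<beta>\<bar> * (C * (M * (2 * norm u + \<bar>\<beta>\<bar>)))"
    unfolding norm_scaleR by (rule mult_left_mono[OF bb[OF that(1,2,4)]]) simp
   moreover have "norm (G u q - G u \<beta>) <= norm (G u q - G u \<beta> - (q - \<beta>) *\<^sub>R b u \<beta>) + norm ((q - \<beta>) *\<^sub>R b u \<beta>)"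
    by (metis diff_add_cancel norm_triangle_ineq)
   ultimately have "norm (G u q - G u \<beta>) <= (C * M) * (\<bar>q - \<beta>\<bar> + (2 * norm u + \<bar>\<beta>\<bar>)) * \<bar>q - \<beta>\<bar>"
    by (simp add: power2_eq_square algebra_simps)
   also have "\<dots> <= (C * M) * 5 * \<bar>q - \<beta>\<bar>"
    using that r CM by (intro mult_right_mono mult_left_mono) auto
   finally show ?thesis by (simp add: mult_ac)
  qed
  show "norm (G v \<beta> - G u q - Lo u q (v - u) - (\<beta> - q) *\<^sub>R b u q) <= 4 * (C * M) * (norm (v - u) + \<bar>\<beta> - q\<bar>) ^ 2"
   if "u \<in> ZZ" "norm u <= r" "v \<in> ZZ" "norm v <= r" "\<bar>q\<bar> <= r" "\<bar>\<beta>\<bar> <= r" for u q v \<beta>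
  proof -
   have "norm (G v \<beta> - G u q - Lo u q (v - u) - (\<beta> - q) *\<^sub>R b u q) <= (C * M) * (2 * norm (v - u) + \<bar>\<beta> - q\<bar>) ^ 2"
    using taylor[OF that] by (simp add: mult.assoc)
   also have "\<dots> <= (C * M) * (2 * (norm (v - u) + \<bar>\<beta> - q\<bar>)) ^ 2"
    using CM by (intro mult_left_mono power_mono) auto
   also have "\<dots> = 4 * (C * M) * (norm (v - u) + \<bar>\<beta> - q\<bar>) ^ 2"
    by (simp only: power_mult_distrib) simp
   finally show ?thesis .
  qed
  show "norm (b u q - q *\<^sub>R Qop cc) <= 4 * (C * M) * (norm u + \<bar>q\<bar>) * \<bar>q\<bar>"
   if "u \<in> ZZ" "norm u <= r" "\<bar>q\<bar> <= r" for u q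
  proof -
   have eq: "b u q - q *\<^sub>R Qop cc = Qop (%t. NL u q 0 1 t - q *\<^sub>R cc t)"
    using Qop_lincomb[OF adm_NL[OF that(1) zero_ZZ, of q 1] adm_cc, of 1 "- q"] by (simp add: b_def)
   have "norm (b u q - q *\<^sub>R Qop cc) <= C * (M * (2 * norm u + \<bar>q\<bar>) * \<bar>q\<bar>)"
    unfolding eq
   proof (rule Qb)
    show "adm (%t. NL u q 0 1 t - q *\<^sub>R cc t)"
     using adm_lincomb[OF adm_NL[OF that(1) zero_ZZ, of q 1] adm_cc, of 1 "- q"] by simp
    show "norm (NL u q 0 1 t - q *\<^sub>R cc t) <= M * (2 * norm u + \<bar>q\<bar>) * \<bar>q\<bar>" if "t >= 0" for t
     using r that \<open>norm u <= r\<close> \<open>\<bar>q\<bar> <= r\<close> by (intro est3) auto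
   qed
   also have "\<dots> = (C * M) * (2 * norm u + \<bar>q\<bar>) * \<bar>q\<bar>" by (simp only: mult.assoc)
   also have "\<dots> <= (C * M) * (4 * (norm u + \<bar>q\<bar>)) * \<bar>q\<bar>"
    using CM by (intro mult_right_mono mult_left_mono) auto
   finally show ?thesis by (simp add: mult_ac)
  qed
 qed (use r CM in auto)
 then obtain a U U' K where UU: "0 < a & a <= r & U 0 = 0 & K >= 0 &
  (ALL q. \<bar>q\<bar> <= a --> U q \<in> ZZ & norm (U q) <= r & G (U q) q = U q) &
  (ALL q u. \<bar>q\<bar> <= a --> u \<in> ZZ --> norm u <= r --> G u q = u --> u = U q) &
  (ALL q. \<bar>q\<bar> < a --> (U has_vector_derivative U' q) (at q) &
    norm (U' q - q *\<^sub>R Qop cc) <= K * q ^ 2 &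
    norm (U q - (q ^ 2 / 2) *\<^sub>R Qop cc) <= K * \<bar>q\<bar> ^ 3)"
  by (elim exE) (rule that)
 have even: "U (- q) = U q" if "\<bar>q\<bar> <= a" for q
 proof -
  have m: "\<bar>- q\<bar> <= a" using that by simp
  have "U (- q) \<in> ZZ" "norm (U (- q)) <= r" "G (U (- q)) (- q) = U (- q)" using UU m by blast+
  then show ?thesis using UU that G_even by metis
 qed
 have "a <= 1" using UU r(2) by linarith
 then show ?thesis
  by (intro exI[of _ a], rule_tac x = U in exI, rule_tac x = U' in exI, rule_tac x = K in exI)
   (use UU even in \<open>auto simp: G_def\<close>)
qed

lemma branch:
 "EX a \<Phi> \<Phi>' K m y v. 0 < a & a <= 1 & \<Phi> 0 = 0 & K >= 0 &
  (EX z w. Qsol (%t. fst (cc t)) (%t. snd (cc t)) z w m) &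
  (ALL q. \<bar>q\<bar> < a --> \<Phi> (- q) = \<Phi> q & (\<Phi> has_real_derivative \<Phi>' q) (at q) &
    \<bar>\<Phi>' q - q * m\<bar> <= K * q ^ 2 & \<bar>\<Phi> q - (q ^ 2 / 2) * m\<bar> <= K * \<bar>q\<bar> ^ 3 &
    (ALL t>=0. ((%t. base t + (y q t, v q t)) has_vector_derivative
      F (base t + (y q t, v q t), (\<Phi> q, q))) (at t within {0..})) &
    (ALL t>=0. y q t \<in> V 1 & v q t \<in> V (- 1) & norm (y q t) <= K * q ^ 2 & norm (v q t) <= K * q ^ 2) &
    R (y q 0) = y q 0 & R (v q 0) = v q 0 & (y q \<longlongrightarrow> 0) at_top & (v q \<longlongrightarrow> 0) at_top)"
proof -
 obtain a U U' K where UU: "0 < a & a <= 1 & U 0 = 0 & K >= 0 &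
  (ALL q. \<bar>q\<bar> <= a --> U q \<in> ZZ & Qop (NN (U q) q) = U q & U (- q) = U q) &
  (ALL q. \<bar>q\<bar> < a --> (U has_vector_derivative U' q) (at q) &
    norm (U' q - q *\<^sub>R Qop cc) <= K * q ^ 2 &
    norm (U q - (q ^ 2 / 2) *\<^sub>R Qop cc) <= K * \<bar>q\<bar> ^ 3)"
  using abstract_branch by (elim exE) (rule that)
 define m where "m = snd (Qop cc)"
 define \<Phi> where "\<Phi> q = snd (U q)" for q
 define \<Phi>' where "\<Phi>' q = snd (U' q)" for q
 define y where "y q t = fst (apply_bcontfun (fst (U q)) t)" for q t
 define v where "v q t = snd (apply_bcontfun (fst (U q)) t)" for q t
 define K' where "K' = K + norm (Qop cc)"
 have K: "K >= 0" "K <= K'" using UU by (auto simp: K'_def)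
 have Qcc: "EX z w. Qsol (%t. fst (cc t)) (%t. snd (cc t)) z w m"
  using Qop_QQ[OF adm_cc] unfolding QQ_def m_def by blast
 have main: "\<Phi> (- q) = \<Phi> q & (\<Phi> has_real_derivative \<Phi>' q) (at q) &
    \<bar>\<Phi>' q - q * m\<bar> <= K' * q ^ 2 & \<bar>\<Phi> q - (q ^ 2 / 2) * m\<bar> <= K' * \<bar>q\<bar> ^ 3 &
    (ALL t>=0. ((%t. base t + (y q t, v q t)) has_vector_derivative
      F (base t + (y q t, v q t), (\<Phi> q, q))) (at t within {0..})) &
    (ALL t>=0. y q t \<in> V 1 & v q t \<in> V (- 1) & norm (y q t) <= K' * q ^ 2 & norm (v q t) <= K' * q ^ 2) &
    R (y q 0) = y q 0 & R (v q 0) = v q 0 & (y q \<longlongrightarrow> 0) at_top & (v q \<longlongrightarrow> 0) at_top"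
  if q: "\<bar>q\<bar> < a" for q
 proof -
  have U: "U q \<in> ZZ" "Qop (NN (U q) q) = U q" "U (- q) = U q" using UU q by auto
  have D: "(U has_vector_derivative U' q) (at q)" "norm (U' q - q *\<^sub>R Qop cc) <= K * q ^ 2"
   "norm (U q - (q ^ 2 / 2) *\<^sub>R Qop cc) <= K * \<bar>q\<bar> ^ 3" using UU q by auto
  have a1: "\<bar>q\<bar> <= 1" using UU q by linarith
  have e1: "\<Phi> (- q) = \<Phi> q" by (simp add: \<Phi>_def U)
  have e2: "(\<Phi> has_real_derivative \<Phi>' q) (at q)"
   unfolding \<Phi>_def[abs_def] \<Phi>'_def has_real_derivative_iff_has_vector_derivative
   by (rule bounded_linear.has_vector_derivative[OF bounded_linear_snd D(1)])
  have snd_le: "\<bar>snd w\<bar> <= norm w" for w :: "(real \<Rightarrow>\<^sub>C ((real ^ 'm) \<times> (real ^ 'm))) \<times> real"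
   using norm_snd_le[of "snd w" "fst w"] by simp
  have e3: "\<bar>\<Phi>' q - q * m\<bar> <= K' * q ^ 2"
  proof -
   have "\<bar>\<Phi>' q - q * m\<bar> <= norm (U' q - q *\<^sub>R Qop cc)"
    using snd_le[of "U' q - q *\<^sub>R Qop cc"] by (simp add: \<Phi>'_def m_def)
   also have "\<dots> <= K * q ^ 2" by (rule D)
   also have "\<dots> <= K' * q ^ 2" using K by (intro mult_right_mono) auto
   finally show ?thesis .
  qed
  have e4: "\<bar>\<Phi> q - (q ^ 2 / 2) * m\<bar> <= K' * \<bar>q\<bar> ^ 3"
  proof -
   have "\<bar>\<Phi> q - (q ^ 2 / 2) * m\<bar> <= norm (U q - (q ^ 2 / 2) *\<^sub>R Qop cc)"
    using snd_le[of "U q - (q ^ 2 / 2) *\<^sub>R Qop cc"] by (simp add: \<Phi>_def m_def)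
   also have "\<dots> <= K * \<bar>q\<bar> ^ 3" by (rule D)
   also have "\<dots> <= K' * \<bar>q\<bar> ^ 3" using K by (intro mult_right_mono) auto
   finally show ?thesis .
  qed
  have nU: "norm (U q) <= K' * q ^ 2"
  proof -
   have "norm (U q) <= norm (U q - (q ^ 2 / 2) *\<^sub>R Qop cc) + norm ((q ^ 2 / 2) *\<^sub>R Qop cc)"
    by (metis diff_add_cancel norm_triangle_ineq)
   also have "\<dots> <= K * \<bar>q\<bar> ^ 3 + (q ^ 2 / 2) * norm (Qop cc)" using D(3) by simp
   also have "\<dots> <= K * q ^ 2 + q ^ 2 * norm (Qop cc)"
   proof (intro add_mono mult_left_mono mult_right_mono)
    have "\<bar>q\<bar> ^ 3 <= \<bar>q\<bar> ^ 2" using a1 by (intro power_decreasing) auto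
    then show "\<bar>q\<bar> ^ 3 <= q ^ 2" by simp
   qed (use K in auto)
   finally show ?thesis by (simp add: K'_def algebra_simps)
  qed
  have yv: "norm (y q t) <= K' * q ^ 2" "norm (v q t) <= K' * q ^ 2" for t
  proof -
   have n: "norm (apply_bcontfun (fst (U q)) t) <= K' * q ^ 2"
    using norm_bounded[of "fst (U q)" t] norm_fst_le[of "fst (U q)" "snd (U q)"] nU by simp
   show "norm (y q t) <= K' * q ^ 2" "norm (v q t) <= K' * q ^ 2"
    using n norm_fst_le[of "y q t" "v q t"] norm_snd_le[of "v q t" "y q t"] by (auto simp: y_def v_def)
  qed
  have admN: "adm (NN (U q) q)" by (rule adm_NN[OF U(1)])
  have Q: "Qsol (%t. fst (NN (U q) q t)) (%t. snd (NN (U q) q t)) (y q) (v q) (\<Phi> q)"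
   using Qop_QQ[OF admN] unfolding QQ_def U(2) y_def[abs_def] v_def[abs_def] \<Phi>_def .
  note QV = Qsol_V[OF adm_admissible[OF admN] Q]
  have sol: "((%t. base t + (y q t, v q t)) has_vector_derivative F (base t + (y q t, v q t), (\<Phi> q, q))) (at t within {0..})"
   if t: "t >= 0" for t
  proof -
   have dy: "(y q has_vector_derivative A t (y q t) + (\<Phi> q *\<^sub>R fm t + fst (NN (U q) q t))) (at t within {0..})"
    and dv: "(v q has_vector_derivative A t (v q t) + (B t (y q t) + \<Phi> q *\<^sub>R \<eta> t + snd (NN (U q) q t))) (at t within {0..})"
    using Q t by (auto simp: Qsol_def Ksol_def hsol_def)
   have bbev: "bb t + ev (U q) q t = (base t + (y q t, v q t), (\<Phi> q, q))"
    by (simp add: bb_def ev_def y_def v_def \<Phi>_def)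
   have lin: "F' (bb t) (ev (U q) q t) =
     (A t (y q t) + \<Phi> q *\<^sub>R fm t, B t (y q t) + A t (v q t) + \<Phi> q *\<^sub>R \<eta> t)"
   proof -
    have "ev (U q) 0 t = ((y q t, v q t), (\<Phi> q, 0))" by (simp add: ev_def y_def v_def \<Phi>_def)
    then show ?thesis
     unfolding F'_ev_split[of "bb t" "U q" q] F'_bb_dq using F'_base[OF t] by (simp add: bb_def)
   qed
   have "((%t. base t + (y q t, v q t)) has_vector_derivative F (base t, (0, 0)) +
     (A t (y q t) + (\<Phi> q *\<^sub>R fm t + fst (NN (U q) q t)), A t (v q t) + (B t (y q t) + \<Phi> q *\<^sub>R \<eta> t + snd (NN (U q) q t)))) (at t within {0..})"
    by (intro has_vector_derivative_add has_vector_derivative_Pair base_sol t dy dv)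
   moreover have "F (base t, (0, 0)) +
     (A t (y q t) + (\<Phi> q *\<^sub>R fm t + fst (NN (U q) q t)), A t (v q t) + (B t (y q t) + \<Phi> q *\<^sub>R \<eta> t + snd (NN (U q) q t)))
     = F (bb t + ev (U q) q t)"
   proof -
    have "(A t (y q t) + (\<Phi> q *\<^sub>R fm t + fst (NN (U q) q t)), A t (v q t) + (B t (y q t) + \<Phi> q *\<^sub>R \<eta> t + snd (NN (U q) q t)))
      = F' (bb t) (ev (U q) q t) + NN (U q) q t"
     unfolding lin by (simp add: prod_eq_iff add_ac)
    then show ?thesis by (simp add: NN_def) (simp add: bb_def)
   qed
   ultimately show ?thesis unfolding bbev by simp
  qed
  show ?thesis using e1 e2 e3 e4 sol yv QV by auto
 qed
 have K': "K' >= 0" using K by linarith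
 have \<Phi>0: "\<Phi> 0 = 0" using UU by (simp add: \<Phi>_def)
 show ?thesis
  by (rule exI[of _ a], rule exI[of _ \<Phi>], rule exI[of _ \<Phi>'], rule exI[of _ K'], rule exI[of _ m],
    rule exI[of _ y], rule exI[of _ v]) (use UU Qcc main K' \<Phi>0 in blast)
qed

end

section \<open>Derivatives of the vector field and the averaged system\<close>

lemma Ck_derivative:
 fixes g :: "'a::euclidean_space => 'b::euclidean_space"
 assumes "Ck (Suc k) g"
 shows "(g has_derivative frechet_derivative g (at x)) (at x)" "Ck k (%x. frechet_derivative g (at x) h)"
proof -
 obtain g' where g': "!!x. (g has_derivative g' x) (at x)" "!!h. Ck k (%x. g' x h)"
  using assms by auto
 have eq: "frechet_derivative g (at x) = g' x" for x
  using frechet_derivative_at[OF g'(1)] by metis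
 show "(g has_derivative frechet_derivative g (at x)) (at x)" "Ck k (%x. frechet_derivative g (at x) h)"
  unfolding eq using g' by blast+
qed

lemma directional_derivative:
 fixes g :: "'a::euclidean_space => 'b::euclidean_space"
 assumes "(g has_derivative g') (at (z + s *\<^sub>R h))"
 shows "((%s. g (z + s *\<^sub>R h)) has_vector_derivative g' h) (at s)"
proof -
 have "((%s. g (z + s *\<^sub>R h)) has_derivative (%r. g' (r *\<^sub>R h))) (at s)"
  by (rule has_derivative_compose[of "%s. z + s *\<^sub>R h" "%r. r *\<^sub>R h" s UNIV g g'])
   (auto intro!: derivative_eq_intros assms)
 then show ?thesis
  unfolding has_vector_derivative_def using linear_cmul[OF has_derivative_linear[OF assms]] by simp
qed

lemma partial_derivatives:
 fixes g :: "'a::euclidean_space \<times> real => 'b::euclidean_space"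
 assumes "Ck 1 g"
 shows "frechet_derivative (%y. g (y, \<mu>)) (at x) u = frechet_derivative g (at (x, \<mu>)) (u, 0)"
  "((%y. g (y, \<mu>)) has_derivative (%u. frechet_derivative g (at (x, \<mu>)) (u, 0))) (at x)"
  "vector_derivative (%m. g (x, m)) (at \<mu>) = frechet_derivative g (at (x, \<mu>)) (0, 1)"
proof -
 have D: "(g has_derivative frechet_derivative g (at z)) (at z)" for z
  using Ck_derivative(1)[of 0 g] assms by simp
 show 1: "((%y. g (y, \<mu>)) has_derivative (%u. frechet_derivative g (at (x, \<mu>)) (u, 0))) (at x)"
  by (rule has_derivative_compose[of "%y. (y, \<mu>)" "%u. (u, 0)" x UNIV g]) (auto intro!: derivative_eq_intros D)
 show "frechet_derivative (%y. g (y, \<mu>)) (at x) u = frechet_derivative g (at (x, \<mu>)) (u, 0)"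
  using frechet_derivative_at[OF 1] by metis
 have "((%s. g ((x, 0) + s *\<^sub>R (0, 1))) has_vector_derivative frechet_derivative g (at (x, \<mu>)) (0, 1)) (at \<mu>)"
  by (rule directional_derivative) (use D[of "(x, \<mu>)"] in simp)
 then show "vector_derivative (%m. g (x, m)) (at \<mu>) = frechet_derivative g (at (x, \<mu>)) (0, 1)"
  by (intro vector_derivative_at) simp
qed

locale smooth_field =
 fixes f :: "'a::euclidean_space => real => 'a"
 assumes smooth: "!!k. Ck k (%(x, \<mu>). f x \<mu>)"
begin

abbreviation "D \<equiv> %g z. frechet_derivative g (at z)"

definition f0 :: "'a \<times> real => 'a" where "f0 z = f (fst z) (snd z)"
definition f1 :: "'a => 'a \<times> real => 'a" where "f1 u z = Dx f (fst z) (snd z) u"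
definition f2 :: "'a => 'a => 'a \<times> real => 'a" where "f2 u v z = Dx2 f (fst z) (snd z) u v"

lemma f0_smooth: "Ck k f0"
 using smooth[of k] by (simp add: f0_def[abs_def] case_prod_unfold)

lemma f1_eq: "f1 u = (%z. D f0 z (u, 0))"
 using partial_derivatives(1)[OF f0_smooth] by (auto simp: fun_eq_iff f1_def Dx_def f0_def)

lemma f1_smooth: "Ck k (f1 u)"
 unfolding f1_eq by (rule Ck_derivative(2)[OF f0_smooth])

lemma f2_eq: "f2 u v = (%z. D (f1 u) z (v, 0))"
 using partial_derivatives(1)[OF f1_smooth] by (auto simp: fun_eq_iff f2_def Dx2_def f1_def)

lemma f2_smooth: "Ck k (f2 u v)"
 unfolding f2_eq by (rule Ck_derivative(2)[OF f1_smooth])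

lemma Dx3_eq: "Dx3 f x \<mu> u v w = D (f2 u v) (x, \<mu>) (w, 0)"
 using partial_derivatives(1)[OF f2_smooth[of 1 u v], of \<mu> x w] by (simp add: Dx3_def f2_def)

lemma Dmu_eq: "Dmu f x \<mu> = D f0 (x, \<mu>) (0, 1)"
 using partial_derivatives(3)[OF f0_smooth[of 1], of x \<mu>] by (simp add: Dmu_def f0_def)

lemma DmuDx_eq: "DmuDx f x \<mu> u = D (f1 u) (x, \<mu>) (0, 1)"
 using partial_derivatives(3)[OF f1_smooth[of 1 u], of x \<mu>] by (simp add: DmuDx_def f1_def)

lemma D0: "(f0 has_derivative D f0 z) (at z)" and D1: "(f1 u has_derivative D (f1 u) z) (at z)"
 and D2: "(f2 u v has_derivative D (f2 u v) z) (at z)"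
 by (rule Ck_derivative(1), rule f0_smooth f1_smooth f2_smooth)+

lemma Dx_linear: "linear (Dx f x \<mu>)"
proof -
 have "Dx f x \<mu> = (%u. D f0 (x, \<mu>) (u, 0))" using f1_eq by (auto simp: fun_eq_iff f1_def)
 moreover have "linear (%u. D f0 (x, \<mu>) (u, 0))"
  using linear_compose[OF _ has_derivative_linear[OF D0[of "(x, \<mu>)"]], of "%u. (u, 0)"]
  by (simp add: o_def linear_iff)
 ultimately show ?thesis by simp
qed

lemma f1_add: "f1 (u + v) z = f1 u z + f1 v z" and f1_scale: "f1 (c *\<^sub>R u) z = c *\<^sub>R f1 u z"
 using linear_add[OF Dx_linear] linear_cmul[OF Dx_linear] by (simp_all add: f1_def)

lemma Df1_add: "D (f1 (u + v)) z h = D (f1 u) z h + D (f1 v) z h"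
proof -
 have "(f1 (u + v) has_derivative (%h. D (f1 u) z h + D (f1 v) z h)) (at z)"
 proof -
  have "f1 (u + v) = (%z. f1 u z + f1 v z)" by (rule ext) (rule f1_add)
  then show ?thesis by (simp only:) (rule has_derivative_add[OF D1 D1])
 qed
 from fun_cong[OF frechet_derivative_at[OF this], of h] show ?thesis by simp
qed

lemma Df1_scale: "D (f1 (c *\<^sub>R u)) z h = c *\<^sub>R D (f1 u) z h"
proof -
 have "(f1 (c *\<^sub>R u) has_derivative (%h. c *\<^sub>R D (f1 u) z h)) (at z)"
 proof -
  have "f1 (c *\<^sub>R u) = (%z. c *\<^sub>R f1 u z)" by (rule ext) (rule f1_scale)
  then show ?thesis by (simp only:) (rule has_derivative_scaleR_right[OF D1])
 qed
 from fun_cong[OF frechet_derivative_at[OF this], of h] show ?thesis by simp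
qed

lemma Dx2_eq: "Dx2 f x \<mu> u v = D (f1 u) (x, \<mu>) (v, 0)"
 using f2_eq by (auto simp: fun_eq_iff f2_def)

lemma Dx2_linear_left: "linear (%u. Dx2 f x \<mu> u v)"
 unfolding Dx2_eq by (intro linearI) (simp_all add: Df1_add Df1_scale)

lemma DmuDx_linear: "linear (DmuDx f x \<mu>)"
 unfolding DmuDx_eq by (intro linearI) (simp_all add: Df1_add Df1_scale)

lemma Dx2_sym: "Dx2 f x \<mu> u v = Dx2 f x \<mu> v u"
 unfolding Dx2_eq
 by (rule second_derivative_symmetric[of f0 "%z. D f0 z", where x = "(x, \<mu>)"])
  (auto simp: f1_eq[symmetric] intro: D0 D1 f1_smooth Ck_derivative(2)[OF f0_smooth])

lemma Dx2_linear_right: "linear (%v. Dx2 f x \<mu> u v)"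
 unfolding Dx2_sym[of x \<mu> u] by (rule Dx2_linear_left)

lemma Dx_has_derivative: "((%y. f y \<mu>) has_derivative Dx f x \<mu>) (at x)"
proof -
 have "Dx f x \<mu> = (%u. D f0 (x, \<mu>) (u, 0))" using f1_eq by (auto simp: fun_eq_iff f1_def)
 then show ?thesis using partial_derivatives(2)[OF f0_smooth[of 1], of \<mu> x] by (simp add: f0_def)
qed

lemma Df0_split: "D f0 (x, \<mu>) (y, m) = Dx f x \<mu> y + m *\<^sub>R Dmu f x \<mu>"
proof -
 have lin: "linear (D f0 (x, \<mu>))" using has_derivative_linear[OF D0] .
 have "(y, m) = (y, 0) + m *\<^sub>R (0, 1)" by simp
 then have "D f0 (x, \<mu>) (y, m) = D f0 (x, \<mu>) (y, 0) + m *\<^sub>R D f0 (x, \<mu>) (0, 1)"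
  by (simp only: linear_add[OF lin] linear_cmul[OF lin])
 then show ?thesis using f1_eq by (simp add: Dmu_eq f1_def fun_eq_iff)
qed

lemma Df1_split: "D (f1 u) (x, \<mu>) (y, m) = Dx2 f x \<mu> u y + m *\<^sub>R DmuDx f x \<mu> u"
proof -
 have lin: "linear (D (f1 u) (x, \<mu>))" using has_derivative_linear[OF D1] .
 have "(y, m) = (y, 0) + m *\<^sub>R (0, 1)" by simp
 then show ?thesis by (simp only: linear_add[OF lin] linear_cmul[OF lin] Dx2_eq DmuDx_eq)
qed

lemma continuous_Ck: "Ck k g ==> continuous_on I c ==> continuous_on I (%t. g (c t))"
 by (rule continuous_on_compose2[OF Ck_continuous]) auto

lemma continuous_Dx:
 assumes "continuous_on I x" "continuous_on I u" "continuous_on I \<mu>"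
 shows "continuous_on I (%t. Dx f (x t) (\<mu> t) (u t))"
proof -
 have eq: "Dx f (x t) (\<mu> t) (u t) = (\<Sum>b\<in>Basis. (u t \<bullet> b) *\<^sub>R f1 b (x t, \<mu> t))" for t
  using linear_sum_Basis[OF Dx_linear[of "x t" "\<mu> t"], of "u t"] by (simp add: f1_def)
 show ?thesis unfolding eq
  by (intro continuous_intros assms continuous_Ck[OF f1_smooth[of 0]])
qed

lemma continuous_Dx2:
 assumes "continuous_on I x" "continuous_on I u" "continuous_on I v"
 shows "continuous_on I (%t. Dx2 f (x t) \<mu> (u t) (v t))"
proof -
 have eq: "Dx2 f (x t) \<mu> (u t) (v t) = (\<Sum>b\<in>Basis. (u t \<bullet> b) *\<^sub>R (\<Sum>c\<in>Basis. (v t \<bullet> c) *\<^sub>R f2 b c (x t, \<mu>)))" for t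
  using linear_sum_Basis[OF Dx2_linear_left[of "x t" \<mu> "v t"], of "u t"]
  by (simp add: f2_def) (rule sum.cong[OF refl], rule arg_cong[of _ _ "(*\<^sub>R) _"], rule linear_sum_Basis[OF Dx2_linear_right])
 show ?thesis unfolding eq
  by (intro continuous_intros assms continuous_Ck[OF f2_smooth[of 0]])
qed

lemma continuous_Dmu: "continuous_on I x ==> continuous_on I (%t. Dmu f (x t) \<mu>)"
 unfolding Dmu_eq by (intro continuous_Ck[OF Ck_derivative(2)[OF f0_smooth, of 0]] continuous_intros)

lemma continuous_DmuDx:
 assumes "continuous_on I x" "continuous_on I u"
 shows "continuous_on I (%t. DmuDx f (x t) \<mu> (u t))"
proof -
 have eq: "DmuDx f (x t) \<mu> (u t) = (\<Sum>b\<in>Basis. (u t \<bullet> b) *\<^sub>R D (f1 b) (x t, \<mu>) (0, 1))" for t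
  using linear_sum_Basis[OF DmuDx_linear[of "x t" \<mu>], of "u t"] by (simp add: DmuDx_eq)
 show ?thesis unfolding eq
  by (intro continuous_intros assms continuous_Ck[OF Ck_derivative(2)[OF f1_smooth, of 0]])
qed

text \<open>Equivariance passes to derivatives; \<open>s = 1\<close> for symmetries and \<open>s = -1\<close> for reversors.\<close>

lemma derivative_equivariant:
 fixes g h :: "'a => 'a"
 assumes J: "linear J" and g: "!!x. (g has_derivative g' x) (at x)" and h: "!!x. (h has_derivative h' x) (at x)"
  and eq: "!!x. g (J x) = s *\<^sub>R J (h x)"
 shows "g' (J x) (J u) = s *\<^sub>R J (h' x u)"
proof -
 have J': "bounded_linear J" using J by (simp add: linear_conv_bounded_linear)
 have 1: "((%y. g (J y)) has_derivative (%u. g' (J x) (J u))) (at x)"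
  by (rule has_derivative_compose[of J J x UNIV g]) (auto intro: g bounded_linear_imp_has_derivative J')
 have 2: "((%y. s *\<^sub>R J (h y)) has_derivative (%u. s *\<^sub>R J (h' x u))) (at x)"
  by (intro has_derivative_scaleR_right bounded_linear.has_derivative[OF J'] h)
 from fun_cong[OF has_derivative_unique[OF 1[unfolded eq] 2]] show ?thesis .
qed

lemma Dx2_has_derivative: "((%y. Dx f y \<mu> u) has_derivative Dx2 f x \<mu> u) (at x)"
 using partial_derivatives(2)[OF f1_smooth[of 1 u], of \<mu> x] by (simp add: f1_def Dx2_eq[symmetric])

lemma Dx3_has_derivative: "((%y. Dx2 f y \<mu> u v) has_derivative Dx3 f x \<mu> u v) (at x)"
 using partial_derivatives(2)[OF f2_smooth[of 1 u v], of \<mu> x] by (simp add: f2_def Dx3_eq[symmetric])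

lemma Dx_equivariant:
 assumes J: "linear J" and eq: "!!x \<mu>. f (J x) \<mu> = s *\<^sub>R J (f x \<mu>)"
 shows "Dx f (J x) \<mu> (J u) = s *\<^sub>R J (Dx f x \<mu> u)"
  and "Dx2 f (J x) \<mu> (J u) (J v) = s *\<^sub>R J (Dx2 f x \<mu> u v)"
  and "Dx3 f (J x) \<mu> (J u) (J v) (J w) = s *\<^sub>R J (Dx3 f x \<mu> u v w)"
proof -
 have 1: "Dx f (J x) \<mu> (J u) = s *\<^sub>R J (Dx f x \<mu> u)" for x u
  by (rule derivative_equivariant[where g = "%y. f y \<mu>" and h = "%y. f y \<mu>" and g' = "%x. Dx f x \<mu>" and h' = "%x. Dx f x \<mu>"])
   (rule J Dx_has_derivative eq)+
 have 2: "Dx2 f (J x) \<mu> (J u) (J v) = s *\<^sub>R J (Dx2 f x \<mu> u v)" for x u v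
  by (rule derivative_equivariant[where g = "%y. Dx f y \<mu> (J u)" and h = "%y. Dx f y \<mu> u" and g' = "%x. Dx2 f x \<mu> (J u)" and h' = "%x. Dx2 f x \<mu> u"])
   (rule J Dx2_has_derivative 1)+
 have 3: "Dx3 f (J x) \<mu> (J u) (J v) (J w) = s *\<^sub>R J (Dx3 f x \<mu> u v w)"
  by (rule derivative_equivariant[where g = "%y. Dx2 f y \<mu> (J u) (J v)" and h = "%y. Dx2 f y \<mu> u v" and g' = "%x. Dx3 f x \<mu> (J u) (J v)" and h' = "%x. Dx3 f x \<mu> u v"])
   (rule J Dx3_has_derivative 2)+
 show "Dx f (J x) \<mu> (J u) = s *\<^sub>R J (Dx f x \<mu> u)" "Dx2 f (J x) \<mu> (J u) (J v) = s *\<^sub>R J (Dx2 f x \<mu> u v)"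
  "Dx3 f (J x) \<mu> (J u) (J v) (J w) = s *\<^sub>R J (Dx3 f x \<mu> u v w)" by (rule 1 2 3)+
qed

lemmas Dx2_equivariant = Dx_equivariant(2) and Dx3_equivariant = Dx_equivariant(3)

lemma vector_derivative_f: "((%m. f x m) has_vector_derivative Dmu f x \<mu>) (at \<mu>)"
 and vector_derivative_Dx: "((%m. Dx f x m u) has_vector_derivative DmuDx f x \<mu> u) (at \<mu>)"
proof -
 have "((%s. f0 ((x, 0) + s *\<^sub>R (0, 1))) has_vector_derivative D f0 (x, \<mu>) (0, 1)) (at \<mu>)"
  by (rule directional_derivative) (use D0[of "(x, \<mu>)"] in simp)
 then show "((%m. f x m) has_vector_derivative Dmu f x \<mu>) (at \<mu>)" by (simp add: f0_def Dmu_eq)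
 have "((%s. f1 u ((x, 0) + s *\<^sub>R (0, 1))) has_vector_derivative D (f1 u) (x, \<mu>) (0, 1)) (at \<mu>)"
  by (rule directional_derivative) (use D1[of u "(x, \<mu>)"] in simp)
 then show "((%m. Dx f x m u) has_vector_derivative DmuDx f x \<mu> u) (at \<mu>)" by (simp add: f1_def DmuDx_eq)
qed

lemma Dmu_equivariant:
 assumes J: "linear J" and eq: "!!x \<mu>. f (J x) \<mu> = s *\<^sub>R J (f x \<mu>)"
 shows "Dmu f (J x) \<mu> = s *\<^sub>R J (Dmu f x \<mu>)"
proof -
 have J': "bounded_linear J" using J by (simp add: linear_conv_bounded_linear)
 have "((%m. s *\<^sub>R J (f x m)) has_vector_derivative s *\<^sub>R J (Dmu f x \<mu>)) (at \<mu>)"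
  by (intro bounded_linear.has_vector_derivative[OF bounded_linear_scaleR_right]
    bounded_linear.has_vector_derivative[OF J'] vector_derivative_f)
 moreover have "((%m. f (J x) m) has_vector_derivative Dmu f (J x) \<mu>) (at \<mu>)" by (rule vector_derivative_f)
 ultimately show ?thesis unfolding eq using vector_derivative_unique_at by blast
qed

lemma DmuDx_equivariant:
 assumes J: "linear J" and eq: "!!x \<mu>. f (J x) \<mu> = s *\<^sub>R J (f x \<mu>)"
 shows "DmuDx f (J x) \<mu> (J u) = s *\<^sub>R J (DmuDx f x \<mu> u)"
proof -
 have J': "bounded_linear J" using J by (simp add: linear_conv_bounded_linear)
 have "((%m. s *\<^sub>R J (Dx f x m u)) has_vector_derivative s *\<^sub>R J (DmuDx f x \<mu> u)) (at \<mu>)"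
  by (intro bounded_linear.has_vector_derivative[OF bounded_linear_scaleR_right]
    bounded_linear.has_vector_derivative[OF J'] vector_derivative_Dx)
 moreover have "((%m. Dx f (J x) m (J u)) has_vector_derivative DmuDx f (J x) \<mu> (J u)) (at \<mu>)"
  by (rule vector_derivative_Dx)
 ultimately show ?thesis unfolding Dx_equivariant(1)[OF J eq] using vector_derivative_unique_at by blast
qed

text \<open>Difference quotient and mean of the vector field at \<open>p + \<alpha> w\<close> and \<open>p - \<alpha> w\<close>. The integral form of the quotient is smooth across \<open>\<alpha> = 0\<close>.\<close>

definition kk :: "'a => 'a => real => real => 'a" where
 "kk p w \<mu> \<alpha> = integral {0..1} (%s. Dx f (p + ((2 * s - 1) * \<alpha>) *\<^sub>R w) \<mu> w)"

definition ee :: "'a => 'a => real => real => 'a" where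
 "ee p w \<mu> \<alpha> = (1 / 2) *\<^sub>R (f (p + \<alpha> *\<^sub>R w) \<mu> + f (p - \<alpha> *\<^sub>R w) \<mu>)"

definition FF :: "('a \<times> 'a) \<times> (real \<times> real) => 'a \<times> 'a" where
 "FF z = (ee (fst (fst z)) (snd (fst z)) (fst (snd z)) (snd (snd z)), kk (fst (fst z)) (snd (fst z)) (fst (snd z)) (snd (snd z)))"

lemma kk_0: "kk p w \<mu> 0 = Dx f p \<mu> w"
 by (simp add: kk_def)

lemma kk_difference: "\<alpha> *\<^sub>R kk p w \<mu> \<alpha> = (1 / 2) *\<^sub>R (f (p + \<alpha> *\<^sub>R w) \<mu> - f (p - \<alpha> *\<^sub>R w) \<mu>)"
proof -
 define g where "g s = (1 / 2) *\<^sub>R f (p + ((2 * s - 1) * \<alpha>) *\<^sub>R w) \<mu>" for s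
 have d: "(g has_vector_derivative \<alpha> *\<^sub>R Dx f (p + ((2 * s - 1) * \<alpha>) *\<^sub>R w) \<mu> w) (at s within {0..1})" for s
 proof -
  have "((%s. f (p + ((2 * s - 1) * \<alpha>) *\<^sub>R w) \<mu>) has_derivative
    (%r. Dx f (p + ((2 * s - 1) * \<alpha>) *\<^sub>R w) \<mu> ((2 * r * \<alpha>) *\<^sub>R w))) (at s within {0..1})"
   by (rule has_derivative_compose[of "%s. p + ((2 * s - 1) * \<alpha>) *\<^sub>R w" "%r. (2 * r * \<alpha>) *\<^sub>R w" s "{0..1}" "%y. f y \<mu>"])
    (auto intro!: derivative_eq_intros Dx_has_derivative)
  then have "((%s. f (p + ((2 * s - 1) * \<alpha>) *\<^sub>R w) \<mu>) has_vector_derivative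
    (2 * \<alpha>) *\<^sub>R Dx f (p + ((2 * s - 1) * \<alpha>) *\<^sub>R w) \<mu> w) (at s within {0..1})"
   unfolding has_vector_derivative_def by (simp add: linear_cmul[OF Dx_linear] mult_ac)
  from bounded_linear.has_vector_derivative[OF bounded_linear_scaleR_right[of "1 / 2"] this]
  show ?thesis by (simp add: g_def[abs_def])
 qed
 have "((%s. \<alpha> *\<^sub>R Dx f (p + ((2 * s - 1) * \<alpha>) *\<^sub>R w) \<mu> w) has_integral (g 1 - g 0)) {0..1}"
  by (rule fundamental_theorem_of_calculus) (use d in auto)
 then have "integral {0..1} (%s. \<alpha> *\<^sub>R Dx f (p + ((2 * s - 1) * \<alpha>) *\<^sub>R w) \<mu> w) = g 1 - g 0"
  by (rule integral_unique)
 then show ?thesis by (simp add: kk_def g_def scaleR_diff_right)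
qed

text \<open>A solution of the averaged system gives back the two orbits \<open>p + \<alpha> w\<close> and
 \<open>p - \<alpha> w\<close>.\<close>

lemma ee_kk:
 "ee p w \<mu> \<alpha> + \<alpha> *\<^sub>R kk p w \<mu> \<alpha> = f (p + \<alpha> *\<^sub>R w) \<mu>"
 "ee p w \<mu> \<alpha> - \<alpha> *\<^sub>R kk p w \<mu> \<alpha> = f (p - \<alpha> *\<^sub>R w) \<mu>"
proof -
 have h: "(1 / 2) *\<^sub>R x + (1 / 2) *\<^sub>R x = x" for x :: 'a by (simp flip: scaleR_add_left)
 show "ee p w \<mu> \<alpha> + \<alpha> *\<^sub>R kk p w \<mu> \<alpha> = f (p + \<alpha> *\<^sub>R w) \<mu>"
  using h[of "f (p + \<alpha> *\<^sub>R w) \<mu>"] unfolding kk_difference ee_def by (simp add: scaleR_add_right scaleR_diff_right)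
 show "ee p w \<mu> \<alpha> - \<alpha> *\<^sub>R kk p w \<mu> \<alpha> = f (p - \<alpha> *\<^sub>R w) \<mu>"
  using h[of "f (p - \<alpha> *\<^sub>R w) \<mu>"] unfolding kk_difference ee_def by (simp add: scaleR_add_right scaleR_diff_right)
qed

lemma kk_even: "kk p w \<mu> (- \<alpha>) = kk p w \<mu> \<alpha>"
proof (cases "\<alpha> = 0")
 case False
 have "\<alpha> *\<^sub>R kk p w \<mu> (- \<alpha>) = - ((- \<alpha>) *\<^sub>R kk p w \<mu> (- \<alpha>))" by simp
 also have "\<dots> = \<alpha> *\<^sub>R kk p w \<mu> \<alpha>" unfolding kk_difference by (simp add: scaleR_diff_right)
 finally show ?thesis using False by simp
qed simp

lemma FF_even: "FF (x, (\<mu>, - \<alpha>)) = FF (x, (\<mu>, \<alpha>))"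
 by (simp add: FF_def kk_even ee_def add.commute)

lemma FF_smooth: "Ck k FF"
proof -
 have bl: "bounded_linear (%z::('a \<times> 'a) \<times> (real \<times> real). fst (fst z))" "bounded_linear (%z::('a \<times> 'a) \<times> (real \<times> real). snd (fst z))"
  "bounded_linear (%z::('a \<times> 'a) \<times> (real \<times> real). fst (snd z))" "bounded_linear (%z::('a \<times> 'a) \<times> (real \<times> real). snd (snd z))"
  by (rule bounded_linear_compose[OF bounded_linear_fst bounded_linear_fst]
    bounded_linear_compose[OF bounded_linear_snd bounded_linear_fst]
    bounded_linear_compose[OF bounded_linear_fst bounded_linear_snd]
    bounded_linear_compose[OF bounded_linear_snd bounded_linear_snd])+
 have p: "Ck k (%z::('a \<times> 'a) \<times> (real \<times> real). fst (fst z))" and w: "Ck k (%z::('a \<times> 'a) \<times> (real \<times> real). snd (fst z))"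
  and m: "Ck k (%z::('a \<times> 'a) \<times> (real \<times> real). fst (snd z))" and al: "Ck k (%z::('a \<times> 'a) \<times> (real \<times> real). snd (snd z))"
  by (rule Ck_bounded_linear, rule bl)+
 have f0c: "Ck k (%z. f0 (g z, h z))" if "Ck k g" "Ck k h" for g :: "('a \<times> 'a) \<times> (real \<times> real) => 'a" and h
  by (rule Ck_compose[OF f0_smooth Ck_Pair[OF that]])
 have "Ck k (%z. (1 / 2) *\<^sub>R (f0 (fst (fst z) + snd (snd z) *\<^sub>R snd (fst z), fst (snd z)) +
   f0 (fst (fst z) + (- 1) *\<^sub>R (snd (snd z) *\<^sub>R snd (fst z)), fst (snd z))))"
  by (intro Ck_bounded_linear_compose[OF bounded_linear_scaleR_right] Ck_add f0c Ck_scaleR p w m al)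
 then have e: "Ck k (%z. ee (fst (fst z)) (snd (fst z)) (fst (snd z)) (snd (snd z)))"
  by (simp add: ee_def f0_def)
 define g where "g x = (\<Sum>b\<in>Basis. (snd (fst (snd x)) \<bullet> b) *\<^sub>R
   f1 b (fst (fst (snd x)) + ((2 * fst x - 1) * snd (snd (snd x))) *\<^sub>R snd (fst (snd x)), fst (snd (snd x))))"
  for x :: "real \<times> (('a \<times> 'a) \<times> (real \<times> real))"
 have g: "Ck k g"
 proof -
  have c: "Ck k (%x. q (snd x))" if "Ck k q" for q :: "('a \<times> 'a) \<times> (real \<times> real) => 'c::euclidean_space"
   by (rule Ck_compose[OF that Ck_bounded_linear[OF bounded_linear_snd]])
  have s: "Ck k (%x::real \<times> (('a \<times> 'a) \<times> (real \<times> real)). 2 * fst x - 1)"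
  proof -
   have "Ck k (%x::real \<times> (('a \<times> 'a) \<times> (real \<times> real)). 2 *\<^sub>R fst x + (- 1))"
    by (intro Ck_add Ck_const Ck_bounded_linear_compose[OF bounded_linear_scaleR_right] Ck_bounded_linear bounded_linear_fst)
   then show ?thesis by simp
  qed
  have sa: "Ck k (%x::real \<times> (('a \<times> 'a) \<times> (real \<times> real)). (2 * fst x - 1) * snd (snd (snd x)))"
   using Ck_scaleR[OF s c[OF al]] by simp
  show ?thesis
   unfolding g_def
   by (intro Ck_sum finite_Basis Ck_scaleR Ck_bounded_linear_compose[OF bounded_linear_inner_left] c[OF w]
     Ck_compose[OF f1_smooth Ck_Pair] Ck_add c[OF p] sa c[OF m])
 qed
 have "kk (fst (fst z)) (snd (fst z)) (fst (snd z)) (snd (snd z)) = integral {0..1} (%s. g (s, z))" for z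
  unfolding kk_def g_def f1_def fst_conv snd_conv
  by (rule Henstock_Kurzweil_Integration.integral_cong) (rule linear_sum_Basis[OF Dx_linear])
 then have kc: "Ck k (%z. kk (fst (fst z)) (snd (fst z)) (fst (snd z)) (snd (snd z)))"
  using Ck_integral[OF g] by simp
 show ?thesis unfolding FF_def[abs_def] by (rule Ck_Pair[OF e kc])
qed

definition FF' where "FF' z h = D FF z h"
definition FF2 where "FF2 z h = D (%z. FF' z (0, (0, 1))) z h"

lemma FF'_props: "(FF has_derivative FF' z) (at z)" "Ck k (%z. FF' z h)"
 using Ck_derivative[OF FF_smooth] by (auto simp: FF'_def[abs_def])

lemma FF2_props: "((%z. FF' z (0, (0, 1))) has_derivative FF2 z) (at z)" "Ck k (%z. FF2 z h)"
 using Ck_derivative[OF FF'_props(2)] by (auto simp: FF2_def[abs_def])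

lemma FF'_slice: "FF' ((p, w), (0, 0)) ((y, v), (m, 0)) =
 (Dx f p 0 y + m *\<^sub>R Dmu f p 0, Dx2 f p 0 y w + Dx f p 0 v + m *\<^sub>R DmuDx f p 0 w)"
proof (rule vector_derivative_unique_at)
 show "((%s. FF (((p, w), (0, 0)) + s *\<^sub>R ((y, v), (m, 0)))) has_vector_derivative FF' ((p, w), (0, 0)) ((y, v), (m, 0))) (at 0)"
  by (rule directional_derivative) (use FF'_props(1)[of "((p, w), (0, 0))"] in \<open>simp add: zero_prod_def\<close>)
 have eq: "FF (((p, w), (0, 0)) + s *\<^sub>R ((y, v), (m, 0))) =
   (f0 ((p, 0) + s *\<^sub>R (y, m)), f1 w ((p, 0) + s *\<^sub>R (y, m)) + s *\<^sub>R f1 v ((p, 0) + s *\<^sub>R (y, m)))" for s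
 proof -
  have h: "(1 / 2) *\<^sub>R (x + x) = x" for x :: 'a by (simp add: scaleR_add_right flip: scaleR_add_left)
  show ?thesis
   by (simp add: FF_def ee_def h kk_0 f0_def f1_def linear_add[OF Dx_linear] linear_cmul[OF Dx_linear])
 qed
 have a: "((%s. f0 ((p, 0) + s *\<^sub>R (y, m))) has_vector_derivative D f0 (p, 0) (y, m)) (at 0)"
  by (rule directional_derivative) (use D0[of "(p, 0)"] in \<open>simp add: zero_prod_def\<close>)
 have b: "((%s. f1 u ((p, 0) + s *\<^sub>R (y, m))) has_vector_derivative D (f1 u) (p, 0) (y, m)) (at 0)" for u
  by (rule directional_derivative) (use D1[of u "(p, 0)"] in \<open>simp add: zero_prod_def\<close>)
 have c: "((%s. s *\<^sub>R f1 v ((p, 0) + s *\<^sub>R (y, m))) has_vector_derivative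
   0 *\<^sub>R D (f1 v) (p, 0) (y, m) + 1 *\<^sub>R f1 v ((p, 0) + 0 *\<^sub>R (y, m))) (at 0)"
  by (rule bounded_bilinear.has_vector_derivative[OF bounded_bilinear_scaleR has_vector_derivative_id b])
 have "((%s. FF (((p, w), (0, 0)) + s *\<^sub>R ((y, v), (m, 0)))) has_vector_derivative
   (D f0 (p, 0) (y, m), D (f1 w) (p, 0) (y, m) + (0 *\<^sub>R D (f1 v) (p, 0) (y, m) + 1 *\<^sub>R f1 v ((p, 0) + 0 *\<^sub>R (y, m))))) (at 0)"
  unfolding eq by (intro has_vector_derivative_Pair has_vector_derivative_add a b c)
 then show "((%s. FF (((p, w), (0, 0)) + s *\<^sub>R ((y, v), (m, 0)))) has_vector_derivative
   (Dx f p 0 y + m *\<^sub>R Dmu f p 0, Dx2 f p 0 y w + Dx f p 0 v + m *\<^sub>R DmuDx f p 0 w)) (at 0)"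
  by (rule has_vector_derivative_eq_rhs)
   (simp add: Df0_split Df1_split f1_def Dx2_sym[of p 0 w] zero_prod_def[symmetric] add_ac)
qed

text \<open>The coefficient \<open>1 / 3\<close> is \<open>\<integral>\<^sub>0\<^sup>1 (2 s - 1)\<^sup>2
 ds\<close>.\<close>

lemma FF2_slice: "FF2 ((p, w), (0, 0)) (0, (0, 1)) = (Dx2 f p 0 w w, (1 / 3) *\<^sub>R Dx3 f p 0 w w w)"
proof -
 define g1 where "g1 a = Dx f (p + a *\<^sub>R w) 0 w" for a
 define g2 where "g2 a = Dx2 f (p + a *\<^sub>R w) 0 w w" for a
 define g3 where "g3 a = Dx3 f (p + a *\<^sub>R w) 0 w w w" for a
 have eqz: "((p, 0) + a *\<^sub>R (w, 0)) = (p + a *\<^sub>R w, 0::real)" for a by simp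
 have d0: "((%a. f (p + a *\<^sub>R w) 0) has_vector_derivative g1 a) (at a)" for a
  using directional_derivative[of f0 "D f0 (p + a *\<^sub>R w, 0)" "(p, 0)" a "(w, 0)"] D0
  by (simp add: eqz f0_def g1_def Df0_split)
 have d1: "(g1 has_vector_derivative g2 a) (at a)" for a
  using directional_derivative[of "f1 w" "D (f1 w) (p + a *\<^sub>R w, 0)" "(p, 0)" a "(w, 0)"] D1
  by (simp add: eqz f1_def g1_def[abs_def] g2_def Df1_split)
 have d2: "(g2 has_vector_derivative g3 a) (at a)" for a
  using directional_derivative[of "f2 w w" "D (f2 w w) (p + a *\<^sub>R w, 0)" "(p, 0)" a "(w, 0)"] D2
  by (simp add: eqz f2_def g2_def[abs_def] g3_def Dx3_eq)
 have c2: "continuous_on UNIV g2" "continuous_on UNIV g3"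
 proof -
  show "continuous_on UNIV g2"
   using d2 by (meson continuous_at_imp_continuous_on has_vector_derivative_continuous)
  have "g3 = (%a. D (f2 w w) (p + a *\<^sub>R w, 0) (w, 0))" by (simp add: g3_def[abs_def] Dx3_eq)
  then show "continuous_on UNIV g3"
   using continuous_Ck[OF Ck_derivative(2)[OF f2_smooth, of 0 w w "(w, 0)"], of UNIV "%a. (p + a *\<^sub>R w, 0)"]
   by (simp add: continuous_intros)
 qed
 have par: "((%a. integral {0..1} (%s. r s *\<^sub>R h ((2 * s - 1) * a))) has_vector_derivative
   integral {0..1} (%s. (r s * (2 * s - 1)) *\<^sub>R h' ((2 * s - 1) * a))) (at a)"
  if h: "!!a. (h has_vector_derivative h' a) (at a)" "continuous_on UNIV h" "continuous_on UNIV h'"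
   and r: "!!s. (r has_real_derivative r' s) (at s)" "continuous_on UNIV r'" for h h' :: "real => 'a" and r r' a
 proof -
  have rc: "continuous_on UNIV r" using r(1) by (meson DERIV_isCont continuous_at_imp_continuous_on)
  define G where "G x = r (fst x) *\<^sub>R h ((2 * fst x - 1) * snd x)" for x :: "real \<times> real"
  define G' where "G' x k = r (fst x) *\<^sub>R ((2 * fst k * snd x + (2 * fst x - 1) * snd k) *\<^sub>R h' ((2 * fst x - 1) * snd x)) +
    (r' (fst x) * fst k) *\<^sub>R h ((2 * fst x - 1) * snd x)" for x k :: "real \<times> real"
  have dG: "(G has_derivative G' x) (at x)" for x
  proof -
   have 1: "((%x. h ((2 * fst x - 1) * snd x)) has_derivative
     (%k. (2 * fst k * snd x + (2 * fst x - 1) * snd k) *\<^sub>R h' ((2 * fst x - 1) * snd x))) (at x)"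
   proof (rule has_derivative_compose[of "%x. (2 * fst x - 1) * snd x" "%k. 2 * fst k * snd x + (2 * fst x - 1) * snd k" x UNIV h "%c. c *\<^sub>R h' ((2 * fst x - 1) * snd x)"])
    show "((%x. (2 * fst x - 1) * snd x) has_derivative (%k. 2 * fst k * snd x + (2 * fst x - 1) * snd k)) (at x)"
     by (auto intro!: derivative_eq_intros simp: fun_eq_iff)
    show "(h has_derivative (%c. c *\<^sub>R h' ((2 * fst x - 1) * snd x))) (at ((2 * fst x - 1) * snd x))"
     using h(1) by (simp add: has_vector_derivative_def)
   qed
   have 2: "((%x. r (fst x)) has_derivative (%k. r' (fst x) * fst k)) (at x)"
    by (rule has_derivative_compose[of fst fst x UNIV r "%c. r' (fst x) * c"])
     (use r(1) in \<open>auto intro!: derivative_eq_intros simp: has_field_derivative_def\<close>)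
   show ?thesis unfolding G_def[abs_def] G'_def[abs_def] by (rule has_derivative_scaleR[OF 2 1])
  qed
  have cG: "continuous_on UNIV (%x. G' x k)" for k
   unfolding G'_def
   by (intro continuous_intros continuous_on_compose2[OF rc] continuous_on_compose2[OF r(2)]
     continuous_on_compose2[OF h(2)] continuous_on_compose2[OF h(3)]) auto
  have "((%z. integral {0..1} (%s. G (s, z))) has_derivative
    (%k. integral {0..1} (%s. G' (s, a) (0, k)))) (at a)"
   by (rule has_derivative_integral_param[OF dG cG])
  moreover have "integral {0..1} (%s. G' (s, a) (0, k)) =
    k *\<^sub>R integral {0..1} (%s. (r s * (2 * s - 1)) *\<^sub>R h' ((2 * s - 1) * a))" for k
   unfolding integral_cmul[symmetric] by (rule integral_cong) (simp add: G'_def mult_ac)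
  ultimately show ?thesis by (simp add: has_vector_derivative_def G_def)
 qed
 have k1: "((%a. kk p w 0 a) has_vector_derivative integral {0..1} (%s. (2 * s - 1) *\<^sub>R g2 ((2 * s - 1) * a))) (at a)" for a
 proof -
  have "continuous_on UNIV g1"
   using d1 by (meson continuous_at_imp_continuous_on has_vector_derivative_continuous)
  from par[OF d1 this c2(1), of "%_. 1" "%_. 0" a]
  show ?thesis by (simp add: kk_def g1_def mult.commute)
 qed
 have k2: "((%a. integral {0..1} (%s. (2 * s - 1) *\<^sub>R g2 ((2 * s - 1) * a))) has_vector_derivative (1 / 3) *\<^sub>R g3 0) (at 0)"
 proof -
  have "((%a. integral {0..1} (%s. (2 * s - 1) *\<^sub>R g2 ((2 * s - 1) * a))) has_vector_derivative
   integral {0..1} (%s. ((2 * s - 1) * (2 * s - 1)) *\<^sub>R g3 ((2 * s - 1) * 0))) (at 0)"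
   by (rule par[OF d2 c2(1) c2(2), where r' = "%_. 2"]) (auto intro!: derivative_eq_intros)
  moreover have "((%s::real. (2 * s - 1) * (2 * s - 1)) has_integral ((2 * 1 - 1) ^ 3 / 6 - (2 * 0 - 1) ^ 3 / 6)) {0..1}"
   by (rule fundamental_theorem_of_calculus)
    (auto intro!: derivative_eq_intros simp: has_real_derivative_iff_has_vector_derivative[symmetric] power2_eq_square)
  then have "((%s. ((2 * s - 1) * (2 * s - 1)) *\<^sub>R g3 0) has_integral (1 / 3) *\<^sub>R g3 0) {0..1}"
   using has_integral_scaleR_left[of "%s::real. (2 * s - 1) * (2 * s - 1)" "1 / 3" "{0..1}" "g3 0"] by simp
  then have "integral {0..1} (%s. ((2 * s - 1) * (2 * s - 1)) *\<^sub>R g3 0) = (1 / 3) *\<^sub>R g3 0"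
   by (rule integral_unique)
  ultimately show ?thesis by simp
 qed
 have m1: "((%a. h (- a)) has_vector_derivative - h' (- a)) (at a)"
  if "!!a. (h has_vector_derivative h' a) (at a)" for h h' :: "real => 'a" and a
 proof -
  have "((h \<circ> uminus) has_vector_derivative (- 1) *\<^sub>R h' (- a)) (at a)"
   by (rule vector_diff_chain_at) (use that in \<open>auto intro!: derivative_eq_intros\<close>)
  then show ?thesis by (simp add: o_def)
 qed
 have e1: "((%a. ee p w 0 a) has_vector_derivative (1 / 2) *\<^sub>R (g1 a + - g1 (- a))) (at a)" for a
 proof -
  have "((%a. f (p + (- a) *\<^sub>R w) 0) has_vector_derivative - g1 (- a)) (at a)" by (rule m1[OF d0])
  then show ?thesis
   unfolding ee_def using d0[of a]
   by (intro bounded_linear.has_vector_derivative[OF bounded_linear_scaleR_right] has_vector_derivative_add) auto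
 qed
 have e2: "((%a. (1 / 2) *\<^sub>R (g1 a + - g1 (- a))) has_vector_derivative g2 0) (at 0)"
 proof -
  have "((%a. (1 / 2) *\<^sub>R (g1 a + - g1 (- a))) has_vector_derivative (1 / 2) *\<^sub>R (g2 0 + - (- g2 (- 0)))) (at 0)"
   by (intro bounded_linear.has_vector_derivative[OF bounded_linear_scaleR_right] has_vector_derivative_add
     has_vector_derivative_minus d1 m1)
  moreover have "(1 / 2) *\<^sub>R (g2 0 + - (- g2 (- 0))) = g2 0"
   by (simp add: scaleR_add_right flip: scaleR_add_left)
  ultimately show ?thesis by simp
 qed
 have slice: "((p, w), (0, 0)) + a *\<^sub>R (0, (0, 1)) = ((p, w), (0::real, a))" for a by simp
 have q1: "FF' ((p, w), (0, a)) (0, (0, 1)) =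
   ((1 / 2) *\<^sub>R (g1 a + - g1 (- a)), integral {0..1} (%s. (2 * s - 1) *\<^sub>R g2 ((2 * s - 1) * a)))" for a
 proof (rule vector_derivative_unique_at)
  show "((%a. FF ((p, w), (0, a))) has_vector_derivative FF' ((p, w), (0, a)) (0, (0, 1))) (at a)"
   using directional_derivative[of FF "FF' ((p, w), (0, a))" "((p, w), (0, 0))" a "(0, (0, 1))"] FF'_props(1)
   unfolding slice by blast
  show "((%a. FF ((p, w), (0, a))) has_vector_derivative
   ((1 / 2) *\<^sub>R (g1 a + - g1 (- a)), integral {0..1} (%s. (2 * s - 1) *\<^sub>R g2 ((2 * s - 1) * a)))) (at a)"
   using has_vector_derivative_Pair[OF e1 k1] by (simp add: FF_def)
 qed
 show ?thesis
 proof (rule vector_derivative_unique_at)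
  show "((%a. FF' ((p, w), (0, a)) (0, (0, 1))) has_vector_derivative FF2 ((p, w), (0, 0)) (0, (0, 1))) (at 0)"
   using directional_derivative[of "%z. FF' z (0, (0, 1))" "FF2 ((p, w), (0, 0))" "((p, w), (0, 0))" 0 "(0, (0, 1))"] FF2_props(1)
   unfolding slice by blast
  show "((%a. FF' ((p, w), (0, a)) (0, (0, 1))) has_vector_derivative (Dx2 f p 0 w w, (1 / 3) *\<^sub>R Dx3 f p 0 w w w)) (at 0)"
   unfolding q1 using has_vector_derivative_Pair[OF e2 k2] by (simp add: g2_def g3_def)
 qed
qed

end

section \<open>The variational equation along a symmetric homoclinic orbit\<close>

text \<open>The hypotheses on the system and on the fundamental solutions, with \<open>S\<close> as a linear
 map. By uniqueness of derivatives \<open>\<phi>\<^sub>1 = f(x\<^sup>h)\<close>.\<close>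

locale reversible_homoclinic = smooth_field f for f :: "real ^ 'm => real => real ^ 'm" +
 fixes n :: nat and ip :: "real ^ 'm => real ^ 'm => real" and R S :: "real ^ 'm => real ^ 'm"
  and \<Lambda> :: "nat => complex" and xh :: "real => real ^ 'm" and \<phi> \<psi> :: "nat => real => real ^ 'm"
 assumes n2: "n >= 2" and card_m: "CARD('m) = 2 * n"
  and linR: "linear R" and RR: "!!x. R (R x) = x" and R_f: "!!x \<mu>. f (R x) \<mu> = - R (f x \<mu>)"
  and f_0: "!!\<mu>. f 0 \<mu> = 0"
  and char_poly: "!!z. det (mat z - (\<chi> i j. complex_of_real (matrix (Dx f 0 0) $ i $ j)))
        = (\<Prod>j = 1..n. (z - \<Lambda> j) * (z + \<Lambda> j))"
  and eigenvalues: "0 < Re (\<Lambda> 1)" "!!j. 1 <= j ==> j < n ==> Re (\<Lambda> j) <= Re (\<Lambda> (j + 1))"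
  and xh_sol: "!!t. (xh has_vector_derivative f (xh t) 0) (at t)"
  and xh_lim: "(xh \<longlongrightarrow> 0) at_top" and xh_sym: "!!t. xh (- t) = R (xh t)" and xh_ne: "EX t. xh t ~= 0"
  and phi1: "!!t. \<phi> 1 t = f (xh t) 0"
  and phi2_bounded: "bounded (range (\<phi> 2))" and phi2_R0: "R (\<phi> 2 0) = \<phi> 2 0"
  and linS: "linear S" and SS: "!!x. S (S x) = x" and S_f: "!!x \<mu>. f (S x) \<mu> = S (f x \<mu>)"
  and S_orth: "{x. S x = - x} = orth_compl ip {x. S x = x}"
  and S_xh: "!!t. S (xh t) = xh t" and S_phi2': "!!t. S (\<phi> 2 t) = - \<phi> 2 t"
  and S_psi': "!!t. S (\<psi> (n + 2) t) = - \<psi> (n + 2) t"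
  and ip: "Defs.scalar_product ip" and R_orth: "{x. R x = - x} = orth_compl ip {x. R x = x}"
  and phi_VE: "!!j t. j \<in> {1..2 * n} ==> (\<phi> j has_vector_derivative Dx f (xh t) 0 (\<phi> j t)) (at t)"
  and phi_lim: "!!j. j \<in> {3..n} ==> (\<phi> j \<longlongrightarrow> 0) at_top"
  and phi_Rn1: "R (\<phi> (n + 1) 0) = \<phi> (n + 1) 0" and phi_Rn2: "R (\<phi> (n + 2) 0) = - \<phi> (n + 2) 0"
  and phi_Rj': "!!j t. j \<in> {3..n} ==> \<phi> (n + j) t = R (\<phi> j (- t))"
  and dual: "!!j k t. j \<in> {1..2 * n} ==> k \<in> {1..2 * n} ==> ip (\<psi> j t) (\<phi> k t) = (if j = k then 1 else 0)"
begin

abbreviation A where "A \<equiv> %t. Dx f (xh t) 0"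

lemma linT: "linear (%x. R (S (R x)))"
 using linear_compose[OF linear_compose[OF linR linS] linR] by (simp add: o_def)

lemma T_f: "f (R (S (R x))) \<mu> = R (S (R (f x \<mu>)))"
proof -
 have "S (- y) = - S y" "R (- y) = - R y" for y
  using linear_cmul[OF linS, of "- 1" y] linear_cmul[OF linR, of "- 1" y] by simp_all
 then show ?thesis by (simp add: R_f S_f)
qed

lemma R_f': "f (R x) \<mu> = (- 1) *\<^sub>R R (f x \<mu>)" and S_f': "f (S x) \<mu> = 1 *\<^sub>R S (f x \<mu>)"
 and T_f': "f (R (S (R x))) \<mu> = 1 *\<^sub>R R (S (R (f x \<mu>)))"
 by (simp add: R_f, simp add: S_f, simp only: T_f scaleR_one)

lemma T_xh: "R (S (R (xh t))) = xh t"
 using S_xh[of "- t"] by (simp add: xh_sym RR)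

lemma xh_continuous: "continuous_on I xh"
 using xh_sol by (meson continuous_at_imp_continuous_on has_vector_derivative_continuous)

lemma halfline_bounded:
 fixes y :: "real => 'c::real_normed_vector"
 assumes c: "continuous_on {0..} y" and l: "(y \<longlongrightarrow> l) at_top" shows "bounded (y ` {0..})"
proof -
 have "eventually (%t. dist (y t) l < 1) at_top" using l by (rule tendstoD) simp
 then obtain T where T: "!!t. t >= T ==> dist (y t) l < 1" by (auto simp: eventually_at_top_linorder)
 have "bounded (y ` {0..T})"
  by (intro compact_imp_bounded compact_continuous_image continuous_on_subset[OF c]) auto
 moreover have "y ` {T..} \<subseteq> ball l 1" using T by (auto simp: dist_commute)
 ultimately have "bounded (y ` {0..T} \<union> y ` {T..})"
  by (meson bounded_Un bounded_ball bounded_subset)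
 then show ?thesis by (rule bounded_subset) force
qed

lemma A_bounded: "EX M. ALL t>=0. ALL x. norm (A t x) <= M * norm x"
proof -
 have "bounded (xh ` {0..})" by (rule halfline_bounded[OF xh_continuous xh_lim])
 then obtain r where r: "!!t. t >= 0 ==> norm (xh t) <= r" by (auto simp: bounded_iff)
 obtain M where M: "!!z h. z \<in> cball 0 r ==> norm (D f0 z h) <= M * norm h"
  using C1_bound[of f0 "D f0" r, OF D0 Ck_continuous[OF Ck_derivative(2)[OF f0_smooth, of 0]]] by blast
 have "norm (A t x) <= M * norm x" if "t >= 0" for t x
 proof -
  have "(xh t, 0::real) \<in> cball 0 r" using r[OF that] unfolding mem_cball dist_0_norm norm_Pair by simp
  from M[OF this, of "(x, 0)"] show ?thesis by (simp add: Df0_split norm_Pair)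
 qed
 then show ?thesis by blast
qed

lemma eigenvalue_pos: "j \<in> {1..n} ==> Re (\<Lambda> j) > 0"
proof (induction j)
 case (Suc j)
 show ?case
 proof (cases "j = 0")
  case False
  then have j: "1 <= j" "j < n" using Suc by auto
  then have "Re (\<Lambda> j) > 0" using Suc by auto
  also have "Re (\<Lambda> j) <= Re (\<Lambda> (Suc j))" using eigenvalues(2)[OF j] by simp
  finally show ?thesis .
 qed (use eigenvalues(1) in simp)
qed simp

lemma A_at_infinity:
 assumes "e > 0" shows "EX T>=0. ALL t>=T. ALL x. norm (A t x - Dx f 0 0 x) <= e * norm x"
proof -
 define d where "d = e / real DIM(real ^ 'm)"
 have d: "d > 0" using assms by (simp add: d_def)
 have "eventually (%t. dist (f1 b (xh t, 0)) (f1 b (0, 0)) < d) at_top" for b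
 proof (rule tendstoD[OF _ d])
  have "isCont (f1 b) (0, 0)" using Ck_continuous[OF f1_smooth[of 0 b]] by (simp add: continuous_on_eq_continuous_at)
  then show "((%t. f1 b (xh t, 0)) \<longlongrightarrow> f1 b (0, 0)) at_top"
   by (rule isCont_tendsto_compose) (intro tendsto_Pair xh_lim tendsto_const)
 qed
 then have "eventually (%t. \<forall>b\<in>Basis. dist (f1 b (xh t, 0)) (f1 b (0, 0)) < d) at_top"
  by (intro eventually_ball_finite finite_Basis) blast
 then obtain T where T: "!!t b. t >= T ==> b \<in> Basis ==> dist (f1 b (xh t, 0)) (f1 b (0, 0)) < d"
  by (auto simp: eventually_at_top_linorder)
 have "norm (A t x - Dx f 0 0 x) <= e * norm x" if "t >= max 0 T" for t x
 proof -
  have "norm ((%x. A t x - Dx f 0 0 x) x) <= (real DIM(real ^ 'm) * d) * norm x"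
   by (rule norm_linear_le_Basis)
    (use T[of t] that in \<open>auto intro!: linear_compose_sub Dx_linear less_imp_le simp: dist_norm f1_def\<close>)
  then show ?thesis by (simp add: d_def)
 qed
 then show ?thesis by (intro exI[of _ "max 0 T"]) auto
qed

lemma phi_halfline: "j \<in> {1..2 * n} ==> hsol A (\<phi> j) (%_. 0)"
 using phi_VE by (auto simp: hsol_def intro: has_vector_derivative_at_within)

lemma phi_bounded: assumes "j \<in> {1..n}" shows "bounded (\<phi> j ` {0..})"
proof -
 have c: "continuous_on {0..} (\<phi> j)" using hsol_continuous[OF phi_halfline[of j]] assms by auto
 consider "j = 1" | "j = 2" | "j \<in> {3..n}" using assms by fastforce
 then show ?thesis
 proof cases
  case 1
  have eq: "\<phi> j = (%t. f (xh t) 0)" unfolding 1 by (rule ext) (rule phi1)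
  have "isCont (%x. f x 0) 0" by (rule has_derivative_continuous[OF Dx_has_derivative])
  from isCont_tendsto_compose[OF this xh_lim] have "(\<phi> j \<longlongrightarrow> f 0 0) at_top" unfolding eq .
  then show ?thesis by (rule halfline_bounded[OF c])
 next
  case 2
  then show ?thesis using phi2_bounded by (metis bounded_subset image_mono top_greatest)
 next
  case 3 then show ?thesis using halfline_bounded[OF c phi_lim] by blast
 qed
qed

sublocale symmetric_homoclinic_VE "Dx f 0 0" R n \<Lambda> A ip \<phi> \<psi> S
proof unfold_locales
 show "Dx f 0 0 (R x) = - R (Dx f 0 0 x)" for x
  using Dx_equivariant(1)[OF linR R_f', of 0 0 x] by (simp add: linear_0[OF linR])
 show "EX M. \<forall>t\<in>{0..\<tau>}. ALL x. norm (A t x) <= M * norm x" for \<tau>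
  using A_bounded by (meson atLeastAtMost_iff)
 show "R (\<phi> 1 0) = - \<phi> 1 0" using R_f[of "xh 0" 0] xh_sym[of 0] unfolding phi1 by (metis add.inverse_inverse add.inverse_neutral)
 show "R (\<phi> j 0) = \<phi> (n + j) 0" if "j \<in> {3..n}" for j using phi_Rj'[OF that, of 0] by simp
 show "A t (S x) = S (A t x)" for t x
  using Dx_equivariant(1)[OF linS S_f', of "xh t" 0 x] by (simp add: S_xh)
 show "A t (R (S (R x))) = R (S (R (A t x)))" for t x
  using Dx_equivariant(1)[OF linT T_f', of "xh t" 0 x] by (simp add: T_xh)
 show "S (\<phi> 1 0) = \<phi> 1 0" using S_f[of "xh 0" 0] unfolding phi1 S_xh by simp
qed (rule S_psi' | fact n2 card_m linR RR Dx_linear char_poly eigenvalue_pos A_at_infinity ip phi_halfline dual phi_bounded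
  phi2_R0 phi_Rn1 phi_Rn2 R_orth linS SS S_orth S_phi2' linear_add[OF linR] linear_cmul[OF linR]
  linear_add[OF linS] linear_cmul[OF linS] linear_add[OF Dx_linear] linear_cmul[OF Dx_linear])+

end

lemma even_integral:
 fixes h :: "real => real"
 assumes h: "integrable lborel h" and even: "!!s. h (- s) = h s"
 shows "h absolutely_integrable_on {0..}" "integral {0..} h = (LBINT s. h s) / 2"
proof -
 have s: "set_integrable lborel X h" if "X \<in> sets borel" for X
  unfolding set_integrable_def by (rule integrable_mult_indicator) (use that h in auto)
 show "h absolutely_integrable_on {0..}"
  using s[of "{0..}"] unfolding set_integrable_def
  by (subst integrable_completion) (auto dest: borel_measurable_integrable)
 have p: "(LINT x:{0..}|lborel. h x) = (LINT x:{0<..}|lborel. h x)"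
  unfolding set_lebesgue_integral_def
 proof (rule integral_cong_AE)
  show "AE x in lborel. indicator {0..} x *\<^sub>R h x = indicator {0<..} x *\<^sub>R h x"
   using AE_lborel_singleton[of "0::real"] by eventually_elim (auto simp: indicator_def)
 qed (use s[of "{0..}"] s[of "{0<..}"] in \<open>auto simp: set_integrable_def dest: borel_measurable_integrable\<close>)
 have "(LINT x:{..<0}|lborel. h x) = (LBINT x. indicator {..<0} (0 + (- 1) * x) *\<^sub>R h (0 + (- 1) * x))"
  unfolding set_lebesgue_integral_def
  by (subst lborel_integral_real_affine[where c = "-1" and t = 0]) auto
 also have "\<dots> = (LINT x:{0<..}|lborel. h x)"
  unfolding set_lebesgue_integral_def by (intro Bochner_Integration.integral_cong) (auto simp: indicator_def even)
 finally have n: "(LINT x:{..<0}|lborel. h x) = (LINT x:{0..}|lborel. h x)" using p by simp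
 have "(LINT x:{..<0} \<union> {0..}|lborel. h x) = (LINT x:{..<0}|lborel. h x) + (LINT x:{0..}|lborel. h x)"
  by (rule set_integral_Un) (auto intro: s)
 moreover have "{..<0} \<union> {0..} = (UNIV :: real set)" by auto
 ultimately have "(LBINT s. h s) = 2 * (LINT x:{0..}|lborel. h x)"
  using n by (simp add: set_lebesgue_integral_def)
 then show "integral {0..} h = (LBINT s. h s) / 2"
  using set_borel_integral_eq_integral(2)[OF s[of "{0..}"]] by simp
qed

context reversible_homoclinic
begin

lemma phi2_VE: "(\<phi> 2 has_vector_derivative A t (\<phi> 2 t)) (at t)"
 by (rule phi_VE) (use n2 in auto)

lemma R_A: "A (- t) x = - R (A t (R x))"
 using Dx_equivariant(1)[OF linR R_f', of "xh t" 0 "R x"] by (simp add: xh_sym RR)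

lemma reflect_derivative:
 assumes "(\<xi> has_vector_derivative d) (at (- t))"
 shows "((%t. R (\<xi> (- t))) has_vector_derivative - R d) (at t)"
proof -
 have "((\<xi> \<circ> uminus) has_vector_derivative (- 1) *\<^sub>R d) (at t)"
  by (rule vector_diff_chain_at) (use assms in \<open>auto intro!: derivative_eq_intros\<close>)
 from bounded_linear.has_vector_derivative[OF _ this, of R] show ?thesis
  using linR linear_neg[OF linR, of d] by (simp add: linear_conv_bounded_linear o_def)
qed

text \<open>Both sides solve the variational equation and agree at \<open>t = 0\<close>.\<close>

lemma VE_reflect:
 assumes sol: "!!t. (\<xi> has_vector_derivative A t (\<xi> t)) (at t)"
  and init: "R (\<xi> 0) = s *\<^sub>R \<xi> 0" and s: "s = 1 \<or> s = - 1"
 shows "\<xi> (- t) = s *\<^sub>R R (\<xi> t)"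
proof -
 define z where "z t = s *\<^sub>R R (\<xi> (- t)) - \<xi> t" for t
 have ss: "s *\<^sub>R s *\<^sub>R x = x" for x :: "real ^ 'm" using s by auto
 have "hsol A z (%_. 0)"
  unfolding hsol_def
 proof (intro allI impI)
  fix t
  have "((%t. s *\<^sub>R R (\<xi> (- t)) - \<xi> t) has_vector_derivative s *\<^sub>R - R (A (- t) (\<xi> (- t))) - A t (\<xi> t)) (at t)"
   by (intro has_vector_derivative_diff sol bounded_linear.has_vector_derivative[OF bounded_linear_scaleR_right]
     reflect_derivative)
  moreover have "s *\<^sub>R - R (A (- t) (\<xi> (- t))) - A t (\<xi> t) = A t (z t)"
   using linear_neg[OF linR] by (simp add: R_A RR z_def linear_diff[OF Dx_linear] linear_cmul[OF Dx_linear])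
  ultimately have "(z has_vector_derivative A t (z t) + 0) (at t)" by (simp add: z_def[abs_def])
  then show "(z has_vector_derivative A t (z t) + 0) (at t within {0..})" by (rule has_vector_derivative_at_within)
 qed
 note hz = this
 have z: "z t = 0" if "t >= 0" for t
  by (rule hsol_unique_zero[OF hz _ A_bound that]) (use s in \<open>auto simp: z_def init\<close>)
 show ?thesis
 proof (cases "t >= 0")
  case True
  then have "\<xi> t = s *\<^sub>R R (\<xi> (- t))" using z by (simp add: z_def)
  then have "s *\<^sub>R R (\<xi> t) = s *\<^sub>R R (s *\<^sub>R R (\<xi> (- t)))" by simp
  then show ?thesis using s by (auto simp: linear_neg[OF linR] RR)
 next
  case False
  then show ?thesis using z[of "- t"] by (simp add: z_def)
 qed
qed

lemma phi_reflect: "\<phi> 1 (- t) = - R (\<phi> 1 t)" "\<phi> 2 (- t) = R (\<phi> 2 t)"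
  "\<phi> (n + 1) (- t) = R (\<phi> (n + 1) t)" "\<phi> (n + 2) (- t) = - R (\<phi> (n + 2) t)"
 using VE_reflect[OF phi_VE, of 1 "- 1" t] VE_reflect[OF phi_VE, of 2 1 t] VE_reflect[OF phi_VE, of "n + 1" 1 t]
  VE_reflect[OF phi_VE, of "n + 2" "- 1" t] phi_R1 phi2_R phi_Rn1 phi_Rn2 n2 by (simp_all del: One_nat_def)

text \<open>A dual basis is unique, and the reflected curve is dual to the \<open>\<phi>\<^sub>k\<close> by
 their own reflection symmetries.\<close>

lemma psi_reflect: "\<psi> (n + 2) (- t) = - R (\<psi> (n + 2) t)"
proof -
 define w where "w = \<psi> (n + 2) (- t) + R (\<psi> (n + 2) t)"
 have dualR: "ip w (\<phi> k (- t)) = 0" if k: "k \<in> {1..2 * n}" for k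
 proof -
  have m: "n + 2 \<in> {1..2 * n}" using n2 by auto
  have w: "ip w (\<phi> k (- t)) = (if n + 2 = k then 1 else 0) + ip (\<psi> (n + 2) t) (R (\<phi> k (- t)))"
   using dual[OF m k, of "- t"] by (simp add: w_def ip_add_left R_adj)
  note d = dual[OF m, of _ t]
  have neg: "ip x (- y) = - ip x y" for x y using linear_neg[OF ip_linear] .
  consider "k = 1" | "k = 2" | "k = n + 1" | "k = n + 2" | j where "j \<in> {3..n}" "k = j" | j where "j \<in> {3..n}" "k = n + j"
   using index_cases[OF k] by blast
  then show ?thesis
  proof cases
   case 1
   have "ip w (\<phi> 1 (- t)) = 0"
    using w[unfolded 1] d[of 1] n2 linear_neg[OF linR, of "R (\<phi> 1 t)"]
    unfolding phi_reflect by (simp add: RR neg del: One_nat_def)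
   then show ?thesis unfolding 1 .
  next
   case 2
   have "ip w (\<phi> 2 (- t)) = 0"
    using w[unfolded 2] d[of "2"] n2 linear_neg[OF linR, of "R (\<phi> 2 t)"]
    unfolding phi_reflect by (simp add: RR neg del: One_nat_def)
   then show ?thesis unfolding 2 .
  next
   case 3
   have "ip w (\<phi> (n + 1) (- t)) = 0"
    using w[unfolded 3] d[of "(n + 1)"] n2 linear_neg[OF linR, of "R (\<phi> (n + 1) t)"]
    unfolding phi_reflect by (simp add: RR neg del: One_nat_def)
   then show ?thesis unfolding 3 .
  next
   case 4
   have "ip w (\<phi> (n + 2) (- t)) = 0"
    using w[unfolded 4] d[of "(n + 2)"] n2 linear_neg[OF linR, of "R (\<phi> (n + 2) t)"]
    unfolding phi_reflect by (simp add: RR neg )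
   then show ?thesis unfolding 4 .
  next
   case 5 then show ?thesis unfolding w using d[of "n + j"] phi_Rj'[of j t] n2 by simp
  next
   case 6 then show ?thesis unfolding w using d[of j] phi_Rj'[of j "- t"] n2 by (simp add: RR)
  qed
 qed
 have "ip w w = (\<Sum>j\<in>{1..2 * n}. ip w (ip (\<psi> j (- t)) w *\<^sub>R \<phi> j (- t)))"
  using representation[of w "- t"] by (metis (no_types, lifting) ip_sum sum.cong)
 also have "\<dots> = 0"
  using dualR linear_cmul[OF ip_linear] by (intro sum.neutral ballI) simp
 finally have "w = 0" using ip_pos by fastforce
 then show ?thesis unfolding w_def by (simp add: eq_neg_iff_add_eq_0)
qed

lemma psi_orth: "S x = x ==> ip (\<psi> (n + 2) t) x = 0"
 using S_adj[of "\<psi> (n + 2) t" x] unfolding S_psi' ip_minus_left by simp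

lemma xh_V: "xh t \<in> V 1"
 by (simp add: V_def S_xh T_xh)

lemma phi2_V: "\<phi> 2 t \<in> V (- 1)"
 using S_phi2'[of "- t"] linear_neg[OF linR] by (simp add: V_def S_phi2' phi_reflect RR)

lemma phi2_decay: "(\<phi> 2 \<longlongrightarrow> 0) at_top"
proof -
 have "hsol A (\<phi> 2) (%_. 0)" "bounded (\<phi> 2 ` {0..})" using n2 phi_halfline[of 2] phi_bounded[of 2] by auto
 then show ?thesis using bounded_solution_decay tendsto_const by blast
qed

lemma phi2_continuous: "continuous_on I (\<phi> 2)"
 using phi2_VE by (meson continuous_at_imp_continuous_on has_vector_derivative_continuous)

lemma V_D:
 assumes "p \<in> V 1"
 shows "f p \<mu> \<in> V 1" "Dmu f p 0 \<in> V 1" "x \<in> V \<sigma> ==> Dx f p \<mu> x \<in> V \<sigma>"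
  "x \<in> V \<sigma> ==> y \<in> V \<tau> ==> Dx2 f p 0 x y \<in> V (\<sigma> * \<tau>)" "x \<in> V \<sigma> ==> DmuDx f p 0 x \<in> V \<sigma>"
proof -
 have p: "S p = p" "R (S (R p)) = p" using assms by (auto simp: V_def)
 show "f p \<mu> \<in> V 1" using S_f[of p] T_f[of p] p by (simp add: V_def)
 show "Dmu f p 0 \<in> V 1"
  using Dmu_equivariant[OF linS S_f', of p 0] Dmu_equivariant[OF linT T_f', of p 0] p by (simp add: V_def)
 show "Dx f p \<mu> x \<in> V \<sigma>" if "x \<in> V \<sigma>"
  using Dx_equivariant(1)[OF linS S_f', of p \<mu> x] Dx_equivariant(1)[OF linT T_f', of p \<mu> x] p that linear_cmul[OF Dx_linear]
  by (simp add: V_def)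
 show "DmuDx f p 0 x \<in> V \<sigma>" if "x \<in> V \<sigma>"
  using DmuDx_equivariant(1)[OF linS S_f', of p 0 x] DmuDx_equivariant(1)[OF linT T_f', of p 0 x] p that linear_cmul[OF DmuDx_linear]
  by (simp add: V_def)
 show "Dx2 f p 0 x y \<in> V (\<sigma> * \<tau>)" if "x \<in> V \<sigma>" "y \<in> V \<tau>"
  using Dx2_equivariant[OF linS S_f', of p 0 x y] Dx2_equivariant[OF linT T_f', of p 0 x y] p that
   linear_cmul[OF Dx2_linear_left] linear_cmul[OF Dx2_linear_right]
  by (simp add: V_def mult.commute)
qed

lemma D_bounds:
 "EX M>=0. ALL t>=0. ALL u v. norm (Dx2 f (xh t) 0 u v) <= M * norm u * norm v & norm (DmuDx f (xh t) 0 u) <= M * norm u"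
proof -
 have "bounded (xh ` {0..})" by (rule halfline_bounded[OF xh_continuous xh_lim])
 then obtain r where r: "!!t. t >= 0 ==> norm (xh t) <= r" by (auto simp: bounded_iff)
 have r': "(xh t, 0::real) \<in> cball 0 r" if "t >= 0" for t
  using r[OF that] unfolding mem_cball dist_0_norm norm_Pair by simp
 have "EX M>=0. \<forall>z\<in>cball 0 r. ALL h. norm (D (f1 b) z h) <= M * norm h" for b
  using C1_bound[of "f1 b" "D (f1 b)" r, OF D1 Ck_continuous[OF Ck_derivative(2)[OF f1_smooth, of 0]]] by blast
 then obtain M where M: "!!b. M b >= 0" "!!b z h. z \<in> cball 0 r ==> norm (D (f1 b) z h) <= M b * norm h" by metis
 define N where "N = sum M Basis"
 have N: "M b <= N" if "b \<in> Basis" for b unfolding N_def using M(1) that by (intro member_le_sum) auto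
 have N0: "N >= 0" unfolding N_def using M(1) by (intro sum_nonneg) auto
 have "norm ((%u. Dx2 f (xh t) 0 u v) u) <= (real DIM(real ^ 'm) * (N * norm v)) * norm u" if t: "t >= 0" for t u v
 proof (rule norm_linear_le_Basis)
  fix b :: "real ^ 'm" assume b: "b \<in> Basis"
  have "norm (Dx2 f (xh t) 0 b v) <= M b * norm v" using M(2)[OF r'[OF t], of b "(v, 0)"] by (simp add: Dx2_eq norm_Pair)
  also have "\<dots> <= N * norm v" using N[OF b] by (intro mult_right_mono) auto
  finally show "norm (Dx2 f (xh t) 0 b v) <= N * norm v" .
 qed (rule Dx2_linear_left)
 moreover have "norm (DmuDx f (xh t) 0 u) <= (real DIM(real ^ 'm) * N) * norm u" if t: "t >= 0" for t u
 proof (rule norm_linear_le_Basis[OF DmuDx_linear])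
  fix b :: "real ^ 'm" assume b: "b \<in> Basis"
  have "norm (DmuDx f (xh t) 0 b) <= M b" using M(2)[OF r'[OF t], of b "(0, 1)"] by (simp add: DmuDx_eq norm_Pair)
  then show "norm (DmuDx f (xh t) 0 b) <= N" using N[OF b] by linarith
 qed
 ultimately show ?thesis using N0
  by (intro exI[of _ "real DIM(real ^ 'm) * N"]) (auto simp: mult_ac)
qed

lemma Dx2_decay:
 assumes "(u \<longlongrightarrow> 0) at_top" "bounded (v ` {0..})"
 shows "((%t. Dx2 f (xh t) 0 (u t) (v t)) \<longlongrightarrow> 0) at_top"
proof -
 obtain M where M: "M >= 0" "!!t u v. t >= 0 ==> norm (Dx2 f (xh t) 0 u v) <= M * norm u * norm v"
  using D_bounds by blast
 obtain K where K: "!!t. t >= 0 ==> norm (v t) <= K" using assms(2) by (auto simp: bounded_iff)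
 have "((%t. M * norm (u t) * K) \<longlongrightarrow> 0) at_top"
  using tendsto_mult_right[OF tendsto_mult_left[OF tendsto_norm[OF assms(1)]], of M K] by simp
 then show ?thesis
 proof (rule Lim_null_comparison[rotated])
  show "\<forall>\<^sub>F t in at_top. norm (Dx2 f (xh t) 0 (u t) (v t)) <= M * norm (u t) * K"
   using eventually_ge_at_top[of 0]
  proof eventually_elim
   case (elim t)
   have "M * norm (u t) * norm (v t) <= M * norm (u t) * K" using K[OF elim] M(1) by (intro mult_left_mono) auto
   then show ?case using M(2)[OF elim, of "u t" "v t"] by linarith
  qed
 qed
qed

lemma DmuDx_decay:
 assumes "(u \<longlongrightarrow> 0) at_top" shows "((%t. DmuDx f (xh t) 0 (u t)) \<longlongrightarrow> 0) at_top"
proof -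
 obtain M where M: "M >= 0" "!!t u. t >= 0 ==> norm (DmuDx f (xh t) 0 u) <= M * norm u" using D_bounds by blast
 have "((%t. M * norm (u t)) \<longlongrightarrow> 0) at_top" using tendsto_mult_left[OF tendsto_norm[OF assms], of M] by simp
 then show ?thesis
 proof (rule Lim_null_comparison[rotated])
  show "\<forall>\<^sub>F t in at_top. norm (DmuDx f (xh t) 0 (u t)) <= M * norm (u t)"
   using eventually_ge_at_top[of 0] by eventually_elim (rule M(2))
 qed
qed

lemma Dmu_decay: "((%t. Dmu f (xh t) 0) \<longlongrightarrow> 0) at_top"
proof -
 have "isCont (%z. D f0 z (0, 1)) (0, 0)"
  using Ck_continuous[OF Ck_derivative(2)[OF f0_smooth, of 0 "(0, 1)"]] by (simp add: continuous_on_eq_continuous_at)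
 then have "((%t. D f0 (xh t, 0) (0, 1)) \<longlongrightarrow> D f0 (0, 0) (0, 1)) at_top"
  by (rule isCont_tendsto_compose) (intro tendsto_Pair xh_lim tendsto_const)
 moreover have "D f0 (0, 0) (0, 1) = 0" using Dmu_eq[of 0 0] by (simp add: Dmu_def f_0)
 ultimately show ?thesis by (simp add: Dmu_eq)
qed

text \<open>The functions \<open>\<xi>\<^sup>\<mu>\<close> and \<open>\<xi>\<^sup>\<alpha>\<close> are normalized differently from \<open>bdry\<close>; a multiple of \<open>\<phi>\<^sub>2\<close> corrects this.\<close>

lemma symmetric_solution_Ksol:
 assumes sol: "!!t. (\<xi> has_vector_derivative A t (\<xi> t) + g t) (at t)"
  and b: "bounded (\<xi> ` {0..})" and sym: "R (\<xi> 0) = \<xi> 0"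
 shows "EX c. Ksol g (%t. \<xi> t - c *\<^sub>R \<phi> 2 t)"
proof
 let ?c = "ip (\<phi> 2 0) (\<xi> 0) / ip (\<phi> 2 0) (\<phi> 2 0)"
 have h: "hsol A \<xi> g" unfolding hsol_def using sol by (auto intro: has_vector_derivative_at_within)
 have "hsol A (%t. 1 *\<^sub>R \<xi> t + (- ?c) *\<^sub>R \<phi> 2 t) (%t. 1 *\<^sub>R g t + (- ?c) *\<^sub>R 0)"
  by (rule hsol_lincomb[OF h phi_halfline]) (use n2 in auto)
 then have 1: "hsol A (%t. \<xi> t - ?c *\<^sub>R \<phi> 2 t) g" by simp
 have 2: "bounded ((%t. \<xi> t - ?c *\<^sub>R \<phi> 2 t) ` {0..})"
  using bounded_minus_comp[OF b bounded_scaleR_comp[OF phi_bounded[of 2]]] n2 by simp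
 have 3: "\<xi> 0 - ?c *\<^sub>R \<phi> 2 0 \<in> bdry"
 proof (rule Fix_bdry)
  show "R (\<xi> 0 - ?c *\<^sub>R \<phi> 2 0) = \<xi> 0 - ?c *\<^sub>R \<phi> 2 0"
   by (simp add: linear_diff[OF linR] linear_cmul[OF linR] sym phi2_R)
  show "ip (\<phi> 2 0) (\<xi> 0 - ?c *\<^sub>R \<phi> 2 0) = 0"
   using phi2_nonzero by (simp add: linear_diff[OF ip_linear] linear_cmul[OF ip_linear])
 qed
 show "Ksol g (%t. \<xi> t - ?c *\<^sub>R \<phi> 2 t)" using 1 2 3 by (simp add: Ksol_def)
qed

text \<open>The integrand over the line is even, so the half-line solvability condition sees half of the
 integral. The multiple \<open>c\<close> accounts for the difference between the normalizations of
 \<open>\<xi>\<close> at \<open>t = 0\<close> against \<open>\<psi>\<^sub>2(0)\<close> and against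
 \<open>\<phi>\<^sub>2(0)\<close>; it contributes nothing, because \<open>D\<^sub>x\<^sup>2 f(\<phi>\<^sub>2,
 \<phi>\<^sub>2)\<close> takes values in the fixed space of \<open>S\<close>. A nonzero Bochner integral
 certifies integrability.\<close>

lemma melnikov:
 assumes g: "continuous_on {0..} g" "(g \<longlongrightarrow> 0) at_top" "!!t. g (- t) = - R (g t)"
  and y: "Ksol (%t. g t - c *\<^sub>R Dx2 f (xh t) 0 (\<phi> 2 t) (\<phi> 2 t)) y"
  and ne: "(LBINT t. ip (\<psi> (n + 2) t) (g t)) ~= 0"
 shows "\<gamma> (n + 2) (y 0) = - (LBINT t. ip (\<psi> (n + 2) t) (g t)) / 2"
proof -
 let ?q = "%t. Dx2 f (xh t) 0 (\<phi> 2 t) (\<phi> 2 t)" and ?h = "%t. ip (\<psi> (n + 2) t) (g t)"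
 have int: "integrable lborel ?h" using ne not_integrable_integral_eq by blast
 have ev: "?h (- t) = ?h t" for t
 proof -
  have "?h (- t) = ip (- R (\<psi> (n + 2) t)) (- R (g t))" by (simp only: psi_reflect g(3))
  also have "\<dots> = ip (R (\<psi> (n + 2) t)) (R (g t))"
   using linear_neg[OF ip_linear, of "- R (\<psi> (n + 2) t)" "R (g t)"] ip_minus_left by simp
  also have "\<dots> = ?h t" by (simp add: R_adj RR)
  finally show ?thesis .
 qed
 note I = even_integral[of ?h, OF int ev]
 have q0: "ip (\<psi> (n + 2) t) (?q t) = 0" for t
  using psi_orth V_D(4)[OF xh_V phi2_V phi2_V] by (simp add: V_def)
 have eq: "ip (\<psi> (n + 2) t) (g t - c *\<^sub>R ?q t) = ?h t" for t
  using q0 by (simp add: linear_diff[OF ip_linear] linear_cmul[OF ip_linear])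
 have b: "bounded (\<phi> 2 ` {0..})" using phi_bounded[of 2] n2 by simp
 have "\<gamma> (n + 2) (y 0) = - integral {0..} (%s. ip (\<psi> (n + 2) s) (g s - c *\<^sub>R ?q s))"
 proof (rule solvability_integral[OF _ _ y])
  show "continuous_on {0..} (%t. g t - c *\<^sub>R ?q t)"
   by (intro continuous_intros g continuous_Dx2 xh_continuous phi2_continuous)
  show "((%t. g t - c *\<^sub>R ?q t) \<longlongrightarrow> 0) at_top"
   using tendsto_diff[OF g(2) tendsto_scaleR[OF tendsto_const[of c] Dx2_decay[OF phi2_decay b]]] by simp
  show "(%s. ip (\<psi> (n + 2) s) (g s - c *\<^sub>R ?q s)) absolutely_integrable_on {0..}" unfolding eq by (rule I)
 qed
 then show ?thesis unfolding eq I(2) by simp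
qed

end

section \<open>The branch on the half-line\<close>

context reversible_homoclinic
begin

text \<open>\<open>S\<close> and \<open>R S R\<close> interchange \<open>p + q w\<close> and \<open>p -
 q w\<close>, so they fix the mean and reverse the difference.\<close>

lemma FF_V: "x \<in> V 1 \<times> V (- 1) ==> FF (x, m) \<in> V 1 \<times> V (- 1)"
proof -
 assume x: "x \<in> V 1 \<times> V (- 1)"
 obtain p w where pw: "x = (p, w)" by (cases x)
 obtain \<mu> q where m: "m = (\<mu>, q)" by (cases m)
 have p: "S p = p" "R (S (R p)) = p" and w: "S w = - w" "R (S (R w)) = - w" and pV: "p \<in> V 1" and wV: "w \<in> V (- 1)"
  using x by (auto simp: pw V_def)
 have e: "S (p + c *\<^sub>R w) = p - c *\<^sub>R w" "R (S (R (p + c *\<^sub>R w))) = p - c *\<^sub>R w" for c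
  using linear_add[OF linS, of p] linear_cmul[OF linS, of c w] linear_add[OF linT, of p] linear_cmul[OF linT, of c w]
  by (simp_all add: p w)
 have fs: "S (f (p + c *\<^sub>R w) \<mu>) = f (p - c *\<^sub>R w) \<mu>" "R (S (R (f (p + c *\<^sub>R w) \<mu>))) = f (p - c *\<^sub>R w) \<mu>" for c
  unfolding S_f[symmetric] T_f[symmetric] e by (rule refl)+
 have fm: "S (f (p - c *\<^sub>R w) \<mu>) = f (p + c *\<^sub>R w) \<mu>" "R (S (R (f (p - c *\<^sub>R w) \<mu>))) = f (p + c *\<^sub>R w) \<mu>" for c
  using fs[of "- c"] by simp_all
 have ee: "ee p w \<mu> q \<in> V 1"
  unfolding V_def ee_def
  using linear_cmul[OF linS, of "1/2"] linear_cmul[OF linT, of "1/2"] linear_add[OF linS] linear_add[OF linT]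
  by (simp add: fs fm add.commute)
 have kk: "kk p w \<mu> q \<in> V (- 1)"
 proof (cases "q = 0")
  case True
  then show ?thesis using V_D(3)[OF pV wV] by (simp add: kk_0)
 next
  case False
  have "(1 / 2) *\<^sub>R (f (p + q *\<^sub>R w) \<mu> - f (p - q *\<^sub>R w) \<mu>) \<in> V (- 1)"
   unfolding V_def
   using linear_cmul[OF linS, of "1/2"] linear_cmul[OF linT, of "1/2"] linear_diff[OF linS] linear_diff[OF linT]
   by (simp add: fs fm scaleR_diff_right)
  then have "(1 / q) *\<^sub>R q *\<^sub>R kk p w \<mu> q \<in> V (- 1)"
   unfolding kk_difference by (rule subspace_scale[OF subspace_V])
  then show ?thesis using False by simp
 qed
 show ?thesis unfolding pw m FF_def fst_conv snd_conv using ee kk by (rule SigmaI)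
qed

lemma FF_0: "FF (0, m) = 0"
 by (simp add: FF_def ee_def kk_def f_0 linear_0[OF Dx_linear] zero_prod_def)

lemma FF_base: "FF ((xh t, \<phi> 2 t), (0, 0)) = (f (xh t) 0, A t (\<phi> 2 t))"
 by (simp add: FF_def ee_def kk_0 scaleR_add_right flip: scaleR_add_left)

end

locale reversible_pitchfork = reversible_homoclinic f n ip R S \<Lambda> xh \<phi> \<psi>
 for f :: "real ^ 'm => real => real ^ 'm" and n ip R S \<Lambda> xh \<phi> \<psi> +
 fixes \<xi>\<mu> \<xi>\<alpha> :: "real => real ^ 'm"
 assumes xim: "!!t. (\<xi>\<mu> has_vector_derivative Dx f (xh t) 0 (\<xi>\<mu> t) + Dmu f (xh t) 0) (at t)"
   "bounded (\<xi>\<mu> ` {0..})" "!!t. \<xi>\<mu> (- t) = R (\<xi>\<mu> t)"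
  and xia: "!!t. (\<xi>\<alpha> has_vector_derivative Dx f (xh t) 0 (\<xi>\<alpha> t) + (1 / 2) *\<^sub>R Dx2 f (xh t) 0 (\<phi> 2 t) (\<phi> 2 t)) (at t)"
   "bounded (\<xi>\<alpha> ` {0..})" "!!t. \<xi>\<alpha> (- t) = R (\<xi>\<alpha> t)"
  and a2: "a2bar ip f xh (\<psi> (n + 2)) (\<phi> 2) \<xi>\<mu> ~= 0" and b2: "b2bar ip f xh (\<psi> (n + 2)) (\<phi> 2) \<xi>\<alpha> ~= 0"
begin

abbreviation "fm \<equiv> %t. Dmu f (xh t) 0"
abbreviation "\<eta> \<equiv> %t. DmuDx f (xh t) 0 (\<phi> 2 t)"
abbreviation "B \<equiv> %t y. Dx2 f (xh t) 0 y (\<phi> 2 t)"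
abbreviation "qq \<equiv> %t. Dx2 f (xh t) 0 (\<phi> 2 t) (\<phi> 2 t)"
abbreviation "cub \<equiv> %t. Dx3 f (xh t) 0 (\<phi> 2 t) (\<phi> 2 t) (\<phi> 2 t)"
abbreviation "base \<equiv> %t. (xh t, \<phi> 2 t)"

lemma phi2_bounded_halfline: "bounded (\<phi> 2 ` {0..})"
 using phi_bounded[of 2] n2 by simp

lemma continuous_coefficients: "continuous_on I fm" "continuous_on I \<eta>" "continuous_on I qq"
  "continuous_on I y ==> continuous_on I (%t. B t (y t))"
 by (intro continuous_Dmu continuous_DmuDx continuous_Dx2 xh_continuous phi2_continuous; assumption)+

lemma B_decay: "bounded (y ` {0..}) ==> ((%t. B t (y t)) \<longlongrightarrow> 0) at_top"
 using Dx2_decay[OF phi2_decay] by (simp add: Dx2_sym[of _ _ _ "\<phi> 2 _"])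

lemma qq_V: "qq t \<in> V 1" and fm_V: "fm t \<in> V 1" and \<eta>_V: "\<eta> t \<in> V (- 1)" and B_V: "y \<in> V 1 ==> B t y \<in> V (- 1)"
 using V_D(4)[OF xh_V phi2_V phi2_V, of t t t] V_D(2)[OF xh_V, of t] V_D(5)[OF xh_V phi2_V, of t t] V_D(4)[OF xh_V _ phi2_V, of y 1 t t]
 by simp_all

lemma reflect_coefficients: "\<eta> (- t) = - R (\<eta> t)" "cub (- t) = - R (cub t)"
  "u' = R u ==> B (- t) u' = - R (B t u)"
 using DmuDx_equivariant(1)[OF linR R_f', of "xh t" 0 "\<phi> 2 t"] Dx3_equivariant[OF linR R_f', of "xh t" 0 "\<phi> 2 t" "\<phi> 2 t" "\<phi> 2 t"]
  Dx2_equivariant[OF linR R_f', of "xh t" 0 u "\<phi> 2 t"] by (simp_all add: xh_sym phi_reflect)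

lemma sol_continuous: "(!!t. (\<xi> has_vector_derivative d t) (at t)) ==> continuous_on I \<xi>" for \<xi> :: "real => real ^ 'm"
 by (meson continuous_at_imp_continuous_on has_vector_derivative_continuous)

text \<open>The obstruction to solving the second linearized equation for \<open>\<mu> = 1\<close>.\<close>

lemma linear_coefficient:
 "\<exists>\<xi> va. Ksol fm \<xi> & Ksol (%t. B t (\<xi> t) + \<eta> t) va &
   \<gamma> (n + 2) (va 0) = - a2bar ip f xh (\<psi> (n + 2)) (\<phi> 2) \<xi>\<mu> / 2"
proof -
 obtain c where c: "Ksol fm (%t. \<xi>\<mu> t - c *\<^sub>R \<phi> 2 t)"
  using symmetric_solution_Ksol[OF xim(1,2)] xim(3)[of 0] by auto
 let ?\<xi> = "%t. \<xi>\<mu> t - c *\<^sub>R \<phi> 2 t" and ?g = "%t. \<eta> t + B t (\<xi>\<mu> t)"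
 have cx: "continuous_on {0..} \<xi>\<mu>" by (rule sol_continuous[OF xim(1)])
 have gc: "continuous_on {0..} ?g" by (intro continuous_on_add continuous_coefficients cx)
 have gl: "(?g \<longlongrightarrow> 0) at_top"
  using tendsto_add[OF DmuDx_decay[OF phi2_decay] B_decay[OF xim(2)]] by simp
 have gr: "?g (- t) = - R (?g t)" for t
  by (simp add: reflect_coefficients(1) reflect_coefficients(3)[OF xim(3)] linear_add[OF linR])
 have eq: "B t (?\<xi> t) + \<eta> t = ?g t - c *\<^sub>R qq t" for t
  by (simp add: linear_diff[OF Dx2_linear_left] linear_cmul[OF Dx2_linear_left])
 have "continuous_on {0..} (%t. ?g t - c *\<^sub>R qq t)" by (intro continuous_intros continuous_coefficients gc)
 moreover have "((%t. ?g t - c *\<^sub>R qq t) \<longlongrightarrow> 0) at_top"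
  using tendsto_diff[OF gl tendsto_scaleR[OF tendsto_const[of c] Dx2_decay[OF phi2_decay phi2_bounded_halfline]]] by simp
 ultimately obtain va where va: "Ksol (%t. ?g t - c *\<^sub>R qq t) va" using Ksol_exists by blast
 have "\<gamma> (n + 2) (va 0) = - a2bar ip f xh (\<psi> (n + 2)) (\<phi> 2) \<xi>\<mu> / 2"
  using melnikov[OF gc gl gr va] a2 by (simp only: a2bar_def simp_thms)
 then show ?thesis using c va unfolding eq[symmetric] by blast
qed

lemma base_VV: "base t \<in> V 1 \<times> V (- 1)"
 using xh_V phi2_V by blast

lemma nonlinear_data:
 assumes \<xi>: "Ksol fm \<xi>" and va: "Ksol (%t. B t (\<xi> t) + \<eta> t) va" and nd: "\<gamma> (n + 2) (va 0) ~= 0"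
 shows "EX MB. nonlinear_problem (Dx f 0 0) R n \<Lambda> A ip \<phi> \<psi> S fm \<eta> B \<xi> va MB FF FF' FF2 base"
proof -
 obtain M where M: "M >= 0" "!!t u v. t >= 0 ==> norm (Dx2 f (xh t) 0 u v) <= M * norm u * norm v"
  using D_bounds by blast
 obtain K where K: "!!t. t >= 0 ==> norm (\<phi> 2 t) <= K" using phi2_bounded_halfline by (auto simp: bounded_iff)
 have Bb: "norm (B t x) <= (M * K) * norm x" if t: "t >= 0" for t x
 proof -
  have "M * norm x * norm (\<phi> 2 t) <= M * norm x * K" using K[OF t] M(1) by (intro mult_left_mono) auto
  then show ?thesis using M(2)[OF t, of x "\<phi> 2 t"] by (simp add: mult_ac)
 qed
 have "nonlinear_problem (Dx f 0 0) R n \<Lambda> A ip \<phi> \<psi> S fm \<eta> B \<xi> va (M * K) FF FF' FF2 base"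
 proof (intro nonlinear_problem.intro linearized_bifurcation.intro linearized_bifurcation_axioms.intro
   nonlinear_problem_axioms.intro)
  show "symmetric_homoclinic_VE (Dx f 0 0) R n \<Lambda> A ip \<phi> \<psi> S" by unfold_locales
  show "(\<eta> \<longlongrightarrow> 0) at_top" by (rule DmuDx_decay[OF phi2_decay])
  show "continuous_on {0..} base" by (intro continuous_on_Pair xh_continuous phi2_continuous)
  show "(base \<longlongrightarrow> 0) at_top" using tendsto_Pair[OF xh_lim phi2_decay] by (simp add: zero_prod_def)
  show "(base has_vector_derivative FF (base t, (0, 0))) (at t within {0..})" for t
   unfolding FF_base by (rule has_vector_derivative_at_within, rule has_vector_derivative_Pair[OF xh_sol phi2_VE])
  show "FF' (base t, (0, 0)) ((y, v), (\<mu>, 0)) = (A t y + \<mu> *\<^sub>R fm t, B t y + A t v + \<mu> *\<^sub>R \<eta> t)" for t y v \<mu>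
   by (rule FF'_slice)
 qed (rule continuous_coefficients(1-3) Dmu_decay fm_V \<eta>_V Dx2_linear_left \<xi> va nd FF'_props FF2_props FF_0 FF_even base_VV
   | (rule continuous_coefficients(4), assumption) | (erule Bb) | (rule B_V, assumption) | (erule FF_V))+
 then show ?thesis by blast
qed

text \<open>The second-order coefficient of the branch solves the linearized problem with right-hand side
 \<open>cc\<close>. Its solution is \<open>m \<xi> + 2 \<zeta>\<close> in the first and \<open>m va + 2
 vb\<close> in the second component, where \<open>va\<close> and \<open>vb\<close> carry the obstructions
 \<open>- a\<^sub>2 / 2\<close> and \<open>- b\<^sub>2 / 2\<close>; they have to cancel.\<close>

lemma half_line_branch:
 defines "m \<equiv> - 2 * b2bar ip f xh (\<psi> (n + 2)) (\<phi> 2) \<xi>\<alpha> / a2bar ip f xh (\<psi> (n + 2)) (\<phi> 2) \<xi>\<mu>"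
 shows "EX a \<Phi> \<Phi>' K p w. 0 < a & \<Phi> 0 = 0 & K >= 0 &
  (ALL q. \<bar>q\<bar> < a --> \<Phi> (- q) = \<Phi> q & (\<Phi> has_real_derivative \<Phi>' q) (at q) &
    \<bar>\<Phi>' q - q * m\<bar> <= K * q ^ 2 & \<bar>\<Phi> q - (q ^ 2 / 2) * m\<bar> <= K * \<bar>q\<bar> ^ 3 &
    (\<forall>s\<in>{1, - 1}. ALL t>=0. ((%t. p q t + (s * q) *\<^sub>R w q t) has_vector_derivative
      f (p q t + (s * q) *\<^sub>R w q t) (\<Phi> q)) (at t within {0..})) &
    (ALL t>=0. p q t \<in> V 1 & w q t \<in> V (- 1) & norm (p q t - xh t) <= K * q ^ 2 & norm (w q t - \<phi> 2 t) <= K * q ^ 2) &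
    R (p q 0) = p q 0 & R (w q 0) = w q 0 & (p q \<longlongrightarrow> 0) at_top & (w q \<longlongrightarrow> 0) at_top)"
proof -
 obtain \<xi> va where \<xi>: "Ksol fm \<xi>" and va: "Ksol (%t. B t (\<xi> t) + \<eta> t) va"
  and gva: "\<gamma> (n + 2) (va 0) = - a2bar ip f xh (\<psi> (n + 2)) (\<phi> 2) \<xi>\<mu> / 2"
  using linear_coefficient by blast
 have "\<gamma> (n + 2) (va 0) ~= 0" using gva a2 by simp
 then obtain MB where "nonlinear_problem (Dx f 0 0) R n \<Lambda> A ip \<phi> \<psi> S fm \<eta> B \<xi> va MB FF FF' FF2 base"
  using nonlinear_data[OF \<xi> va] by blast
 then interpret P: nonlinear_problem "Dx f 0 0" R n \<Lambda> A ip \<phi> \<psi> S fm \<eta> B \<xi> va MB FF FF' FF2 base .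
 have cc: "P.cc t = (qq t, (1 / 3) *\<^sub>R cub t)" for t
  unfolding P.cc_def P.bb_def by (rule FF2_slice)
 have cub: "continuous_on {0..} (%t. (1 / 3) *\<^sub>R cub t)" "((%t. (1 / 3) *\<^sub>R cub t) \<longlongrightarrow> 0) at_top"
  using P.adm_admissible[OF P.adm_cc] unfolding cc P.admissible_def by auto
 obtain c where c: "Ksol (%t. (1 / 2) *\<^sub>R qq t) (%t. \<xi>\<alpha> t - c *\<^sub>R \<phi> 2 t)"
  using symmetric_solution_Ksol[OF xia(1,2)] xia(3)[of 0] by auto
 let ?\<zeta> = "%t. \<xi>\<alpha> t - c *\<^sub>R \<phi> 2 t" and ?g = "%t. (1 / 6) *\<^sub>R cub t + B t (\<xi>\<alpha> t)"
 have six: "(1 / 6) *\<^sub>R x = (1 / 2) *\<^sub>R ((1 / 3) *\<^sub>R x)" for x :: "real ^ 'm" by simp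
 have gc: "continuous_on {0..} ?g"
  unfolding six by (intro continuous_on_add continuous_on_scaleR continuous_on_const cub continuous_coefficients sol_continuous[OF xia(1)])
 have gl: "(?g \<longlongrightarrow> 0) at_top"
  using tendsto_add[OF tendsto_scaleR[OF tendsto_const[of "1 / 2"] cub(2)] B_decay[OF xia(2)]] by simp
 have gr: "?g (- t) = - R (?g t)" for t
  by (simp add: reflect_coefficients(2) reflect_coefficients(3)[OF xia(3)] linear_add[OF linR] linear_cmul[OF linR])
 have "continuous_on {0..} (%t. ?g t - c *\<^sub>R qq t)" by (intro continuous_on_diff continuous_on_scaleR continuous_on_const continuous_coefficients gc)
 moreover have "((%t. ?g t - c *\<^sub>R qq t) \<longlongrightarrow> 0) at_top"
  using tendsto_diff[OF gl tendsto_scaleR[OF tendsto_const[of c] Dx2_decay[OF phi2_decay phi2_bounded_halfline]]] by simp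
 ultimately obtain vb where vb: "Ksol (%t. ?g t - c *\<^sub>R qq t) vb" using Ksol_exists by blast
 have gvb: "\<gamma> (n + 2) (vb 0) = - b2bar ip f xh (\<psi> (n + 2)) (\<phi> 2) \<xi>\<alpha> / 2"
  using melnikov[OF gc gl gr vb] b2 by (simp only: b2bar_def simp_thms)
 obtain a \<Phi> \<Phi>' K m' y v where br: "0 < a & a <= 1 & \<Phi> 0 = 0 & K >= 0 &
  (EX z w. P.Qsol (%t. fst (P.cc t)) (%t. snd (P.cc t)) z w m') &
  (ALL q. \<bar>q\<bar> < a --> \<Phi> (- q) = \<Phi> q & (\<Phi> has_real_derivative \<Phi>' q) (at q) &
    \<bar>\<Phi>' q - q * m'\<bar> <= K * q ^ 2 & \<bar>\<Phi> q - (q ^ 2 / 2) * m'\<bar> <= K * \<bar>q\<bar> ^ 3 &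
    (ALL t>=0. ((%t. base t + (y q t, v q t)) has_vector_derivative
      FF (base t + (y q t, v q t), (\<Phi> q, q))) (at t within {0..})) &
    (ALL t>=0. y q t \<in> V 1 & v q t \<in> V (- 1) & norm (y q t) <= K * q ^ 2 & norm (v q t) <= K * q ^ 2) &
    R (y q 0) = y q 0 & R (v q 0) = v q 0 & (y q \<longlongrightarrow> 0) at_top & (v q \<longlongrightarrow> 0) at_top)"
  using P.branch by (elim exE) (rule that)
 have m: "m' = m"
 proof -
  obtain z w where zw: "P.Qsol (%t. fst (P.cc t)) (%t. snd (P.cc t)) z w m'" using br by blast
  have z: "Ksol (%t. m' *\<^sub>R fm t + qq t) z" and w: "Ksol (%t. B t (z t) + m' *\<^sub>R \<eta> t + (1 / 3) *\<^sub>R cub t) w"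
   and gw: "\<gamma> (n + 2) (w 0) = 0" using zw by (auto simp: P.Qsol_def cc)
  have "Ksol (%t. m' *\<^sub>R fm t + 2 *\<^sub>R ((1 / 2) *\<^sub>R qq t)) (%t. m' *\<^sub>R \<xi> t + 2 *\<^sub>R ?\<zeta> t)"
   by (rule Ksol_lincomb[OF \<xi> c])
  then have "Ksol (%t. m' *\<^sub>R fm t + qq t) (%t. m' *\<^sub>R \<xi> t + 2 *\<^sub>R ?\<zeta> t)" by simp
  from Ksol_unique[OF z this] have zeq: "z t = m' *\<^sub>R \<xi> t + 2 *\<^sub>R ?\<zeta> t" if "t >= 0" for t using that .
  have "Ksol (%t. m' *\<^sub>R (B t (\<xi> t) + \<eta> t) + 2 *\<^sub>R (?g t - c *\<^sub>R qq t)) (%t. m' *\<^sub>R va t + 2 *\<^sub>R vb t)"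
   by (rule Ksol_lincomb[OF va vb])
  then have "Ksol (%t. B t (z t) + m' *\<^sub>R \<eta> t + (1 / 3) *\<^sub>R cub t) (%t. m' *\<^sub>R va t + 2 *\<^sub>R vb t)"
  proof (rule P.Ksol_cong)
   fix t :: real assume t: "t >= 0"
   show "B t (z t) + m' *\<^sub>R \<eta> t + (1 / 3) *\<^sub>R cub t = m' *\<^sub>R (B t (\<xi> t) + \<eta> t) + 2 *\<^sub>R (?g t - c *\<^sub>R qq t)"
    unfolding zeq[OF t]
    by (simp add: linear_add[OF Dx2_linear_left] linear_diff[OF Dx2_linear_left] linear_cmul[OF Dx2_linear_left] algebra_simps)
  qed (rule refl)
  from Ksol_unique[OF w this, of 0] have "w 0 = m' *\<^sub>R va 0 + 2 *\<^sub>R vb 0" by simp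
  then have "m' * \<gamma> (n + 2) (va 0) + 2 * \<gamma> (n + 2) (vb 0) = 0" using gw P.\<gamma>_lincomb by metis
  then show ?thesis unfolding gva gvb m_def using a2 by (simp add: field_simps)
 qed
 define p where "p q t = xh t + y q t" for q t
 define w where "w q t = \<phi> 2 t + v q t" for q t
 have main: "(\<forall>s\<in>{1, - 1}. ALL t>=0. ((%t. p q t + (s * q) *\<^sub>R w q t) has_vector_derivative
      f (p q t + (s * q) *\<^sub>R w q t) (\<Phi> q)) (at t within {0..})) &
    (ALL t>=0. p q t \<in> V 1 & w q t \<in> V (- 1) & norm (p q t - xh t) <= K * q ^ 2 & norm (w q t - \<phi> 2 t) <= K * q ^ 2) &
    R (p q 0) = p q 0 & R (w q 0) = w q 0 & (p q \<longlongrightarrow> 0) at_top & (w q \<longlongrightarrow> 0) at_top"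
  if q: "\<bar>q\<bar> < a" for q
 proof (intro conjI ballI allI impI)
  have b: "ALL t>=0. ((%t. base t + (y q t, v q t)) has_vector_derivative
      FF (base t + (y q t, v q t), (\<Phi> q, q))) (at t within {0..})"
   "ALL t>=0. y q t \<in> V 1 & v q t \<in> V (- 1) & norm (y q t) <= K * q ^ 2 & norm (v q t) <= K * q ^ 2"
   "R (y q 0) = y q 0" "R (v q 0) = v q 0" "(y q \<longlongrightarrow> 0) at_top" "(v q \<longlongrightarrow> 0) at_top"
   using br q by blast+
  fix t s :: real assume s: "s \<in> {1, - 1}" and t: "t >= 0"
  have d: "((%t. (p q t, w q t)) has_vector_derivative (ee (p q t) (w q t) (\<Phi> q) q, kk (p q t) (w q t) (\<Phi> q) q)) (at t within {0..})"
   using b(1) t by (simp add: p_def w_def FF_def)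
  have "((%t. p q t + (s * q) *\<^sub>R w q t) has_vector_derivative
    ee (p q t) (w q t) (\<Phi> q) q + (s * q) *\<^sub>R kk (p q t) (w q t) (\<Phi> q) q) (at t within {0..})"
   using bounded_linear.has_vector_derivative[OF bounded_linear_fst d]
    bounded_linear.has_vector_derivative[OF bounded_linear_snd d]
   by (intro has_vector_derivative_add bounded_linear.has_vector_derivative[OF bounded_linear_scaleR_right]) simp_all
  moreover have "ee (p q t) (w q t) (\<Phi> q) q + (s * q) *\<^sub>R kk (p q t) (w q t) (\<Phi> q) q = f (p q t + (s * q) *\<^sub>R w q t) (\<Phi> q)"
   using s ee_kk[of "p q t" "w q t" "\<Phi> q" q] by auto
  ultimately show "((%t. p q t + (s * q) *\<^sub>R w q t) has_vector_derivative f (p q t + (s * q) *\<^sub>R w q t) (\<Phi> q)) (at t within {0..})"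
   by simp
 next
  have b: "ALL t>=0. y q t \<in> V 1 & v q t \<in> V (- 1) & norm (y q t) <= K * q ^ 2 & norm (v q t) <= K * q ^ 2"
   "R (y q 0) = y q 0" "R (v q 0) = v q 0" "(y q \<longlongrightarrow> 0) at_top" "(v q \<longlongrightarrow> 0) at_top"
   using br q by blast+
  show "R (p q 0) = p q 0" "R (w q 0) = w q 0"
   using b xh_sym[of 0] phi2_R by (simp_all add: p_def w_def linear_add[OF linR])
  show "(p q \<longlongrightarrow> 0) at_top" "(w q \<longlongrightarrow> 0) at_top"
   using tendsto_add[OF xh_lim b(4)] tendsto_add[OF phi2_decay b(5)] by (simp_all add: p_def[abs_def] w_def[abs_def])
  fix t :: real assume t: "t >= 0"
  show "p q t \<in> V 1" "w q t \<in> V (- 1)"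
   using b(1) t xh_V phi2_V unfolding p_def w_def by (auto intro: subspace_add[OF subspace_V])
  show "norm (p q t - xh t) <= K * q ^ 2" "norm (w q t - \<phi> 2 t) <= K * q ^ 2"
   using b(1) t by (simp_all add: p_def w_def)
 qed
 show ?thesis
  by (rule exI[of _ a], rule exI[of _ \<Phi>], rule exI[of _ \<Phi>'], rule exI[of _ K], rule exI[of _ p], rule exI[of _ w])
   (use br[unfolded m] main in blast)
qed

end

section \<open>Extension to the whole line and persistence in the fixed space\<close>

lemma quadratic_derivative:
 fixes \<Phi> \<Phi>' :: "real => real"
 assumes a: "a > 0" and K: "K >= 0"
  and d: "!!\<alpha>. \<bar>\<alpha>\<bar> < a ==> (\<Phi> has_real_derivative \<Phi>' \<alpha>) (at \<alpha>)" "!!\<alpha>. \<bar>\<alpha>\<bar> < a ==> \<bar>\<Phi>' \<alpha> - \<alpha> * m\<bar> <= K * \<alpha> ^ 2"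
 shows "deriv \<Phi> 0 = 0" "(deriv \<Phi> has_real_derivative m) (at 0)"
proof -
 have eq: "deriv \<Phi> \<alpha> = \<Phi>' \<alpha>" if "\<bar>\<alpha>\<bar> < a" for \<alpha> using d(1)[OF that] by (rule DERIV_imp_deriv)
 show 0: "deriv \<Phi> 0 = 0" using d(2)[of 0] a eq[of 0] by simp
 have "((%h. K * \<bar>h\<bar>) \<longlongrightarrow> K * \<bar>0\<bar>) (at 0)" by (intro tendsto_intros)
 then have "((%h. K * \<bar>h\<bar>) \<longlongrightarrow> 0) (at 0)" by simp
 then have "((%h. (deriv \<Phi> (0 + h) - deriv \<Phi> 0) / h - m) \<longlongrightarrow> 0) (at 0)"
 proof (rule Lim_null_comparison[rotated])
  have "\<forall>\<^sub>F h in at 0. h ~= (0::real) & \<bar>h\<bar> < a" using a by (auto simp: eventually_at dist_real_def)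
  then show "\<forall>\<^sub>F h in at 0. norm ((deriv \<Phi> (0 + h) - deriv \<Phi> 0) / h - m) <= K * \<bar>h\<bar>"
  proof eventually_elim
   case (elim h)
   have "(deriv \<Phi> (0 + h) - deriv \<Phi> 0) / h - m = (\<Phi>' h - h * m) / h" using elim eq 0 by (simp add: field_simps)
   also have "norm \<dots> = \<bar>\<Phi>' h - h * m\<bar> / \<bar>h\<bar>" by simp
   also have "\<dots> <= (K * h ^ 2) / \<bar>h\<bar>" using d(2) elim by (intro divide_right_mono) auto
   also have "\<dots> = K * \<bar>h\<bar>" using elim by (simp add: power2_eq_square field_simps)
   finally show ?case .
  qed
 qed
 then show "(deriv \<Phi> has_real_derivative m) (at 0)" unfolding DERIV_def using Lim_null by blast
qed

lemma has_derivative_Un: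
 assumes "(f has_derivative f') (at x within S)" "(f has_derivative f') (at x within T)"
 shows "(f has_derivative f') (at x within S \<union> T)"
 using assms unfolding has_derivative_within by (auto intro: Lim_Un)

context reversible_homoclinic
begin

definition reflected_extension :: "(real => real ^ 'm) => real => real ^ 'm" where
 "reflected_extension x t = (if t >= 0 then x t else R (x (- t)))"

text \<open>The two one-sided derivatives at \<open>0\<close> agree because \<open>x 0\<close> is fixed by the
 reversor.\<close>

lemma reflected_extension:
 assumes x: "!!t. t >= 0 ==> (x has_vector_derivative f (x t) \<mu>) (at t within {0..})"
  and x0: "R (x 0) = x 0" and lim: "(x \<longlongrightarrow> 0) at_top"
 shows "(reflected_extension x has_vector_derivative f (reflected_extension x t) \<mu>) (at t)"
  "symmetric R (reflected_extension x)" "(reflected_extension x \<longlongrightarrow> 0) at_top" "(reflected_extension x \<longlongrightarrow> 0) at_bot"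
proof -
 let ?X = "reflected_extension x"
 have R: "bounded_linear R" using linR by (simp add: linear_conv_bounded_linear)
 have neg: "?X t = R (x (- t))" if "t <= 0" for t using that x0 by (cases "t = 0") (auto simp: reflected_extension_def)
 have right: "(?X has_vector_derivative f (?X t) \<mu>) (at t within {0..})" if t: "t >= 0" for t
 proof -
  have "(?X has_vector_derivative f (x t) \<mu>) (at t within {0..})"
   using x[OF t] by (rule has_vector_derivative_transform[rotated 2]) (use t in \<open>auto simp: reflected_extension_def\<close>)
  then show ?thesis using t by (simp add: reflected_extension_def)
 qed
 have left: "(?X has_vector_derivative f (?X t) \<mu>) (at t within {..0})" if t: "t <= 0" for t
 proof -
  have "(x has_vector_derivative f (x (- t)) \<mu>) (at (- t) within uminus ` {..0})"
   using x[of "- t"] t by simp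
  then have "((x \<circ> uminus) has_vector_derivative (- 1) *\<^sub>R f (x (- t)) \<mu>) (at t within {..0})"
   by (rule vector_diff_chain_within[rotated]) (auto intro!: derivative_eq_intros)
  from bounded_linear.has_vector_derivative[OF R this]
  have "((%t. R (x (- t))) has_vector_derivative f (R (x (- t))) \<mu>) (at t within {..0})"
   using linear_neg[OF linR] by (simp add: o_def R_f)
  then have "(?X has_vector_derivative f (R (x (- t))) \<mu>) (at t within {..0})"
   by (rule has_vector_derivative_transform[rotated 2]) (use t neg in auto)
  then show ?thesis using neg[OF t] by simp
 qed
 show "(?X has_vector_derivative f (?X t) \<mu>) (at t)"
 proof (cases "t = 0")
  case True
  have "(?X has_vector_derivative f (?X t) \<mu>) (at t within {..0} \<union> {0..})"
   using left[of t] right[of t] unfolding has_vector_derivative_def by (intro has_derivative_Un) (simp_all add: True)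
  moreover have "{..0} \<union> {0..} = (UNIV :: real set)" by auto
  ultimately show ?thesis by simp
 next
  case False
  show ?thesis
  proof (cases "t > 0")
   case True
   then show ?thesis using has_vector_derivative_at_halfline[OF right True] by simp
  next
   case f: False
   then have t: "t <= 0" by simp
   have eq: "at t within {..0} = at t" by (rule at_within_open_subset[of _ "{..<0}"]) (use False t in auto)
   show ?thesis using left[OF t] unfolding eq .
  qed
 qed
 show "symmetric R ?X"
  unfolding symmetric_def
 proof
  fix t show "?X t = R (?X (- t))"
   using x0 by (cases "t = 0"; cases "t > 0") (auto simp: reflected_extension_def RR)
 qed
 have "\<forall>\<^sub>F t in at_top. x t = ?X t"
  using eventually_ge_at_top[of 0] by eventually_elim (simp add: reflected_extension_def)
 with lim show top: "(?X \<longlongrightarrow> 0) at_top" by (rule Lim_transform_eventually)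
 have "((%t. R (?X (- t))) \<longlongrightarrow> R 0) at_bot"
  by (rule bounded_linear.tendsto[OF R], rule filterlim_compose[OF top]) (rule filterlim_uminus_at_top_at_bot)
 then have "((%t. R (?X (- t))) \<longlongrightarrow> 0) at_bot" by (simp add: linear_0[OF linR])
 moreover have "R (?X (- t)) = ?X t" for t using \<open>symmetric R ?X\<close> unfolding symmetric_def by (metis (no_types, lifting))
 ultimately show "(?X \<longlongrightarrow> 0) at_bot" by simp
qed

lemma reflected_extension_close:
 assumes C: "!!x. norm (R x) <= C * norm x" "C >= 1" and y: "!!t. y (- t) = R (y t)"
  and e: "!!t. t >= 0 ==> norm (x t - y t) <= e"
 shows "norm (reflected_extension x t - y t) <= C * e"
proof (cases "t >= 0")
 case True
 have e0: "e >= 0" using e[OF True] norm_ge_zero order_trans by blast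
 have "norm (x t - y t) <= 1 * e" using e[OF True] by simp
 also have "\<dots> <= C * e" using C(2) e0 by (rule mult_right_mono)
 finally show ?thesis using True by (simp add: reflected_extension_def)
next
 case False
 have "reflected_extension x t - y t = R (x (- t) - y (- t))"
  using False y[of "- t"] by (simp add: reflected_extension_def linear_diff[OF linR])
 also have "norm \<dots> <= C * norm (x (- t) - y (- t))" by (rule C)
 also have "\<dots> <= C * e" using C(2) e[of "- t"] False by (intro mult_left_mono) auto
 finally show ?thesis .
qed

lemma R_bound: "EX C>=1. ALL x. norm (R x) <= C * norm x"
proof -
 obtain C where C: "!!x. norm (R x) <= C * norm x" using linear_bounded[OF linR] by blast
 have "norm (R x) <= max 1 C * norm x" for x
  using C[of x] mult_right_mono[of C "max 1 C" "norm x"] by simp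
 then show ?thesis by (intro exI[of _ "max 1 C"]) simp
qed

definition symmetric_source :: "(real => real ^ 'm) => bool" where
 "symmetric_source g \<longleftrightarrow> continuous_on {0..} g & (g \<longlongrightarrow> 0) at_top & (ALL t>=0. g t \<in> V 1)"

definition Kop :: "(real => real ^ 'm) => real \<Rightarrow>\<^sub>C (real ^ 'm)" where
 "Kop g = halfline_bcontfun (SOME y. Ksol g y)"

lemma Kop:
 assumes g: "symmetric_source g"
 shows "EX y. Ksol g y & (ALL t. apply_bcontfun (Kop g) t = y (max 0 t))"
proof -
 have "EX y. Ksol g y" using g Ksol_exists by (auto simp: symmetric_source_def)
 then have k: "Ksol g (SOME y. Ksol g y)" by (rule someI_ex)
 have "apply_bcontfun (Kop g) t = (SOME y. Ksol g y) (max 0 t)" for t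
  unfolding Kop_def
  by (rule halfline_bcontfun[OF hsol_continuous]) (use k[unfolded Ksol_def[of g "SOME y. Ksol g y"]] in blast)+
 then show ?thesis using k by blast
qed

lemma Kop_properties:
 assumes g: "symmetric_source g"
 shows "hsol A (apply_bcontfun (Kop g)) g" "(apply_bcontfun (Kop g) \<longlongrightarrow> 0) at_top"
  "t >= 0 ==> apply_bcontfun (Kop g) t \<in> V 1" "R (apply_bcontfun (Kop g) 0) = apply_bcontfun (Kop g) 0"
proof -
 obtain y where y: "Ksol g y" "!!t. apply_bcontfun (Kop g) t = y (max 0 t)" using Kop[OF g] by blast
 have gs: "continuous_on {0..} g" "(g \<longlongrightarrow> 0) at_top" "!!t. t >= 0 ==> g t \<in> V 1"
  using g by (auto simp: symmetric_source_def)
 have y0: "\<gamma> (n + 2) (y 0) = 0" by (rule solvability_zero[OF gs(1,2) y(1)]) (use gs(3) V_plus_orth in auto)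
 show "hsol A (apply_bcontfun (Kop g)) g"
  by (rule hsol_cong[of A y g]) (use y in \<open>auto simp: Ksol_def\<close>)
 show "(apply_bcontfun (Kop g) \<longlongrightarrow> 0) at_top"
  using Ksol_tendsto[OF y(1) gs(2)]
  by (rule Lim_transform_eventually) (use y(2) in \<open>auto intro: eventually_mono[OF eventually_ge_at_top[of 0]]\<close>)
 show "apply_bcontfun (Kop g) t \<in> V 1" if "t >= 0" using Ksol_V[OF y(1) gs(3) y0 _ that] that y(2)[of t] by simp
 show "R (apply_bcontfun (Kop g) 0) = apply_bcontfun (Kop g) 0"
  using bdry_Fix[OF _ y0] y by (simp add: Ksol_def)
qed

lemma Kop_diff:
 assumes g: "symmetric_source g" and h: "symmetric_source h" and H: "!!t. t >= 0 ==> norm (g t - h t) <= H"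
 shows "norm (Kop g - Kop h) <= K_const * H"
proof (rule norm_bound)
 fix t
 obtain y where y: "Ksol g y" "!!t. apply_bcontfun (Kop g) t = y (max 0 t)" using Kop[OF g] by blast
 obtain z where z: "Ksol h z" "!!t. apply_bcontfun (Kop h) t = z (max 0 t)" using Kop[OF h] by blast
 have "norm (y (max 0 t) - z (max 0 t)) <= K_const * H"
  by (rule Ksol_bound[OF Ksol_diff[OF y(1) z(1)]])
   (use g h H in \<open>auto simp: symmetric_source_def intro: continuous_on_diff\<close>)
 then show "norm (apply_bcontfun (Kop g - Kop h) t) <= K_const * H" using y(2) z(2) by simp
qed

text \<open>The first bound controls the nonlinear remainder along the whole orbit, the second one the
 dependence on the parameter.\<close>

lemma f0_estimates:
 "EX M>=0. ALL t>=0. ALL u v \<mu> \<nu>. norm u <= 1 --> norm v <= 1 --> \<bar>\<mu>\<bar> <= 1 --> \<bar>\<nu>\<bar> <= 1 -->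
   norm (f (xh t + u) \<mu> - f (xh t + v) \<mu> - A t (u - v)) <= M * (norm u + 2 * norm v + \<bar>\<mu>\<bar>) * norm (u - v) &
   norm (f (xh t + u) \<mu> - f (xh t + u) \<nu>) <= 3 * M * \<bar>\<mu> - \<nu>\<bar>"
proof -
 have "bounded (xh ` {0..})" by (rule halfline_bounded[OF xh_continuous xh_lim])
 then obtain r where r: "!!t. t >= 0 ==> norm (xh t) <= r" by (auto simp: bounded_iff)
 obtain M where M: "M >= 0" "!!z h. z \<in> cball 0 (r + 2) ==> norm (D f0 z h) <= M * norm h"
  "!!z z' h. z \<in> cball 0 (r + 2) ==> z' \<in> cball 0 (r + 2) ==> norm (D f0 z' h - D f0 z h) <= M * norm (z' - z) * norm h"
  "!!z z'. z \<in> cball 0 (r + 2) ==> z' \<in> cball 0 (r + 2) ==> norm (f0 z' - f0 z - D f0 z (z' - z)) <= M * norm (z' - z) ^ 2"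
  using C2_bounds[of f0 "D f0" "r + 2", OF D0 Ck_derivative(2)[OF f0_smooth]] by blast
 have ball: "(xh t + u, \<mu>) \<in> cball 0 (r + 2)" if "t >= 0" "norm u <= 1" "\<bar>\<mu>\<bar> <= 1" for t u and \<mu> :: real
 proof -
  have "norm (xh t + u, \<mu>) <= norm (xh t + u) + \<bar>\<mu>\<bar>" using norm_Pair_le[of "xh t + u" \<mu>] by simp
  also have "\<dots> <= r + 2" using norm_triangle_ineq[of "xh t" u] r[of t] that by linarith
  finally show ?thesis unfolding mem_cball dist_0_norm .
 qed
 have e1: "norm (f (xh t + u) \<mu> - f (xh t + v) \<mu> - A t (u - v)) <= M * (norm u + 2 * norm v + \<bar>\<mu>\<bar>) * norm (u - v)"
  if t: "t >= 0" and u: "norm u <= 1" and v: "norm v <= 1" and \<mu>: "\<bar>\<mu>\<bar> <= 1" for t u v \<mu>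
 proof -
  let ?z' = "(xh t + u, \<mu>)" and ?z = "(xh t + v, \<mu>)" and ?b = "(xh t + 0, 0::real)" and ?h = "(u - v, 0::real)"
  have b: "?z' \<in> cball 0 (r + 2)" "?z \<in> cball 0 (r + 2)" "?b \<in> cball 0 (r + 2)" by (rule ball; use t u v \<mu> in simp)+
  have h: "?z' - ?z = ?h" "norm ?h = norm (u - v)" by (simp_all add: norm_Pair)
  have vb: "norm (?z - ?b) <= norm v + \<bar>\<mu>\<bar>" using norm_Pair_le[of v \<mu>] by simp
  have "norm (f0 ?z' - f0 ?z - D f0 ?b ?h) <= norm (f0 ?z' - f0 ?z - D f0 ?z ?h) + norm (D f0 ?z ?h - D f0 ?b ?h)"
   by (rule order_trans[OF eq_refl norm_triangle_ineq]) (rule arg_cong[of _ _ norm], simp add: algebra_simps)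
  also have "\<dots> <= M * norm (u - v) ^ 2 + M * (norm v + \<bar>\<mu>\<bar>) * norm (u - v)"
  proof (rule add_mono)
   show "norm (f0 ?z' - f0 ?z - D f0 ?z ?h) <= M * norm (u - v) ^ 2" using M(4)[OF b(2,1)] unfolding h .
   have "norm (D f0 ?z ?h - D f0 ?b ?h) <= M * norm (?z - ?b) * norm ?h" by (rule M(3)[OF b(3,2)])
   also have "\<dots> <= M * (norm v + \<bar>\<mu>\<bar>) * norm (u - v)" unfolding h using vb M(1) by (intro mult_right_mono mult_left_mono) auto
   finally show "norm (D f0 ?z ?h - D f0 ?b ?h) <= M * (norm v + \<bar>\<mu>\<bar>) * norm (u - v)" .
  qed
  also have "\<dots> = M * (norm (u - v) + norm v + \<bar>\<mu>\<bar>) * norm (u - v)" by (simp add: algebra_simps power2_eq_square)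
  also have "\<dots> <= M * (norm u + 2 * norm v + \<bar>\<mu>\<bar>) * norm (u - v)"
   using norm_triangle_ineq4[of u v] M(1) by (intro mult_right_mono mult_left_mono) auto
  finally show ?thesis by (simp add: f0_def Df0_split)
 qed
 have e2: "norm (f (xh t + u) \<mu> - f (xh t + u) \<nu>) <= 3 * M * \<bar>\<mu> - \<nu>\<bar>"
  if t: "t >= 0" and u: "norm u <= 1" and \<mu>: "\<bar>\<mu>\<bar> <= 1" "\<bar>\<nu>\<bar> <= 1" for t u \<mu> \<nu>
 proof -
  let ?z' = "(xh t + u, \<mu>)" and ?z = "(xh t + u, \<nu>)"
  have b: "?z' \<in> cball 0 (r + 2)" "?z \<in> cball 0 (r + 2)" by (rule ball; use t u \<mu> in simp)+
  have h: "norm (?z' - ?z) = \<bar>\<mu> - \<nu>\<bar>" by (simp add: norm_Pair)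
  have "norm (f0 ?z' - f0 ?z) <= norm (f0 ?z' - f0 ?z - D f0 ?z (?z' - ?z)) + norm (D f0 ?z (?z' - ?z))"
   by (rule order_trans[OF eq_refl norm_triangle_ineq]) (rule arg_cong[of _ _ norm], simp add: algebra_simps)
  also have "\<dots> <= M * \<bar>\<mu> - \<nu>\<bar> ^ 2 + M * \<bar>\<mu> - \<nu>\<bar>"
   using M(4)[OF b(2,1)] M(2)[OF b(2), of "?z' - ?z"] unfolding h by (rule add_mono)
  also have "\<dots> <= M * (2 * \<bar>\<mu> - \<nu>\<bar>) + M * \<bar>\<mu> - \<nu>\<bar>"
   using \<mu> M(1) unfolding power2_eq_square by (intro add_mono mult_left_mono mult_right_mono) auto
  finally show ?thesis by (simp add: f0_def)
 qed
 show ?thesis using M(1) e1 e2 by (intro exI[of _ M]) auto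
qed

end

context reversible_homoclinic
begin

text \<open>For values in \<open>V 1\<close> the solvability condition holds automatically, so the contraction
 is for \<open>y\<close> alone, with \<open>\<mu>\<close> as a parameter.\<close>

lemma persistence:
 "EX a>0. EX C>=0. EX y. (ALL t. y 0 t = 0) & (ALL \<mu>. \<bar>\<mu>\<bar> <= a -->
   (ALL t>=0. ((%t. xh t + y \<mu> t) has_vector_derivative f (xh t + y \<mu> t) \<mu>) (at t within {0..}) &
    y \<mu> t \<in> V 1 & norm (y \<mu> t) <= C * \<bar>\<mu>\<bar>) & R (y \<mu> 0) = y \<mu> 0 & (y \<mu> \<longlongrightarrow> 0) at_top)"
proof -
 define N where "N u \<mu> t = f (xh t + apply_bcontfun u t) \<mu> - f (xh t) 0 - A t (apply_bcontfun u t)" for u \<mu> t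
 define Z where "Z = {u :: real \<Rightarrow>\<^sub>C (real ^ 'm). (apply_bcontfun u \<longlongrightarrow> 0) at_top & (ALL t>=0. apply_bcontfun u t \<in> V 1)}"
 obtain M where M: "M >= 0" "!!t u v \<mu>. t >= 0 ==> norm u <= 1 ==> norm v <= 1 ==> \<bar>\<mu>\<bar> <= 1 ==>
    norm (f (xh t + u) \<mu> - f (xh t + v) \<mu> - A t (u - v)) <= M * (norm u + 2 * norm v + \<bar>\<mu>\<bar>) * norm (u - v)"
   "!!t u \<mu> \<nu>. t >= 0 ==> norm u <= 1 ==> \<bar>\<mu>\<bar> <= 1 ==> \<bar>\<nu>\<bar> <= 1 ==>
    norm (f (xh t + u) \<mu> - f (xh t + u) \<nu>) <= 3 * M * \<bar>\<mu> - \<nu>\<bar>"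
  using f0_estimates by (metis norm_zero zero_le_one)
 have K0: "K_const >= 0" using K_const by blast
 define \<rho> where "\<rho> = 1 / (1 + 8 * K_const * M)"
 have \<rho>: "0 < \<rho>" "\<rho> <= 1" "K_const * (4 * M * \<rho>) <= 1 / 2"
 proof -
  have p: "K_const * M >= 0" "M * K_const >= 0" using K0 M(1) by simp_all
  then show "0 < \<rho>" "\<rho> <= 1" by (simp_all add: \<rho>_def)
  show "K_const * (4 * M * \<rho>) <= 1 / 2" using p by (simp add: \<rho>_def field_simps)
 qed
 have src: "symmetric_source (N u \<mu>)" if u: "u \<in> Z" for u \<mu>
  unfolding symmetric_source_def
 proof (intro conjI allI impI)
  have cu: "continuous_on {0..} (apply_bcontfun u)" by simp
  have cf: "continuous_on UNIV f0" by (rule Ck_continuous[OF f0_smooth[of 0]])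
  have f: "continuous_on {0..} (%t. f (x t) \<nu>)" if "continuous_on {0..} x" for x \<nu>
   using continuous_on_compose2[OF cf continuous_on_Pair[OF that continuous_on_const[of _ \<nu>]]] by (simp add: f0_def)
  show "continuous_on {0..} (N u \<mu>)"
   unfolding N_def[abs_def]
   by (intro continuous_on_diff f continuous_Dx continuous_on_add continuous_on_const xh_continuous cu)
  have lu: "(apply_bcontfun u \<longlongrightarrow> 0) at_top" using u by (simp add: Z_def)
  have lf: "((%t. f (x t) \<nu>) \<longlongrightarrow> 0) at_top" if "(x \<longlongrightarrow> 0) at_top" for x \<nu>
  proof -
   have "isCont f0 (0, \<nu>)" using cf by (simp add: continuous_on_eq_continuous_at)
   from isCont_tendsto_compose[OF this tendsto_Pair[OF that tendsto_const]] show ?thesis by (simp add: f0_def f_0)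
  qed
  obtain MA where MA: "!!t x. t >= 0 ==> norm (A t x) <= MA * norm x" using A_bounded by blast
  have lA: "((%t. A t (apply_bcontfun u t)) \<longlongrightarrow> 0) at_top"
  proof (rule Lim_null_comparison)
   show "\<forall>\<^sub>F t in at_top. norm (A t (apply_bcontfun u t)) <= MA * norm (apply_bcontfun u t)"
    using eventually_ge_at_top[of 0] by eventually_elim (rule MA)
   show "((%t. MA * norm (apply_bcontfun u t)) \<longlongrightarrow> 0) at_top"
    using tendsto_mult_left[OF tendsto_norm[OF lu], of MA] by simp
  qed
  have lxu: "((%t. xh t + apply_bcontfun u t) \<longlongrightarrow> 0) at_top" using tendsto_add[OF xh_lim lu] by simp
  show "(N u \<mu> \<longlongrightarrow> 0) at_top"
   using tendsto_diff[OF tendsto_diff[OF lf[OF lxu, of \<mu>] lf[OF xh_lim, of 0]] lA] by (simp add: N_def[abs_def])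
  fix t :: real assume "t >= 0"
  then have ut: "apply_bcontfun u t \<in> V 1" using u by (simp add: Z_def)
  show "N u \<mu> t \<in> V 1"
   unfolding N_def
   by (intro subspace_diff[OF subspace_V] V_D(1) V_D(3) subspace_add[OF subspace_V] xh_V ut)
 qed
 have "EX a' U. 0 < a' & a' <= \<rho> & U 0 = 0 & (ALL q. \<bar>q\<bar> <= a' --> U q \<in> Z & norm (U q) <= \<rho> & Kop (N (U q) q) = U q) &
  (ALL q u. \<bar>q\<bar> <= a' --> u \<in> Z --> norm u <= \<rho> --> Kop (N u q) = u --> u = U q) &
  (ALL q \<beta>. \<bar>q\<bar> <= a' --> \<bar>\<beta>\<bar> <= a' --> norm (U q - U \<beta>) <= 2 * (K_const * (3 * M)) * \<bar>q - \<beta>\<bar>)"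
 proof (rule parametric_fixed_point[where G = "%u \<mu>. Kop (N u \<mu>)"])
  show "closed Z" unfolding Z_def by (rule closed_decaying[OF closed_subspace[OF subspace_V]])
  show "0 \<in> Z" using subspace_0[OF subspace_V] by (simp add: Z_def)
  show "Kop (N u \<mu>) \<in> Z" if "u \<in> Z" for u \<mu>
   unfolding Z_def using Kop_properties(2,3)[OF src[OF that, of \<mu>]] by blast
  have pt: "norm (apply_bcontfun u t) <= \<rho>" "norm (apply_bcontfun u t) <= 1" if "norm u <= \<rho>" for u :: "real \<Rightarrow>\<^sub>C (real ^ 'm)" and t
   using norm_bounded[of u t] that \<rho>(2) by linarith+
  show "norm (Kop (N u \<mu>) - Kop (N v \<mu>)) <= norm (u - v) / 2"
   if "u \<in> Z" "norm u <= \<rho>" "v \<in> Z" "norm v <= \<rho>" "\<bar>\<mu>\<bar> <= \<rho>" for u v \<mu>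
  proof -
   have "norm (Kop (N u \<mu>) - Kop (N v \<mu>)) <= K_const * ((4 * M * \<rho>) * norm (u - v))"
   proof (rule Kop_diff[OF src src])
    fix t :: real assume t: "t >= 0"
    let ?u = "apply_bcontfun u t" and ?v = "apply_bcontfun v t"
    have "N u \<mu> t - N v \<mu> t = f (xh t + ?u) \<mu> - f (xh t + ?v) \<mu> - A t (?u - ?v)"
     by (simp add: N_def linear_diff[OF Dx_linear])
    also have "norm \<dots> <= M * (norm ?u + 2 * norm ?v + \<bar>\<mu>\<bar>) * norm (?u - ?v)"
     using pt that \<rho>(2) by (intro M(2) t) auto
    also have "\<dots> <= M * (4 * \<rho>) * norm (u - v)"
    proof (intro mult_mono)
     show "norm ?u + 2 * norm ?v + \<bar>\<mu>\<bar> <= 4 * \<rho>" using pt(1)[OF that(2), of t] pt(1)[OF that(4), of t] that(5) by linarith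
     show "norm (?u - ?v) <= norm (u - v)" using norm_bounded[of "u - v" t] by simp
    qed (use M(1) \<rho> in auto)
    finally show "norm (N u \<mu> t - N v \<mu> t) <= (4 * M * \<rho>) * norm (u - v)" by (simp add: mult_ac)
   qed (use that in auto)
   also have "\<dots> = (K_const * (4 * M * \<rho>)) * norm (u - v)" by (simp only: mult.assoc)
   also have "\<dots> <= (1 / 2) * norm (u - v)" using \<rho>(3) by (intro mult_right_mono) auto
   finally show ?thesis by simp
  qed
  show "norm (Kop (N u \<mu>) - Kop (N u \<nu>)) <= (K_const * (3 * M)) * \<bar>\<mu> - \<nu>\<bar>"
   if "u \<in> Z" "norm u <= \<rho>" "\<bar>\<mu>\<bar> <= \<rho>" "\<bar>\<nu>\<bar> <= \<rho>" for u \<mu> \<nu>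
  proof -
   have "norm (Kop (N u \<mu>) - Kop (N u \<nu>)) <= K_const * (3 * M * \<bar>\<mu> - \<nu>\<bar>)"
   proof (rule Kop_diff[OF src src])
    fix t :: real assume t: "t >= 0"
    have "N u \<mu> t - N u \<nu> t = f (xh t + apply_bcontfun u t) \<mu> - f (xh t + apply_bcontfun u t) \<nu>" by (simp add: N_def)
    also have "norm \<dots> <= 3 * M * \<bar>\<mu> - \<nu>\<bar>" using pt that \<rho>(2) by (intro M(3) t) auto
    finally show "norm (N u \<mu> t - N u \<nu> t) <= 3 * M * \<bar>\<mu> - \<nu>\<bar>" .
   qed (use that in auto)
   then show ?thesis by (simp only: mult.assoc)
  qed
  show "Kop (N 0 0) = 0"
  proof -
   have N0: "N 0 0 = (%_. 0)" by (rule ext) (simp add: N_def linear_0[OF Dx_linear])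
   have s0: "symmetric_source (%_. 0)" using subspace_0[OF subspace_V] by (simp add: symmetric_source_def)
   have "Ksol (%_. 0) y ==> t >= 0 ==> y t = 0" for y t
    using Ksol_bound[of "%_. 0" y 0 t] by simp
   then have "apply_bcontfun (Kop (%_. 0)) t = apply_bcontfun 0 t" for t
    using Kop[OF s0] by fastforce
   then show ?thesis unfolding N0 by (rule bcontfun_eqI)
  qed
 qed (use \<rho> K0 M(1) in auto)
 then obtain a' U where aU: "0 < a'" "U 0 = 0"
  "!!\<mu>. \<bar>\<mu>\<bar> <= a' ==> U \<mu> \<in> Z & Kop (N (U \<mu>) \<mu>) = U \<mu>"
  "!!\<mu> \<nu>. \<bar>\<mu>\<bar> <= a' ==> \<bar>\<nu>\<bar> <= a' ==> norm (U \<mu> - U \<nu>) <= 2 * (K_const * (3 * M)) * \<bar>\<mu> - \<nu>\<bar>"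
  by blast
 define y where "y \<mu> t = apply_bcontfun (U \<mu>) t" for \<mu> t
 have main: "(ALL t>=0. ((%t. xh t + y \<mu> t) has_vector_derivative f (xh t + y \<mu> t) \<mu>) (at t within {0..}) &
    y \<mu> t \<in> V 1 & norm (y \<mu> t) <= (2 * (K_const * (3 * M))) * \<bar>\<mu>\<bar>) & R (y \<mu> 0) = y \<mu> 0 & (y \<mu> \<longlongrightarrow> 0) at_top"
  if \<mu>: "\<bar>\<mu>\<bar> <= a'" for \<mu>
 proof -
  have U: "U \<mu> \<in> Z" "Kop (N (U \<mu>) \<mu>) = U \<mu>" using aU(3)[OF \<mu>] by auto
  have y: "hsol A (y \<mu>) (N (U \<mu>) \<mu>)" "(y \<mu> \<longlongrightarrow> 0) at_top" "!!t. t >= 0 ==> y \<mu> t \<in> V 1" "R (y \<mu> 0) = y \<mu> 0"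
   using Kop_properties(1,2,4)[OF src[OF U(1), of \<mu>]] U(1) unfolding U(2) y_def[abs_def] Z_def by auto
  have n: "norm (y \<mu> t) <= (2 * (K_const * (3 * M))) * \<bar>\<mu>\<bar>" for t
   using norm_bounded[of "U \<mu>" t] aU(4)[OF \<mu>, of 0] aU(1,2) unfolding y_def by simp
  have d: "((%t. xh t + y \<mu> t) has_vector_derivative f (xh t + y \<mu> t) \<mu>) (at t within {0..})" if t: "t >= 0" for t
  proof -
   have "(y \<mu> has_vector_derivative A t (y \<mu> t) + N (U \<mu>) \<mu> t) (at t within {0..})" using y(1) t by (simp add: hsol_def)
   from has_vector_derivative_add[OF has_vector_derivative_at_within[OF xh_sol] this] show ?thesis
    by (simp add: N_def y_def)
  qed
  show ?thesis using d y(2-4) n by blast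
 qed
 have C: "2 * (K_const * (3 * M)) >= 0" using K0 M(1) by simp
 have y0: "ALL t. y 0 t = 0" by (simp add: y_def aU(2))
 show ?thesis
  by (rule exI[of _ a'], rule conjI[OF aU(1)], rule exI[of _ "2 * (K_const * (3 * M))"], rule conjI[OF C], rule exI[of _ y])
   (use y0 main in blast)
qed

lemma persistent_orbits:
 "EX b>0. EX Y. Y 0 = xh & uniform_limit UNIV Y xh (at 0) &
   (ALL \<mu>. \<bar>\<mu>\<bar> < b --> homoclinic (%x. f x \<mu>) (Y \<mu>) & symmetric R (Y \<mu>) & (ALL t. S (Y \<mu> t) = Y \<mu> t))"
proof -
 obtain a C y where a: "a > 0" "C >= 0" "!!t. y 0 t = 0" and y: "!!\<mu>. \<bar>\<mu>\<bar> <= a ==>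
   (ALL t>=0. ((%t. xh t + y \<mu> t) has_vector_derivative f (xh t + y \<mu> t) \<mu>) (at t within {0..}) &
    y \<mu> t \<in> V 1 & norm (y \<mu> t) <= C * \<bar>\<mu>\<bar>) & R (y \<mu> 0) = y \<mu> 0 & (y \<mu> \<longlongrightarrow> 0) at_top"
  using persistence by blast
 obtain CR where CR: "CR >= 1" "!!x. norm (R x) <= CR * norm x" using R_bound by blast
 obtain t0 where t0: "xh t0 ~= 0" using xh_ne by blast
 define Y where "Y \<mu> = reflected_extension (%t. xh t + y \<mu> t)" for \<mu>
 define b where "b = min a (norm (xh t0) / (CR * C + 1))"
 have CC: "CR * C >= 0" using CR a by simp
 have b: "b > 0" using a t0 CC by (simp add: b_def add_nonneg_pos)
 have close: "norm (Y \<mu> t - xh t) <= CR * (C * \<bar>\<mu>\<bar>)" if "\<bar>\<mu>\<bar> <= a" for \<mu> t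
  unfolding Y_def
  by (rule reflected_extension_close[where C = CR and y = xh]) (use y[OF that] CR xh_sym in simp_all)
 have Y0: "Y 0 = xh"
  by (rule ext) (use close[of 0] a in simp)
 have ul: "uniform_limit UNIV Y xh (at 0)"
  unfolding uniform_limit_iff
 proof (intro allI impI)
  fix e :: real assume e: "e > 0"
  define d where "d = min a (e / (CR * C + 1))"
  have d: "d > 0" using a e CC by (simp add: d_def add_nonneg_pos)
  have "dist (Y \<mu> t) (xh t) < e" if \<mu>: "\<bar>\<mu>\<bar> < d" for \<mu> t
  proof -
   have "norm (Y \<mu> t - xh t) <= (CR * C) * \<bar>\<mu>\<bar>" using close[of \<mu> t] \<mu> by (simp add: d_def mult.assoc)
   also have "\<dots> <= (CR * C + 1) * \<bar>\<mu>\<bar>" by (simp add: algebra_simps)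
   also have "\<dots> < e" using \<mu> CC by (simp add: d_def pos_less_divide_eq add_nonneg_pos mult.commute)
   finally show ?thesis by (simp add: dist_norm)
  qed
  then show "\<forall>\<^sub>F \<mu> in at 0. \<forall>t\<in>UNIV. dist (Y \<mu> t) (xh t) < e"
   unfolding eventually_at using d by (auto intro!: exI[of _ d] simp: dist_real_def)
 qed
 have main: "homoclinic (%x. f x \<mu>) (Y \<mu>) & symmetric R (Y \<mu>) & (ALL t. S (Y \<mu> t) = Y \<mu> t)" if \<mu>: "\<bar>\<mu>\<bar> < b" for \<mu>
 proof -
  have \<mu>a: "\<bar>\<mu>\<bar> <= a" using \<mu> by (simp add: b_def)
  note y\<mu> = y[OF \<mu>a]
  have "R (xh 0 + y \<mu> 0) = xh 0 + y \<mu> 0" using y\<mu> xh_sym[of 0] by (simp add: linear_add[OF linR])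
  moreover have "((%t. xh t + y \<mu> t) \<longlongrightarrow> 0) at_top" using tendsto_add[OF xh_lim, of "y \<mu>" 0] y\<mu> by simp
  ultimately have ext: "!!t. (Y \<mu> has_vector_derivative f (Y \<mu> t) \<mu>) (at t)" "symmetric R (Y \<mu>)" "(Y \<mu> \<longlongrightarrow> 0) at_top" "(Y \<mu> \<longlongrightarrow> 0) at_bot"
   using reflected_extension[of "%t. xh t + y \<mu> t" \<mu>] y\<mu> unfolding Y_def by blast+
  have "Y \<mu> t0 ~= 0"
  proof
   assume "Y \<mu> t0 = 0"
   then have "norm (xh t0) <= (CR * C) * \<bar>\<mu>\<bar>" using close[OF \<mu>a, of t0] by (simp add: mult.assoc)
   also have "\<dots> <= (CR * C + 1) * \<bar>\<mu>\<bar>" by (simp add: algebra_simps)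
   also have "\<dots> < norm (xh t0)" using \<mu> CC by (simp add: b_def pos_less_divide_eq add_nonneg_pos mult.commute)
   finally show False by simp
  qed
  then have h: "homoclinic (%x. f x \<mu>) (Y \<mu>)" using ext by (auto simp: homoclinic_def)
  have v: "xh t + y \<mu> t \<in> V 1" if "t >= 0" for t using y\<mu> that subspace_add[OF subspace_V xh_V] by blast
  have "S (Y \<mu> t) = Y \<mu> t" for t
  proof (cases "t >= 0")
   case True then show ?thesis using v by (simp add: Y_def reflected_extension_def V_def)
  next
   case False
   then have "R (S (R (xh (- t) + y \<mu> (- t)))) = xh (- t) + y \<mu> (- t)" using v[of "- t"] by (simp add: V_def)
   then have "S (R (xh (- t) + y \<mu> (- t))) = R (xh (- t) + y \<mu> (- t))" using RR by metis
   then show ?thesis using False by (simp add: Y_def reflected_extension_def)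
  qed
  then show ?thesis using h ext by blast
 qed
 show ?thesis
  by (rule exI[of _ b], rule conjI[OF b], rule exI[of _ Y]) (use Y0 ul main in blast)
qed

end

context reversible_pitchfork
begin

text \<open>The two orbits differ at \<open>t = 0\<close> by \<open>2 q w(0)\<close>, and
 \<open>w(0)\<close> is close to \<open>\<phi>\<^sub>2(0) ~= 0\<close>.\<close>

lemma conjugate_orbits:
 defines "m \<equiv> - 2 * b2bar ip f xh (\<psi> (n + 2)) (\<phi> 2) \<xi>\<alpha> / a2bar ip f xh (\<psi> (n + 2)) (\<phi> 2) \<xi>\<mu>"
 shows "EX a \<Phi> \<Phi>' K X. 0 < a & \<Phi> 0 = 0 & K >= 0 &
  (ALL q. \<bar>q\<bar> < a --> \<Phi> (- q) = \<Phi> q & (\<Phi> has_real_derivative \<Phi>' q) (at q) &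
    \<bar>\<Phi>' q - q * m\<bar> <= K * q ^ 2 & \<bar>\<Phi> q - (q ^ 2 / 2) * m\<bar> <= K * \<bar>q\<bar> ^ 3) &
  (ALL q. \<bar>q\<bar> < a --> q ~= 0 --> X q ~= (%t. S (X q t)) &
    homoclinic (%x. f x (\<Phi> q)) (X q) & symmetric R (X q) &
    homoclinic (%x. f x (\<Phi> q)) (%t. S (X q t)) & symmetric R (%t. S (X q t)) &
    (ALL t. norm (X q t - (xh t + q *\<^sub>R \<phi> 2 t)) <= K * q ^ 2))"
proof -
 obtain a \<Phi> \<Phi>' K p w where br0: "0 < a & \<Phi> 0 = 0 & K >= 0 & (ALL q. \<bar>q\<bar> < a -->
   \<Phi> (- q) = \<Phi> q & (\<Phi> has_real_derivative \<Phi>' q) (at q) &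
    \<bar>\<Phi>' q - q * m\<bar> <= K * q ^ 2 & \<bar>\<Phi> q - (q ^ 2 / 2) * m\<bar> <= K * \<bar>q\<bar> ^ 3 &
    (\<forall>s\<in>{1, - 1}. ALL t>=0. ((%t. p q t + (s * q) *\<^sub>R w q t) has_vector_derivative
      f (p q t + (s * q) *\<^sub>R w q t) (\<Phi> q)) (at t within {0..})) &
    (ALL t>=0. p q t \<in> V 1 & w q t \<in> V (- 1) & norm (p q t - xh t) <= K * q ^ 2 & norm (w q t - \<phi> 2 t) <= K * q ^ 2) &
    R (p q 0) = p q 0 & R (w q 0) = w q 0 & (p q \<longlongrightarrow> 0) at_top & (w q \<longlongrightarrow> 0) at_top)"
  using half_line_branch[folded m_def] by (elim exE) (rule that)
 have a: "0 < a" "\<Phi> 0 = 0" "K >= 0" using br0 by blast+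
 note br = br0[THEN conjunct2, THEN conjunct2, THEN conjunct2, rule_format]
 obtain CR where CR: "CR >= 1" "!!x. norm (R x) <= CR * norm x" using R_bound by blast
 define x where "x s q t = p q t + (s * q) *\<^sub>R w q t" for s q t
 define X where "X s q = reflected_extension (x s q)" for s q
 have n0: "norm (\<phi> 2 0) > 0" using phi2_nonzero linear_0[OF ip_linear, of "\<phi> 2 0"] by auto
 define a' where "a' = min 1 (min a (norm (\<phi> 2 0) / (K + 1)))"
 have a': "a' > 0" "a' <= 1" "a' <= a" using a n0 by (auto simp: a'_def)
 have sol: "!!t. (X s q has_vector_derivative f (X s q t) (\<Phi> q)) (at t)" "symmetric R (X s q)"
   "(X s q \<longlongrightarrow> 0) at_top" "(X s q \<longlongrightarrow> 0) at_bot" if "\<bar>q\<bar> < a" "s \<in> {1, - 1}" for s q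
 proof -
  note b = br[OF that(1)]
  have d: "(x s q has_vector_derivative f (x s q t) (\<Phi> q)) (at t within {0..})" if "t >= 0" for t
   using b that \<open>s \<in> {1, - 1}\<close> unfolding x_def[abs_def] by blast
  have "R (x s q 0) = x s q 0" using b by (simp add: x_def linear_add[OF linR] linear_cmul[OF linR])
  moreover have "(x s q \<longlongrightarrow> 0) at_top"
  proof -
   have "((%t. p q t + (s * q) *\<^sub>R w q t) \<longlongrightarrow> 0 + (s * q) *\<^sub>R 0) at_top" using b by (intro tendsto_intros) auto
   then show ?thesis by (simp add: x_def[abs_def])
  qed
  ultimately show "!!t. (X s q has_vector_derivative f (X s q t) (\<Phi> q)) (at t)" "symmetric R (X s q)"
   "(X s q \<longlongrightarrow> 0) at_top" "(X s q \<longlongrightarrow> 0) at_bot"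
   unfolding X_def using reflected_extension[OF d] by blast+
 qed
 have SX: "S (X 1 q t) = X (- 1) q t" if q: "\<bar>q\<bar> < a" for q t
 proof -
  have e: "S (x 1 q t) = x (- 1) q t" "R (S (R (x 1 q t))) = x (- 1) q t" if "t >= 0" for t
  proof -
   have v: "S (p q t) = p q t" "R (S (R (p q t))) = p q t" "S (w q t) = - w q t" "R (S (R (w q t))) = - w q t"
    using br[OF q] that by (auto simp: V_def)
   show "S (x 1 q t) = x (- 1) q t" "R (S (R (x 1 q t))) = x (- 1) q t"
    using linear_add[OF linS, of "p q t"] linear_cmul[OF linS, of q "w q t"]
     linear_add[OF linT, of "p q t"] linear_cmul[OF linT, of q "w q t"] by (simp_all add: x_def v)
  qed
  show ?thesis
  proof (cases "t >= 0")
   case True then show ?thesis using e by (simp add: X_def reflected_extension_def)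
  next
   case False
   then have "R (S (R (x 1 q (- t)))) = x (- 1) q (- t)" using e by simp
   then have "S (R (x 1 q (- t))) = R (x (- 1) q (- t))" using RR by metis
   then show ?thesis using False by (simp add: X_def reflected_extension_def)
  qed
 qed
 have ne: "X 1 q 0 ~= S (X 1 q 0)" if q: "\<bar>q\<bar> < a'" "q ~= 0" for q
 proof
  have qa: "\<bar>q\<bar> < a" using q a' by simp
  assume "X 1 q 0 = S (X 1 q 0)"
  then have "x 1 q 0 = x (- 1) q 0" using SX[OF qa, of 0] by (simp add: X_def reflected_extension_def)
  then have "(2 * q) *\<^sub>R w q 0 = 0"
   by (simp add: x_def eq_neg_iff_add_eq_0 flip: scaleR_add_left)
  then have "w q 0 = 0" using q by simp
  then have "norm (\<phi> 2 0) <= K * q ^ 2" using br[OF qa] by (metis diff_0 norm_minus_cancel order_refl)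
  also have "\<dots> <= (K + 1) * \<bar>q\<bar>"
  proof -
   have "q ^ 2 <= \<bar>q\<bar>" using q a'(2) mult_left_le[of "\<bar>q\<bar>" "\<bar>q\<bar>"] by (simp add: power2_eq_square flip: abs_mult)
   then show ?thesis using a(3) by (intro mult_mono) auto
  qed
  also have "\<dots> < norm (\<phi> 2 0)" using q a(3) by (simp add: a'_def pos_less_divide_eq mult.commute)
  finally show False by simp
 qed
 have hom: "homoclinic (%x. f x (\<Phi> q)) (X s q)" if "\<bar>q\<bar> < a'" "q ~= 0" "s \<in> {1, - 1}" for s q
 proof -
  have qa: "\<bar>q\<bar> < a" using that a' by simp
  have "X s q 0 ~= 0"
  proof
   assume z: "X s q 0 = 0"
   have "X 1 q 0 = S (X (- 1) q 0)" using SX[OF qa, of 0] SS by metis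
   then have "X 1 q 0 = 0 \<or> S (X 1 q 0) = 0" using z that(3) SX[OF qa, of 0] by auto
   then have "X 1 q 0 = 0" using SS[of "X 1 q 0"] linear_0[OF linS] by auto
   then show False using ne[OF that(1,2)] linear_0[OF linS] by simp
  qed
  then show ?thesis unfolding homoclinic_def using sol[OF qa that(3)] by blast
 qed
 have close: "norm (X 1 q t - (xh t + q *\<^sub>R \<phi> 2 t)) <= (CR * (2 * K)) * q ^ 2" if q: "\<bar>q\<bar> < a'" for q t
 proof -
  have qa: "\<bar>q\<bar> < a" using q a' by simp
  have "norm (X 1 q t - (xh t + q *\<^sub>R \<phi> 2 t)) <= CR * ((2 * K) * q ^ 2)"
   unfolding X_def
  proof (rule reflected_extension_close[where C = CR and y = "%t. xh t + q *\<^sub>R \<phi> 2 t"])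
   show "norm (R x) <= CR * norm x" for x by (rule CR)
   show "CR >= 1" by (rule CR)
   show "xh (- t) + q *\<^sub>R \<phi> 2 (- t) = R (xh t + q *\<^sub>R \<phi> 2 t)" for t
    by (simp add: xh_sym phi_reflect linear_add[OF linR] linear_cmul[OF linR])
   fix t :: real assume t: "t >= 0"
   have "x 1 q t - (xh t + q *\<^sub>R \<phi> 2 t) = (p q t - xh t) + q *\<^sub>R (w q t - \<phi> 2 t)"
    by (simp add: x_def scaleR_diff_right)
   also have "norm \<dots> <= norm (p q t - xh t) + \<bar>q\<bar> * norm (w q t - \<phi> 2 t)" by (metis norm_triangle_ineq norm_scaleR)
   also have "\<dots> <= K * q ^ 2 + 1 * (K * q ^ 2)"
    using br[OF qa] t q a'(2) by (intro add_mono mult_mono) auto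
   finally show "norm (x 1 q t - (xh t + q *\<^sub>R \<phi> 2 t)) <= (2 * K) * q ^ 2" by simp
  qed
  then show ?thesis by (simp only: mult.assoc)
 qed
 define K' where "K' = CR * (2 * K)"
 have K': "K <= K'" "K' >= 0"
 proof -
  have "1 * K <= CR * (2 * K)" using CR(1) a(3) by (intro mult_mono) auto
  then show "K <= K'" "K' >= 0" using a(3) by (auto simp: K'_def)
 qed
 have est: "\<Phi> (- q) = \<Phi> q & (\<Phi> has_real_derivative \<Phi>' q) (at q) &
    \<bar>\<Phi>' q - q * m\<bar> <= K' * q ^ 2 & \<bar>\<Phi> q - (q ^ 2 / 2) * m\<bar> <= K' * \<bar>q\<bar> ^ 3" if "\<bar>q\<bar> < a'" for q
 proof -
  have "K * q ^ 2 <= K' * q ^ 2" "K * \<bar>q\<bar> ^ 3 <= K' * \<bar>q\<bar> ^ 3" using K' by (auto intro: mult_right_mono)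
  moreover have "\<bar>q\<bar> < a" using that a' by simp
  ultimately show ?thesis using br[of q] by (meson order_trans)
 qed
 have orb: "X 1 q ~= (%t. S (X 1 q t)) &
    homoclinic (%x. f x (\<Phi> q)) (X 1 q) & symmetric R (X 1 q) &
    homoclinic (%x. f x (\<Phi> q)) (%t. S (X 1 q t)) & symmetric R (%t. S (X 1 q t)) &
    (ALL t. norm (X 1 q t - (xh t + q *\<^sub>R \<phi> 2 t)) <= K' * q ^ 2)" if q: "\<bar>q\<bar> < a'" "q ~= 0" for q
 proof -
  have qa: "\<bar>q\<bar> < a" using q a' by simp
  have eq: "(%t. S (X 1 q t)) = X (- 1) q" using SX[OF qa] by (rule ext)
  have "X 1 q ~= (%t. S (X 1 q t))" using ne[OF q] by metis
  then show ?thesis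
   using hom[OF q] sol(2)[OF qa] close[OF q(1)] unfolding eq K'_def by blast
 qed
 show ?thesis
  by (rule exI[of _ a'], rule exI[of _ \<Phi>], rule exI[of _ \<Phi>'], rule exI[of _ K'], rule exI[of _ "X 1"])
   (use a'(1) a(2) K'(2) est orb in blast)
qed

end

section \<open>The pitchfork bifurcation\<close>

theorem theorem3p9:
  fixes f :: "real ^ 'm \<Rightarrow> real \<Rightarrow> real ^ 'm"
    and n :: nat
    and ip :: "real ^ 'm \<Rightarrow> real ^ 'm \<Rightarrow> real"
    and R :: "real ^ 'm \<Rightarrow> real ^ 'm"
    and S :: "real ^ 'm ^ 'm"
    and \<Lambda> :: "nat \<Rightarrow> complex"
    and xh :: "real \<Rightarrow> real ^ 'm"
    and \<phi> \<psi> :: "nat \<Rightarrow> real \<Rightarrow> real ^ 'm"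
    and \<kappa> :: real
    and q :: "real \<Rightarrow> real"
    and \<xi>\<mu> \<xi>\<alpha> :: "real \<Rightarrow> real ^ 'm"
  assumes n: "n \<ge> 2" "CARD('m) = 2 * n"
    and analytic: "real_analytic (\<lambda>(x, \<mu>). f x \<mu>)"
    and R1: "linear R" "\<And>x. R (R x) = x" "\<And>x \<mu>. f (R x) \<mu> + R (f x \<mu>) = 0" "dim (Fix R) = n"
    and R2: "\<And>\<mu>. f 0 \<mu> = 0"
    and R3: "\<And>z. det (mat z - (\<chi> i j. complex_of_real (matrix (Dx f 0 0) $ i $ j)))
               = (\<Prod>j = 1..n. (z - \<Lambda> j) * (z + \<Lambda> j))"
      "0 < Re (\<Lambda> 1)" "\<And>j. 1 \<le> j \<Longrightarrow> j < n \<Longrightarrow> Re (\<Lambda> j) \<le> Re (\<Lambda> (j + 1))"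
    and R4: "homoclinic (\<lambda>x. f x 0) xh" "symmetric R xh" "xh 0 \<in> Fix R"
    and R5: "\<And>t. (xh has_vector_derivative \<phi> 1 t) (at t)"
      "bounded (range (\<phi> 1))" "bounded (range (\<phi> 2))" "\<phi> 2 0 \<in> Fix R"
      "\<And>\<xi>. solves_VE f xh \<xi> \<Longrightarrow> bounded (range \<xi>) \<Longrightarrow>
         \<exists>a b. \<forall>t. \<xi> t = a *\<^sub>R \<phi> 1 t + b *\<^sub>R \<phi> 2 t"
    and R6: "S ** S = mat 1" "\<And>x \<mu>. S *v f x \<mu> = f (S *v x) \<mu>"
    and R7: "Xminus S = orth_compl ip (Xplus S)"
      "\<And>t. xh t \<in> Xplus S" "\<And>t. \<psi> (n + 1) t \<in> Xplus S"
      "\<And>t. \<phi> 2 t \<in> Xminus S" "\<And>t. \<psi> (n + 2) t \<in> Xminus S"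
    and ip: "scalar_product ip" "{x. R x = - x} = orth_compl ip (Fix R)"
    and phi: "\<And>j. j \<in> {1..2 * n} \<Longrightarrow> solves_VE f xh (\<phi> j)"
      "lin_indep_funs {1..2 * n} \<phi>"
      "\<And>j. j \<in> {3..n} \<Longrightarrow> (\<phi> j \<longlongrightarrow> 0) at_top"
      "\<And>j. j \<in> {3..n} \<Longrightarrow> filterlim (\<lambda>t. norm (\<phi> j t)) at_top at_bot"
      "filterlim (\<lambda>t. norm (\<phi> (n + 1) t)) at_top at_top"
      "filterlim (\<lambda>t. norm (\<phi> (n + 1) t)) at_top at_bot"
      "\<phi> (n + 1) 0 \<in> Fix R"
      "filterlim (\<lambda>t. norm (\<phi> (n + 2) t)) at_top at_top"
      "filterlim (\<lambda>t. norm (\<phi> (n + 2) t)) at_top at_bot"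
      "R (\<phi> (n + 2) 0) = - \<phi> (n + 2) 0"
      "\<And>j t. j \<in> {3..n} \<Longrightarrow> \<phi> (n + j) t = R (\<phi> j (- t))"
    and psi: "\<And>j k t. j \<in> {1..2 * n} \<Longrightarrow> k \<in> {1..2 * n} \<Longrightarrow>
        ip (\<psi> j t) (\<phi> k t) = (if j = k then 1 else 0)"
    and kappa: "0 < \<kappa>" "\<kappa> < Re (\<Lambda> 1) / 4"
    and q: "continuous_on UNIV q" "bdd_above (range (\<lambda>t. \<bar>q t\<bar> * exp (\<kappa> * \<bar>t\<bar>)))"
      "\<And>t. q t = q (- t)" "(LBINT t. q t) = 1"
    and xi_mu: "\<xi>\<mu> \<in> Z10 ip R \<kappa> \<psi>"
      "solves_inhom_VE ip q (\<psi> (n + 2)) (\<phi> (n + 2)) f xh (\<lambda>t. Dmu f (xh t) 0) \<xi>\<mu>"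
    and xi_alpha: "\<xi>\<alpha> \<in> Z10 ip R \<kappa> \<psi>"
      "solves_inhom_VE ip q (\<psi> (n + 2)) (\<phi> (n + 2)) f xh
         (\<lambda>t. (1/2) *\<^sub>R Dx2 f (xh t) 0 (\<phi> 2 t) (\<phi> 2 t)) \<xi>\<alpha>"
    and a2: "a2bar ip f xh (\<psi> (n + 2)) (\<phi> 2) \<xi>\<mu> \<noteq> 0"
    and b2: "b2bar ip f xh (\<psi> (n + 2)) (\<phi> 2) \<xi>\<alpha> \<noteq> 0"
  shows "\<exists>(I1 :: real set) (I2 :: real set) (\<Phi> :: real \<Rightarrow> real)
           (Y :: real \<Rightarrow> real \<Rightarrow> real ^ 'm) (X :: real \<Rightarrow> real \<Rightarrow> real ^ 'm) (C :: real).
      open I1 \<and> is_interval I1 \<and> 0 \<in> I1 \<and>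
      open I2 \<and> is_interval I2 \<and> 0 \<in> I2 \<and>
      (\<forall>\<alpha>\<in>I2. \<Phi> differentiable (at \<alpha>)) \<and>
      \<Phi> 0 = 0 \<and> deriv \<Phi> 0 = 0 \<and>
      deriv \<Phi> differentiable (at 0) \<and> deriv (deriv \<Phi>) 0 \<noteq> 0 \<and>
      (\<forall>\<alpha>\<in>I2. - \<alpha> \<in> I2 \<and> \<Phi> \<alpha> = \<Phi> (- \<alpha>)) \<and>
      (\<forall>\<mu>\<in>I1. homoclinic (\<lambda>x. f x \<mu>) (Y \<mu>) \<and> symmetric R (Y \<mu>) \<and> (\<forall>t. Y \<mu> t \<in> Xplus S)) \<and>
      Y 0 = xh \<and> uniform_limit UNIV Y xh (at 0) \<and>
      (\<forall>\<alpha>\<in>I2 - {0}. \<exists>x'.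
         conjugate_pair S (X \<alpha>) x' \<and>
         homoclinic (\<lambda>x. f x (\<Phi> \<alpha>)) (X \<alpha>) \<and> symmetric R (X \<alpha>) \<and>
         homoclinic (\<lambda>x. f x (\<Phi> \<alpha>)) x' \<and> symmetric R x' \<and>
         (\<forall>t. norm (X \<alpha> t - (xh t + \<alpha> *\<^sub>R \<phi> 2 t)) \<le> C * sqrt (\<bar>\<alpha>\<bar> ^ 4 + \<bar>\<Phi> \<alpha>\<bar> ^ 2))) \<and>
      (a2bar ip f xh (\<psi> (n + 2)) (\<phi> 2) \<xi>\<mu> * b2bar ip f xh (\<psi> (n + 2)) (\<phi> 2) \<xi>\<alpha> < 0
         \<longrightarrow> deriv (deriv \<Phi>) 0 > 0 \<and> (\<forall>\<alpha>\<in>I2 - {0}. \<Phi> \<alpha> > 0)) \<and>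
      (a2bar ip f xh (\<psi> (n + 2)) (\<phi> 2) \<xi>\<mu> * b2bar ip f xh (\<psi> (n + 2)) (\<phi> 2) \<xi>\<alpha> > 0
         \<longrightarrow> deriv (deriv \<Phi>) 0 < 0 \<and> (\<forall>\<alpha>\<in>I2 - {0}. \<Phi> \<alpha> < 0))"
proof -
 let ?S = "(*v) S" and ?\<Phi>'' = "- 2 * b2bar ip f xh (\<psi> (n + 2)) (\<phi> 2) \<xi>\<alpha> / a2bar ip f xh (\<psi> (n + 2)) (\<phi> 2) \<xi>\<mu>"
 have fR: "f (R x) \<mu> = - R (f x \<mu>)" for x \<mu> using R1(3)[of x \<mu>] by (simp add: eq_neg_iff_add_eq_0)
 have xh: "!!t. (xh has_vector_derivative f (xh t) 0) (at t)" "(xh \<longlongrightarrow> 0) at_top" "EX t. xh t ~= 0"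
  using R4(1) by (auto simp: homoclinic_def)
 have xhR: "xh (- t) = R (xh t)" for t using R4(2) R1(2) unfolding symmetric_def by metis
 have SS: "?S (?S x) = x" for x by (simp add: matrix_vector_mul_assoc R6(1))
 have S_orth: "{x. ?S x = - x} = orth_compl ip {x. ?S x = x}" using R7(1) by (simp add: Xplus_def Xminus_def)
 interpret H: reversible_homoclinic f n ip R ?S \<Lambda> xh \<phi> \<psi>
 proof
  show "Ck k (%(x, \<mu>). f x \<mu>)" for k by (rule real_analytic_Ck[OF analytic])
  show "\<phi> 1 t = f (xh t) 0" for t using vector_derivative_unique_at[OF R5(1) xh(1)] .
  show "R (\<phi> 2 0) = \<phi> 2 0" "R (\<phi> (n + 1) 0) = \<phi> (n + 1) 0" using R5(4) phi(7) by (simp_all add: Fix_def)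
  show "?S (xh t) = xh t" "?S (\<phi> 2 t) = - \<phi> 2 t" "?S (\<psi> (n + 2) t) = - \<psi> (n + 2) t" for t
   using R7(2,4,5) by (simp_all add: Xplus_def Xminus_def)
  show "{x. R x = - x} = orth_compl ip {x. R x = x}" using ip(2) by (simp add: Fix_def)
  show "(\<phi> j has_vector_derivative Dx f (xh t) 0 (\<phi> j t)) (at t)" if "j \<in> {1..2 * n}" for j t
   using phi(1)[OF that] by (simp add: solves_VE_def)
  show "f (?S x) \<mu> = ?S (f x \<mu>)" for x \<mu> using R6(2) by simp
 qed (fact n R1(1) R1(2) fR R2 R3 xh xhR R5(3) SS S_orth ip(1) phi(10) linear_add[OF R1(1)] linear_cmul[OF R1(1)]
   matrix_vector_right_distrib matrix_vector_mult_scaleR | erule phi(3) | erule phi(11) | (erule psi, assumption) | (rule R3; assumption))+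
 have bounded: "bounded (z ` {0..})" if z: "z \<in> Z10 ip R \<kappa> \<psi>" for z
 proof -
  obtain M where M: "!!t. t >= 0 ==> norm (z t) * exp (\<kappa> * \<bar>t\<bar>) <= M"
   using z by (auto simp: Z10_def Z1_def bdd_above_def)
  have "norm (z t) <= M" if t: "t >= 0" for t
  proof -
   have "1 <= exp (\<kappa> * \<bar>t\<bar>)" using kappa(1) t by simp
   then have "norm (z t) * 1 <= norm (z t) * exp (\<kappa> * \<bar>t\<bar>)" by (rule mult_left_mono) simp
   then show ?thesis using M[OF t] by simp
  qed
  then show ?thesis by (auto simp: bounded_iff)
 qed
 have reflect: "z (- t) = R (z t)" if "z \<in> Z10 ip R \<kappa> \<psi>" for z t
 proof -
  have "symmetric R z" using that by (simp add: Z10_def Z1_def)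
  then have "z (- t) = R (z (- (- t)))" unfolding symmetric_def by (rule spec)
  then show ?thesis by simp
 qed
 \<comment> \<open>Both inhomogeneities take values in the fixed space of \<open>S\<close>, which \<open>\<psi> (n + 2)\<close> annihilates.\<close>
 have no_Pi: "Pi_op ip q (\<psi> (n + 2)) (\<phi> (n + 2)) g t = 0" if "!!t. ?S (g t) = g t" for g t
  using H.psi_orth[OF that] by (simp add: Pi_op_def)
 have S_fm: "?S (Dmu f (xh t) 0) = Dmu f (xh t) 0" for t
  using H.V_D(2)[OF H.xh_V] by (simp add: H.V_def)
 have S_qq: "?S ((1 / 2) *\<^sub>R Dx2 f (xh t) 0 (\<phi> 2 t) (\<phi> 2 t)) = (1 / 2) *\<^sub>R Dx2 f (xh t) 0 (\<phi> 2 t) (\<phi> 2 t)" for t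
  using H.V_D(4)[OF H.xh_V H.phi2_V H.phi2_V] by (simp add: H.V_def matrix_vector_mult_scaleR)
 interpret P: reversible_pitchfork f n ip R ?S \<Lambda> xh \<phi> \<psi> \<xi>\<mu> \<xi>\<alpha>
 proof
  show "(\<xi>\<mu> has_vector_derivative Dx f (xh t) 0 (\<xi>\<mu> t) + Dmu f (xh t) 0) (at t)" for t
   using xi_mu(2) no_Pi[OF S_fm] by (simp add: solves_inhom_VE_def)
  show "(\<xi>\<alpha> has_vector_derivative Dx f (xh t) 0 (\<xi>\<alpha> t) + (1 / 2) *\<^sub>R Dx2 f (xh t) 0 (\<phi> 2 t) (\<phi> 2 t)) (at t)" for t
   using xi_alpha(2) no_Pi[OF S_qq] by (simp add: solves_inhom_VE_def)
 qed (fact a2 b2 bounded[OF xi_mu(1)] bounded[OF xi_alpha(1)] reflect[OF xi_mu(1)] reflect[OF xi_alpha(1)])+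
 define m where "m = ?\<Phi>''"
 have m0: "m ~= 0" using a2 b2 by (simp add: m_def)
 obtain b Y where b: "b > 0" and Y: "Y 0 = xh" "uniform_limit UNIV Y xh (at 0)"
  "!!\<mu>. \<bar>\<mu>\<bar> < b ==> homoclinic (%x. f x \<mu>) (Y \<mu>) & symmetric R (Y \<mu>) & (ALL t. ?S (Y \<mu> t) = Y \<mu> t)"
  using H.persistent_orbits by blast
 obtain a \<Phi> \<Phi>' K X where br: "0 < a & \<Phi> 0 = 0 & K >= 0 &
  (ALL \<alpha>. \<bar>\<alpha>\<bar> < a --> \<Phi> (- \<alpha>) = \<Phi> \<alpha> & (\<Phi> has_real_derivative \<Phi>' \<alpha>) (at \<alpha>) &
    \<bar>\<Phi>' \<alpha> - \<alpha> * m\<bar> <= K * \<alpha> ^ 2 & \<bar>\<Phi> \<alpha> - (\<alpha> ^ 2 / 2) * m\<bar> <= K * \<bar>\<alpha>\<bar> ^ 3) &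
  (ALL \<alpha>. \<bar>\<alpha>\<bar> < a --> \<alpha> ~= 0 --> X \<alpha> ~= (%t. ?S (X \<alpha> t)) &
    homoclinic (%x. f x (\<Phi> \<alpha>)) (X \<alpha>) & symmetric R (X \<alpha>) &
    homoclinic (%x. f x (\<Phi> \<alpha>)) (%t. ?S (X \<alpha> t)) & symmetric R (%t. ?S (X \<alpha> t)) &
    (ALL t. norm (X \<alpha> t - (xh t + \<alpha> *\<^sub>R \<phi> 2 t)) <= K * \<alpha> ^ 2))"
  using P.conjugate_orbits[folded m_def] by (elim exE) (rule that)
 have a: "0 < a" "\<Phi> 0 = 0" "K >= 0" using br by blast+
 have d: "(\<Phi> has_real_derivative \<Phi>' \<alpha>) (at \<alpha>)" "\<Phi> (- \<alpha>) = \<Phi> \<alpha>" "\<bar>\<Phi>' \<alpha> - \<alpha> * m\<bar> <= K * \<alpha> ^ 2"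
  "\<bar>\<Phi> \<alpha> - (\<alpha> ^ 2 / 2) * m\<bar> <= K * \<bar>\<alpha>\<bar> ^ 3" if "\<bar>\<alpha>\<bar> < a" for \<alpha> using br that by blast+
 note deriv = quadratic_derivative[OF a(1,3) d(1,3)]
 define c where "c = min a (\<bar>m\<bar> / (4 * (K + 1)))"
 have c: "c > 0" "c <= a" using a m0 by (auto simp: c_def)
 have sign: "\<bar>\<Phi> \<alpha> - (\<alpha> ^ 2 / 2) * m\<bar> < \<bar>(\<alpha> ^ 2 / 2) * m\<bar>" if \<alpha>: "\<bar>\<alpha>\<bar> < c" "\<alpha> ~= 0" for \<alpha>
 proof -
  have "\<bar>\<alpha>\<bar> * (4 * (K + 1)) < \<bar>m\<bar>" using \<alpha> a(3) by (simp add: c_def pos_less_divide_eq)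
  then have "K * \<bar>\<alpha>\<bar> < \<bar>m\<bar> / 2" using a(3) by (simp add: algebra_simps)
  then have "(K * \<bar>\<alpha>\<bar>) * \<alpha> ^ 2 < (\<bar>m\<bar> / 2) * \<alpha> ^ 2" using \<alpha>(2) by (intro mult_strict_right_mono) auto
  moreover have "K * \<bar>\<alpha>\<bar> ^ 3 = (K * \<bar>\<alpha>\<bar>) * \<alpha> ^ 2" by (simp add: power3_eq_cube power2_eq_square)
  moreover have "\<bar>(\<alpha> ^ 2 / 2) * m\<bar> = (\<bar>m\<bar> / 2) * \<alpha> ^ 2" by (simp add: abs_mult)
  ultimately show ?thesis using d(4)[of \<alpha>] \<alpha> c by linarith
 qed
 have pos: "\<Phi> \<alpha> > 0" if "m > 0" "\<bar>\<alpha>\<bar> < c" "\<alpha> ~= 0" for \<alpha>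
 proof -
  have "(\<alpha> ^ 2 / 2) * m > 0" using that by simp
  then show ?thesis using sign[OF that(2,3)] by linarith
 qed
 have neg: "\<Phi> \<alpha> < 0" if "m < 0" "\<bar>\<alpha>\<bar> < c" "\<alpha> ~= 0" for \<alpha>
 proof -
  have "(\<alpha> ^ 2 / 2) * m < 0" using that by (simp add: mult_pos_neg)
  then show ?thesis using sign[OF that(2,3)] by linarith
 qed
 have dd: "deriv (deriv \<Phi>) 0 = m" by (rule DERIV_imp_deriv[OF deriv(2)])
 have orb: "EX x'. conjugate_pair S (X \<alpha>) x' &
     homoclinic (%x. f x (\<Phi> \<alpha>)) (X \<alpha>) & symmetric R (X \<alpha>) &
     homoclinic (%x. f x (\<Phi> \<alpha>)) x' & symmetric R x' &
     (ALL t. norm (X \<alpha> t - (xh t + \<alpha> *\<^sub>R \<phi> 2 t)) <= K * sqrt (\<bar>\<alpha>\<bar> ^ 4 + \<bar>\<Phi> \<alpha>\<bar> ^ 2))"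
  if \<alpha>: "\<bar>\<alpha>\<bar> < c" "\<alpha> ~= 0" for \<alpha>
 proof -
  have "\<bar>\<alpha>\<bar> < a" using \<alpha> c by linarith
  then have B: "X \<alpha> ~= (%t. ?S (X \<alpha> t)) &
    homoclinic (%x. f x (\<Phi> \<alpha>)) (X \<alpha>) & symmetric R (X \<alpha>) &
    homoclinic (%x. f x (\<Phi> \<alpha>)) (%t. ?S (X \<alpha> t)) & symmetric R (%t. ?S (X \<alpha> t)) &
    (ALL t. norm (X \<alpha> t - (xh t + \<alpha> *\<^sub>R \<phi> 2 t)) <= K * \<alpha> ^ 2)" using br \<alpha>(2) by blast
  have "\<alpha> ^ 2 <= sqrt (\<bar>\<alpha>\<bar> ^ 4 + \<bar>\<Phi> \<alpha>\<bar> ^ 2)"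
   by (rule real_le_rsqrt) (simp add: power_even_abs flip: power_mult)
  then have "K * \<alpha> ^ 2 <= K * sqrt (\<bar>\<alpha>\<bar> ^ 4 + \<bar>\<Phi> \<alpha>\<bar> ^ 2)" using a(3) by (rule mult_left_mono)
  then have "ALL t. norm (X \<alpha> t - (xh t + \<alpha> *\<^sub>R \<phi> 2 t)) <= K * sqrt (\<bar>\<alpha>\<bar> ^ 4 + \<bar>\<Phi> \<alpha>\<bar> ^ 2)"
   using B order_trans by blast
  then show ?thesis
   using B unfolding conjugate_pair_def by (intro exI[of _ "%t. ?S (X \<alpha> t)"] conjI refl) auto
 qed
 have I: "\<mu> \<in> {- e<..<e} \<longleftrightarrow> \<bar>\<mu>\<bar> < e" for \<mu> e :: real by auto
 have m_sign: "(a2bar ip f xh (\<psi> (n + 2)) (\<phi> 2) \<xi>\<mu> * b2bar ip f xh (\<psi> (n + 2)) (\<phi> 2) \<xi>\<alpha> < 0 --> m > 0) &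
   (a2bar ip f xh (\<psi> (n + 2)) (\<phi> 2) \<xi>\<mu> * b2bar ip f xh (\<psi> (n + 2)) (\<phi> 2) \<xi>\<alpha> > 0 --> m < 0)"
  unfolding m_def by (auto simp: mult_less_0_iff zero_less_mult_iff divide_less_0_iff zero_less_divide_iff)
 show ?thesis
 proof (rule exI[of _ "{- b<..<b}"], rule exI[of _ "{- c<..<c}"], rule exI[of _ \<Phi>], rule exI[of _ Y], rule exI[of _ X],
   rule exI[of _ K], intro conjI)
  show "\<forall>\<alpha>\<in>{- c<..<c}. \<Phi> differentiable (at \<alpha>)"
   unfolding Ball_def I using d(1) c(2) by (meson order_less_le_trans real_differentiable_def)
  show "deriv \<Phi> differentiable (at 0)" using deriv(2) by (auto simp: real_differentiable_def)
  show "\<forall>\<alpha>\<in>{- c<..<c}. - \<alpha> \<in> {- c<..<c} & \<Phi> \<alpha> = \<Phi> (- \<alpha>)"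
   unfolding Ball_def I using d(2) c(2) by auto
  show "\<forall>\<mu>\<in>{- b<..<b}. homoclinic (%x. f x \<mu>) (Y \<mu>) & symmetric R (Y \<mu>) & (ALL t. Y \<mu> t \<in> Xplus S)"
   unfolding Ball_def I Xplus_def using Y(3) by simp
  show "a2bar ip f xh (\<psi> (n + 2)) (\<phi> 2) \<xi>\<mu> * b2bar ip f xh (\<psi> (n + 2)) (\<phi> 2) \<xi>\<alpha> < 0
     --> deriv (deriv \<Phi>) 0 > 0 & (\<forall>\<alpha>\<in>{- c<..<c} - {0}. \<Phi> \<alpha> > 0)"
   using m_sign pos dd unfolding Ball_def Diff_iff I by auto
  show "a2bar ip f xh (\<psi> (n + 2)) (\<phi> 2) \<xi>\<mu> * b2bar ip f xh (\<psi> (n + 2)) (\<phi> 2) \<xi>\<alpha> > 0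
     --> deriv (deriv \<Phi>) 0 < 0 & (\<forall>\<alpha>\<in>{- c<..<c} - {0}. \<Phi> \<alpha> < 0)"
   using m_sign neg dd unfolding Ball_def Diff_iff I by auto
 qed ((rule ballI, rule orb; force simp: abs_less_iff) | (use b c a Y(1,2) deriv(1) dd m0 in \<open>simp add: is_interval_oo\<close>))+
qed

end
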